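(* Let $X_1,\dots,X_n$ be a piecewise locally stationary process, let $H:\mathbb{R}^2\to\mathbb{R}$ and $W_n:[0,1]^2\to\mathbb{R}$ be symmetric Borel functions, with $E[H(x,X_j)]=0$ for every $j$ and every $x\in\mathbb{R}$, and with $c_0\le\sum_{k=1}^n\sum_{j=1}^nW_n^2(t_k,t_j)\le C_0$ for some constants $0<c_0\le C_0<\infty$. Let $D_n$ be as defined in the context (under the degeneracy assumption $D_n=V_n=\sum_{k,j=1}^nW_n(t_k,t_j)H(X_k,X_j)$). Assume: (1) For some $\eta\in(0,1]$ and some function $L:\mathbb{R}\to\mathbb{R}$, the function $H^*(t,s):=H(t,s)/[L(t)L(s)]$ belongs to $W_0^{\eta}(\mathbb{R}^2)$. (2) For some $\epsilon>0$, each of the functions $M=L$ and $M=L^*$, where $L^*(x)=xL(x)$, is differentiable, satisfies $\max_{a\le t\le b}|M'(t)|\le C(|M'(a)|+|M'(b)|+1)$ for all $a\le b$ with a finite constant $C$ independent of $a,b$, and satisfies $\max_j\|M(X_j)\|_{8+4\epsilon}<\infty$ and $\max_j\|M'(X_j)\|_{8+4\epsilon}<\infty$; and $\delta_X(k,8+4\epsilon)=O(\rho^k)$ for some $\rho\in[0,1)$. (3) With $$\mathcal V_n=\sum_{j=1}^{n-1}\Big[\sum_{k=1}^n(W_n(t_j,t_k)-W_n(t_{j+1},t_k))^2\Big]^{1/2}+\Big[\sum_{k=1}^nW_n^2(1,t_k)\Big]^{1/2},$$ $n^{1/4}(\log n)^2\,\mathcal V_n=o(1)$; and for some $\delta>0$,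 $$\sum_{j=1}^n\Big[\sum_{|k-j|\le(\log n)^{1+\delta}}(W_n(t_j,t_j)-W_n(t_j,t_k))^2\Big]^{1/2}=o(1).$$ (4) For some $\delta>0$, if $|m-l|=O(\log n)$, then $\sum_{k=m}^l\big[\sum_{|j-k|\le(\log n)^{1+\delta}}W_n^2(t_k,t_j)\big]^{1/2}=o(1)$. (5) For all $q\in\mathbb N$ and all $s=(s_1,\dots,s_q)\in\mathbb{R}^q$ with $s_1<\dots<s_q$ and all $s_j\ne0$, and for all $k=0,\dots,r$ and $t\in[d_k,d_{k+1}]$: the matrix $\Sigma_k(t,s)$ (defined in the context) is positive definite if $L$ is constant, and the matrix $\Sigma^*_k(t,s)$ (defined in the context) is positive definite if $L$ is not constant. (6) There is $C<\infty$ with $\|G_k(t,\mathcal F_0)-G_k(s,\mathcal F_0)\|_4\le C|t-s|$ for all $t,s\in[d_k,d_{k+1}]$, $k=0,\dots,r$. Then there exist constants $\alpha_{n,1},\alpha_{n,2},\dots$ with $\sum_{k=1}^\infty\alpha_{n,k}^2=O(1)$ and i.i.d. standard normal random variables $Z_1,Z_2,\dots$ such that for any bounded and continuous function $h$, $$\Big|E[h(D_n-E D_n)]-E\Big[h\Big(\sum_{j=1}^\infty\alpha_{n,j}(Z_j^2-1)\Big)\Big]\Big|\to0\quad\text{as }n\to\infty.$$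
   Context: Notation: $t_k=k/n$; $\|Y\|_p=(E|Y|^p)^{1/p}$; $i=\sqrt{-1}$; inner sum indices range over $\{1,\dots,n\}$. Piecewise locally stationary model: there are an integer $r\ge0$ and nonrandom points $0=d_0<d_1<\dots<d_r<d_{r+1}=1$ such that $$X_k=\sum_{j=0}^rG_j(t_k,\mathcal F_k)\mathbf 1\{d_j<t_k\le d_{j+1}\},\qquad k=1,\dots,n,$$ where $\mathcal F_k=(\dots,\varepsilon_{k-1},\varepsilon_k)$, $(\varepsilon_k)_{k\in\mathbb Z}$ are i.i.d. random variables and $G_j$ are measurable real functions of $(t,\mathcal F)$, $t\in(d_j,d_{j+1}]$, understood to be defined also at $t=d_j$ when closed intervals are used. Dependence measures: $\delta_X(k,p)=\max_{0\le l\le r}\sup_{t\in(d_l,d_{l+1}]}\|G_l(t,\mathcal F_0)-G_l(t,\mathcal F_{0,-k})\|_p$, where $\mathcal F_{0,-k}$ is $\mathcal F_0$ with $\varepsilon_{-k}$ replaced by $\varepsilon'_{-k}$, and $(\varepsilon'_j)$ is an independent i.i.d. copy of $(\varepsilon_j)$. Wiener ring: for $\eta\ge0$, $f:\mathbb{R}^2\to\mathbb{R}$ belongs to $W_0^\eta(\mathbb{R}^2)$ if there is $g\in L^1(\mathbb{R}^2)$, complex valued, with $f(x,y)=\int_{\mathbb{R}^2}g(t,s)e^{itx+isy}\,dt\,ds$ and $\int_{\mathbb{R}^2}|(t,s)|^{\eta}|g(t,s)|\,dt\,ds<\infty$. $D_n$: let $g$ be the function representing $H^*$ in this way, $\beta_k(x)=L(X_k)\exp(ixX_k)$,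 $\gamma_k(x)=\beta_k(x)-E[\beta_k(x)]$; then $D_n=\int_{\mathbb{R}^2}g(x,y)\sum_{k,j=1}^nW_n(t_k,t_j)\gamma_k(x)\gamma_j(y)\,dx\,dy$. Long-run covariances: for $s\in\mathbb{R}^q$, $t\in[d_k,d_{k+1}]$ and $G=G_k(t,\mathcal F_j)$ let $$\beta_{k,j}(t,s)=L(G)\,(\cos(s_1G),\sin(s_1G),\dots,\cos(s_qG),\sin(s_qG))^\top,\qquad \beta^*_{k,j}(t,s)=(L(G),\beta_{k,j}(t,s)^\top)^\top,$$ $\Sigma_k(t,s)=\sum_{j=-\infty}^\infty\operatorname{Cov}[\beta_{k,0}(t,s),\beta_{k,j}(t,s)]$ and $\Sigma_k^*(t,s)=\sum_{j=-\infty}^\infty\operatorname{Cov}[\beta^*_{k,0}(t,s),\beta^*_{k,j}(t,s)]$.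
   Formalization: Condition (5) as written can never hold (for s=(-1,1) two cosine coordinates coincide, so both matrices are singular); positive definiteness is required only for those s that also satisfy s_i ≠ -s_j for all i, j. *)

theory Defs
  imports "HOL-Probability.Probability" "HOL-Library.Landau_Symbols" "Jordan_Normal_Form.Matrix"
begin

definition grid :: "nat \<Rightarrow> nat \<Rightarrow> real" where
  "grid n k = real k / real n"

text \<open>The extended value \<open>\<infinity>\<close> keeps a missing moment from being read as the norm \<open>0\<close>.\<close>

definition Lp_norm :: "'w measure \<Rightarrow> real \<Rightarrow> ('w \<Rightarrow> real) \<Rightarrow> ennreal" where
  "Lp_norm M p Y =
     (let I = (\<integral>\<^sup>+\<omega>. ennreal (\<bar>Y \<omega>\<bar> powr p) \<partial>M)
      in if I = \<infinity> then \<infinity> else ennreal (enn2real I powr (1 / p)))"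

definition covariance :: "'w measure \<Rightarrow> ('w \<Rightarrow> real) \<Rightarrow> ('w \<Rightarrow> real) \<Rightarrow> real" where
  "covariance M U V =
     (\<integral>\<omega>. (U \<omega> - (\<integral>\<omega>'. U \<omega>' \<partial>M)) * (V \<omega> - (\<integral>\<omega>'. V \<omega>' \<partial>M)) \<partial>M)"

text \<open>
  The one-sided past \<open>(\<dots>, \<epsilon>\<^sub>k\<^sub>-\<^sub>1, \<epsilon>\<^sub>k)\<close> is coded as a sequence read backwards in time:
  coordinate \<open>i\<close> carries \<open>\<epsilon>\<close> at time \<open>k - i\<close>.
\<close>

definition past :: "(int \<Rightarrow> 'w \<Rightarrow> real) \<Rightarrow> int \<Rightarrow> 'w \<Rightarrow> nat \<Rightarrow> real" where
  "past \<epsilon> k \<omega> = (\<lambda>i. \<epsilon> (k - int i) \<omega>)"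

definition coupled_past ::
  "(int \<Rightarrow> 'w \<Rightarrow> real) \<Rightarrow> (int \<Rightarrow> 'w \<Rightarrow> real) \<Rightarrow> nat \<Rightarrow> 'w \<Rightarrow> nat \<Rightarrow> real" where
  "coupled_past \<epsilon> \<epsilon>' k \<omega> = (past \<epsilon> 0 \<omega>)(k := \<epsilon>' (- int k) \<omega>)"

text \<open>
  \<open>(\<epsilon>\<^sub>k)\<close> is i.i.d. and \<open>(\<epsilon>'\<^sub>k)\<close> is an independent copy of it: all variables of both families are
  jointly independent with one common law. \<open>G j\<close> carries no requirement outside
  \<open>[d j, d (j + 1)]\<close>.
\<close>

definition pls_model ::
  "'w measure \<Rightarrow> (int \<Rightarrow> 'w \<Rightarrow> real) \<Rightarrow> (int \<Rightarrow> 'w \<Rightarrow> real) \<Rightarrow>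
   nat \<Rightarrow> (nat \<Rightarrow> real) \<Rightarrow> (nat \<Rightarrow> real \<Rightarrow> (nat \<Rightarrow> real) \<Rightarrow> real) \<Rightarrow> bool" where
  "pls_model M \<epsilon> \<epsilon>' r d G \<longleftrightarrow>
     prob_space M \<and>
     prob_space.indep_vars M (\<lambda>_. borel) (case_sum \<epsilon> \<epsilon>') UNIV \<and>
     (\<forall>k. distr M borel (\<epsilon> k) = distr M borel (\<epsilon> 0)) \<and>
     (\<forall>k. distr M borel (\<epsilon>' k) = distr M borel (\<epsilon> 0)) \<and>
     d 0 = 0 \<and> d (r + 1) = 1 \<and> (\<forall>j\<le>r. d j < d (j + 1)) \<and>
     (\<forall>j\<le>r. (\<lambda>(t, x). G j t x) \<in> borel_measurable
        (restrict_space borel {d j..d (j + 1)} \<Otimes>\<^sub>M (\<Pi>\<^sub>M i\<in>UNIV. borel)))"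

text \<open>The row \<open>X\<^sub>1, \<dots>, X\<^sub>n\<close> depends on \<open>n\<close> through the grid, so \<open>X\<close> is a triangular array.\<close>

definition pls_process ::
  "(int \<Rightarrow> 'w \<Rightarrow> real) \<Rightarrow> nat \<Rightarrow> (nat \<Rightarrow> real) \<Rightarrow> (nat \<Rightarrow> real \<Rightarrow> (nat \<Rightarrow> real) \<Rightarrow> real) \<Rightarrow>
   nat \<Rightarrow> nat \<Rightarrow> 'w \<Rightarrow> real" where
  "pls_process \<epsilon> r d G n k \<omega> =
     (\<Sum>j=0..r. G j (grid n k) (past \<epsilon> (int k) \<omega>) * indicator {d j<..d (j + 1)} (grid n k))"

definition dep_measure ::
  "'w measure \<Rightarrow> (int \<Rightarrow> 'w \<Rightarrow> real) \<Rightarrow> (int \<Rightarrow> 'w \<Rightarrow> real) \<Rightarrow>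
   nat \<Rightarrow> (nat \<Rightarrow> real) \<Rightarrow> (nat \<Rightarrow> real \<Rightarrow> (nat \<Rightarrow> real) \<Rightarrow> real) \<Rightarrow> nat \<Rightarrow> real \<Rightarrow> ennreal" where
  "dep_measure M \<epsilon> \<epsilon>' r d G k p =
     (SUP l\<in>{0..r}. SUP t\<in>{d l<..d (l + 1)}.
        Lp_norm M p (\<lambda>\<omega>. G l t (past \<epsilon> 0 \<omega>) - G l t (coupled_past \<epsilon> \<epsilon>' k \<omega>)))"

definition wiener_rep :: "real \<Rightarrow> (real \<Rightarrow> real \<Rightarrow> real) \<Rightarrow> (real \<times> real \<Rightarrow> complex) \<Rightarrow> bool" where
  "wiener_rep \<eta> f g \<longleftrightarrow>
     integrable lborel g \<and>
     (\<forall>x y. complex_of_real (f x y) =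
        (\<integral>z. g z * exp (\<i> * complex_of_real (fst z * x + snd z * y)) \<partial>lborel)) \<and>
     integrable lborel (\<lambda>z. norm z powr \<eta> * cmod (g z))"

definition beta :: "(real \<Rightarrow> real) \<Rightarrow> ('w \<Rightarrow> real) \<Rightarrow> real \<Rightarrow> 'w \<Rightarrow> complex" where
  "beta L Y x \<omega> = complex_of_real (L (Y \<omega>)) * exp (\<i> * complex_of_real (x * Y \<omega>))"

definition gam :: "'w measure \<Rightarrow> (real \<Rightarrow> real) \<Rightarrow> ('w \<Rightarrow> real) \<Rightarrow> real \<Rightarrow> 'w \<Rightarrow> complex" where
  "gam M L Y x \<omega> = beta L Y x \<omega> - (\<integral>\<omega>'. beta L Y x \<omega>' \<partial>M)"

text \<open>
  The integral is a complex number with vanishing imaginary part: since the represented function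
  is real, \<open>g (-z)\<close> is the conjugate of \<open>g z\<close> for almost every \<open>z\<close>, and \<open>gam\<close> has the same
  symmetry. \<open>Re\<close> only changes the type.
\<close>

definition D_stat ::
  "'w measure \<Rightarrow> (real \<Rightarrow> real) \<Rightarrow> (real \<times> real \<Rightarrow> complex) \<Rightarrow> (nat \<Rightarrow> real \<Rightarrow> real \<Rightarrow> real) \<Rightarrow>
   (nat \<Rightarrow> nat \<Rightarrow> 'w \<Rightarrow> real) \<Rightarrow> nat \<Rightarrow> 'w \<Rightarrow> real" where
  "D_stat M L g W X n \<omega> =
     Re (\<integral>z. g z * (\<Sum>k=1..n. \<Sum>j=1..n. complex_of_real (W n (grid n k) (grid n j)) *
            gam M L (X n k) (fst z) \<omega> * gam M L (X n j) (snd z) \<omega>) \<partial>lborel)"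

definition controlled_deriv :: "(real \<Rightarrow> real) \<Rightarrow> bool" where
  "controlled_deriv f \<longleftrightarrow>
     (\<forall>x. f differentiable (at x)) \<and>
     (\<exists>C. \<forall>a b. a \<le> b \<longrightarrow>
        (\<forall>t\<in>{a..b}. \<bar>deriv f t\<bar> \<le> C * (\<bar>deriv f a\<bar> + \<bar>deriv f b\<bar> + 1)))"

definition uniform_moment ::
  "'w measure \<Rightarrow> (nat \<Rightarrow> nat \<Rightarrow> 'w \<Rightarrow> real) \<Rightarrow> real \<Rightarrow> (real \<Rightarrow> real) \<Rightarrow> bool" where
  "uniform_moment M X p f \<longleftrightarrow>
     (SUP n\<in>{1..}. SUP j\<in>{1..n}. Lp_norm M p (\<lambda>\<omega>. f (X n j \<omega>))) < \<infinity>"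

definition weight_variation :: "(nat \<Rightarrow> real \<Rightarrow> real \<Rightarrow> real) \<Rightarrow> nat \<Rightarrow> real" where
  "weight_variation W n =
     (\<Sum>j=1..n - 1. sqrt (\<Sum>k=1..n.
        (W n (grid n j) (grid n k) - W n (grid n (j + 1)) (grid n k))\<^sup>2)) +
     sqrt (\<Sum>k=1..n. (W n 1 (grid n k))\<^sup>2)"

definition log_window :: "real \<Rightarrow> nat \<Rightarrow> nat \<Rightarrow> nat set" where
  "log_window \<delta> n j = {k \<in> {1..n}. \<bar>real k - real j\<bar> \<le> ln (real n) powr (1 + \<delta>)}"

text \<open>
  A frequency vector \<open>(s\<^sub>1, \<dots>, s\<^sub>q)\<close> is a list of length \<open>q\<close>; cosines sit at the even and sines at
  the odd positions, counted from 0.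
\<close>

definition beta_vec :: "(real \<Rightarrow> real) \<Rightarrow> real list \<Rightarrow> real \<Rightarrow> real vec" where
  "beta_vec L s x = Matrix.vec (2 * length s)
     (\<lambda>i. L x * (if even i then cos (s ! (i div 2) * x) else sin (s ! (i div 2) * x)))"

definition beta_star_vec :: "(real \<Rightarrow> real) \<Rightarrow> real list \<Rightarrow> real \<Rightarrow> real vec" where
  "beta_star_vec L s x = vCons (L x) (beta_vec L s x)"

definition long_run_cov ::
  "'w measure \<Rightarrow> (int \<Rightarrow> 'w \<Rightarrow> real) \<Rightarrow> ((nat \<Rightarrow> real) \<Rightarrow> real) \<Rightarrow> nat \<Rightarrow> (real \<Rightarrow> real vec) \<Rightarrow>
   real mat" where
  "long_run_cov M \<epsilon> F N b = Matrix.mat N N (\<lambda>(u, v).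
     \<Sum>\<^sub>\<infinity>j\<in>UNIV. covariance M (\<lambda>\<omega>. vec_index (b (F (past \<epsilon> 0 \<omega>))) u)
                               (\<lambda>\<omega>. vec_index (b (F (past \<epsilon> j \<omega>))) v))"

definition Sigma_mat ::
  "'w measure \<Rightarrow> (int \<Rightarrow> 'w \<Rightarrow> real) \<Rightarrow> (real \<Rightarrow> real) \<Rightarrow> ((nat \<Rightarrow> real) \<Rightarrow> real) \<Rightarrow> real list \<Rightarrow>
   real mat" where
  "Sigma_mat M \<epsilon> L F s = long_run_cov M \<epsilon> F (2 * length s) (beta_vec L s)"

definition Sigma_star_mat ::
  "'w measure \<Rightarrow> (int \<Rightarrow> 'w \<Rightarrow> real) \<Rightarrow> (real \<Rightarrow> real) \<Rightarrow> ((nat \<Rightarrow> real) \<Rightarrow> real) \<Rightarrow> real list \<Rightarrow>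
   real mat" where
  "Sigma_star_mat M \<epsilon> L F s = long_run_cov M \<epsilon> F (2 * length s + 1) (beta_star_vec L s)"

definition pos_def :: "real mat \<Rightarrow> bool" where
  "pos_def A \<longleftrightarrow> square_mat A \<and> transpose_mat A = A \<and>
     (\<forall>v \<in> carrier_vec (dim_row A). v \<noteq> 0\<^sub>v (dim_row A) \<longrightarrow> scalar_prod v (A *\<^sub>v v) > 0)"

definition iid_std_normal :: "'z measure \<Rightarrow> (nat \<Rightarrow> 'z \<Rightarrow> real) \<Rightarrow> bool" where
  "iid_std_normal N Z \<longleftrightarrow>
     prob_space N \<and> prob_space.indep_vars N (\<lambda>_. borel) Z UNIV \<and>
     (\<forall>j. distributed N lborel (Z j) std_normal_density)"

end

theory Submission
  imports Defs
begin

text \<open>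
  The statistic is a mixture over frequencies: \<open>D = \<integral> g(x,y) Q(x,y)\<close>, where \<open>Q(x,y)\<close> is the quadratic form
  with matrix \<open>W\<close> in the centred variables \<open>L(X\<^sub>k) exp(i x X\<^sub>k)\<close> and \<open>L(X\<^sub>k) exp(i y X\<^sub>k)\<close>. It is compared
  with a Gaussian quadratic form in three moves.

  \<^bold>\<open>Stability.\<close> A centred quadratic form in weakly dependent variables has a standard deviation of at
  most a constant times the Hilbert-Schmidt norm of its matrix (\<open>quadratic_form_variance\<close>, an
  Efron-Stein argument with Schur's test). The constant grows with the frequency: replacing the
  innovation of lag \<open>l\<close> moves \<open>cos(x X)\<close> by at most a constant times \<open>min 1 ((1 + |x|) \<rho>\<^sup>l)\<close>, hence
  times \<open>((1 + |x|) \<rho>\<^sup>l)\<^sup>s\<close> with \<open>s = \<eta>/2\<close>; the product of two such factors is what the moment condition on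
  \<open>g\<close> integrates. So, with an error that is small in \<open>L\<^sup>1\<close> uniformly in the sample size
  (\<open>wform_error\<close>), one may round the frequencies to a finite grid, replace each variable by its
  conditional mean given the last \<open>m\<close> innovations, and delete from the matrix the diagonal blocks of
  length \<open>l\<close> and narrow gaps between the blocks. The gaps carry a share \<open>m/l\<close> of the mass of the
  matrix for a suitable offset (\<open>sum_gap_le\<close>), and the blocks carry a vanishing share because \<open>W\<close>
  varies little near the diagonal (\<open>near_diagonal_small\<close>).

  \<^bold>\<open>Exchange.\<close> What is left is a quadratic form in independent blocks of bounded size, without terms
  inside a block. Lindeberg's argument replaces one block after the other by a Gaussian vector with
  the same covariances (\<open>lindeberg\<close>). The third-order error is controlled by the largest row norm of
  the matrix, which is at most the total variation \<open>V\<^sub>n\<close> of the rows plus the last row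
  (\<open>row_le_variation\<close>), and \<open>V\<^sub>n\<close> tends to \<open>0\<close>.

  \<^bold>\<open>Diagonalisation.\<close> The standard Gaussian sequence is invariant under plane rotations, so Jacobi's
  rotations make the Gaussian form diagonal up to any error; its trace is zero, which gives
  \<open>\<Sum> \<alpha>\<^sub>i (z\<^sub>i\<^sup>2 - 1)\<close> (\<open>quad_chaos_approx\<close>). The second moments agree in all replacements, which bounds
  \<open>\<Sum> \<alpha>\<^sub>i\<^sup>2\<close>.

  All comparisons are made for characteristic functions. Two sequences of laws with bounded first
  moments and asymptotically equal characteristic functions are asymptotically equal on bounded
  continuous functions, although neither has to converge (\<open>char_close_imp_weak_close\<close>); and the
  coefficients for different accuracies are merged by \<open>diagonal_choice\<close>.
\<close>

text \<open>An \<open>rseq\<close> is an innovation sequence, a standard Gaussian sequence or the vector of one block.\<close>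
type_synonym rseq = "nat \<Rightarrow> real"
type_synonym statistic = "rseq \<Rightarrow> real"
type_synonym array = "nat \<Rightarrow> nat \<Rightarrow> real"

section \<open>Bounds on moments\<close>

text \<open>The bound \<open>a\<close> on the \<open>p\<close>-th absolute norm is part of the predicate, so that Minkowski and Hoelder
  become rules that compose without side conditions on integrability.\<close>
definition mom_le :: "'a measure \<Rightarrow> nat \<Rightarrow> ('a \<Rightarrow> real) \<Rightarrow> real \<Rightarrow> bool" where
  "mom_le M p f a \<longleftrightarrow> f \<in> borel_measurable M \<and> 0 \<le> a \<and>
     (\<integral>\<^sup>+x. ennreal (\<bar>f x\<bar> ^ p) \<partial>M) \<le> ennreal (a ^ p)"

lemma mom_le_measurable[measurable_dest]: "mom_le M p f a \<Longrightarrow> f \<in> borel_measurable M"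
  by (simp add: mom_le_def)

lemma mom_le_mono:
  assumes "mom_le M p f a" and [measurable]: "g \<in> borel_measurable M"
    and "\<And>x. x \<in> space M \<Longrightarrow> \<bar>g x\<bar> \<le> \<bar>f x\<bar>" and "a \<le> b"
  shows "mom_le M p g b"
proof -
  have "(\<integral>\<^sup>+x. ennreal (\<bar>g x\<bar> ^ p) \<partial>M) \<le> (\<integral>\<^sup>+x. ennreal (\<bar>f x\<bar> ^ p) \<partial>M)"
    using assms(3) by (intro nn_integral_mono ennreal_leI power_mono) auto
  also have "\<dots> \<le> ennreal (a ^ p)" using assms(1) by (simp add: mom_le_def)
  also have "\<dots> \<le> ennreal (b ^ p)"
    using assms(1,4) by (intro ennreal_leI power_mono) (auto simp: mom_le_def)
  finally show ?thesis using assms by (auto simp: mom_le_def)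
qed

lemma mom_le_weaken: "mom_le M p f a \<Longrightarrow> a \<le> b \<Longrightarrow> mom_le M p f b"
  by (rule mom_le_mono[of M p f a]) (auto simp: mom_le_def)

lemma mom_le_cmult:
  assumes "mom_le M p f a"
  shows "mom_le M p (\<lambda>x. c * f x) (\<bar>c\<bar> * a)"
proof -
  have [measurable]: "f \<in> borel_measurable M" using assms by (simp add: mom_le_def)
  have "(\<integral>\<^sup>+x. ennreal (\<bar>c * f x\<bar> ^ p) \<partial>M) = (\<integral>\<^sup>+x. ennreal (\<bar>c\<bar>^p) * ennreal (\<bar>f x\<bar> ^ p) \<partial>M)"
    by (intro nn_integral_cong) (auto simp: abs_mult power_mult_distrib ennreal_mult)
  also have "\<dots> = ennreal (\<bar>c\<bar>^p) * (\<integral>\<^sup>+x. ennreal (\<bar>f x\<bar> ^ p) \<partial>M)"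
    by (rule nn_integral_cmult) simp
  also have "\<dots> \<le> ennreal (\<bar>c\<bar>^p) * ennreal (a ^ p)"
    using assms by (intro mult_left_mono) (auto simp: mom_le_def)
  also have "\<dots> = ennreal ((\<bar>c\<bar> * a) ^ p)"
    using assms by (auto simp: mom_le_def power_mult_distrib ennreal_mult)
  finally show ?thesis using assms by (auto simp: mom_le_def)
qed

lemma mom_le_uminus: "mom_le M p f a \<Longrightarrow> mom_le M p (\<lambda>x. - f x) a"
  using mom_le_cmult[of M p f a "-1"] by simp

lemma convex_power_nonneg: "convex_on {0::real..} (\<lambda>x. x ^ p)"
proof (cases "even p")
  case True
  then show ?thesis using convex_on_subset[OF convex_power_even[OF True], of "{0..}"] by auto
next
  case False then show ?thesis by (simp add: convex_power_odd)
qed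

text \<open>Jensen for the weights \<open>a/(a+b)\<close> and \<open>b/(a+b)\<close>; integrated, it is Minkowski's inequality.\<close>
lemma power_add_le_weighted:
  fixes u v a b :: real
  assumes "0 \<le> u" "0 \<le> v" "0 < a" "0 < b"
  shows "(u + v) ^ Suc q \<le> (a + b) ^ q * (u ^ Suc q / a ^ q + v ^ Suc q / b ^ q)"
proof -
  let ?t = "b / (a + b)"
  have t: "0 \<le> ?t" "?t \<le> 1" "1 - ?t = a / (a+b)" using assms by (auto simp: field_simps)
  have "((1 - ?t) *\<^sub>R (u / a) + ?t *\<^sub>R (v / b)) ^ Suc q
     \<le> (1 - ?t) * (u / a) ^ Suc q + ?t * (v / b) ^ Suc q"
    using t assms by (intro convex_onD[OF convex_power_nonneg]) auto
  also have "(1 - ?t) *\<^sub>R (u / a) + ?t *\<^sub>R (v / b) = (u + v) / (a + b)"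
    unfolding t(3) using assms by (simp add: add_divide_distrib)
  finally have "(u + v) ^ Suc q \<le> (a+b) ^ Suc q * (a / (a + b) * (u / a) ^ Suc q + ?t * (v / b) ^ Suc q)"
    unfolding t(3) using assms by (simp add: power_divide divide_le_eq mult.commute)
  also have "\<dots> = (a + b) ^ q * (u ^ Suc q / a ^ q + v ^ Suc q / b ^ q)"
  proof -
    have "(a+b) ^ Suc q * (a / (a + b) * (u / a) ^ Suc q) = (a+b)^q * (u ^ Suc q / a^q)"
      using assms by (simp add: power_divide)
    moreover have "(a+b) ^ Suc q * (b / (a + b) * (v / b) ^ Suc q) = (a+b)^q * (v ^ Suc q / b^q)"
      using assms by (simp add: power_divide)
    ultimately show ?thesis by (simp add: algebra_simps)
  qed
  finally show ?thesis .
qed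

text \<open>The two norms serve as weights in \<open>power_add_le_weighted\<close>; they are enlarged a little,
  since zero is no weight.\<close>
lemma mom_le_add:
  assumes f: "mom_le M p f a" and g: "mom_le M p g b" and "1 \<le> p"
  shows "mom_le M p (\<lambda>x. f x + g x) (a + b)"
proof -
  have [measurable]: "f \<in> borel_measurable M" "g \<in> borel_measurable M"
    and ab: "0 \<le> a" "0 \<le> b" using f g by (auto simp: mom_le_def)
  obtain q where p: "p = Suc q" using \<open>1 \<le> p\<close> by (cases p) auto
  have pos: "(\<integral>\<^sup>+x. ennreal (\<bar>f x + g x\<bar> ^ p) \<partial>M) \<le> ennreal ((a' + b') ^ p)"
    if "a < a'" "b < b'" for a' b'
  proof -
    have p': "0 < a'" "0 < b'" using ab that by auto
    have "(\<integral>\<^sup>+x. ennreal (\<bar>f x + g x\<bar> ^ p) \<partial>M) \<le>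
      (\<integral>\<^sup>+x. ennreal ((a' + b') ^ q / a' ^ q) * ennreal (\<bar>f x\<bar> ^ p) +
             ennreal ((a' + b') ^ q / b' ^ q) * ennreal (\<bar>g x\<bar> ^ p) \<partial>M)"
    proof (intro nn_integral_mono)
      fix x
      have "\<bar>f x + g x\<bar> ^ p \<le> (\<bar>f x\<bar> + \<bar>g x\<bar>) ^ p" by (intro power_mono) auto
      also have "\<dots> \<le> (a' + b') ^ q * (\<bar>f x\<bar> ^ p / a' ^ q + \<bar>g x\<bar> ^ p / b' ^ q)"
        unfolding p by (intro power_add_le_weighted) (use p' in auto)
      finally have "\<bar>f x + g x\<bar> ^ p \<le> (a' + b') ^ q / a' ^ q * \<bar>f x\<bar> ^ p + (a' + b') ^ q / b' ^ q * \<bar>g x\<bar> ^ p"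
        by (simp add: algebra_simps)
      then have "ennreal (\<bar>f x + g x\<bar> ^ p) \<le> ennreal ((a' + b') ^ q / a' ^ q * \<bar>f x\<bar> ^ p + (a' + b') ^ q / b' ^ q * \<bar>g x\<bar> ^ p)"
        by (rule ennreal_leI)
      also have "\<dots> = ennreal ((a' + b') ^ q / a' ^ q) * ennreal (\<bar>f x\<bar> ^ p) +
             ennreal ((a' + b') ^ q / b' ^ q) * ennreal (\<bar>g x\<bar> ^ p)"
        using p' by (subst ennreal_plus) (simp_all add: ennreal_mult[symmetric])
      finally show "ennreal (\<bar>f x + g x\<bar> ^ p) \<le> \<dots>" .
    qed
    also have "\<dots> = ennreal ((a' + b') ^ q / a' ^ q) * (\<integral>\<^sup>+x. ennreal (\<bar>f x\<bar> ^ p) \<partial>M) +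
             ennreal ((a' + b') ^ q / b' ^ q) * (\<integral>\<^sup>+x. ennreal (\<bar>g x\<bar> ^ p) \<partial>M)"
      by (simp add: nn_integral_add nn_integral_cmult)
    also have "\<dots> \<le> ennreal ((a' + b') ^ q / a' ^ q) * ennreal (a' ^ p) +
             ennreal ((a' + b') ^ q / b' ^ q) * ennreal (b' ^ p)"
      using mom_le_weaken[OF f, of a'] mom_le_weaken[OF g, of b'] that
      by (intro add_mono mult_left_mono) (auto simp: mom_le_def)
    also have "\<dots> = ennreal ((a' + b') ^ q / a' ^ q * a' ^ p + (a' + b') ^ q / b' ^ q * b' ^ p)"
      using p' by (subst ennreal_plus) (simp_all add: ennreal_mult[symmetric])
    also have "(a' + b') ^ q / a' ^ q * a' ^ p + (a' + b') ^ q / b' ^ q * b' ^ p = (a'+b')^p"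
      using p' by (simp add: p field_simps)
    finally show ?thesis .
  qed
  have "(\<lambda>n. ennreal (((a + 1 / Suc n) + (b + 1 / Suc n)) ^ p)) \<longlonglongrightarrow> ennreal (((a + 0) + (b + 0)) ^ p)"
    by (intro tendsto_ennrealI tendsto_intros LIMSEQ_Suc[OF lim_1_over_n])
  then have "(\<integral>\<^sup>+x. ennreal (\<bar>f x + g x\<bar> ^ p) \<partial>M) \<le> ennreal (((a + 0) + (b + 0)) ^ p)"
    by (rule LIMSEQ_le_const) (intro exI allI impI pos, simp_all)
  then show ?thesis using ab by (simp add: mom_le_def)
qed

lemma mom_le_diff: "mom_le M p f a \<Longrightarrow> mom_le M p g b \<Longrightarrow> 1 \<le> p \<Longrightarrow> mom_le M p (\<lambda>x. f x - g x) (a + b)"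
  using mom_le_add[of M p f a "\<lambda>x. - g x" b] mom_le_uminus[of M p g b] by simp

lemma mom_le_sum:
  assumes "finite I" "1 \<le> p" "\<And>i. i \<in> I \<Longrightarrow> mom_le M p (f i) (a i)"
  shows "mom_le M p (\<lambda>x. \<Sum>i\<in>I. f i x) (\<Sum>i\<in>I. a i)"
  using assms
proof (induction I rule: finite_induct)
  case empty then show ?case by (simp add: mom_le_def power_0_left)
next
  case (insert i I)
  then show ?case using mom_le_add[of M p "f i" "a i"] by simp
qed

lemma mom_le_mult:
  assumes f: "mom_le M (2 * p) f a" and g: "mom_le M (2 * p) g b"
  shows "mom_le M p (\<lambda>x. f x * g x) (a * b)"
proof -
  have [measurable]: "f \<in> borel_measurable M" "g \<in> borel_measurable M"
    and ab: "0 \<le> a" "0 \<le> b" using f g by (auto simp: mom_le_def)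
  let ?I = "\<integral>\<^sup>+x. ennreal (\<bar>f x * g x\<bar> ^ p) \<partial>M"
  have "?I^2 = (\<integral>\<^sup>+x. ennreal (\<bar>f x\<bar> ^ p) * ennreal (\<bar>g x\<bar> ^ p) \<partial>M)^2"
    by (simp add: abs_mult power_mult_distrib ennreal_mult)
  also have "\<dots> \<le> (\<integral>\<^sup>+x. (ennreal (\<bar>f x\<bar> ^ p))^2 \<partial>M) * (\<integral>\<^sup>+x. (ennreal (\<bar>g x\<bar> ^ p))^2 \<partial>M)"
    by (rule Cauchy_Schwarz_nn_integral) auto
  also have "\<dots> = (\<integral>\<^sup>+x. ennreal (\<bar>f x\<bar> ^ (2 * p)) \<partial>M) * (\<integral>\<^sup>+x. ennreal (\<bar>g x\<bar> ^ (2 * p)) \<partial>M)"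
    by (simp add: ennreal_power power_mult[symmetric] mult.commute)
  also have "\<dots> \<le> ennreal (a ^ (2*p)) * ennreal (b ^ (2*p))"
    using f g by (intro mult_mono) (auto simp: mom_le_def)
  also have "\<dots> = (ennreal ((a * b) ^ p))^2"
    using ab by (simp add: ennreal_power power_mult[symmetric] mult.commute power_mult_distrib ennreal_mult)
  finally have sq: "?I^2 \<le> (ennreal ((a * b) ^ p))^2" .
  have "?I \<le> ennreal ((a * b) ^ p)"
  proof (rule ccontr)
    assume "\<not> ?I \<le> ennreal ((a * b) ^ p)"
    then have lt: "ennreal ((a * b) ^ p) < ?I" by simp
    have "?I \<noteq> \<infinity>"
    proof
      assume "?I = \<infinity>"
      then have "(ennreal ((a * b) ^ p))^2 = \<infinity>" using sq by (simp add: top_unique)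
      moreover have "(ennreal ((a * b) ^ p))^2 = ennreal (((a * b) ^ p)^2)"
        using ab by (intro ennreal_power) auto
      ultimately show False by simp
    qed
    then obtain r where r: "?I = ennreal r" "0 \<le> r" by (cases ?I) auto
    have "r^2 \<le> ((a * b) ^ p)^2"
      using sq r ab by (simp add: ennreal_power)
    then have "r \<le> (a * b) ^ p" by (rule power2_le_imp_le) (use ab in auto)
    then show False using lt r ab by (simp add: ennreal_leI leD)
  qed
  then show ?thesis using ab by (simp add: mom_le_def)
qed

lemma (in prob_space) mom_le_const: "mom_le M p (\<lambda>_. c) \<bar>c\<bar>"
  by (simp add: mom_le_def emeasure_space_1)

lemma (in prob_space) mom_le_half: "mom_le M (2 * p) f a \<Longrightarrow> mom_le M p f a"
  using mom_le_mult[of M p f a "\<lambda>_. 1" 1] mom_le_const[of "2*p" 1] by simp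

lemma mom_le_distr:
  assumes [measurable]: "T \<in> measurable M N" "f \<in> borel_measurable N"
  shows "mom_le (distr M N T) p f a \<longleftrightarrow> mom_le M p (\<lambda>x. f (T x)) a"
  by (simp add: mom_le_def nn_integral_distr)

lemma mom_le_AE_cong:
  assumes "mom_le M p f a" "AE x in M. f x = g x" and [measurable]: "g \<in> borel_measurable M"
  shows "mom_le M p g a"
proof -
  have "(\<integral>\<^sup>+x. ennreal (\<bar>f x\<bar> ^ p) \<partial>M) = (\<integral>\<^sup>+x. ennreal (\<bar>g x\<bar> ^ p) \<partial>M)"
    by (rule nn_integral_cong_AE) (use assms(2) in auto)
  then show ?thesis using assms(1) by (auto simp: mom_le_def)
qed

lemma mom_le_integrable_power:
  assumes "mom_le M p f a" shows "integrable M (\<lambda>x. \<bar>f x\<bar> ^ p)" "(LINT x|M. \<bar>f x\<bar> ^ p) \<le> a ^ p"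
proof -
  have [measurable]: "f \<in> borel_measurable M" and "0 \<le> a" using assms by (auto simp: mom_le_def)
  show i: "integrable M (\<lambda>x. \<bar>f x\<bar> ^ p)"
    by (rule integrableI_bounded) (use assms in \<open>auto simp: mom_le_def power_abs intro: le_less_trans\<close>)
  show "(LINT x|M. \<bar>f x\<bar> ^ p) \<le> a ^ p"
    using assms nn_integral_eq_integral[OF i] \<open>0 \<le> a\<close> by (simp add: mom_le_def)
qed

lemma mom_leI_integrable:
  assumes "integrable M (\<lambda>x. \<bar>f x\<bar> ^ p)" "(LINT x|M. \<bar>f x\<bar> ^ p) \<le> a ^ p" "0 \<le> a" "f \<in> borel_measurable M"
  shows "mom_le M p f a"
  using assms nn_integral_eq_integral[OF assms(1)] by (simp add: mom_le_def)

lemma mom_le_even: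
  assumes "mom_le M p f a" "even p" shows "integrable M (\<lambda>x. f x ^ p)" "(LINT x|M. f x ^ p) \<le> a ^ p"
  using mom_le_integrable_power[OF assms(1)] assms(2) by (auto simp: power_even_abs)

lemma mom_le_mult_integrable:
  assumes "mom_le M 2 f a" "mom_le M 2 g b"
  shows "integrable M (\<lambda>x. f x * g x)" "\<bar>\<integral>x. f x * g x \<partial>M\<bar> \<le> a * b"
proof -
  have m: "mom_le M 1 (\<lambda>x. f x * g x) (a * b)" using mom_le_mult[of M 1] assms by simp
  have "(\<lambda>x. f x * g x) \<in> borel_measurable M" using m by (simp add: mom_le_def)
  then show i: "integrable M (\<lambda>x. f x * g x)"
    using mom_le_integrable_power(1)[OF m] by (simp add: integrable_abs_iff)
  show "\<bar>\<integral>x. f x * g x \<partial>M\<bar> \<le> a * b"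
    using order_trans[OF integral_abs_bound mom_le_integrable_power(2)[OF m, simplified]] by simp
qed

lemma (in prob_space) mom_le_integrable:
  assumes "mom_le M 2 f a"
  shows "integrable M f" "\<bar>expectation f\<bar> \<le> a"
  using mom_le_mult_integrable[OF assms mom_le_const[of 2 1]] by auto

lemma (in prob_space) mom_le_4_2: "mom_le M 4 f a \<Longrightarrow> mom_le M 2 f a"
  using mom_le_half[of 2] by simp

lemma (in prob_space) mom_le_8_4: "mom_le M 8 f a \<Longrightarrow> mom_le M 4 f a"
  using mom_le_half[of 4] by simp

lemma (in prob_space) mom_le_abs_1:
  assumes "mom_le M 2 f a" shows "integrable M (\<lambda>x. \<bar>f x\<bar>)" "(LINT x|M. \<bar>f x\<bar>) \<le> a"
  using mom_le_integrable_power[of M 1 f a] mom_le_half[of 1 f a] assms by auto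

lemma (in prob_space) mom_le_center:
  assumes "mom_le M 4 f a" shows "mom_le M 4 (\<lambda>x. f x - expectation f) (2 * a)"
proof -
  have "\<bar>expectation f\<bar> \<le> a" using mom_le_integrable(2)[OF mom_le_4_2[OF assms]] .
  then have "mom_le M 4 (\<lambda>_. expectation f) a" by (rule mom_le_weaken[OF mom_le_const])
  from mom_le_diff[OF assms this] show ?thesis by (simp only: mult_2)
qed

lemma (in prob_space) power_even_integral_le:
  fixes f :: "'a \<Rightarrow> real"
  assumes "even p" "integrable M f" "integrable M (\<lambda>x. f x ^ p)"
  shows "(expectation f) ^ p \<le> expectation (\<lambda>x. f x ^ p)"
proof -
  have "AE x in M. f x \<in> UNIV" by simp
  from jensens_inequality[OF assms(2) this _ assms(3) convex_power_even[OF assms(1)], of 0 0]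
  show ?thesis by blast
qed

text \<open>Jensen inside and Fubini outside: conditional means do not increase norms.\<close>
lemma mom_le_partial_integral:
  assumes N: "prob_space N" and f: "mom_le (M \<Otimes>\<^sub>M N) p f a" and "even p" "p > 0"
  shows "mom_le M p (\<lambda>x. \<integral>y. f (x, y) \<partial>N) a"
proof -
  interpret N: prob_space N by fact
  have [measurable]: "f \<in> borel_measurable (M \<Otimes>\<^sub>M N)" using f by (simp add: mom_le_def)
  have "(\<integral>\<^sup>+x. ennreal (\<bar>\<integral>y. f (x, y) \<partial>N\<bar> ^ p) \<partial>M) \<le> (\<integral>\<^sup>+x. (\<integral>\<^sup>+y. ennreal (\<bar>f (x, y)\<bar> ^ p) \<partial>N) \<partial>M)"
  proof (rule nn_integral_mono)
    fix x assume x: "x \<in> space M"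
    then have [measurable]: "(\<lambda>y. f (x, y)) \<in> borel_measurable N" by simp
    show "ennreal (\<bar>\<integral>y. f (x, y) \<partial>N\<bar> ^ p) \<le> (\<integral>\<^sup>+y. ennreal (\<bar>f (x, y)\<bar> ^ p) \<partial>N)"
    proof (cases "(\<integral>\<^sup>+y. ennreal (\<bar>f (x, y)\<bar> ^ p) \<partial>N) = \<infinity> \<or> \<not> integrable N (\<lambda>y. f (x,y))")
      case True then show ?thesis using \<open>p > 0\<close> by (auto simp: not_integrable_integral_eq power_0_left)
    next
      case False
      have i: "integrable N (\<lambda>y. f (x, y) ^ p)"
        by (rule integrableI_bounded) (use False in \<open>auto simp: power_abs top.not_eq_extremum\<close>)
      have "\<bar>\<integral>y. f (x, y) \<partial>N\<bar> ^ p \<le> (LINT y|N. \<bar>f (x, y)\<bar> ^ p)"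
        using N.power_even_integral_le[OF \<open>even p\<close> _ i] False \<open>even p\<close> by (simp add: power_even_abs)
      also have "ennreal \<dots> = (\<integral>\<^sup>+y. ennreal (\<bar>f (x, y)\<bar> ^ p) \<partial>N)"
        using i \<open>even p\<close> by (intro nn_integral_eq_integral[symmetric]) (auto simp: power_even_abs)
      finally show ?thesis by (simp add: ennreal_leI)
    qed
  qed
  also have "\<dots> = (\<integral>\<^sup>+z. ennreal (\<bar>f z\<bar> ^ p) \<partial>(M \<Otimes>\<^sub>M N))"
    by (rule N.nn_integral_fst) simp
  also have "\<dots> \<le> ennreal (a ^ p)" using f by (simp add: mom_le_def)
  finally show ?thesis using f by (simp add: mom_le_def)
qed

section \<open>Independent innovations and their coupled copies\<close>

lemma iid_reindex:
  fixes \<sigma> :: "'i \<Rightarrow> 'k"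
  assumes "prob_space \<mu>" "inj \<sigma>"
  shows "distr (\<Pi>\<^sub>M k\<in>UNIV. \<mu>) (\<Pi>\<^sub>M i\<in>UNIV. \<mu>) (\<lambda>w i. w (\<sigma> i)) = (\<Pi>\<^sub>M i\<in>UNIV. \<mu>)"
  using distr_PiM_reindex[of UNIV "\<lambda>_. \<mu>" \<sigma> UNIV] assms by (simp add: restrict_def)

lemma measurable_PiM_reindex:
  "(\<lambda>w i. w (\<sigma> i)) \<in> (\<Pi>\<^sub>M k\<in>UNIV. \<mu>) \<rightarrow>\<^sub>M (\<Pi>\<^sub>M i\<in>UNIV. \<mu>)"
  by (rule measurable_PiM_single') (auto simp: space_PiM)

lemma indep_vars_PiM_coordinates:
  fixes \<nu> :: "'k \<Rightarrow> 'b measure"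
  assumes "\<And>k. prob_space (\<nu> k)"
  shows "prob_space.indep_vars (PiM UNIV \<nu>) \<nu> (\<lambda>k w. w k) UNIV"
proof -
  interpret prob_space "\<Pi>\<^sub>M k\<in>UNIV. \<nu> k" by (intro prob_space_PiM assms)
  have "distr (Pi\<^sub>M UNIV \<nu>) (Pi\<^sub>M UNIV \<nu>) (\<lambda>x. \<lambda>i\<in>UNIV. x i) = Pi\<^sub>M UNIV \<nu>"
    by (simp add: restrict_def distr_id2)
  moreover have "(\<Pi>\<^sub>M i\<in>UNIV. distr (Pi\<^sub>M UNIV \<nu>) (\<nu> i) (\<lambda>w. w i)) = Pi\<^sub>M UNIV \<nu>"
    by (intro PiM_cong refl distr_PiM_component assms) auto
  ultimately show ?thesis
    by (subst indep_vars_iff_distr_eq_PiM) auto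
qed

text \<open>Two disjoint groups of coordinates of an i.i.d. family are independent i.i.d. families.\<close>
lemma iid_split:
  fixes \<mu> :: "'b measure"
  assumes "prob_space \<mu>"
  shows "distr (\<Pi>\<^sub>M k\<in>(UNIV :: ('i + 'j) set). \<mu>) ((\<Pi>\<^sub>M i\<in>(UNIV::'i set). \<mu>) \<Otimes>\<^sub>M (\<Pi>\<^sub>M j\<in>(UNIV::'j set). \<mu>))
      (\<lambda>w. (\<lambda>i. w (Inl i), \<lambda>j. w (Inr j)))
    = (\<Pi>\<^sub>M i\<in>(UNIV::'i set). \<mu>) \<Otimes>\<^sub>M (\<Pi>\<^sub>M j\<in>(UNIV::'j set). \<mu>)"
proof -
  let ?\<Omega> = "\<Pi>\<^sub>M k\<in>(UNIV :: ('i + 'j) set). \<mu>"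
  let ?I = "\<Pi>\<^sub>M i\<in>(UNIV::'i set). \<mu>" and ?J = "\<Pi>\<^sub>M j\<in>(UNIV::'j set). \<mu>"
  interpret \<Omega>: prob_space ?\<Omega> by (intro prob_space_PiM assms)
  have ind: "\<Omega>.indep_vars (\<lambda>_. \<mu>) (\<lambda>k w. w k) UNIV"
    by (rule indep_vars_PiM_coordinates) (rule assms)
  have ri: "\<Omega>.indep_var (PiM (range Inl) (\<lambda>_. \<mu>)) (\<lambda>w. restrict (\<lambda>i. w i) (range Inl))
      (PiM (range Inr) (\<lambda>_. \<mu>)) (\<lambda>w. restrict (\<lambda>i. w i) (range Inr))"
    by (rule \<Omega>.indep_var_restrict[OF ind]) auto
  let ?A = "PiM (range Inl) (\<lambda>_. \<mu>) :: ('i + 'j \<Rightarrow> 'b) measure"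
  let ?B = "PiM (range Inr) (\<lambda>_. \<mu>) :: ('i + 'j \<Rightarrow> 'b) measure"
  have [measurable]: "(\<lambda>f i. f (Inl i)) \<in> ?A \<rightarrow>\<^sub>M ?I"
    by (rule measurable_PiM_single') (auto simp: space_PiM)
  have [measurable]: "(\<lambda>f i. f (Inr i)) \<in> ?B \<rightarrow>\<^sub>M ?J"
    by (rule measurable_PiM_single') (auto simp: space_PiM)
  interpret A: prob_space ?A by (intro prob_space_PiM assms)
  interpret B: prob_space ?B by (intro prob_space_PiM assms)
  have rA: "distr ?\<Omega> ?A (\<lambda>w. restrict w (range Inl)) = ?A"
    using distr_PiM_reindex[of UNIV "\<lambda>_. \<mu>" "\<lambda>x. x" "range Inl :: ('i + 'j) set"] assms by (simp add: restrict_def)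
  have rB: "distr ?\<Omega> ?B (\<lambda>w. restrict w (range Inr)) = ?B"
    using distr_PiM_reindex[of UNIV "\<lambda>_. \<mu>" "\<lambda>x. x" "range Inr :: ('i + 'j) set"] assms by (simp add: restrict_def)
  have AB: "distr ?\<Omega> (?A \<Otimes>\<^sub>M ?B) (\<lambda>w. (restrict w (range Inl), restrict w (range Inr))) = ?A \<Otimes>\<^sub>M ?B"
    using ri unfolding \<Omega>.indep_var_distribution_eq rA rB by simp
  have fA: "distr ?A ?I (\<lambda>f i. f (Inl i)) = ?I"
    using distr_PiM_reindex[of "range Inl" "\<lambda>_. \<mu>" "Inl :: 'i \<Rightarrow> 'i + 'j" UNIV] assms by (simp add: restrict_def)
  have fB: "distr ?B ?J (\<lambda>f i. f (Inr i)) = ?J"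
    using distr_PiM_reindex[of "range Inr" "\<lambda>_. \<mu>" "Inr :: 'j \<Rightarrow> 'i + 'j" UNIV] assms by (simp add: restrict_def)
  have "(\<lambda>z. (\<lambda>i. fst z (Inl i), \<lambda>i. snd z (Inr i))) \<in> ?A \<Otimes>\<^sub>M ?B \<rightarrow>\<^sub>M ?I \<Otimes>\<^sub>M ?J"
    by (intro measurable_Pair measurable_compose[OF measurable_fst] measurable_compose[OF measurable_snd]) simp_all
  then have m1: "(\<lambda>(f, g). (\<lambda>i. f (Inl i), \<lambda>i. g (Inr i))) \<in> ?A \<Otimes>\<^sub>M ?B \<rightarrow>\<^sub>M ?I \<Otimes>\<^sub>M ?J"
    by (simp add: split_beta)
  have m2: "(\<lambda>w. (restrict w (range Inl), restrict w (range Inr))) \<in> ?\<Omega> \<rightarrow>\<^sub>M ?A \<Otimes>\<^sub>M ?B"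
    by (intro measurable_Pair measurable_restrict measurable_component_singleton) auto
  interpret J: prob_space ?J by (intro prob_space_PiM assms)
  have "?I \<Otimes>\<^sub>M ?J = distr ?A ?I (\<lambda>f i. f (Inl i)) \<Otimes>\<^sub>M distr ?B ?J (\<lambda>f i. f (Inr i))"
    by (simp only: fA fB)
  also have "\<dots> = distr (?A \<Otimes>\<^sub>M ?B) (?I \<Otimes>\<^sub>M ?J) (\<lambda>(f, g). (\<lambda>i. f (Inl i), \<lambda>i. g (Inr i)))"
    by (rule pair_measure_distr) (measurable, simp add: fB J.sigma_finite_measure_axioms)
  also have "\<dots> = distr ?\<Omega> (?I \<Otimes>\<^sub>M ?J) ((\<lambda>(f, g). (\<lambda>i. f (Inl i), \<lambda>i. g (Inr i))) \<circ>
      (\<lambda>w. (restrict w (range Inl), restrict w (range Inr))))"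
    by (subst AB[symmetric], rule distr_distr[OF m1 m2])
  finally show ?thesis by (simp add: comp_def)
qed

text \<open>A sequence of innovations read backwards in time has law \<open>S\<close>. Under \<open>S2\<close> each coordinate has
  an independent copy, addressed by \<open>Inr\<close>.\<close>
locale iid_law = prob_space \<mu> for \<mu> :: "real measure" +
  assumes sets_law[measurable_cong]: "sets \<mu> = sets borel"
begin

abbreviation S :: "rseq measure" where "S \<equiv> \<Pi>\<^sub>M i\<in>UNIV. \<mu>"
abbreviation S2 :: "(nat + nat \<Rightarrow> real) measure" where "S2 \<equiv> \<Pi>\<^sub>M i\<in>UNIV. \<mu>"

text \<open>\<open>mix B\<close> reads the copy at the coordinates in \<open>B\<close>, so \<open>mix {} w\<close> and \<open>mix {l} w\<close> are the two
  ends of a coupling that renews the innovation of lag \<open>l\<close>.\<close>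
definition mix :: "nat set \<Rightarrow> (nat + nat \<Rightarrow> real) \<Rightarrow> nat \<Rightarrow> real" where
  "mix B w i = w (if i \<in> B then Inr i else Inl i)"

definition flip :: "nat set \<Rightarrow> nat + nat \<Rightarrow> nat + nat" where
  "flip B c = (case c of Inl i \<Rightarrow> if i \<in> B then Inr i else Inl i | Inr i \<Rightarrow> if i \<in> B then Inl i else Inr i)"

sublocale S: prob_space S by (intro prob_space_PiM) (rule prob_space_axioms)
sublocale S2: prob_space S2 by (intro prob_space_PiM) (rule prob_space_axioms)

lemma space_law[simp]: "space \<mu> = UNIV"
  using sets_eq_imp_space_eq[OF sets_law] by simp

lemma space_S[simp]: "space S = UNIV" "space S2 = UNIV"
  by (auto simp: space_PiM)

lemma mix_measurable[measurable]: "mix B \<in> S2 \<rightarrow>\<^sub>M S"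
  unfolding mix_def[abs_def] by (rule measurable_PiM_reindex)

lemma distr_mix: "distr S2 S (mix B) = S"
  unfolding mix_def[abs_def]
  by (rule iid_reindex[OF prob_space_axioms]) (rule injI, simp split: if_splits)

lemma inj_flip: "inj (flip B)"
proof (rule injI)
  fix c d assume "flip B c = flip B d"
  moreover have "flip B (flip B c) = c" for c by (cases c) (simp_all add: flip_def)
  ultimately show "c = d" by metis
qed

lemma distr_flip: "distr S2 S2 (\<lambda>w c. w (flip B c)) = S2"
  by (rule iid_reindex[OF prob_space_axioms inj_flip])

lemma mix_flip: "mix C (\<lambda>c. w (flip B c)) = mix (sym_diff C B) w"
  by (rule ext) (simp add: mix_def flip_def)

lemma mom_le_mix:
  assumes "mom_le S p f a" shows "mom_le S2 p (\<lambda>w. f (mix B w)) a"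
proof -
  have [measurable]: "f \<in> borel_measurable S" using assms by (simp add: mom_le_def)
  have "mom_le (distr S2 S (mix B)) p f a" using assms by (simp add: distr_mix)
  then show ?thesis by (simp add: mom_le_distr)
qed

lemma integral_mix:
  fixes f :: "statistic"
  assumes [measurable]: "f \<in> borel_measurable S"
  shows "(LINT w|S2. f (mix B w)) = (LINT x|S. f x)"
proof -
  have "(LINT x|S. f x) = (LINT x|(distr S2 S (mix B)). f x)" by (simp only: distr_mix)
  also have "\<dots> = (LINT w|S2. f (mix B w))" by (rule integral_distr) measurable
  finally show ?thesis ..
qed

lemma integrable_mix:
  fixes f :: "statistic"
  assumes "integrable S f"
  shows "integrable S2 (\<lambda>w. f (mix B w))"
  using assms distr_mix[of B] by (intro integrable_distr[OF mix_measurable]) simp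

lemma integral_flip:
  fixes F :: "(nat + nat \<Rightarrow> real) \<Rightarrow> real"
  assumes [measurable]: "F \<in> borel_measurable S2"
  shows "(LINT w|S2. F (\<lambda>c. w (flip B c))) = (LINT w|S2. F w)"
proof -
  have "(LINT x|S2. F x) = (LINT x|(distr S2 S2 (\<lambda>w c. w (flip B c))). F x)" by (simp only: distr_flip)
  also have "\<dots> = (LINT w|S2. F (\<lambda>c. w (flip B c)))"
    by (rule integral_distr[OF measurable_PiM_reindex assms])
  finally show ?thesis ..
qed

lemma mom_le_flip:
  assumes "mom_le S2 p F a" shows "mom_le S2 p (\<lambda>w. F (\<lambda>c. w (flip B c))) a"
proof -
  have [measurable]: "F \<in> borel_measurable S2" using assms by (simp add: mom_le_def)
  have "mom_le (distr S2 S2 (\<lambda>w c. w (flip B c))) p F a" using assms by (simp add: distr_flip)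
  then show ?thesis by (simp add: mom_le_distr[OF measurable_PiM_reindex])
qed

subsection \<open>Density of functions of finitely many coordinates\<close>

text \<open>An integrable function hardly depends on far coordinates. Both arguments read the copy at the first
  \<open>N\<close> coordinates, as at the end of a telescoping sum over renewed coordinates.\<close>
definition approx_fin :: "statistic \<Rightarrow> bool" where
  "approx_fin f \<longleftrightarrow> integrable S f \<and>
     (\<lambda>N. \<integral>w. \<bar>f (mix {..<N} w) - f (mix UNIV w)\<bar> \<partial>S2) \<longlonglongrightarrow> 0"

lemma approx_fin_L1_lim:
  assumes s: "\<And>i. approx_fin (s i)" and f: "integrable S f"
    and lim: "(\<lambda>i. \<integral>x. \<bar>s i x - f x\<bar> \<partial>S) \<longlonglongrightarrow> 0"
  shows "approx_fin f"
proof -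
  have si[simp]: "integrable S (s i)" for i using s by (simp add: approx_fin_def)
  have im: "integrable S2 (\<lambda>w. g (mix B w))" if "integrable S g" for g :: "_ \<Rightarrow> real" and B using that by (rule integrable_mix)
  have "(\<lambda>N. \<integral>w. \<bar>f (mix {..<N} w) - f (mix UNIV w)\<bar> \<partial>S2) \<longlonglongrightarrow> 0"
  proof (rule LIMSEQ_I)
    fix r :: real assume r: "0 < r"
    obtain i where i: "(LINT x|S. \<bar>s i x - f x\<bar>) < r / 3"
      using order_tendstoD(2)[OF lim, of "r/3"] r by (auto simp: eventually_sequentially)
    obtain N0 where N0: "\<And>N. N \<ge> N0 \<Longrightarrow> (LINT w|S2. \<bar>s i (mix {..<N} w) - s i (mix UNIV w)\<bar>) < r / 3"
      using order_tendstoD(2)[OF conjunct2[OF s[of i, unfolded approx_fin_def]], of "r/3"] r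
      by (auto simp: eventually_sequentially)
    show "\<exists>no. \<forall>n\<ge>no. norm ((LINT w|S2. \<bar>f (mix {..<n} w) - f (mix UNIV w)\<bar>) - 0) < r"
    proof (intro exI allI impI)
      fix N assume "N \<ge> N0"
      have eq: "(LINT w|S2. \<bar>s i (mix B w) - f (mix B w)\<bar>) = (LINT x|S. \<bar>s i x - f x\<bar>)" for B
      proof (rule integral_mix[of "\<lambda>x. \<bar>s i x - f x\<bar>"])
        show "(\<lambda>x. \<bar>s i x - f x\<bar>) \<in> borel_measurable S"
          by (rule borel_measurable_integrable) (intro integrable_abs Bochner_Integration.integrable_diff si f)
      qed
      have "(LINT w|S2. \<bar>f (mix {..<N} w) - f (mix UNIV w)\<bar>)
        \<le> (LINT w|S2. \<bar>s i (mix {..<N} w) - f (mix {..<N} w)\<bar> + \<bar>s i (mix {..<N} w) - s i (mix UNIV w)\<bar>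
             + \<bar>s i (mix UNIV w) - f (mix UNIV w)\<bar>)"
        by (intro integral_mono integrable_abs Bochner_Integration.integrable_diff
            Bochner_Integration.integrable_add im f si) auto
      also have "\<dots> = (LINT w|S2. \<bar>s i (mix {..<N} w) - f (mix {..<N} w)\<bar>)
         + (LINT w|S2. \<bar>s i (mix {..<N} w) - s i (mix UNIV w)\<bar>)
         + (LINT w|S2. \<bar>s i (mix UNIV w) - f (mix UNIV w)\<bar>)"
        by (simp add: im f)
      also have "\<dots> = (LINT x|S. \<bar>s i x - f x\<bar>) + (LINT w|S2. \<bar>s i (mix {..<N} w) - s i (mix UNIV w)\<bar>)
         + (LINT x|S. \<bar>s i x - f x\<bar>)" unfolding eq ..
      finally show "norm ((LINT w|S2. \<bar>f (mix {..<N} w) - f (mix UNIV w)\<bar>) - 0) < r"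
        using i N0[OF \<open>N \<ge> N0\<close>] by simp
    qed
  qed
  then show ?thesis using f by (simp add: approx_fin_def)
qed

lemma approx_fin_cmult: assumes "approx_fin f" shows "approx_fin (\<lambda>x. c * f x)"
proof -
  have "(\<lambda>N. \<bar>c\<bar> * (LINT w|S2. \<bar>f (mix {..<N} w) - f (mix UNIV w)\<bar>)) \<longlonglongrightarrow> \<bar>c\<bar> * 0"
    using assms by (intro tendsto_intros) (auto simp: approx_fin_def)
  then show ?thesis using assms
    by (simp add: approx_fin_def abs_mult flip: right_diff_distrib)
qed

lemma approx_fin_add: assumes "approx_fin f" "approx_fin g" shows "approx_fin (\<lambda>x. f x + g x)"
proof -
  have i: "integrable S f" "integrable S g" using assms by (auto simp: approx_fin_def)
  have "(\<lambda>N. (LINT w|S2. \<bar>f (mix {..<N} w) - f (mix UNIV w)\<bar>) + (LINT w|S2. \<bar>g (mix {..<N} w) - g (mix UNIV w)\<bar>)) \<longlonglongrightarrow> 0 + 0"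
    using assms by (intro tendsto_add) (auto simp: approx_fin_def)
  then have lim: "(\<lambda>N. (LINT w|S2. \<bar>f (mix {..<N} w) - f (mix UNIV w)\<bar>) + (LINT w|S2. \<bar>g (mix {..<N} w) - g (mix UNIV w)\<bar>)) \<longlonglongrightarrow> 0"
    by simp
  have "(\<lambda>N. \<integral>w. \<bar>f (mix {..<N} w) + g (mix {..<N} w) - (f (mix UNIV w) + g (mix UNIV w))\<bar> \<partial>S2) \<longlonglongrightarrow> 0"
  proof (rule Lim_null_comparison[OF always_eventually[OF allI] lim])
    fix N
    have "(LINT w|S2. \<bar>f (mix {..<N} w) + g (mix {..<N} w) - (f (mix UNIV w) + g (mix UNIV w))\<bar>)
      \<le> (LINT w|S2. \<bar>f (mix {..<N} w) - f (mix UNIV w)\<bar> + \<bar>g (mix {..<N} w) - g (mix UNIV w)\<bar>)"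
      by (intro integral_mono) (auto simp: integrable_mix i)
    then show "norm (LINT w|S2. \<bar>f (mix {..<N} w) + g (mix {..<N} w) - (f (mix UNIV w) + g (mix UNIV w))\<bar>)
      \<le> (LINT w|S2. \<bar>f (mix {..<N} w) - f (mix UNIV w)\<bar>) + (LINT w|S2. \<bar>g (mix {..<N} w) - g (mix UNIV w)\<bar>)"
      by (simp add: integrable_mix i)
  qed
  then show ?thesis using i by (simp add: approx_fin_def)
qed

lemma approx_fin_sum:
  "finite I \<Longrightarrow> (\<And>i. i \<in> I \<Longrightarrow> approx_fin (f i)) \<Longrightarrow> approx_fin (\<lambda>x. \<Sum>i\<in>I. f i x)"
proof (induction I rule: finite_induct)
  case empty then show ?case by (simp add: approx_fin_def)
next
  case (insert i I) then show ?case using approx_fin_add[of "f i"] by simp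
qed

text \<open>Cylinder sets depend on finitely many coordinates, and the property passes to complements and
  countable disjoint unions.\<close>
lemma approx_fin_indicator:
  assumes "A \<in> sets S" shows "approx_fin (indicator A)"
proof -
  have fin: "integrable S (indicator A :: _ \<Rightarrow> real)" if "A \<in> sets S" for A
    using that by (simp add: integrable_indicator_iff S.emeasure_eq_measure)
  have S_eq: "sets S = sigma_sets UNIV (prod_algebra UNIV (\<lambda>_. \<mu>))"
    using sets_PiM[of UNIV "\<lambda>_. \<mu>"] by (simp add: PiE_def)
  have stable: "Int_stable (prod_algebra UNIV (\<lambda>_::nat. \<mu>))" by (rule Int_stable_prod_algebra)
  have sub: "prod_algebra UNIV (\<lambda>_::nat. \<mu>) \<subseteq> Pow UNIV" by simp
  have "A \<in> sigma_sets UNIV (prod_algebra UNIV (\<lambda>_. \<mu>))" using assms S_eq by simp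
  then show ?thesis
  proof (induction rule: sigma_sets_induct_disjoint[OF stable sub, consumes 1, case_names basic empty compl union])
    case (basic A)
    from basic obtain J E where J: "A = prod_emb UNIV (\<lambda>_. \<mu>) J (Pi\<^sub>E J E)" "finite J"
      by (rule prod_algebraE) auto
    have A: "A \<in> sets S" using basic S_eq by (auto intro: sigma_sets.Basic)
    have in_A: "x \<in> A \<longleftrightarrow> (\<forall>j\<in>J. x j \<in> E j)" for x
      by (auto simp: J(1) prod_emb_def PiE_iff)
    obtain N0 where N0: "\<And>j. j \<in> J \<Longrightarrow> j < N0" using J(2) by (metis finite_nat_set_iff_bounded)
    have "(LINT w|S2. \<bar>indicator A (mix {..<N} w) - indicator A (mix UNIV w) :: real\<bar>) = 0" if "N \<ge> N0" for N
    proof -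
      have "mix {..<N} w j = mix UNIV w j" if "j \<in> J" for j w
        using N0[OF that] \<open>N \<ge> N0\<close> by (simp add: mix_def)
      then have "indicator A (mix {..<N} w) = (indicator A (mix UNIV w) :: real)" for w
        by (auto simp: indicator_def in_A)
      then show ?thesis by simp
    qed
    then have "(\<lambda>N. \<integral>w. \<bar>indicator A (mix {..<N} w) - indicator A (mix UNIV w) :: real\<bar> \<partial>S2) \<longlonglongrightarrow> 0"
      by (intro tendsto_eventually eventually_sequentiallyI)
    then show ?case using fin[OF A] by (simp add: approx_fin_def)
  next
    case empty then show ?case by (simp add: approx_fin_def)
  next
    case (compl A)
    have "approx_fin (\<lambda>x. indicator UNIV x + (- 1) * indicator A x)"
    proof (intro approx_fin_add approx_fin_cmult compl)
      show "approx_fin (indicator UNIV)" by (simp add: approx_fin_def)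
    qed
    moreover have "(\<lambda>x. indicator UNIV x + (- 1) * indicator A x) = (indicator (UNIV - A) :: _ \<Rightarrow> real)"
      by (auto simp: fun_eq_iff indicator_def)
    ultimately show ?case by simp
  next
    case (union A)
    have A: "A i \<in> sets S" for i using union(2) S_eq by auto
    have eq: "(\<Sum>i<n. indicator (A i) x :: real) = indicator (\<Union>i<n. A i) x" for n x
      using union(1) by (intro indicator_UN_disjoint[symmetric]) (auto simp: disjoint_family_on_def)
    show ?case
    proof (rule approx_fin_L1_lim[where s="\<lambda>n x. \<Sum>i<n. indicator (A i) x"])
      show "approx_fin (\<lambda>x. \<Sum>i<n. indicator (A i) x)" for n
        using union(3) by (intro approx_fin_sum) auto
      show "integrable S (indicator (\<Union> (range A)) :: _ \<Rightarrow> real)" using A by (intro fin) auto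
      have "(\<lambda>n. \<integral>x. \<bar>indicator (\<Union>i<n. A i) x - indicator (\<Union> (range A)) x\<bar> \<partial>S) \<longlonglongrightarrow> (LINT x|S. (0::real))"
      proof (rule integral_dominated_convergence[where w="\<lambda>_. 1"])
        show "AE x in S. (\<lambda>n. \<bar>indicator (\<Union>i<n. A i) x - indicator (\<Union> (range A)) x\<bar>) \<longlonglongrightarrow> (0::real)"
        proof (rule AE_I2, rule tendsto_rabs_zero, rule LIM_zero)
          fix x show "(\<lambda>n. indicator (\<Union>i<n. A i) x) \<longlonglongrightarrow> (indicator (\<Union> (range A)) x :: real)"
            by (rule LIMSEQ_indicator_UN)
        qed
        show "AE x in S. norm \<bar>indicator (\<Union>i<n. A i) x - indicator (\<Union> (range A)) x :: real\<bar> \<le> 1" for n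
          by (intro AE_I2) (auto simp: indicator_def split: if_splits)
      qed (use A in \<open>auto intro!: borel_measurable_indicator\<close>)
      then show "(\<lambda>n. \<integral>x. \<bar>(\<Sum>i<n. indicator (A i) x) - indicator (\<Union> (range A)) x :: real\<bar> \<partial>S) \<longlonglongrightarrow> 0"
        by (simp only: eq integral_zero)
    qed
  qed
qed

lemma approx_fin_integrable:
  assumes "integrable S f" shows "approx_fin f"
  using assms
proof (induction rule: integrable_induct)
  case (base A c)
  then show ?case using approx_fin_cmult[OF approx_fin_indicator[of A], of c] by (simp add: mult.commute)
next
  case (add f g) then show ?case by (intro approx_fin_add)
next
  case (lim f s)
  show ?case
  proof (rule approx_fin_L1_lim[of s])
    have [measurable]: "s i \<in> borel_measurable S" "f \<in> borel_measurable S" for i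
      using borel_measurable_integrable[OF \<open>integrable S f\<close>] borel_measurable_integrable[OF \<open>integrable S (s i)\<close>] by auto
    have "(\<lambda>i. \<integral>x. \<bar>s i x - f x\<bar> \<partial>S) \<longlonglongrightarrow> (LINT x|S. 0)"
    proof (rule integral_dominated_convergence[where w="\<lambda>x. 3 * \<bar>f x\<bar>"])
      show "AE x in S. (\<lambda>i. \<bar>s i x - f x\<bar>) \<longlonglongrightarrow> 0"
        using \<open>\<And>x. x \<in> space S \<Longrightarrow> (\<lambda>i. s i x) \<longlonglongrightarrow> f x\<close> by (auto intro!: tendsto_rabs_zero LIM_zero)
      show "AE x in S. norm \<bar>s i x - f x\<bar> \<le> 3 * \<bar>f x\<bar>" for i
      proof (rule AE_I2)
        fix x show "norm \<bar>s i x - f x\<bar> \<le> 3 * \<bar>f x\<bar>"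
          using \<open>\<And>i x. x \<in> space S \<Longrightarrow> norm (s i x) \<le> 2 * norm (f x)\<close>[of x i] by simp
      qed
      show "integrable S (\<lambda>x. 3 * \<bar>f x\<bar>)" using \<open>integrable S f\<close> by simp
    qed simp_all
    then show "(\<lambda>i. \<integral>x. \<bar>s i x - f x\<bar> \<partial>S) \<longlonglongrightarrow> 0" by simp
  qed (use lim \<open>integrable S f\<close> in auto)
qed

end

section \<open>Efron-Stein inequalities for influences\<close>

context iid_law begin

lemma pair_law: "distr S2 (S \<Otimes>\<^sub>M S) (\<lambda>w. (mix {} w, mix UNIV w)) = S \<Otimes>\<^sub>M S"
  using iid_split[OF prob_space_axioms, where 'i=nat and 'j=nat] by (simp add: mix_def[abs_def])

lemma flip_integral_mix:
  fixes F :: "(nat set \<Rightarrow> nat \<Rightarrow> real) \<Rightarrow> real"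
  assumes "(\<lambda>w. F (\<lambda>C. mix C w)) \<in> borel_measurable S2"
  shows "(LINT w|S2. F (\<lambda>C. mix C w)) = (LINT w|S2. F (\<lambda>C. mix (sym_diff C B) w))"
  using integral_flip[OF assms, of B] by (simp add: mix_flip)

lemma sym_diff_lessThan:
  "sym_diff {} A = A" "sym_diff A A = {}" "sym_diff {..<l} {l} = {..<Suc l}" "sym_diff {..<Suc l} {l} = {..<l}"
  "sym_diff {..<Suc l} {..<l} = {l}" for l :: nat
  by auto

text \<open>The covariance of \<open>f\<close> with itself telescopes over the renewed coordinates. Flipping the coordinate
  \<open>l\<close> preserves the law of the coupling, which turns each increment into the mean of a product of two
  differences; both have the mean square of the influence.\<close>
lemma efron_stein_bounded:
  fixes f :: "statistic"
  assumes [measurable]: "f \<in> borel_measurable S" and K: "\<And>x. \<bar>f x\<bar> \<le> K"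
    and D: "\<And>N. (\<Sum>l<N. \<integral>w. (f (mix {} w) - f (mix {l} w))^2 \<partial>S2) \<le> D"
  shows "(LINT x|S. (f x)^2) - (LINT x|S. f x)^2 \<le> D / 2"
proof -
  have K0: "0 \<le> K" using K[of undefined] by linarith
  have bnd: "integrable S2 g" if "g \<in> borel_measurable S2" "\<And>w. \<bar>g w\<bar> \<le> L" for g :: "_ \<Rightarrow> real" and L
    by (rule S2.integrable_const_bound[where B=L]) (use that in auto)
  have bb: "\<bar>f x * f y\<bar> \<le> K * K" for x y
    unfolding abs_mult by (intro mult_mono K K0) auto
  have i2[simp]: "integrable S2 (\<lambda>w. f (mix A w) * f (mix B w))" for A B
    by (rule bnd[of _ "K * K"]) (auto intro: bb)
  define c where "c N = (LINT w|S2. f (mix {} w) * f (mix {..<N} w))" for N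
  define d where "d l = (LINT w|S2. (f (mix {} w) - f (mix {l} w))^2)" for l
  have isq[simp]: "integrable S2 (\<lambda>w. (f (mix A w) - f (mix B w))^2)" for A B
    by (simp add: power2_eq_square algebra_simps)
  have step: "c l - c (Suc l) \<le> d l / 2" for l
  proof -
    define a where "a = (LINT w|S2. f (mix {} w) * (f (mix {..<l} w) - f (mix {..<Suc l} w)))"
    have a1: "a = c l - c (Suc l)" by (simp add: a_def c_def right_diff_distrib)
    have a2: "a = (LINT w|S2. f (mix {l} w) * (f (mix {..<Suc l} w) - f (mix {..<l} w)))"
      unfolding a_def
      by (subst flip_integral_mix[where F="\<lambda>m. f (m {}) * (f (m {..<l}) - f (m {..<Suc l}))" and B="{l}"])
        (measurable, simp only: sym_diff_lessThan)
    have "2 * a = a + a" by simp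
    also have "\<dots> = (LINT w|S2. (f (mix {} w) - f (mix {l} w)) * (f (mix {..<l} w) - f (mix {..<Suc l} w)))"
      by (subst (2) a2, unfold a_def, subst Bochner_Integration.integral_add[symmetric])
        (auto simp: algebra_simps intro!: Bochner_Integration.integral_cong)
    also have "\<dots> \<le> (LINT w|S2. (1/2) * ((f (mix {} w) - f (mix {l} w))^2 + (f (mix {..<l} w) - f (mix {..<Suc l} w))^2))"
    proof (rule integral_mono)
      show "integrable S2 (\<lambda>w. (f (mix {} w) - f (mix {l} w)) * (f (mix {..<l} w) - f (mix {..<Suc l} w)))"
        by (simp add: algebra_simps)
      show "integrable S2 (\<lambda>w. (1/2) * ((f (mix {} w) - f (mix {l} w))^2 + (f (mix {..<l} w) - f (mix {..<Suc l} w))^2))"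
        by simp
      show "u * v \<le> (1/2) * (u^2 + v^2)" for u v :: real
        using sum_squares_bound[of u v] by simp
    qed
    also have "\<dots> = (1/2) * (d l + (LINT w|S2. (f (mix {..<l} w) - f (mix {..<Suc l} w))^2))"
      by (simp add: d_def)
    also have "(LINT w|S2. (f (mix {..<l} w) - f (mix {..<Suc l} w))^2) = d l"
      unfolding d_def
    proof -
      have "sym_diff {..<l} {..<l} = {}" "sym_diff {..<Suc l} {..<l} = {l}" by auto
      moreover have "(\<lambda>w. (f (mix {..<l} w) - f (mix {..<Suc l} w))^2) \<in> borel_measurable S2" by measurable
      ultimately show "(LINT w|S2. (f (mix {..<l} w) - f (mix {..<Suc l} w))^2) = (LINT w|S2. (f (mix {} w) - f (mix {l} w))^2)"
        using flip_integral_mix[where F="\<lambda>m. (f (m {..<l}) - f (m {..<Suc l}))^2" and B="{..<l}"] by simp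
    qed
    finally show ?thesis using a1 by simp
  qed
  have "c 0 - c N \<le> (\<Sum>l<N. d l / 2)" for N
  proof (induction N)
    case (Suc N) then show ?case using step[of N] by simp
  qed simp
  also have "(\<Sum>l<N. d l / 2) \<le> D / 2" for N
    using D[of N] by (simp add: d_def sum_divide_distrib[symmetric])
  finally have cN: "c 0 - c N \<le> D / 2" for N .
  have c0: "c 0 = (LINT x|S. (f x)^2)"
    unfolding c_def using integral_mix[of "\<lambda>x. (f x)^2" "{}"] by (simp add: power2_eq_square)
  have iS: "integrable S f" by (rule S.integrable_const_bound[where B=K]) (use K in auto)
  have prod: "(LINT w|S2. f (mix {} w) * f (mix UNIV w)) = (LINT x|S. f x)^2"
  proof -
    interpret SS: pair_prob_space S S ..
    have "(LINT w|S2. f (mix {} w) * f (mix UNIV w)) = (LINT z|(distr S2 (S \<Otimes>\<^sub>M S) (\<lambda>w. (mix {} w, mix UNIV w))). f (fst z) * f (snd z))"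
      by (subst integral_distr) auto
    also have "\<dots> = (LINT x|S. (LINT y|S. f x * f y))"
      unfolding pair_law
      by (subst SS.integral_fst'[symmetric])
        (auto intro!: SS.P.integrable_const_bound[where B="K * K"] bb)
    finally show ?thesis by (simp add: power2_eq_square)
  qed
  have "(\<lambda>N. c N - (LINT x|S. f x)^2) \<longlonglongrightarrow> 0"
  proof (rule Lim_null_comparison[OF always_eventually[OF allI]])
    fix N
    have "\<bar>c N - (LINT x|S. f x)^2\<bar> = \<bar>\<integral>w. f (mix {} w) * (f (mix {..<N} w) - f (mix UNIV w)) \<partial>S2\<bar>"
      by (simp add: prod[symmetric] c_def right_diff_distrib)
    also have "\<dots> \<le> (LINT w|S2. \<bar>f (mix {} w) * (f (mix {..<N} w) - f (mix UNIV w))\<bar>)"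
      by (rule integral_abs_bound)
    also have "\<dots> \<le> (LINT w|S2. K * \<bar>f (mix {..<N} w) - f (mix UNIV w)\<bar>)"
    proof (intro integral_mono)
      show "integrable S2 (\<lambda>w. \<bar>f (mix {} w) * (f (mix {..<N} w) - f (mix UNIV w))\<bar>)"
        by (simp add: right_diff_distrib)
      show "integrable S2 (\<lambda>w. K * \<bar>f (mix {..<N} w) - f (mix UNIV w)\<bar>)"
        by (simp add: integrable_mix iS)
    qed (auto simp: abs_mult intro!: mult_right_mono K)
    finally show "norm (c N - (LINT x|S. f x)^2) \<le> K * (LINT w|S2. \<bar>f (mix {..<N} w) - f (mix UNIV w)\<bar>)"
      by simp
  next
    have "(\<lambda>N. K * (LINT w|S2. \<bar>f (mix {..<N} w) - f (mix UNIV w)\<bar>)) \<longlonglongrightarrow> K * 0"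
      using approx_fin_integrable[OF iS] by (intro tendsto_intros) (simp add: approx_fin_def)
    then show "(\<lambda>N. K * (LINT w|S2. \<bar>f (mix {..<N} w) - f (mix UNIV w)\<bar>)) \<longlonglongrightarrow> 0" by simp
  qed
  then have "c \<longlonglongrightarrow> (LINT x|S. f x)^2" by (simp add: LIM_zero_iff)
  then have "(\<lambda>N. c 0 - c N) \<longlonglongrightarrow> c 0 - (LINT x|S. f x)^2" by (intro tendsto_intros)
  then have "c 0 - (LINT x|S. f x)^2 \<le> D / 2"
    by (rule LIMSEQ_le_const2) (use cN in auto)
  then show ?thesis by (simp add: c0)
qed

text \<open>\<open>a\<close> bounds the \<open>L\<^sup>p\<close> distance caused by renewing the innovation of lag \<open>l\<close>; this is the dependence
  measure of the process.\<close>
definition infl :: "nat \<Rightarrow> statistic \<Rightarrow> nat \<Rightarrow> real \<Rightarrow> bool" where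
  "infl p f l a \<longleftrightarrow> mom_le S2 p (\<lambda>w. f (mix {} w) - f (mix {l} w)) a"

text \<open>Truncation reduces the claim to bounded functions, and truncation does not increase influences.\<close>
lemma efron_stein:
  assumes f: "mom_le S 2 f c" and a: "\<And>l. infl 2 f l (a l)"
    and D: "\<And>N. (\<Sum>l<N. (a l)^2) \<le> D"
  shows "mom_le S 2 (\<lambda>x. f x - (LINT x|S. f x)) (sqrt (D / 2))"
    "(LINT x|S. (f x)^2) - (LINT x|S. f x)^2 \<le> D / 2"
proof -
  have [measurable]: "f \<in> borel_measurable S" using f by (simp add: mom_le_def)
  have D0: "0 \<le> D" using D[of 0] by simp
  define g where "g K x = max (- real K) (min (real K) (f x))" for K :: nat and x
  have [measurable]: "g K \<in> borel_measurable S" for K unfolding g_def[abs_def] by measurable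
  have gb: "\<bar>g K x\<bar> \<le> real K" for K x by (auto simp: g_def)
  have gf: "\<bar>g K x\<bar> \<le> \<bar>f x\<bar>" for K x by (auto simp: g_def)
  have gd: "\<bar>g K x - g K y\<bar> \<le> \<bar>f x - f y\<bar>" for K x y unfolding g_def by linarith
  have if2: "integrable S (\<lambda>x. (f x)^2)" using mom_le_even(1)[OF f] by simp
  have i1: "integrable S f" by (rule S.mom_le_integrable(1)[OF f])
  have lim: "(\<lambda>K. g K x) \<longlonglongrightarrow> f x" for x
  proof (rule tendsto_eventually, rule eventually_sequentiallyI)
    fix K assume "nat \<lceil>\<bar>f x\<bar>\<rceil> \<le> K"
    then have "\<bar>f x\<bar> \<le> real K" by linarith
    then show "g K x = f x" by (auto simp: g_def)
  qed
  have gK: "(LINT x|S. (g K x)^2) - (LINT x|S. g K x)^2 \<le> D / 2" for K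
  proof (rule efron_stein_bounded[OF _ gb])
    fix N
    have "(LINT w|S2. (g K (mix {} w) - g K (mix {l} w))^2) \<le> (a l)^2" for l
    proof -
      have "mom_le S2 2 (\<lambda>w. g K (mix {} w) - g K (mix {l} w)) (a l)"
        using a[of l] unfolding infl_def by (rule mom_le_mono) (auto intro: gd)
      from mom_le_even(2)[OF this] show ?thesis by simp
    qed
    then have "(\<Sum>l<N. \<integral>w. (g K (mix {} w) - g K (mix {l} w))^2 \<partial>S2) \<le> (\<Sum>l<N. (a l)^2)"
      by (intro sum_mono)
    also have "\<dots> \<le> D" by (rule D)
    finally show "(\<Sum>l<N. \<integral>w. (g K (mix {} w) - g K (mix {l} w))^2 \<partial>S2) \<le> D" .
  qed simp
  have "(\<lambda>K. \<integral>x. (g K x)^2 \<partial>S) \<longlonglongrightarrow> (LINT x|S. (f x)^2)"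
    by (rule integral_dominated_convergence[where w="\<lambda>x. (f x)^2"])
      (auto intro!: if2 AE_I2 tendsto_power lim gf simp: abs_le_square_iff[symmetric])
  moreover have "(\<lambda>K. \<integral>x. g K x \<partial>S) \<longlonglongrightarrow> (LINT x|S. f x)"
    by (rule integral_dominated_convergence[where w="\<lambda>x. \<bar>f x\<bar>"])
      (auto intro!: i1 AE_I2 lim gf)
  ultimately have "(\<lambda>K. (LINT x|S. (g K x)^2) - (LINT x|S. g K x)^2) \<longlonglongrightarrow> (LINT x|S. (f x)^2) - (LINT x|S. f x)^2"
    by (intro tendsto_intros)
  then show v: "(LINT x|S. (f x)^2) - (LINT x|S. f x)^2 \<le> D / 2"
    by (rule LIMSEQ_le_const2) (use gK in auto)
  have sq: "(f x - (LINT x|S. f x))^2 = (f x)^2 - 2 * (LINT x|S. f x) * f x + (LINT x|S. f x)^2" for x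
    by (simp add: power2_eq_square algebra_simps)
  have "(LINT x|S. (f x - (LINT x|S. f x))^2) = (LINT x|S. (f x)^2) - (LINT x|S. f x)^2"
    unfolding sq using S.prob_space by (subst Bochner_Integration.integral_add, simp_all add: if2 i1)
      (simp add: power2_eq_square)
  then show "mom_le S 2 (\<lambda>x. f x - (LINT x|S. f x)) (sqrt (D / 2))"
    using v D0 if2 i1 by (intro mom_leI_integrable) (auto simp: sq)
qed

text \<open>Efron-Stein for \<open>f\<^sup>2\<close>, whose increments factor as \<open>(f - f')(f + f')\<close>, yields a quadratic inequality for
  the square root of the fourth moment.\<close>
lemma moment4_le_influences:
  assumes f: "mom_le S 4 f c" and mean: "(LINT x|S. f x) = 0" and a: "\<And>l. infl 4 f l (a l)"
    and D: "\<And>N. (\<Sum>l<N. (a l)^2) \<le> D"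
  shows "mom_le S 4 f (2 * sqrt D)"
proof -
  have [measurable]: "f \<in> borel_measurable S" using f by (simp add: mom_le_def)
  have D0: "0 \<le> D" using D[of 0] by simp
  define s where "s = sqrt (LINT x|S. (f x) ^ 4)"
  have i4: "integrable S (\<lambda>x. (f x) ^ 4)" using mom_le_even(1)[OF f] by simp
  have s0: "0 \<le> s" by (simp add: s_def)
  have s2: "s^2 = (LINT x|S. (f x) ^ 4)" by (simp add: s_def)
  have fs: "mom_le S 4 f (sqrt s)"
  proof (rule mom_leI_integrable)
    have "sqrt s ^ 4 = ((sqrt s)^2)^2" by (simp flip: power_mult)
    then have "sqrt s ^ 4 = s^2" using s0 by simp
    then show "(LINT x|S. \<bar>f x\<bar> ^ 4) \<le> sqrt s ^ 4" using s2 by (simp add: power_even_abs)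
  qed (use i4 s0 in \<open>simp_all add: power_even_abs\<close>)
  have infl_sq: "infl 2 (\<lambda>x. (f x)^2) l (a l * (2 * sqrt s))" for l
  proof -
    have "mom_le S2 4 (\<lambda>w. f (mix {} w) + f (mix {l} w)) (sqrt s + sqrt s)"
      by (intro mom_le_add mom_le_mix fs) simp
    then have "mom_le S2 2 (\<lambda>w. (f (mix {} w) - f (mix {l} w)) * (f (mix {} w) + f (mix {l} w))) (a l * (sqrt s + sqrt s))"
      using a[of l] unfolding infl_def by (intro mom_le_mult) auto
    moreover have "(\<lambda>w. (f (mix {} w) - f (mix {l} w)) * (f (mix {} w) + f (mix {l} w))) = (\<lambda>w. (f (mix {} w))^2 - (f (mix {l} w))^2)"
      by (simp add: power2_eq_square algebra_simps)
    ultimately show ?thesis by (simp add: infl_def)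
  qed
  have "(LINT x|S. ((f x)^2)^2) - (LINT x|S. (f x)^2)^2 \<le> (4 * s * D) / 2"
  proof (rule efron_stein(2)[OF _ infl_sq])
    show "mom_le S 2 (\<lambda>x. (f x)^2) (c * c)"
      using mom_le_mult[of S 2 f c f c] f by (simp add: power2_eq_square)
    have "(\<Sum>l<N. (a l * (2 * sqrt s))^2) = 4 * s * (\<Sum>l<N. (a l)^2)" for N
      using s0 by (simp add: power_mult_distrib sum_distrib_left algebra_simps)
    also have "\<dots> N \<le> 4 * s * D" for N using s0 D[of N] by (intro mult_left_mono) auto
    finally show "(\<Sum>l<N. (a l * (2 * sqrt s))^2) \<le> 4 * s * D" for N .
  qed
  then have v4: "s^2 \<le> (LINT x|S. (f x)^2)^2 + 2 * s * D" by (simp add: s2 algebra_simps)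
  have a2: "infl 2 f l (a l)" for l
    using a[of l] S2.mom_le_4_2 unfolding infl_def by blast
  have "(LINT x|S. (f x)^2) \<le> D / 2"
    using efron_stein(2)[OF S.mom_le_4_2[OF f] a2 D] mean by simp
  moreover have "0 \<le> (LINT x|S. (f x)^2)" by simp
  ultimately have "(LINT x|S. (f x)^2)^2 \<le> (D / 2)^2" by (intro power_mono)
  with v4 have main: "s^2 \<le> D^2 / 4 + 2 * s * D" by (simp add: power_divide)
  have "s \<le> 3 * D"
  proof (rule ccontr)
    assume "\<not> s \<le> 3 * D"
    then have lt: "3 * D < s" by simp
    then have "s > 0" using D0 by linarith
    have "(3 * D) * D \<le> s * D" using lt D0 by (intro mult_right_mono) auto
    moreover have "s * (3 * D) < s * s" using lt \<open>s > 0\<close> by (intro mult_strict_left_mono)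
    moreover have "0 \<le> D * D" by simp
    moreover have "s * (3 * D) = 3 * (s * D)" "(3 * D) * D = 3 * (D * D)" by simp_all
    moreover have "s * s \<le> D * D / 4 + 2 * (s * D)" using main by (simp add: power2_eq_square)
    ultimately show False by linarith
  qed
  then have "sqrt s \<le> 2 * sqrt D"
    using D0 s0 by (intro real_le_lsqrt) (auto simp: power_mult_distrib)
  then show ?thesis by (rule mom_le_weaken[OF fs])
qed

end

text \<open>Row and column sums of the influence matrix are at most \<open>a\<close>, hence so is its operator norm.\<close>
lemma schur_test:
  fixes u :: "'i \<Rightarrow> nat \<Rightarrow> real"
  assumes "finite I" and u: "\<And>k l. k \<in> I \<Longrightarrow> 0 \<le> u k l" and A: "\<And>l. (\<Sum>k\<in>I. u k l) \<le> a"
    and B: "\<And>k N. k \<in> I \<Longrightarrow> (\<Sum>l<N. u k l) \<le> a" and a0: "0 \<le> a"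
  shows "(\<Sum>l<N. (\<Sum>k\<in>I. \<bar>c k\<bar> * u k l)^2) \<le> a^2 * (\<Sum>k\<in>I. (c k)^2)"
proof -
  have "(\<Sum>k\<in>I. \<bar>c k\<bar> * u k l)^2 \<le> a * (\<Sum>k\<in>I. (c k)^2 * u k l)" for l
  proof -
    have "(\<Sum>k\<in>I. \<bar>c k\<bar> * u k l)^2 = (\<Sum>k\<in>I. sqrt (u k l) * (\<bar>c k\<bar> * sqrt (u k l)))^2"
      using u by (intro arg_cong[where f="\<lambda>x. x^2"] sum.cong) (auto simp: algebra_simps)
    also have "\<dots> \<le> (\<Sum>k\<in>I. (sqrt (u k l))^2) * (\<Sum>k\<in>I. (\<bar>c k\<bar> * sqrt (u k l))^2)"
      by (rule Cauchy_Schwarz_ineq_sum)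
    also have "\<dots> = (\<Sum>k\<in>I. u k l) * (\<Sum>k\<in>I. (c k)^2 * u k l)"
      using u by (simp add: power_mult_distrib)
    also have "\<dots> \<le> a * (\<Sum>k\<in>I. (c k)^2 * u k l)"
      using A u by (intro mult_right_mono sum_nonneg) auto
    finally show ?thesis .
  qed
  then have "(\<Sum>l<N. (\<Sum>k\<in>I. \<bar>c k\<bar> * u k l)^2) \<le> (\<Sum>l<N. a * (\<Sum>k\<in>I. (c k)^2 * u k l))"
    by (intro sum_mono)
  also have "\<dots> = a * (\<Sum>k\<in>I. (c k)^2 * (\<Sum>l<N. u k l))"
    by (simp add: sum_distrib_left[symmetric] sum.swap[of _ I])
  also have "\<dots> \<le> a * (\<Sum>k\<in>I. (c k)^2 * a)"
    using B a0 by (intro mult_left_mono sum_mono) auto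
  also have "\<dots> = a^2 * (\<Sum>k\<in>I. (c k)^2)"
    by (simp add: sum_distrib_right[symmetric] power2_eq_square)
  finally show ?thesis .
qed

context iid_law begin

lemma infl_measurable_mult:
  assumes "\<And>l. infl p (f k) l (u k l)" shows "infl p (\<lambda>x. c * f k x) l (\<bar>c\<bar> * u k l)"
  using mom_le_cmult[OF assms[unfolded infl_def], of c l] by (simp add: infl_def right_diff_distrib)

lemma infl_sum:
  assumes "finite I" "1 \<le> p" "\<And>k. k \<in> I \<Longrightarrow> infl p (f k) l (u k)"
  shows "infl p (\<lambda>x. \<Sum>k\<in>I. f k x) l (\<Sum>k\<in>I. u k)"
  using mom_le_sum[OF assms(1,2), of S2 "\<lambda>k w. f k (mix {} w) - f k (mix {l} w)" u] assms(3)
  by (simp add: infl_def sum_subtractf)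

text \<open>The column sums bound the total effect of one innovation, the row sums the total dependence of one
  variable.\<close>
definition infl_array :: "'i set \<Rightarrow> ('i \<Rightarrow> statistic) \<Rightarrow> real \<Rightarrow> bool" where
  "infl_array I f a \<longleftrightarrow> finite I \<and> 0 \<le> a \<and>
     (\<forall>k\<in>I. (\<exists>c. mom_le S 4 (f k) c) \<and> (LINT x|S. f k x) = 0) \<and>
     (\<exists>u. (\<forall>k\<in>I. \<forall>l. infl 4 (f k) l (u k l)) \<and> (\<forall>l. (\<Sum>k\<in>I. u k l) \<le> a) \<and> (\<forall>k\<in>I. \<forall>N. (\<Sum>l<N. u k l) \<le> a))"

lemma mom4_linear_form:
  assumes "infl_array I f a"
  shows "mom_le S 4 (\<lambda>x. \<Sum>k\<in>I. c k * f k x) (2 * a * sqrt (\<Sum>k\<in>I. (c k)^2))"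
proof -
  obtain u where fin: "finite I" and a0: "0 \<le> a" and u: "\<And>k l. k \<in> I \<Longrightarrow> infl 4 (f k) l (u k l)"
     "\<And>l. (\<Sum>k\<in>I. u k l) \<le> a" "\<And>k N. k \<in> I \<Longrightarrow> (\<Sum>l<N. u k l) \<le> a"
    using assms unfolding infl_array_def by blast
  have u0: "0 \<le> u k l" if "k \<in> I" for k l using u(1)[OF that, of l] by (auto simp: infl_def mom_le_def)
  have "\<forall>k\<in>I. \<exists>b. mom_le S 4 (f k) b" using assms by (auto simp: infl_array_def)
  then obtain b where b: "\<And>k. k \<in> I \<Longrightarrow> mom_le S 4 (f k) (b k)" by metis
  have mean: "(LINT x|S. f k x) = 0" if "k \<in> I" for k using assms that by (auto simp: infl_array_def)
  have "mom_le S 4 (\<lambda>x. \<Sum>k\<in>I. c k * f k x) (2 * sqrt (a^2 * (\<Sum>k\<in>I. (c k)^2)))"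
  proof (rule moment4_le_influences)
    show "mom_le S 4 (\<lambda>x. \<Sum>k\<in>I. c k * f k x) (\<Sum>k\<in>I. \<bar>c k\<bar> * b k)"
      by (intro mom_le_sum mom_le_cmult b fin) auto
    show "(LINT x|S. (\<Sum>k\<in>I. c k * f k x)) = 0"
      using S.mom_le_integrable(1)[OF S.mom_le_4_2[OF b]] mean by (subst Bochner_Integration.integral_sum) auto
    show "infl 4 (\<lambda>x. \<Sum>k\<in>I. c k * f k x) l (\<Sum>k\<in>I. \<bar>c k\<bar> * u k l)" for l
    proof (intro infl_sum fin)
      fix k assume "k \<in> I" then show "infl 4 (\<lambda>x. c k * f k x) l (\<bar>c k\<bar> * u k l)"
        using infl_measurable_mult[of 4 f k u] u(1) by blast
    qed simp
    show "(\<Sum>l<N. (\<Sum>k\<in>I. \<bar>c k\<bar> * u k l)^2) \<le> a^2 * (\<Sum>k\<in>I. (c k)^2)" for N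
      by (rule schur_test[OF fin u0 u(2) u(3) a0])
  qed
  moreover have "2 * sqrt (a^2 * (\<Sum>k\<in>I. (c k)^2)) = 2 * a * sqrt (\<Sum>k\<in>I. (c k)^2)"
    using a0 by (simp add: real_sqrt_mult)
  ultimately show ?thesis by simp
qed

text \<open>A renewed innovation changes the form by increments of \<open>f\<close> times linear forms in \<open>g\<close> and increments of
  \<open>g\<close> times linear forms in \<open>f\<close>. Fourth moments of the linear forms and Schur's test make these
  influences square-summable, with a sum proportional to the total mass of the matrix.\<close>
lemma quadratic_form_variance:
  fixes A :: "'i \<Rightarrow> 'j \<Rightarrow> real"
  assumes f: "infl_array I f a" and g: "infl_array J g b"
  defines "Q \<equiv> (\<lambda>x. \<Sum>k\<in>I. \<Sum>j\<in>J. A k j * f k x * g j x)"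
  shows "mom_le S 2 (\<lambda>x. Q x - (LINT x|S. Q x)) (3 * a * b * sqrt (\<Sum>k\<in>I. \<Sum>j\<in>J. (A k j)^2))"
    and "\<exists>c. mom_le S 2 Q c"
proof -
  obtain u where fin: "finite I" and a0: "0 \<le> a" and u: "\<And>k l. k \<in> I \<Longrightarrow> infl 4 (f k) l (u k l)"
     "\<And>l. (\<Sum>k\<in>I. u k l) \<le> a" "\<And>k N. k \<in> I \<Longrightarrow> (\<Sum>l<N. u k l) \<le> a"
    using f unfolding infl_array_def by blast
  obtain v where finJ: "finite J" and b0: "0 \<le> b" and v: "\<And>k l. k \<in> J \<Longrightarrow> infl 4 (g k) l (v k l)"
     "\<And>l. (\<Sum>k\<in>J. v k l) \<le> b" "\<And>k N. k \<in> J \<Longrightarrow> (\<Sum>l<N. v k l) \<le> b"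
    using g unfolding infl_array_def by blast
  have u0: "0 \<le> u k l" if "k \<in> I" for k l using u(1)[OF that, of l] by (auto simp: infl_def mom_le_def)
  have v0: "0 \<le> v k l" if "k \<in> J" for k l using v(1)[OF that, of l] by (auto simp: infl_def mom_le_def)
  have "\<forall>k\<in>I. \<exists>b. mom_le S 4 (f k) b" using f by (auto simp: infl_array_def)
  then obtain bf where bf: "\<And>k. k \<in> I \<Longrightarrow> mom_le S 4 (f k) (bf k)" by metis
  have "\<forall>k\<in>J. \<exists>b. mom_le S 4 (g k) b" using g by (auto simp: infl_array_def)
  then obtain bg where bg: "\<And>k. k \<in> J \<Longrightarrow> mom_le S 4 (g k) (bg k)" by metis
  define R where "R k = 2 * b * sqrt (\<Sum>j\<in>J. (A k j)^2)" for k
  define T where "T j = 2 * a * sqrt (\<Sum>k\<in>I. (A k j)^2)" for j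
  define F where "F = (\<Sum>k\<in>I. \<Sum>j\<in>J. (A k j)^2)"
  have row: "mom_le S 4 (\<lambda>x. \<Sum>j\<in>J. A k j * g j x) (R k)" for k
    unfolding R_def by (rule mom4_linear_form[OF g])
  have col: "mom_le S 4 (\<lambda>x. \<Sum>k\<in>I. A k j * f k x) (T j)" for j
    unfolding T_def by (rule mom4_linear_form[OF f])
  have R0: "0 \<le> R k" and T0: "0 \<le> T j" for k j using a0 b0 by (auto simp: R_def T_def sum_nonneg)
  define e where "e l = (\<Sum>k\<in>I. \<bar>R k\<bar> * u k l) + (\<Sum>j\<in>J. \<bar>T j\<bar> * v j l)" for l
  have Qi: "infl 2 Q l (e l)" for l
  proof -
    note [intro] = mom_le_mix[OF row] mom_le_mix[OF col]
    have "mom_le S2 2 (\<lambda>w. (\<Sum>k\<in>I. (f k (mix {} w) - f k (mix {l} w)) * (\<Sum>j\<in>J. A k j * g j (mix {} w)))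
         + (\<Sum>j\<in>J. (g j (mix {} w) - g j (mix {l} w)) * (\<Sum>k\<in>I. A k j * f k (mix {l} w))))
       ((\<Sum>k\<in>I. u k l * R k) + (\<Sum>j\<in>J. v j l * T j))"
      using u(1) v(1) unfolding infl_def
      by (intro mom_le_add mom_le_sum mom_le_mult fin finJ) auto
    moreover have "(\<Sum>k\<in>I. (f k x - f k y) * (\<Sum>j\<in>J. A k j * g j x))
         + (\<Sum>j\<in>J. (g j x - g j y) * (\<Sum>k\<in>I. A k j * f k y)) = Q x - Q y" for x y
    proof -
      have "(\<Sum>j\<in>J. (g j x - g j y) * (\<Sum>k\<in>I. A k j * f k y)) = (\<Sum>k\<in>I. \<Sum>j\<in>J. (g j x - g j y) * (A k j * f k y))"
        by (simp add: sum_distrib_left sum.swap[of _ J])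
      then show ?thesis
        by (simp add: Q_def sum_distrib_left sum.distrib[symmetric] sum_subtractf[symmetric] algebra_simps)
    qed
    moreover have "(\<Sum>k\<in>I. u k l * R k) + (\<Sum>j\<in>J. v j l * T j) = e l"
      using R0 T0 by (simp add: e_def mult.commute)
    ultimately show ?thesis by (simp add: infl_def)
  qed
  have Qm: "mom_le S 2 Q (\<Sum>k\<in>I. bf k * R k)"
  proof -
    have "mom_le S 2 (\<lambda>x. \<Sum>k\<in>I. f k x * (\<Sum>j\<in>J. A k j * g j x)) (\<Sum>k\<in>I. bf k * R k)"
      using bf row by (intro mom_le_sum mom_le_mult fin) auto
    then show ?thesis by (simp add: Q_def sum_distrib_left mult_ac)
  qed
  then show "\<exists>c. mom_le S 2 Q c" by blast
  have sumR: "(\<Sum>k\<in>I. (R k)^2) = 4 * b^2 * F"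
    by (simp add: R_def F_def power_mult_distrib sum_nonneg sum_distrib_left)
  have sumT: "(\<Sum>j\<in>J. (T j)^2) = 4 * a^2 * F"
    unfolding F_def by (subst sum.swap) (simp add: T_def power_mult_distrib sum_nonneg sum_distrib_left)
  have "(\<Sum>l<N. (e l)^2) \<le> 16 * (a * b)^2 * F" for N
  proof -
    have "(\<Sum>l<N. (e l)^2) \<le> (\<Sum>l<N. 2 * (\<Sum>k\<in>I. \<bar>R k\<bar> * u k l)^2 + 2 * (\<Sum>j\<in>J. \<bar>T j\<bar> * v j l)^2)"
    proof (rule sum_mono)
      show "(e l)^2 \<le> 2 * (\<Sum>k\<in>I. \<bar>R k\<bar> * u k l)^2 + 2 * (\<Sum>j\<in>J. \<bar>T j\<bar> * v j l)^2" for l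
        unfolding e_def using sum_squares_bound[of "\<Sum>k\<in>I. \<bar>R k\<bar> * u k l" "\<Sum>j\<in>J. \<bar>T j\<bar> * v j l"]
        by (simp add: power2_sum)
    qed
    also have "\<dots> = 2 * (\<Sum>l<N. (\<Sum>k\<in>I. \<bar>R k\<bar> * u k l)^2) + 2 * (\<Sum>l<N. (\<Sum>j\<in>J. \<bar>T j\<bar> * v j l)^2)"
      by (simp add: sum.distrib sum_distrib_left)
    also have "\<dots> \<le> 2 * (a^2 * (\<Sum>k\<in>I. (R k)^2)) + 2 * (b^2 * (\<Sum>j\<in>J. (T j)^2))"
      by (intro add_mono mult_left_mono schur_test fin finJ u0 v0 u(2,3) v(2,3) a0 b0) auto
    also have "\<dots> = 16 * (a * b)^2 * F" unfolding sumR sumT by (simp add: power_mult_distrib)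
    finally show ?thesis .
  qed
  note es = efron_stein(1)[OF Qm Qi this]
  have "16 * (a * b)^2 * F / 2 = 8 * (a * b)^2 * F" by simp
  with es have "mom_le S 2 (\<lambda>x. Q x - (LINT x|S. Q x)) (sqrt (8 * (a * b)^2 * F))" by metis
  moreover have "sqrt (8 * (a * b)^2 * F) \<le> 3 * a * b * sqrt F"
  proof -
    have "sqrt (8 * (a * b)^2 * F) \<le> sqrt (9 * (a * b)^2 * F)"
      by (intro real_sqrt_le_mono mult_right_mono) (auto simp: F_def sum_nonneg)
    also have "\<dots> = 3 * a * b * sqrt F"
      using a0 b0 by (simp add: real_sqrt_mult)
    finally show ?thesis .
  qed
  ultimately show "mom_le S 2 (\<lambda>x. Q x - (LINT x|S. Q x)) (3 * a * b * sqrt (\<Sum>k\<in>I. \<Sum>j\<in>J. (A k j)^2))"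
    unfolding F_def by (rule mom_le_weaken)
qed

definition join :: "nat \<Rightarrow> rseq \<Rightarrow> rseq \<Rightarrow> nat \<Rightarrow> real" where
  "join m x y i = (if i < m then x i else y i)"

text \<open>The conditional mean given the last \<open>m\<close> innovations.\<close>
definition avg :: "nat \<Rightarrow> statistic \<Rightarrow> statistic" where
  "avg m f x = (LINT y|S. f (join m x y))"

lemma join_measurable[measurable]:
  assumes [measurable]: "f \<in> M \<rightarrow>\<^sub>M S" "g \<in> M \<rightarrow>\<^sub>M S"
  shows "(\<lambda>z. join m (f z) (g z)) \<in> M \<rightarrow>\<^sub>M S"
proof (rule measurable_PiM_single')
  fix i show "(\<lambda>z. join m (f z) (g z) i) \<in> M \<rightarrow>\<^sub>M \<mu>"
    unfolding join_def by (cases "i < m") (auto intro: measurable_compose[OF assms(1)] measurable_compose[OF assms(2)])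
qed simp

lemma join_mix: "join m (mix {} w) (mix UNIV w) = mix {m..} w"
  by (auto simp: join_def mix_def fun_eq_iff)

lemma avg_measurable[measurable]:
  assumes [measurable]: "f \<in> borel_measurable S" shows "avg m f \<in> borel_measurable S"
  unfolding avg_def[abs_def] by measurable

lemma avg_cong: "(\<And>i. i < m \<Longrightarrow> x i = y i) \<Longrightarrow> avg m f x = avg m f y"
  unfolding avg_def by (intro Bochner_Integration.integral_cong arg_cong[where f=f]) (auto simp: join_def fun_eq_iff)

lemma mom_le_pair:
  assumes "mom_le S2 p (\<lambda>w. F (mix {} w, mix UNIV w)) a" and [measurable]: "F \<in> borel_measurable (S \<Otimes>\<^sub>M S)"
  shows "mom_le (S \<Otimes>\<^sub>M S) p F a"
proof -
  have "mom_le (distr S2 (S \<Otimes>\<^sub>M S) (\<lambda>w. (mix {} w, mix UNIV w))) p F a"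
    using assms(1) by (subst mom_le_distr) auto
  then show ?thesis by (simp add: pair_law)
qed

sublocale SS: pair_prob_space S S ..

lemma join_mom:
  assumes "mom_le S p f c"
  shows "mom_le (S \<Otimes>\<^sub>M S) p (\<lambda>z. f (join m (fst z) (snd z))) c"
proof -
  have [measurable]: "f \<in> borel_measurable S" using assms by (simp add: mom_le_def)
  show ?thesis by (rule mom_le_pair) (use mom_le_mix[OF assms] in \<open>simp_all add: join_mix\<close>)
qed

lemma avg_AE_integrable:
  assumes "mom_le S 4 f c" shows "AE x in S. integrable S (\<lambda>y. f (join m x y))"
  using SS.AE_integrable_fst'[OF SS.P.mom_le_integrable(1)[OF SS.P.mom_le_4_2[OF join_mom[OF assms]]]] by simp

lemma avg_mom:
  assumes "mom_le S 4 f c" shows "mom_le S 4 (avg m f) c"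
  using mom_le_partial_integral[OF S.prob_space_axioms join_mom[OF assms]] by (simp add: avg_def[abs_def])

lemma mom_le_limit:
  assumes f: "\<And>n. mom_le M p (f n) a" and lim: "AE x in M. (\<lambda>n. f n x) \<longlonglongrightarrow> g x"
    and [measurable]: "g \<in> borel_measurable M"
  shows "mom_le M p g a"
proof -
  have [measurable]: "f n \<in> borel_measurable M" for n using f[of n] by (simp add: mom_le_def)
  have "(\<integral>\<^sup>+x. ennreal (\<bar>g x\<bar> ^ p) \<partial>M) = (\<integral>\<^sup>+x. liminf (\<lambda>n. ennreal (\<bar>f n x\<bar> ^ p)) \<partial>M)"
  proof (rule nn_integral_cong_AE)
    show "AE x in M. ennreal (\<bar>g x\<bar> ^ p) = liminf (\<lambda>n. ennreal (\<bar>f n x\<bar> ^ p))"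
      using lim
    proof eventually_elim
      case (elim x)
      then have "(\<lambda>n. ennreal (\<bar>f n x\<bar> ^ p)) \<longlonglongrightarrow> ennreal (\<bar>g x\<bar> ^ p)"
        by (intro tendsto_ennrealI tendsto_intros)
      then show ?case by (intro lim_imp_Liminf[symmetric]) auto
    qed
  qed
  also have "\<dots> \<le> liminf (\<lambda>n. \<integral>\<^sup>+x. ennreal (\<bar>f n x\<bar> ^ p) \<partial>M)"
    by (rule nn_integral_liminf) simp
  also have "\<dots> \<le> liminf (\<lambda>n::nat. ennreal (a ^ p))"
    using f by (intro Liminf_mono always_eventually) (auto simp: mom_le_def)
  also have "\<dots> = ennreal (a ^ p)" by (simp add: Liminf_const)
  finally show ?thesis using f[of 0] by (simp add: mom_le_def)
qed

text \<open>Renewing the innovations of lags \<open>m, m+1, \<dots>\<close> one after the other costs one influence each, and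
  averaging over the renewed ones does not increase the norm. Fatou covers the infinitely many lags.\<close>
lemma avg_error:
  assumes f: "mom_le S 4 f c" and u: "\<And>l. infl 4 f l (u l)" and B: "\<And>N. (\<Sum>l=m..<N. u l) \<le> B"
  shows "mom_le S 4 (\<lambda>x. f x - avg m f x) B"
proof -
  have [measurable]: "f \<in> borel_measurable S" using f by (simp add: mom_le_def)
  have tel: "mom_le S2 4 (\<lambda>w. f (mix {} w) - f (mix {m..<N} w)) (\<Sum>l=m..<N. u l)" for N
  proof (induction N)
    case 0 then show ?case by (simp add: mom_le_def)
  next
    case (Suc N)
    show ?case
    proof (cases "m \<le> N")
      case False
      then have "{m..<Suc N} = {}" by auto
      then show ?thesis by (simp add: mom_le_def)
    next
      case True
      have sd: "sym_diff {} {m..<N} = {m..<N}" "sym_diff {N} {m..<N} = {m..<Suc N}" using True by auto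
      have "mom_le S2 4 (\<lambda>w. f (mix {m..<N} w) - f (mix {m..<Suc N} w)) (u N)"
        using mom_le_flip[OF u[of N, unfolded infl_def], where B="{m..<N}"] by (simp only: mix_flip sd)
      from mom_le_add[OF Suc this] True show ?thesis by simp
    qed
  qed
  have i1: "integrable S f" by (rule S.mom_le_integrable(1)[OF S.mom_le_4_2[OF f]])
  have "(\<lambda>N. \<integral>w. \<bar>f (mix {m..<N} w) - f (mix {m..} w)\<bar> \<partial>S2) \<longlonglongrightarrow> 0"
  proof (rule Lim_transform_eventually)
    show "(\<lambda>N. \<integral>w. \<bar>f (mix {..<N} w) - f (mix UNIV w)\<bar> \<partial>S2) \<longlonglongrightarrow> 0"
      using approx_fin_integrable[OF i1] by (simp add: approx_fin_def)
    show "\<forall>\<^sub>F N in sequentially. (LINT w|S2. \<bar>f (mix {..<N} w) - f (mix UNIV w)\<bar>) = (LINT w|S2. \<bar>f (mix {m..<N} w) - f (mix {m..} w)\<bar>)"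
    proof (rule eventually_sequentiallyI)
      fix N assume "m \<le> N"
      then have sd: "sym_diff {..<N} {..<m} = {m..<N}" "sym_diff UNIV {..<m} = {m..}" by auto
      have "(\<lambda>w. \<bar>f (mix {..<N} w) - f (mix UNIV w)\<bar>) \<in> borel_measurable S2" by measurable
      from flip_integral_mix[where F="\<lambda>q. \<bar>f (q {..<N}) - f (q UNIV)\<bar>" and B="{..<m}", OF this]
      show "(LINT w|S2. \<bar>f (mix {..<N} w) - f (mix UNIV w)\<bar>) = (LINT w|S2. \<bar>f (mix {m..<N} w) - f (mix {m..} w)\<bar>)"
        by (simp only: sd)
    qed
  qed
  then obtain r where r: "strict_mono r" "AE w in S2. (\<lambda>n. f (mix {m..<r n} w) - f (mix {m..} w)) \<longlonglongrightarrow> 0"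
    using tendsto_L1_AE_subseq[of S2 "\<lambda>N w. f (mix {m..<N} w) - f (mix {m..} w)"]
    by (auto simp: integrable_mix i1)
  have "mom_le S2 4 (\<lambda>w. f (mix {} w) - f (mix {m..} w)) B"
  proof (rule mom_le_limit)
    show "mom_le S2 4 (\<lambda>w. f (mix {} w) - f (mix {m..<r n} w)) B" for n
      by (rule mom_le_weaken[OF tel B])
    show "AE w in S2. (\<lambda>n. f (mix {} w) - f (mix {m..<r n} w)) \<longlonglongrightarrow> f (mix {} w) - f (mix {m..} w)"
      using r(2) by eventually_elim (auto intro!: tendsto_intros simp: LIM_zero_iff)
  qed simp
  then have "mom_le (S \<Otimes>\<^sub>M S) 4 (\<lambda>z. f (fst z) - f (join m (fst z) (snd z))) B"
    by (intro mom_le_pair) (simp_all add: join_mix)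
  from mom_le_partial_integral[OF S.prob_space_axioms this]
  have "mom_le S 4 (\<lambda>x. \<integral>y. f x - f (join m x y) \<partial>S) B" by simp
  moreover have "AE x in S. (LINT y|S. f x - f (join m x y)) = f x - avg m f x"
    using avg_AE_integrable[OF f, of m] by eventually_elim (use S.prob_space in \<open>simp add: avg_def\<close>)
  ultimately show ?thesis by (rule mom_le_AE_cong) measurable
qed

lemma infl_avg_zero:
  assumes [measurable]: "f \<in> borel_measurable S" and "m \<le> l" shows "infl p (avg m f) l 0"
proof -
  have "avg m f (mix {} w) = avg m f (mix {l} w)" for w
    using assms(2) by (intro avg_cong) (auto simp: mix_def)
  then show ?thesis by (cases "p = 0") (auto simp: infl_def mom_le_def S2.emeasure_space_1[simplified] power_0_left)
qed

text \<open>The same average is taken on both ends of the coupling, so Jensen applies to their difference.\<close>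
lemma infl_avg:
  assumes f: "mom_le S 4 f c" and u: "infl 4 f l a" and "l < m"
  shows "infl 4 (avg m f) l a"
proof -
  have [measurable]: "f \<in> borel_measurable S" using f by (simp add: mom_le_def)
  define S3 where "S3 = (\<Pi>\<^sub>M i\<in>(UNIV :: ((nat + nat) + nat) set). \<mu>)"
  \<comment> \<open>a third copy, \<open>Inr\<close>, supplies the innovations over which both ends are averaged\<close>
  define \<sigma> :: "nat + nat \<Rightarrow> (nat + nat) + nat" where
    "\<sigma> c = (case c of Inl i \<Rightarrow> if i < m then Inl (Inl i) else Inr i | Inr i \<Rightarrow> Inl (Inr i))" for c
  have inj: "inj \<sigma>" by (rule injI) (auto simp: \<sigma>_def split: sum.splits if_splits)
  have s1: "distr S3 S2 (\<lambda>v c. v (\<sigma> c)) = S2" unfolding S3_def by (rule iid_reindex[OF prob_space_axioms inj])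
  have s2: "distr S3 (S2 \<Otimes>\<^sub>M S) (\<lambda>v. (\<lambda>i. v (Inl i), \<lambda>j. v (Inr j))) = S2 \<Otimes>\<^sub>M S"
    unfolding S3_def by (rule iid_split[OF prob_space_axioms])
  have m1: "(\<lambda>v c. v (\<sigma> c)) \<in> S3 \<rightarrow>\<^sub>M S2" unfolding S3_def by (rule measurable_PiM_reindex)
  have m2: "(\<lambda>v. (\<lambda>i. v (Inl i), \<lambda>j. v (Inr j))) \<in> S3 \<rightarrow>\<^sub>M S2 \<Otimes>\<^sub>M S"
    unfolding S3_def by (intro measurable_Pair measurable_PiM_reindex)
  have eq: "mix {} (\<lambda>c. v (\<sigma> c)) = join m (mix {} (\<lambda>i. v (Inl i))) (\<lambda>j. v (Inr j))"
    "mix {l} (\<lambda>c. v (\<sigma> c)) = join m (mix {l} (\<lambda>i. v (Inl i))) (\<lambda>j. v (Inr j))" for v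
    using \<open>l < m\<close> by (auto simp: mix_def \<sigma>_def join_def fun_eq_iff)
  have "mom_le (distr S3 S2 (\<lambda>v c. v (\<sigma> c))) 4 (\<lambda>w. f (mix {} w) - f (mix {l} w)) a"
    unfolding s1 using u by (simp add: infl_def)
  then have "mom_le S3 4 (\<lambda>v. f (mix {} (\<lambda>c. v (\<sigma> c))) - f (mix {l} (\<lambda>c. v (\<sigma> c)))) a"
    by (subst (asm) mom_le_distr[OF m1]) measurable
  then have "mom_le (distr S3 (S2 \<Otimes>\<^sub>M S) (\<lambda>v. (\<lambda>i. v (Inl i), \<lambda>j. v (Inr j)))) 4
      (\<lambda>z. f (join m (mix {} (fst z)) (snd z)) - f (join m (mix {l} (fst z)) (snd z))) a"
    by (subst mom_le_distr[OF m2]) (measurable, simp add: eq)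
  then have "mom_le (S2 \<Otimes>\<^sub>M S) 4 (\<lambda>z. f (join m (mix {} (fst z)) (snd z)) - f (join m (mix {l} (fst z)) (snd z))) a"
    unfolding s2 .
  from mom_le_partial_integral[OF S.prob_space_axioms this]
  have "mom_le S2 4 (\<lambda>w. \<integral>y. f (join m (mix {} w) y) - f (join m (mix {l} w) y) \<partial>S) a" by simp
  moreover have AE: "AE w in S2. integrable S (\<lambda>y. f (join m (mix B w) y))" for B
  proof (rule AE_distrD[OF mix_measurable])
    show "AE x in distr S2 S (mix B). integrable S (\<lambda>y. f (join m x y))"
      unfolding distr_mix by (rule avg_AE_integrable[OF f])
  qed
  have "AE w in S2. (LINT y|S. f (join m (mix {} w) y) - f (join m (mix {l} w) y)) = avg m f (mix {} w) - avg m f (mix {l} w)"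
    using AE[of "{}"] AE[of "{l}"] by eventually_elim (simp add: avg_def)
  ultimately show ?thesis
    unfolding infl_def by (rule mom_le_AE_cong) measurable
qed

end

section \<open>From characteristic functions to weak closeness\<close>

lemma norm_integral_le_integral:
  fixes f :: "'a \<Rightarrow> 'b::{banach, second_countable_topology}"
  assumes "integrable M f" "\<And>x. norm (f x) \<le> g x" "integrable M g"
  shows "norm (LINT x|M. f x) \<le> (LINT x|M. g x)"
proof -
  have "norm (LINT x|M. f x) \<le> (LINT x|M. norm (f x))" by (rule integral_norm_bound)
  also have "\<dots> \<le> (LINT x|M. g x)" using assms by (intro integral_mono) auto
  finally show ?thesis .
qed

lemma first_moment_tail:
  assumes "real_distribution M" "mom_le M 1 (\<lambda>x. x) c" "0 < k"
  shows "measure M {-k<..k} \<ge> 1 - c / k"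
proof -
  interpret real_distribution M by fact
  have i: "integrable M (\<lambda>x. \<bar>x\<bar>)" and le: "(LINT x|M. \<bar>x\<bar>) \<le> c" using mom_le_integrable_power[OF assms(2)] by auto
  have "measure M {x\<in>space M. \<bar>x\<bar> \<ge> k} \<le> (LINT x|M. \<bar>x\<bar>) / k"
    by (rule integral_Markov_inequality_measure[where A="{}"]) (use i assms in auto)
  also have "\<dots> \<le> c / k" using le assms by (intro divide_right_mono) auto
  finally have "measure M {x\<in>space M. \<bar>x\<bar> \<ge> k} \<le> c / k" .
  moreover have "measure M {x\<in>space M. \<bar>x\<bar> \<ge> k} = 1 - measure M (space M - {x\<in>space M. \<bar>x\<bar> \<ge> k})"
    by (subst prob_compl) auto
  moreover have "measure M (space M - {x\<in>space M. \<bar>x\<bar> \<ge> k}) \<le> measure M {-k<..k}"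
    by (rule finite_measure_mono) auto
  ultimately show ?thesis by linarith
qed

lemma tight_first_moment:
  assumes "\<And>n. real_distribution (\<mu> n)" "\<And>n. mom_le (\<mu> n) 1 (\<lambda>x. x) c"
  shows "tight \<mu>"
  unfolding tight_def
proof (intro conjI allI impI)
  fix e :: real assume e: "0 < e"
  have c0: "0 \<le> c" using assms(2)[of 0] by (simp add: mom_le_def)
  define k where "k = (c + 1) / e"
  have k: "0 < k" "c < k * e" using c0 e by (auto simp: k_def)
  then have "c / k < e" by (simp add: divide_less_eq mult.commute)
  then have "1 - e < measure (\<mu> n) {-k<..k}" for n
    using first_moment_tail[OF assms k(1), of n] by linarith
  then show "\<exists>a b. a < b \<and> (\<forall>n. 1 - e < measure (\<mu> n) {a<..b})"
    using k by (intro exI[of _ "-k"] exI[of _ k]) auto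
qed (rule assms)

text \<open>Otherwise some subsequence stays away from zero. By tightness both laws converge along a further
  subsequence, to limits with the same characteristic function, which contradicts uniqueness.\<close>
theorem char_close_imp_weak_close:
  fixes \<mu> \<nu> :: "nat \<Rightarrow> real measure" and h :: "real \<Rightarrow> real"
  assumes \<mu>: "\<And>n. real_distribution (\<mu> n)" "\<And>n. mom_le (\<mu> n) 1 (\<lambda>x. x) c"
    and \<nu>: "\<And>n. real_distribution (\<nu> n)" "\<And>n. mom_le (\<nu> n) 1 (\<lambda>x. x) c"
    and ch: "\<And>t. (\<lambda>n. char (\<mu> n) t - char (\<nu> n) t) \<longlonglongrightarrow> 0"
    and h: "continuous_on UNIV h" "bounded (range h)"
  shows "(\<lambda>n. (LINT x|(\<mu> n). h x) - (LINT x|(\<nu> n). h x)) \<longlonglongrightarrow> 0"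
proof (rule ccontr)
  let ?a = "\<lambda>n. (LINT x|(\<mu> n). h x) - (LINT x|(\<nu> n). h x)"
  assume "\<not> ?a \<longlonglongrightarrow> 0"
  then obtain e where e: "e > 0" "\<And>N. \<exists>n\<ge>N. e \<le> norm (?a n - 0)"
    unfolding LIMSEQ_iff not_all not_ex not_imp not_less by blast
  have "infinite {n. e \<le> norm (?a n - 0)}"
    unfolding infinite_nat_iff_unbounded_le mem_Collect_eq using e(2) by blast
  from infinite_enumerate[OF this] obtain s :: "nat \<Rightarrow> nat"
    where s': "strict_mono s" "\<forall>n. s n \<in> {n. e \<le> norm (?a n - 0)}" by metis
  then have s: "strict_mono s" "e \<le> norm (?a (s n) - 0)" for n
    by simp_all
  obtain r1 M1 where r1: "strict_mono r1" "real_distribution M1" "weak_conv_m (\<mu> \<circ> s \<circ> r1) M1"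
    using tight_imp_convergent_subsubsequence[OF tight_first_moment[of \<mu> c, OF \<mu>(1) \<mu>(2)] s(1)]
    by (elim exE conjE) (rule that)
  have sr1: "strict_mono (s \<circ> r1)" using s(1) r1(1) by (simp add: strict_mono_o)
  obtain r2 M2 where r2: "strict_mono r2" "real_distribution M2" "weak_conv_m (\<nu> \<circ> (s \<circ> r1) \<circ> r2) M2"
    using tight_imp_convergent_subsubsequence[OF tight_first_moment[of \<nu> c, OF \<nu>(1) \<nu>(2)] sr1]
    by (elim exE conjE) (rule that)
  define u where "u n = s (r1 (r2 n))" for n
  have w1: "weak_conv_m (\<lambda>n. \<mu> (u n)) M1"
    using r1(3) r2(1) LIMSEQ_subseq_LIMSEQ[OF _ r2(1)]
    unfolding weak_conv_m_def weak_conv_def u_def comp_def by blast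
  have w2: "weak_conv_m (\<lambda>n. \<nu> (u n)) M2" using r2(3) by (simp add: comp_def u_def)
  have su: "strict_mono u" using strict_mono_o[OF sr1 r2(1)] by (simp add: u_def[abs_def] comp_def)
  have "char M1 t = char M2 t" for t
  proof -
    have c1: "(\<lambda>n. char (\<mu> (u n)) t) \<longlonglongrightarrow> char M1 t"
      by (rule levy_continuity1) (use \<mu> r1 w1 in auto)
    have c2: "(\<lambda>n. char (\<nu> (u n)) t) \<longlonglongrightarrow> char M2 t"
      by (rule levy_continuity1) (use \<nu> r2 w2 in auto)
    have "(\<lambda>n. char (\<mu> (u n)) t - char (\<nu> (u n)) t) \<longlonglongrightarrow> 0"
      using LIMSEQ_subseq_LIMSEQ[OF ch su] by (simp add: comp_def)
    then have "char M1 t - char M2 t = 0" using tendsto_diff[OF c1 c2] LIMSEQ_unique by blast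
    then show ?thesis by simp
  qed
  then have M: "M1 = M2" using r1 r2 by (intro Levy_uniqueness) auto
  obtain K where K: "\<And>x. norm (h x) \<le> K" using h(2) by (auto simp: bounded_iff)
  have hc: "isCont h x" for x using h(1) by (simp add: continuous_on_eq_continuous_at)
  have "(\<lambda>n. \<integral>x. h x \<partial>\<mu> (u n)) \<longlonglongrightarrow> (LINT x|M1. h x)"
    by (rule weak_conv_imp_integral_bdd_continuous_conv[OF _ r1(2) w1 hc K]) (rule \<mu>)
  moreover have "(\<lambda>n. \<integral>x. h x \<partial>\<nu> (u n)) \<longlonglongrightarrow> (LINT x|M2. h x)"
    by (rule weak_conv_imp_integral_bdd_continuous_conv[OF _ r2(2) w2 hc K]) (rule \<nu>)
  ultimately have "(\<lambda>n. ?a (u n)) \<longlonglongrightarrow> 0" using tendsto_diff M by fastforce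
  then have "\<forall>\<^sub>F n in sequentially. norm (?a (u n)) < e"
    using order_tendstoD(2)[OF tendsto_norm_zero e(1)] by blast
  then obtain n where "norm (?a (u n)) < e" by (auto simp: eventually_sequentially)
  then show False using s(2)[of "r1 (r2 n)"] by (simp add: u_def)
qed

section \<open>Lindeberg exchange for forms in independent blocks\<close>

lemma (in prob_space) mom_le_third:
  assumes "mom_le M 4 f a"
  shows "integrable M (\<lambda>x. \<bar>f x\<bar> ^ 3)" "(LINT x|M. \<bar>f x\<bar> ^ 3) \<le> a ^ 3"
proof -
  have [measurable]: "f \<in> borel_measurable M" using assms by (simp add: mom_le_def)
  have 1: "mom_le M 2 (\<lambda>x. \<bar>f x\<bar>) a" by (rule mom_le_mono[OF mom_le_4_2[OF assms]]) auto
  have 2: "mom_le M 2 (\<lambda>x. f x * f x) (a * a)" using mom_le_mult[of M 2 f a f a] assms by simp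
  have eq: "\<bar>f x\<bar> ^ 3 = \<bar>f x\<bar> * (f x * f x)" for x by (simp add: power3_eq_cube)
  show "integrable M (\<lambda>x. \<bar>f x\<bar> ^ 3)" unfolding eq by (rule mom_le_mult_integrable[OF 1 2])
  show "(LINT x|M. \<bar>f x\<bar> ^ 3) \<le> a ^ 3"
    unfolding eq using mom_le_mult_integrable(2)[OF 1 2] by (simp add: power3_eq_cube mult_ac)
qed

text \<open>In the expansion of the fourth power only the even terms survive; induction over the summands.\<close>
lemma (in prob_space) indep_sum_mom4:
  fixes X :: "nat \<Rightarrow> 'a \<Rightarrow> real" and N :: nat
  assumes "indep_vars (\<lambda>_. borel) X {..<N}" "\<And>b. b < N \<Longrightarrow> mom_le M 4 (X b) (a b)"
    "\<And>b. b < N \<Longrightarrow> expectation (X b) = 0"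
  shows "mom_le M 4 (\<lambda>x. \<Sum>b<N. X b x) (sqrt (3 * (\<Sum>b<N. (a b)^2)))"
  using assms(1,2,3)
proof (induction N)
  case 0 then show ?case by (simp add: mom_le_def)
next
  case (Suc N)
  define T where "T x = (\<Sum>b<N. X b x)" for x
  define s where "s = sqrt (3 * (\<Sum>b<N. (a b)^2))"
  have T4: "mom_le M 4 T s" unfolding T_def[abs_def] s_def
    by (rule Suc.IH) (use Suc.prems indep_vars_subset[OF Suc.prems(1), of "{..<N}"] in auto)
  have X4: "mom_le M 4 (X N) (a N)" using Suc.prems by simp
  note [measurable] = mom_le_measurable[OF T4] mom_le_measurable[OF X4]
  have EX: "expectation (X N) = 0" using Suc.prems by simp
  have iT: "integrable M T" and iX: "integrable M (X N)"
    using mom_le_integrable(1)[OF mom_le_4_2] T4 X4 by blast+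
  have ET: "expectation T = 0" unfolding T_def
    using Suc.prems(3) mom_le_integrable(1)[OF mom_le_4_2[OF Suc.prems(2)]] by (subst Bochner_Integration.integral_sum) auto
  have "indep_vars (\<lambda>_. borel) X (insert N {..<N})" using Suc.prems(1) by (simp add: lessThan_Suc)
  then have ind: "indep_var borel (X N) borel T"
    unfolding T_def[abs_def] by (intro indep_vars_sum) auto
  have ind': "indep_var borel (\<lambda>x. X N x ^ i) borel (\<lambda>x. T x ^ j)" for i j
    using indep_var_compose[OF ind, of "\<lambda>x. x ^ i" borel "\<lambda>x. x ^ j" borel] by (simp add: comp_def)
  have TT: "mom_le M 2 (\<lambda>x. T x * T x) (s * s)" using mom_le_mult[of M 2 T s T s] T4 by simp
  have TX: "mom_le M 2 (\<lambda>x. T x * X N x) (s * a N)" using mom_le_mult[of M 2 T s "X N" "a N"] T4 X4 by simp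
  have XX: "mom_le M 2 (\<lambda>x. X N x * X N x) (a N * a N)" using mom_le_mult[of M 2 "X N" "a N" "X N" "a N"] X4 by simp
  have i31: "integrable M (\<lambda>x. X N x * T x ^ 3)" using mom_le_mult_integrable(1)[OF TT TX] by (simp add: power3_eq_cube mult_ac)
  have i13: "integrable M (\<lambda>x. X N x ^ 3 * T x)" using mom_le_mult_integrable(1)[OF XX TX] by (simp add: power3_eq_cube mult_ac)
  have i22: "integrable M (\<lambda>x. (X N x)^2 * (T x)^2)" using mom_le_mult_integrable(1)[OF TX TX] by (simp add: power2_eq_square mult_ac)
  have i4: "integrable M (\<lambda>x. T x ^ 4)" "integrable M (\<lambda>x. X N x ^ 4)"
    using mom_le_even(1)[OF T4] mom_le_even(1)[OF X4] by auto
  have i3: "integrable M (\<lambda>x. T x ^ 3)" "integrable M (\<lambda>x. X N x ^ 3)"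
    using mom_le_third(1)[OF T4] mom_le_third(1)[OF X4] by (auto simp: power_abs[symmetric] integrable_abs_iff)
  have i2: "integrable M (\<lambda>x. (T x)^2)" "integrable M (\<lambda>x. (X N x)^2)"
    using mom_le_even(1)[OF mom_le_4_2[OF T4]] mom_le_even(1)[OF mom_le_4_2[OF X4]] by auto
  have e31: "(LINT x|M. X N x * T x ^ 3) = 0"
    using indep_var_lebesgue_integral[OF ind'[of 1 3]] iX i3 EX by simp
  have e13: "(LINT x|M. X N x ^ 3 * T x) = 0"
    using indep_var_lebesgue_integral[OF ind'[of 3 1]] iT i3 ET by simp
  have e22: "(LINT x|M. (X N x)^2 * (T x)^2) \<le> (a N)^2 * s^2"
    using indep_var_lebesgue_integral[OF ind'[of 2 2]] i2 mom_le_even(2)[OF mom_le_4_2[OF T4]] mom_le_even(2)[OF mom_le_4_2[OF X4]]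
    by (auto intro!: mult_mono)
  have ex: "(T x + X N x) ^ 4 = T x ^ 4 + 4 * (X N x * T x ^ 3) + 6 * ((X N x)^2 * (T x)^2) + 4 * (X N x ^ 3 * T x) + X N x ^ 4" for x
    by (simp add: power4_eq_xxxx power2_eq_square power3_eq_cube algebra_simps)
  have "(LINT x|M. (T x + X N x) ^ 4) = (LINT x|M. T x ^ 4) + 6 * (LINT x|M. (X N x)^2 * (T x)^2) + (LINT x|M. X N x ^ 4)"
    unfolding ex by (simp add: i31 i13 i22 i4 e31 e13)
  also have "\<dots> \<le> s ^ 4 + 6 * ((a N)^2 * s^2) + a N ^ 4"
    using mom_le_even(2)[OF T4] mom_le_even(2)[OF X4] e22 by simp
  also have "\<dots> \<le> (s^2 + 3 * (a N)^2)^2"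
  proof -
    have "(s^2 + 3 * (a N)^2)^2 = s ^ 4 + 6 * ((a N)^2 * s^2) + 9 * a N ^ 4"
      by (simp add: power2_eq_square power4_eq_xxxx algebra_simps)
    moreover have "0 \<le> a N ^ 4" by simp
    ultimately show ?thesis by linarith
  qed
  also have "s^2 = 3 * (\<Sum>b<N. (a b)^2)" by (simp add: s_def sum_nonneg)
  also have "(3 * (\<Sum>b<N. (a b)^2) + 3 * (a N)^2)^2 = (sqrt (3 * (\<Sum>b<Suc N. (a b)^2))) ^ 4"
  proof -
    have "(sqrt (3 * (\<Sum>b<Suc N. (a b)^2))) ^ 4 = ((sqrt (3 * (\<Sum>b<Suc N. (a b)^2)))^2)^2" by (simp flip: power_mult)
    also have "(sqrt (3 * (\<Sum>b<Suc N. (a b)^2)))^2 = 3 * (\<Sum>b<Suc N. (a b)^2)"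
      by (rule real_sqrt_pow2) (simp add: sum_nonneg)
    finally show ?thesis by (simp add: algebra_simps)
  qed
  finally have "mom_le M 4 (\<lambda>x. T x + X N x) (sqrt (3 * (\<Sum>b<Suc N. (a b)^2)))"
    using i31 i13 i22 i4 by (intro mom_leI_integrable) (auto simp: power_even_abs ex sum_nonneg)
  then show ?case by (simp add: T_def)
qed

text \<open>The characteristic function of a random variable at one frequency.\<close>
abbreviation chf :: "'a measure \<Rightarrow> ('a \<Rightarrow> real) \<Rightarrow> real \<Rightarrow> complex" where
  "chf M f t \<equiv> (LINT x|M. iexp (t * f x))"

lemma (in prob_space) iexp_taylor2:
  assumes "mom_le M 4 g a"
  shows "cmod ((LINT x|M. iexp (t * (r + g x)))
     - iexp (t * r) * (1 + \<i> * t * complex_of_real (expectation g) - complex_of_real (t^2 / 2 * expectation (\<lambda>x. (g x)^2))))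
     \<le> abs t ^ 3 / 6 * (LINT x|M. \<bar>g x\<bar> ^ 3)"
proof -
  have [measurable]: "g \<in> borel_measurable M" using assms by (simp add: mom_le_def)
  have ig: "integrable M g" by (rule mom_le_integrable(1)[OF mom_le_4_2[OF assms]])
  have ig2: "integrable M (\<lambda>x. (g x)^2)" using mom_le_even(1)[OF mom_le_4_2[OF assms]] by simp
  let ?P = "\<lambda>x. 1 + \<i> * t * complex_of_real (g x) - complex_of_real (t^2 / 2 * (g x)^2)"
  have ie: "integrable M (\<lambda>x. iexp (t * (r + g x)))"
    by (rule integrable_const_bound[where B=1]) auto
  have iP: "integrable M ?P"
    using ig ig2 by (intro Bochner_Integration.integrable_diff Bochner_Integration.integrable_add integrable_mult_right integrable_of_real) auto
  have EP: "(LINT x|M. ?P x) = 1 + \<i> * t * complex_of_real (expectation g) - complex_of_real (t^2 / 2 * expectation (\<lambda>x. (g x)^2))"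
  proof -
    have i1: "integrable M (\<lambda>x. \<i> * t * complex_of_real (g x))" using ig by (intro integrable_mult_right integrable_of_real)
    have i2: "integrable M (\<lambda>x. complex_of_real (t^2 / 2 * (g x)^2))" using ig2 by (intro integrable_of_real integrable_mult_right)
    have "(LINT x|M. ?P x) = (LINT x|M. 1) + (LINT x|M. \<i> * t * complex_of_real (g x)) - (LINT x|M. complex_of_real (t^2 / 2 * (g x)^2))"
      by (subst Bochner_Integration.integral_diff[OF Bochner_Integration.integrable_add i2], simp, rule i1,
          subst Bochner_Integration.integral_add, simp, rule i1, rule refl)
    also have "(LINT x|M. \<i> * t * complex_of_real (g x)) = \<i> * t * complex_of_real (expectation g)"
      by (simp only: integral_mult_right_zero integral_complex_of_real)
    also have "(LINT x|M. complex_of_real (t^2 / 2 * (g x)^2)) = complex_of_real (t^2 / 2 * expectation (\<lambda>x. (g x)^2))"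
      by (simp only: integral_complex_of_real integral_mult_right_zero)
    also have "(LINT x|M. 1) = (1::complex)" using prob_space by simp
    finally show ?thesis .
  qed
  have pw: "cmod (iexp (t * (r + g x)) - iexp (t * r) * ?P x) \<le> abs t ^ 3 / 6 * \<bar>g x\<bar> ^ 3" for x
  proof -
    have "iexp (t * (r + g x)) - iexp (t * r) * ?P x = iexp (t * r) * (iexp (t * g x) - ?P x)"
      by (simp add: exp_add[symmetric] algebra_simps)
    then have A1: "cmod (iexp (t * (r + g x)) - iexp (t * r) * ?P x) = cmod (iexp (t * g x) - ?P x)"
      by (simp only: norm_mult norm_exp_i_times mult_1)
    have A2: "?P x = (\<Sum>k\<le>2. (\<i> * complex_of_real (t * g x)) ^ k / fact k)"
      by (simp add: numeral_2_eq_2 power2_eq_square field_simps)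
    have "cmod (iexp (t * g x) - (\<Sum>k\<le>2. (\<i> * complex_of_real (t * g x)) ^ k / fact k)) \<le> \<bar>t * g x\<bar> ^ Suc 2 / fact (Suc 2)"
      by (rule iexp_approx1)
    also have "\<bar>t * g x\<bar> ^ Suc 2 / fact (Suc 2) = abs t ^ 3 / 6 * \<bar>g x\<bar> ^ 3"
    proof -
      have "fact (Suc 2) = (6::real)" "Suc 2 = 3" by (simp_all add: eval_nat_numeral)
      then show ?thesis by (simp only: abs_mult power_mult_distrib times_divide_eq_left)
    qed
    finally show ?thesis unfolding A1 unfolding A2 .
  qed
  have "cmod ((LINT x|M. iexp (t * (r + g x))) - iexp (t * r) * (LINT x|M. ?P x))
    = cmod (LINT x|M. iexp (t * (r + g x)) - iexp (t * r) * ?P x)"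
    using ie iP by simp
  also have "\<dots> \<le> (LINT x|M. abs t ^ 3 / 6 * \<bar>g x\<bar> ^ 3)"
    by (rule norm_integral_le_integral[OF _ pw]) (intro Bochner_Integration.integrable_diff ie integrable_mult_right iP mom_le_third(1)[OF assms])+
  also have "\<dots> = abs t ^ 3 / 6 * (LINT x|M. \<bar>g x\<bar> ^ 3)" by simp
  finally show ?thesis unfolding EP .
qed

abbreviation vec_borel :: "rseq measure" where "vec_borel \<equiv> \<Pi>\<^sub>M i\<in>UNIV. borel"

text \<open>A law of one block: coordinate \<open>i\<close> of the vector matters only if \<open>i\<close> belongs to block \<open>s\<close>.\<close>
definition block_law :: "nat \<Rightarrow> (nat \<Rightarrow> nat) \<Rightarrow> real \<Rightarrow> nat \<Rightarrow> rseq measure \<Rightarrow> bool" where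
  "block_law p bl c s \<nu> \<longleftrightarrow> prob_space \<nu> \<and> sets \<nu> = sets vec_borel \<and>
     (\<forall>i<p. bl i = s \<longrightarrow> mom_le \<nu> 4 (\<lambda>v. v i) c \<and> (LINT v|\<nu>. v i) = 0)"

text \<open>\<open>w b\<close> is the vector of block \<open>b\<close>, and variable \<open>i\<close> is its coordinate \<open>i\<close>.\<close>
definition block_form :: "nat \<Rightarrow> (nat \<Rightarrow> nat) \<Rightarrow> array \<Rightarrow> array \<Rightarrow> real" where
  "block_form p bl B w = (\<Sum>i<p. \<Sum>j<p. B i j * (w (bl i) i * w (bl j) j))"

lemma coordinate_measurable:
  assumes "\<And>s. sets (\<nu> s) = sets vec_borel"
  shows "(\<lambda>w. w b i) \<in> borel_measurable (PiM UNIV \<nu>)"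
proof -
  have "(\<lambda>v. v i) \<in> borel_measurable (\<nu> b)"
    using assms by (subst measurable_cong_sets[OF assms refl]) (rule measurable_component_singleton, simp)
  from measurable_compose[OF measurable_component_singleton[of b UNIV \<nu>] this] show ?thesis by simp
qed

text \<open>Blocks are independent, so squares of block norms add up; within a block of at most \<open>m\<close> variables
  Cauchy-Schwarz costs the factor \<open>m\<close>.\<close>
lemma linear_form_mom4:
  fixes \<beta> :: "nat \<Rightarrow> real"
  assumes \<nu>: "\<And>s. block_law p bl c s (\<nu> s)" and m: "\<And>s. card {i. i < p \<and> bl i = s} \<le> m" and "0 \<le> c"
  shows "mom_le (PiM UNIV \<nu>) 4 (\<lambda>w. \<Sum>j<p. \<beta> j * w (bl j) j) (2 * c * sqrt (m * (\<Sum>j<p. (\<beta> j)^2)))"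
proof -
  have pr: "prob_space (\<nu> s)" and sets[measurable_cong]: "sets (\<nu> s) = sets vec_borel" for s
    using \<nu> by (auto simp: block_law_def)
  interpret P: prob_space "\<Pi>\<^sub>M s\<in>UNIV. \<nu> s" by (intro prob_space_PiM pr)
  obtain N where N: "\<And>i. i < p \<Longrightarrow> bl i < N"
    using finite_nat_set_iff_bounded[of "bl ` {..<p}"] by auto
  define J where "J b = {j. j < p \<and> bl j = b}" for b
  have fJ[simp]: "finite (J b)" for b by (simp add: J_def)
  have split: "(\<Sum>j<p. g j) = (\<Sum>b<N. \<Sum>j\<in>J b. g j)" for g :: "nat \<Rightarrow> real"
    using sum.group[of "{..<p}" "{..<N}" bl g] N by (auto simp: J_def image_subset_iff)
  define x where "x b w = (\<Sum>j\<in>J b. \<beta> j * w b j)" for b and w :: "array"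
  define a where "a b = (\<Sum>j\<in>J b. \<bar>\<beta> j\<bar> * c)" for b
  have vm: "(\<lambda>v. v i) \<in> borel_measurable (\<nu> b)" for i b
    by (subst measurable_cong_sets[OF sets refl]) (rule measurable_component_singleton, simp)
  have xb: "mom_le (\<nu> b) 4 (\<lambda>v. \<Sum>j\<in>J b. \<beta> j * v j) (a b)" "(LINT v|(\<nu> b). (\<Sum>j\<in>J b. \<beta> j * v j)) = 0" for b
  proof -
    interpret N: prob_space "\<nu> b" by (rule pr)
    have mj: "mom_le (\<nu> b) 4 (\<lambda>v. v j) c" "(LINT v|(\<nu> b). v j) = 0" if "j \<in> J b" for j
      using \<nu>[of b] that by (auto simp: block_law_def J_def)
    show "mom_le (\<nu> b) 4 (\<lambda>v. \<Sum>j\<in>J b. \<beta> j * v j) (a b)"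
      unfolding a_def by (intro mom_le_sum mom_le_cmult mj) auto
    show "(LINT v|(\<nu> b). (\<Sum>j\<in>J b. \<beta> j * v j)) = 0"
      using mj N.mom_le_integrable(1)[OF N.mom_le_4_2] by (subst Bochner_Integration.integral_sum) auto
  qed
  have law: "distr (PiM UNIV \<nu>) (\<nu> b) (\<lambda>w. w b) = \<nu> b" for b
    by (rule distr_PiM_component) (auto intro: pr)
  have cm: "(\<lambda>w. w b) \<in> (PiM UNIV \<nu>) \<rightarrow>\<^sub>M \<nu> b" for b by simp
  have fm: "(\<lambda>v. \<Sum>j\<in>J b. \<beta> j * v j) \<in> borel_measurable (\<nu> b)" for b
    by (intro borel_measurable_sum borel_measurable_times borel_measurable_const vm)
  have "mom_le (PiM UNIV \<nu>) 4 (\<lambda>w. \<Sum>b<N. x b w) (sqrt (3 * (\<Sum>b<N. (a b)^2)))"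
  proof (rule P.indep_sum_mom4)
    have "P.indep_vars \<nu> (\<lambda>k w. w k) UNIV" by (rule indep_vars_PiM_coordinates) (rule pr)
    then have "P.indep_vars (\<lambda>_. borel) (\<lambda>b w. \<Sum>j\<in>J b. \<beta> j * w b j) UNIV"
      by (rule P.indep_vars_compose2) (rule fm)
    then show "P.indep_vars (\<lambda>_. borel) x {..<N}"
      unfolding x_def[abs_def] by (rule P.indep_vars_subset) simp
    show "mom_le (PiM UNIV \<nu>) 4 (x b) (a b)" for b
    proof -
      have "mom_le (distr (PiM UNIV \<nu>) (\<nu> b) (\<lambda>w. w b)) 4 (\<lambda>v. \<Sum>j\<in>J b. \<beta> j * v j) (a b)"
        unfolding law by (rule xb(1))
      then show ?thesis unfolding x_def[abs_def] mom_le_distr[OF cm fm] .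
    qed
    show "P.expectation (x b) = 0" for b
      using integral_distr[OF cm[of b] fm[of b]] xb(2)[of b] unfolding x_def[abs_def] law by simp
  qed
  moreover have "sqrt (3 * (\<Sum>b<N. (a b)^2)) \<le> 2 * c * sqrt (m * (\<Sum>j<p. (\<beta> j)^2))"
  proof -
    have "(a b)^2 \<le> c^2 * m * (\<Sum>j\<in>J b. (\<beta> j)^2)" for b
    proof -
      have "(a b)^2 = c^2 * (\<Sum>j\<in>J b. 1 * \<bar>\<beta> j\<bar>)^2"
        by (simp add: a_def sum_distrib_right[symmetric] power_mult_distrib)
      also have "\<dots> \<le> c^2 * ((\<Sum>j\<in>J b. 1^2) * (\<Sum>j\<in>J b. \<bar>\<beta> j\<bar>\<^sup>2))"
        by (intro mult_left_mono Cauchy_Schwarz_ineq_sum) simp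
      also have "\<dots> \<le> c^2 * (m * (\<Sum>j\<in>J b. \<bar>\<beta> j\<bar>\<^sup>2))"
        using m[of b] by (intro mult_left_mono mult_right_mono sum_nonneg) (auto simp: J_def)
      finally show ?thesis by (simp add: mult.assoc)
    qed
    then have "(\<Sum>b<N. (a b)^2) \<le> (\<Sum>b<N. c^2 * m * (\<Sum>j\<in>J b. (\<beta> j)^2))" by (intro sum_mono)
    also have "\<dots> = c^2 * m * (\<Sum>j<p. (\<beta> j)^2)" by (simp add: split sum_distrib_left)
    finally have "3 * (\<Sum>b<N. (a b)^2) \<le> 4 * (c^2 * m * (\<Sum>j<p. (\<beta> j)^2))"
      using sum_nonneg[of "{..<N}" "\<lambda>b. (a b)^2"] by simp
    then have "sqrt (3 * (\<Sum>b<N. (a b)^2)) \<le> sqrt ((2 * c)^2 * (m * (\<Sum>j<p. (\<beta> j)^2)))"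
      by (intro real_sqrt_le_mono) (simp add: power_mult_distrib mult_ac)
    also have "\<dots> = 2 * c * sqrt (m * (\<Sum>j<p. (\<beta> j)^2))"
      using \<open>0 \<le> c\<close> by (simp add: real_sqrt_mult)
    finally show ?thesis .
  qed
  moreover have "(\<Sum>b<N. x b w) = (\<Sum>j<p. \<beta> j * w (bl j) j)" for w
    unfolding split x_def by (intro sum.cong refl) (auto simp: J_def)
  ultimately show ?thesis by (auto intro: mom_le_weaken)
qed

lemma mom_le_indep_mult:
  assumes "prob_space M" "prob_space N" and f: "mom_le M p f a" and g: "mom_le N p g b"
  shows "mom_le (M \<Otimes>\<^sub>M N) p (\<lambda>z. f (fst z) * g (snd z)) (a * b)"
proof -
  interpret M: prob_space M by fact
  interpret N: prob_space N by fact
  note [measurable] = mom_le_measurable[OF f] mom_le_measurable[OF g]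
  have a: "0 \<le> a" "0 \<le> b" using f g by (auto simp: mom_le_def)
  have "(\<integral>\<^sup>+z. ennreal (\<bar>f (fst z) * g (snd z)\<bar> ^ p) \<partial>(M \<Otimes>\<^sub>M N))
    = (\<integral>\<^sup>+x. (\<integral>\<^sup>+y. ennreal (\<bar>f x\<bar> ^ p) * ennreal (\<bar>g y\<bar> ^ p) \<partial>N) \<partial>M)"
    by (subst N.nn_integral_fst[symmetric]) (auto simp: abs_mult power_mult_distrib ennreal_mult)
  also have "\<dots> = (\<integral>\<^sup>+x. ennreal (\<bar>f x\<bar> ^ p) \<partial>M) * (\<integral>\<^sup>+y. ennreal (\<bar>g y\<bar> ^ p) \<partial>N)"
    by (simp add: nn_integral_cmult nn_integral_multc)
  also have "\<dots> \<le> ennreal (a ^ p) * ennreal (b ^ p)"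
    using f g by (intro mult_mono) (auto simp: mom_le_def)
  also have "\<dots> = ennreal ((a * b) ^ p)" using a by (simp add: power_mult_distrib ennreal_mult)
  finally show ?thesis using a by (simp add: mom_le_def)
qed

lemma PiM_replace:
  fixes \<nu> :: "nat \<Rightarrow> 'a measure"
  assumes "\<And>s. prob_space (\<nu> s)"
  shows "distr (\<nu> s \<Otimes>\<^sub>M (\<Pi>\<^sub>M i\<in>UNIV - {s}. \<nu> i)) (PiM UNIV \<nu>) (\<lambda>z. (snd z)(s := fst z)) = PiM UNIV \<nu>"
  using distr_pair_PiM_eq_PiM[of "UNIV - {s}" \<nu> s] assms by (simp add: insert_absorb split_beta')

lemma measurable_replace:
  "(\<lambda>z. (snd z)(s := fst z)) \<in> (\<nu> s \<Otimes>\<^sub>M (\<Pi>\<^sub>M i\<in>UNIV - {s}. \<nu> i)) \<rightarrow>\<^sub>M PiM UNIV \<nu>"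
proof (rule measurable_PiM_single')
  fix i
  show "(\<lambda>z. ((snd z)(s := fst z)) i) \<in> (\<nu> s \<Otimes>\<^sub>M (\<Pi>\<^sub>M i\<in>UNIV - {s}. \<nu> i)) \<rightarrow>\<^sub>M \<nu> i"
  proof (cases "i = s")
    case False
    then have "(\<lambda>z. (snd z) i) \<in> (\<nu> s \<Otimes>\<^sub>M (\<Pi>\<^sub>M i\<in>UNIV - {s}. \<nu> i)) \<rightarrow>\<^sub>M \<nu> i"
      by (intro measurable_compose[OF measurable_snd measurable_component_singleton]) simp
    then show ?thesis using False by simp
  qed simp
qed (auto simp: space_pair_measure space_PiM PiE_def Pi_def)

text \<open>Without terms inside block \<open>s\<close> the form is affine in that block: \<open>Q = r + L\<close> with a linear form
  \<open>L\<close> whose coefficients depend on the other blocks. Matching covariances cancel the Taylor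
  expansion of the exponential up to the third absolute moment of \<open>L\<close>.\<close>
lemma lindeberg_swap:
  fixes B :: "array"
  assumes \<nu>: "\<And>b. block_law p bl c b (\<nu> b)" and \<nu>': "\<And>b. block_law p bl c b (\<nu>' b)"
    and same: "\<And>b. b \<noteq> s \<Longrightarrow> \<nu> b = \<nu>' b"
    and cov: "\<And>i j. i < p \<Longrightarrow> j < p \<Longrightarrow> bl i = s \<Longrightarrow> bl j = s \<Longrightarrow> (LINT v|(\<nu> s). v i * v j) = (LINT v|(\<nu>' s). v i * v j)"
    and m: "\<And>s. card {i. i < p \<and> bl i = s} \<le> m" and c: "0 \<le> c"
    and diag: "\<And>i j. i < p \<Longrightarrow> j < p \<Longrightarrow> bl i = bl j \<Longrightarrow> B i j = 0"
  defines "a \<equiv> (\<Sum>i\<in>{i. i < p \<and> bl i = s}. c * (2 * c * sqrt (m * (\<Sum>j<p. (B i j + B j i)^2))))"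
  shows "cmod (chf (PiM UNIV \<nu>) (block_form p bl B) t - chf (PiM UNIV \<nu>') (block_form p bl B) t)
     \<le> abs t ^ 3 / 3 * a ^ 3"
    and "(LINT w|(PiM UNIV \<nu>). (block_form p bl B w)^2) = (LINT w|(PiM UNIV \<nu>'). (block_form p bl B w)^2)"
proof -
  define R where "R = (\<Pi>\<^sub>M i\<in>UNIV - {s}. \<nu> i)"
  have R': "R = (\<Pi>\<^sub>M i\<in>UNIV - {s}. \<nu>' i)" unfolding R_def by (intro PiM_cong) (auto simp: same)
  define I where "I = {i. i < p \<and> bl i = s}"
  have fI[simp]: "finite I" by (simp add: I_def)
  define \<beta> where "\<beta> i j = (if bl j = s then 0 else B i j + B j i)" for i j
  define \<xi> where "\<xi> i w = (\<Sum>j<p. \<beta> i j * w (bl j) j)" for i and w :: "array"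
  define y where "y i w = (if bl i = s then 0 else w (bl i) i)" for i and w :: "array"
  define r where "r w = (\<Sum>i<p. \<Sum>j<p. B i j * (y i w * y j w))" for w
  define L where "L v w = (\<Sum>i\<in>I. v i * \<xi> i w)" for v and w :: "array"
  define Q where "Q = block_form p bl B"
  have \<xi>_upd[simp]: "\<xi> i (w(s := v)) = \<xi> i w" for i v w
    unfolding \<xi>_def by (intro sum.cong refl) (simp add: \<beta>_def)
  have decomp: "Q (w(s := v)) = r w + L v w" for v w
  proof -
    define u where "u i = (if bl i = s then v i else 0)" for i
    have x: "(w(s := v)) (bl i) i = y i w + u i" for i by (simp add: y_def u_def)
    have e: "B i j * ((y i w + u i) * (y j w + u j)) = B i j * (y i w * y j w) + (u i * (B i j * y j w) + u j * (B i j * y i w))"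
      if "i < p" "j < p" for i j
    proof -
      have "B i j * (u i * u j) = 0" using diag[OF that] by (auto simp: u_def)
      then show ?thesis by (simp add: algebra_simps)
    qed
    have "Q (w(s := v)) = (\<Sum>i<p. \<Sum>j<p. B i j * (y i w * y j w) + (u i * (B i j * y j w) + u j * (B i j * y i w)))"
      unfolding Q_def block_form_def x by (intro sum.cong refl e) auto
    also have "\<dots> = r w + ((\<Sum>i<p. \<Sum>j<p. u i * (B i j * y j w)) + (\<Sum>i<p. \<Sum>j<p. u j * (B i j * y i w)))"
      by (simp add: sum.distrib r_def)
    also have "(\<Sum>i<p. \<Sum>j<p. u j * (B i j * y i w)) = (\<Sum>i<p. \<Sum>j<p. u i * (B j i * y j w))"
      by (rule sum.swap)
    also have "(\<Sum>i<p. \<Sum>j<p. u i * (B i j * y j w)) + \<dots> = (\<Sum>i<p. u i * \<xi> i w)"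
      unfolding sum.distrib[symmetric] \<xi>_def sum_distrib_left
      by (intro sum.cong refl) (auto simp: \<beta>_def y_def algebra_simps)
    also have "\<dots> = L v w"
      unfolding L_def I_def by (rule sum.mono_neutral_cong_right) (auto simp: u_def)
    finally show ?thesis .
  qed
  have mom_v: "mom_le N 4 (\<lambda>v. v i) c" "(LINT v|N. v i) = 0" if "i \<in> I" "block_law p bl c s N" for i N
    using that by (auto simp: I_def block_law_def)
  have gen: "prob_space (PiM UNIV \<kappa>) \<and> prob_space (\<kappa> s) \<and> prob_space (\<Pi>\<^sub>M i\<in>UNIV - {s}. \<kappa> i) \<and>
      Q \<in> borel_measurable (PiM UNIV \<kappa>) \<and> r \<in> borel_measurable (\<Pi>\<^sub>M i\<in>UNIV - {s}. \<kappa> i) \<and>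
      mom_le (\<kappa> s \<Otimes>\<^sub>M (\<Pi>\<^sub>M i\<in>UNIV - {s}. \<kappa> i)) 4 (\<lambda>z. L (fst z) (snd z)) a \<and> (\<exists>q. mom_le (PiM UNIV \<kappa>) 2 Q q)
      \<and> (\<forall>w. \<exists>q. mom_le (\<kappa> s) 4 (\<lambda>v. L v w) q)"
    if \<kappa>: "\<And>b. block_law p bl c b (\<kappa> b)" for \<kappa>
  proof (intro conjI)
    have pr: "prob_space (\<kappa> b)" and sets: "sets (\<kappa> b) = sets vec_borel" for b
      using \<kappa> by (auto simp: block_law_def)
    show P: "prob_space (PiM UNIV \<kappa>)" by (intro prob_space_PiM pr)
    show "prob_space (\<kappa> s)" by (rule pr)
    show PR: "prob_space (\<Pi>\<^sub>M i\<in>UNIV - {s}. \<kappa> i)" by (intro prob_space_PiM pr)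
    have vm: "(\<lambda>v. v i) \<in> borel_measurable (\<kappa> b)" for i b
      by (subst measurable_cong_sets[OF sets refl]) (rule measurable_component_singleton, simp)
    show Qm: "Q \<in> borel_measurable (PiM UNIV \<kappa>)"
      unfolding Q_def block_form_def[abs_def]
      by (intro borel_measurable_sum borel_measurable_times borel_measurable_const coordinate_measurable sets)
    have ym: "y i \<in> borel_measurable (\<Pi>\<^sub>M i\<in>UNIV - {s}. \<kappa> i)" for i
      unfolding y_def[abs_def]
      by (cases "bl i = s") (auto intro!: measurable_compose[OF measurable_component_singleton[of "bl i" "UNIV - {s}" \<kappa>] vm])
    show "r \<in> borel_measurable (\<Pi>\<^sub>M i\<in>UNIV - {s}. \<kappa> i)"
      unfolding r_def[abs_def] by (intro borel_measurable_sum borel_measurable_times borel_measurable_const ym)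
    have \<xi>R: "mom_le (\<Pi>\<^sub>M i\<in>UNIV - {s}. \<kappa> i) 4 (\<xi> i) (2 * c * sqrt (m * (\<Sum>j<p. (B i j + B j i)^2)))" for i
    proof -
      have "mom_le (PiM UNIV \<kappa>) 4 (\<xi> i) (2 * c * sqrt (m * (\<Sum>j<p. (\<beta> i j)^2)))"
        unfolding \<xi>_def[abs_def] by (rule linear_form_mom4[OF \<kappa> m c])
      moreover have "2 * c * sqrt (m * (\<Sum>j<p. (\<beta> i j)^2)) \<le> 2 * c * sqrt (m * (\<Sum>j<p. (B i j + B j i)^2))"
        using c by (intro mult_left_mono real_sqrt_le_mono sum_mono) (auto simp: \<beta>_def)
      ultimately have "mom_le (PiM UNIV \<kappa>) 4 (\<xi> i) (2 * c * sqrt (m * (\<Sum>j<p. (B i j + B j i)^2)))"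
        by (rule mom_le_weaken)
      then have x: "mom_le (\<kappa> s \<Otimes>\<^sub>M (\<Pi>\<^sub>M i\<in>UNIV - {s}. \<kappa> i)) 4 (\<lambda>z. \<xi> i (snd z)) (2 * c * sqrt (m * (\<Sum>j<p. (B i j + B j i)^2)))"
        by (subst (asm) PiM_replace[OF pr, where s=s, symmetric], subst (asm) mom_le_distr[OF measurable_replace])
          (auto simp: mom_le_def)
      have \<xi>m: "\<xi> i \<in> borel_measurable (\<Pi>\<^sub>M i\<in>UNIV - {s}. \<kappa> i)"
      proof -
        have "\<xi> i = (\<lambda>w. \<Sum>j<p. \<beta> i j * y j w)" by (auto simp: fun_eq_iff \<xi>_def y_def \<beta>_def intro!: sum.cong)
        then show ?thesis by (auto intro!: borel_measurable_sum borel_measurable_times ym)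
      qed
      interpret PR: prob_space "\<Pi>\<^sub>M i\<in>UNIV - {s}. \<kappa> i" by (rule PR)
      interpret Ps: prob_space "\<kappa> s" by (rule pr)
      have "(\<integral>\<^sup>+z. ennreal (\<bar>\<xi> i (snd z)\<bar> ^ 4) \<partial>(\<kappa> s \<Otimes>\<^sub>M (\<Pi>\<^sub>M i\<in>UNIV - {s}. \<kappa> i)))
        = (\<integral>\<^sup>+v. (\<integral>\<^sup>+w. ennreal (\<bar>\<xi> i w\<bar> ^ 4) \<partial>(\<Pi>\<^sub>M i\<in>UNIV - {s}. \<kappa> i)) \<partial>\<kappa> s)"
        using \<xi>m by (subst PR.nn_integral_fst[symmetric]) auto
      also have "\<dots> = (\<integral>\<^sup>+w. ennreal (\<bar>\<xi> i w\<bar> ^ 4) \<partial>(\<Pi>\<^sub>M i\<in>UNIV - {s}. \<kappa> i))"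
        by (simp add: Ps.emeasure_space_1)
      finally show ?thesis using x \<xi>m by (simp add: mom_le_def)
    qed
    show "mom_le (\<kappa> s \<Otimes>\<^sub>M (\<Pi>\<^sub>M i\<in>UNIV - {s}. \<kappa> i)) 4 (\<lambda>z. L (fst z) (snd z)) a"
      unfolding L_def a_def I_def[symmetric]
      by (intro mom_le_sum mom_le_indep_mult pr PR mom_v \<xi>R \<kappa>) auto
    have wi: "mom_le (PiM UNIV \<kappa>) 4 (\<lambda>w. w (bl i) i) c" if "i < p" for i
    proof -
      have "mom_le (\<kappa> (bl i)) 4 (\<lambda>v. v i) c" using \<kappa>[of "bl i"] that by (auto simp: block_law_def)
      then have "mom_le (distr (PiM UNIV \<kappa>) (\<kappa> (bl i)) (\<lambda>w. w (bl i))) 4 (\<lambda>v. v i) c"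
        by (subst distr_PiM_component) (auto intro: pr)
      then show ?thesis by (subst (asm) mom_le_distr[OF _ vm]) auto
    qed
    have "mom_le (PiM UNIV \<kappa>) 2 Q (\<Sum>i<p. \<Sum>j<p. \<bar>B i j\<bar> * (c * c))"
      unfolding Q_def block_form_def[abs_def]
      by (intro mom_le_sum mom_le_cmult mom_le_mult) (auto intro: wi)
    then show "\<exists>q. mom_le (PiM UNIV \<kappa>) 2 Q q" by blast
    show "\<forall>w. \<exists>q. mom_le (\<kappa> s) 4 (\<lambda>v. L v w) q"
    proof
      fix w
      have "mom_le (\<kappa> s) 4 (\<lambda>v. \<Sum>i\<in>I. \<xi> i w * v i) (\<Sum>i\<in>I. \<bar>\<xi> i w\<bar> * c)"
        by (intro mom_le_sum mom_le_cmult mom_v \<kappa>) auto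
      then show "\<exists>q. mom_le (\<kappa> s) 4 (\<lambda>v. L v w) q" unfolding L_def by (auto simp: mult.commute)
    qed
  qed
  note g1 = gen[OF \<nu>, folded R_def] and g2 = gen[OF \<nu>', folded R']
  interpret R: prob_space R using g1 by blast
  interpret P1: prob_space "\<nu> s" using g1 by blast
  interpret P2: prob_space "\<nu>' s" using g2 by blast
  interpret PR1: pair_prob_space "\<nu> s" R ..
  interpret PR2: pair_prob_space "\<nu>' s" R ..
  have [measurable]: "r \<in> borel_measurable R" using g1 by blast
  have L1: "mom_le (\<nu> s \<Otimes>\<^sub>M R) 4 (\<lambda>z. L (fst z) (snd z)) a" and L2: "mom_le (\<nu>' s \<Otimes>\<^sub>M R) 4 (\<lambda>z. L (fst z) (snd z)) a"
    using g1 g2 by blast+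
  have l1: "\<exists>q. mom_le (\<nu> s) 4 (\<lambda>v. L v w) q" and l2: "\<exists>q. mom_le (\<nu>' s) 4 (\<lambda>v. L v w) q" for w
    using g1 g2 by blast+
  note [measurable] = mom_le_measurable[OF L1] mom_le_measurable[OF L2]
  have EL: "(LINT v|N. L v w) = 0" "(LINT v|N. (L v w)^2) = (\<Sum>i\<in>I. \<Sum>j\<in>I. \<xi> i w * \<xi> j w * (LINT v|N. v i * v j))"
    if N: "block_law p bl c s N" for N w
  proof -
    interpret N: prob_space N using N by (simp add: block_law_def)
    have m2: "mom_le N 2 (\<lambda>v. v i) c" if "i \<in> I" for i using N.mom_le_4_2[OF mom_v(1)[OF that N]] .
    show "(LINT v|N. L v w) = 0"
      unfolding L_def using N.mom_le_integrable(1)[OF m2] mom_v(2)[OF _ N]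
      by (subst Bochner_Integration.integral_sum) auto
    have "(L v w)^2 = (\<Sum>i\<in>I. \<Sum>j\<in>I. \<xi> i w * \<xi> j w * (v i * v j))" for v
      by (simp add: L_def power2_eq_square sum_product mult_ac)
    then show "(LINT v|N. (L v w)^2) = (\<Sum>i\<in>I. \<Sum>j\<in>I. \<xi> i w * \<xi> j w * (LINT v|N. v i * v j))"
      using mom_le_mult_integrable(1)[OF m2 m2]
      by (simp add: Bochner_Integration.integral_sum)
  qed
  have EL2: "(LINT v|(\<nu> s). (L v w)^2) = (LINT v|(\<nu>' s). (L v w)^2)" for w
    unfolding EL(2)[OF \<nu>] EL(2)[OF \<nu>'] by (intro sum.cong refl arg_cong2[where f="(*)"] cov) (auto simp: I_def)
  have fubini: "(LINT w|(PiM UNIV \<kappa>). F (Q w)) = (LINT w|R. (LINT v|(\<kappa> s). F (r w + L v w))) \<and> integrable R (\<lambda>w. \<integral>v. F (r w + L v w) \<partial>\<kappa> s)"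
    if \<kappa>: "\<And>b. block_law p bl c b (\<kappa> b)" and R\<kappa>: "R = (\<Pi>\<^sub>M i\<in>UNIV - {s}. \<kappa> i)" and F[measurable]: "F \<in> borel_measurable borel" and i: "integrable (PiM UNIV \<kappa>) (\<lambda>w. F (Q w))"
    for \<kappa> and F :: "real \<Rightarrow> 'x::{banach,second_countable_topology}"
  proof -
    have pr: "prob_space (\<kappa> b)" for b using \<kappa> by (auto simp: block_law_def)
    interpret P: prob_space "\<kappa> s" by (rule pr)
    interpret PR: pair_prob_space "\<kappa> s" R ..
    have Qm: "(\<lambda>w. F (Q w)) \<in> borel_measurable (PiM UNIV \<kappa>)" using i by auto
    have mr: "(\<lambda>z. (snd z)(s := fst z)) \<in> \<kappa> s \<Otimes>\<^sub>M R \<rightarrow>\<^sub>M PiM UNIV \<kappa>" unfolding R\<kappa> by (rule measurable_replace)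
    have d: "distr (\<kappa> s \<Otimes>\<^sub>M R) (PiM UNIV \<kappa>) (\<lambda>z. (snd z)(s := fst z)) = PiM UNIV \<kappa>"
      unfolding R\<kappa> by (rule PiM_replace[OF pr])
    have i': "integrable (\<kappa> s \<Otimes>\<^sub>M R) (case_prod (\<lambda>v w. F (r w + L v w)))"
    proof -
      have "integrable (distr (\<kappa> s \<Otimes>\<^sub>M R) (PiM UNIV \<kappa>) (\<lambda>z. (snd z)(s := fst z))) (\<lambda>w. F (Q w))"
        using i by (simp only: d)
      then show ?thesis unfolding integrable_distr_eq[OF mr Qm] by (simp add: decomp split_beta')
    qed
    have "(LINT w|(PiM UNIV \<kappa>). F (Q w)) = (LINT z|(\<kappa> s \<Otimes>\<^sub>M R). F (Q ((snd z)(s := fst z))))"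
      by (subst d[symmetric], rule integral_distr[OF mr Qm])
    also have "\<dots> = (LINT w|R. (LINT v|(\<kappa> s). F (r w + L v w)))"
      using PR.integral_snd[OF i'] by (simp add: decomp split_beta')
    finally show ?thesis using PR.integrable_snd[OF i'] by simp
  qed
  note Fub1 = fubini[OF \<nu> R_def] and Fub2 = fubini[OF \<nu>' R']
  interpret PP1: prob_space "\<Pi>\<^sub>M b\<in>UNIV. \<nu> b" using g1 by blast
  interpret PP2: prob_space "\<Pi>\<^sub>M b\<in>UNIV. \<nu>' b" using g2 by blast
  have [measurable]: "Q \<in> borel_measurable (PiM UNIV \<nu>)" "Q \<in> borel_measurable (PiM UNIV \<nu>')"
    using g1 g2 by blast+
  have ie: "(\<lambda>q. iexp (t * q)) \<in> borel_measurable borel" by measurable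
  have E1: "(chf (PiM UNIV \<nu>) Q t) = (LINT w|R. (LINT v|(\<nu> s). iexp (t * (r w + L v w))))" "integrable R (\<lambda>w. \<integral>v. iexp (t * (r w + L v w)) \<partial>\<nu> s)"
    using Fub1[OF ie] PP1.integrable_const_bound[of "\<lambda>w. iexp (t * Q w)" 1] by auto
  have E2: "(chf (PiM UNIV \<nu>') Q t) = (LINT w|R. (LINT v|(\<nu>' s). iexp (t * (r w + L v w))))" "integrable R (\<lambda>w. \<integral>v. iexp (t * (r w + L v w)) \<partial>\<nu>' s)"
    using Fub2[OF ie] PP2.integrable_const_bound[of "\<lambda>w. iexp (t * Q w)" 1] by auto
  define D1 where "D1 w = (LINT v|(\<nu> s). \<bar>L v w\<bar> ^ 3)" for w
  define D2 where "D2 w = (LINT v|(\<nu>' s). \<bar>L v w\<bar> ^ 3)" for w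
  have iD1: "integrable R D1" "(LINT w|R. D1 w) \<le> a ^ 3"
    using PR1.integrable_snd[of "\<lambda>v w. \<bar>L v w\<bar> ^ 3"] PR1.integral_snd[of "\<lambda>v w. \<bar>L v w\<bar> ^ 3"] PR1.P.mom_le_third[OF L1]
    by (auto simp: D1_def[abs_def] split_beta')
  have iD2: "integrable R D2" "(LINT w|R. D2 w) \<le> a ^ 3"
    using PR2.integrable_snd[of "\<lambda>v w. \<bar>L v w\<bar> ^ 3"] PR2.integral_snd[of "\<lambda>v w. \<bar>L v w\<bar> ^ 3"] PR2.P.mom_le_third[OF L2]
    by (auto simp: D2_def[abs_def] split_beta')
  have pw: "cmod ((LINT v|(\<nu> s). iexp (t * (r w + L v w))) - (LINT v|(\<nu>' s). iexp (t * (r w + L v w)))) \<le> abs t ^ 3 / 6 * D1 w + abs t ^ 3 / 6 * D2 w" for w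
  proof -
    obtain q1 q2 where q: "mom_le (\<nu> s) 4 (\<lambda>v. L v w) q1" "mom_le (\<nu>' s) 4 (\<lambda>v. L v w) q2" using l1 l2 by blast
    note a1 = P1.iexp_taylor2[OF q(1), of t "r w"] and a2 = P2.iexp_taylor2[OF q(2), of t "r w"]
    show ?thesis
      using norm_triangle_le_diff[OF add_mono[OF a1 a2]] unfolding D1_def D2_def EL(1)[OF \<nu>] EL(1)[OF \<nu>'] EL2 by simp
  qed
  have "cmod (chf (PiM UNIV \<nu>) Q t - chf (PiM UNIV \<nu>') Q t)
    = cmod (LINT w|R. (LINT v|(\<nu> s). iexp (t * (r w + L v w))) - (LINT v|(\<nu>' s). iexp (t * (r w + L v w))))"
    unfolding E1(1) E2(1) using E1(2) E2(2) by simp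
  also have "\<dots> \<le> (LINT w|R. abs t ^ 3 / 6 * D1 w + abs t ^ 3 / 6 * D2 w)"
    by (rule norm_integral_le_integral[OF _ pw]) (intro Bochner_Integration.integrable_diff Bochner_Integration.integrable_add integrable_mult_right E1 E2 iD1 iD2)+
  also have "\<dots> = abs t ^ 3 / 6 * ((LINT w|R. D1 w) + (LINT w|R. D2 w))"
    using iD1 iD2 by (simp add: distrib_left)
  also have "\<dots> \<le> abs t ^ 3 / 6 * (a ^ 3 + a ^ 3)"
    using iD1 iD2 by (intro mult_left_mono add_mono) auto
  finally show "cmod (chf (PiM UNIV \<nu>) (block_form p bl B) t - chf (PiM UNIV \<nu>') (block_form p bl B) t)
     \<le> abs t ^ 3 / 3 * a ^ 3" by (simp add: Q_def mult.commute)
  have sq: "(\<lambda>q::real. q^2) \<in> borel_measurable borel" by measurable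
  have iQ1: "integrable (PiM UNIV \<nu>) (\<lambda>w. (Q w)^2)" and iQ2: "integrable (PiM UNIV \<nu>') (\<lambda>w. (Q w)^2)"
    using g1 g2 mom_le_even(1)[of _ 2 Q] by fastforce+
  have "(LINT v|N. (r w + L v w)^2) = (r w)^2 + (LINT v|N. (L v w)^2)"
    if N: "block_law p bl c s N" "mom_le N 4 (\<lambda>v. L v w) q" for w N q
  proof -
    interpret N: prob_space N using N by (simp add: block_law_def)
    have "integrable N (\<lambda>v. L v w)" "integrable N (\<lambda>v. (L v w)^2)"
      using N.mom_le_integrable(1)[OF N.mom_le_4_2[OF N(2)]] mom_le_even(1)[OF N.mom_le_4_2[OF N(2)]] by auto
    then show ?thesis using EL(1)[OF N(1)] N.prob_space by (simp add: power2_sum)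
  qed
  then have "(LINT v|(\<nu> s). (r w + L v w)^2) = (LINT v|(\<nu>' s). (r w + L v w)^2)" for w
    using l1[of w] l2[of w] \<nu>[of s] \<nu>'[of s] EL2[of w] by metis
  then show "(LINT w|(PiM UNIV \<nu>). (block_form p bl B w)^2) = (LINT w|(PiM UNIV \<nu>'). (block_form p bl B w)^2)"
    using Fub1[OF sq iQ1] Fub2[OF sq iQ2] by (simp add: Q_def)
qed

text \<open>An exchange costs the cube of the sum of the row norms of its block. One factor is at most a multiple of
  \<open>sqrt \<tau>\<close>; the squares that remain sum up to the total mass of the matrix.\<close>
theorem lindeberg:
  fixes B :: "array" and m :: nat
  assumes \<nu>: "\<And>b. block_law p bl c b (\<nu> b)" and \<gamma>: "\<And>b. block_law p bl c b (\<gamma> b)"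
    and N: "\<And>i. i < p \<Longrightarrow> bl i < N" and beyond: "\<And>b. N \<le> b \<Longrightarrow> \<nu> b = \<gamma> b"
    and cov: "\<And>i j. i < p \<Longrightarrow> j < p \<Longrightarrow> bl i = bl j \<Longrightarrow> (LINT v|(\<nu> (bl i)). v i * v j) = (LINT v|(\<gamma> (bl i)). v i * v j)"
    and m: "\<And>s. card {i. i < p \<and> bl i = s} \<le> m" and c: "0 \<le> c"
    and diag: "\<And>i j. i < p \<Longrightarrow> j < p \<Longrightarrow> bl i = bl j \<Longrightarrow> B i j = 0"
    and \<tau>: "\<And>i. i < p \<Longrightarrow> (\<Sum>j<p. (B i j + B j i)^2) \<le> \<tau>" "0 \<le> \<tau>"
  shows "cmod (chf (PiM UNIV \<nu>) (block_form p bl B) t - chf (PiM UNIV \<gamma>) (block_form p bl B) t)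
     \<le> abs t ^ 3 * (3 * c ^ 6 * m ^ 4 * sqrt \<tau> * (\<Sum>i<p. \<Sum>j<p. (B i j + B j i)^2))"
    and "(LINT w|(PiM UNIV \<nu>). (block_form p bl B w)^2) = (LINT w|(PiM UNIV \<gamma>). (block_form p bl B w)^2)"
proof -
  define w where "w i = (\<Sum>j<p. (B i j + B j i)^2)" for i
  have w0: "0 \<le> w i" for i by (simp add: w_def sum_nonneg)
  define I where "I s = {i. i < p \<and> bl i = s}" for s
  have fI[simp]: "finite (I s)" for s by (simp add: I_def)
  define \<kappa> where "\<kappa> s b = (if b < s then \<gamma> b else \<nu> b)" for s b
  have \<kappa>l: "block_law p bl c b (\<kappa> s b)" for s b by (simp add: \<kappa>_def \<nu> \<gamma>)
  define \<phi> where "\<phi> s = (chf (\<Pi>\<^sub>M b\<in>UNIV. \<kappa> s b) (block_form p bl B) t)" for s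
  define \<psi> where "\<psi> s = (LINT x|(\<Pi>\<^sub>M b\<in>UNIV. \<kappa> s b). (block_form p bl B x)^2)" for s
  define a where "a s = (\<Sum>i\<in>I s. c * (2 * c * sqrt (m * w i)))" for s
  have covs: "(LINT v|(\<kappa> s s). v i * v j) = (LINT v|(\<kappa> (Suc s) s). v i * v j)" if "i < p" "j < p" "bl i = s" "bl j = s" for i j s
    using cov[of i j] that by (auto simp: \<kappa>_def)
  have ks: "\<kappa> s b = \<kappa> (Suc s) b" if "b \<noteq> s" for s b using that by (auto simp: \<kappa>_def less_Suc_eq)
  have step: "cmod (\<phi> s - \<phi> (Suc s)) \<le> abs t ^ 3 / 3 * a s ^ 3" and sq: "\<psi> s = \<psi> (Suc s)" for s
    unfolding \<phi>_def \<psi>_def a_def I_def w_def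
    by (rule lindeberg_swap[OF \<kappa>l \<kappa>l ks covs m c diag]; assumption)+
  have a3: "a s ^ 3 \<le> 8 * c ^ 6 * m ^ 4 * sqrt \<tau> * (\<Sum>i\<in>I s. w i)" for s
  proof -
    define W where "W = (\<Sum>i\<in>I s. w i)"
    have W0: "0 \<le> W" by (simp add: W_def sum_nonneg w0)
    have cs: "(\<Sum>i\<in>I s. 1 * sqrt (w i))^2 \<le> (\<Sum>i\<in>I s. 1^2) * (\<Sum>i\<in>I s. (sqrt (w i))^2)"
      by (rule Cauchy_Schwarz_ineq_sum)
    also have "\<dots> \<le> m * W" using m[of s] w0 W0 by (auto simp: I_def W_def intro!: mult_right_mono)
    finally have sw: "(\<Sum>i\<in>I s. sqrt (w i)) \<le> sqrt (m * W)" by (intro real_le_rsqrt) simp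
    have "a s = 2 * c^2 * sqrt m * (\<Sum>i\<in>I s. sqrt (w i))"
      by (simp add: a_def real_sqrt_mult sum_distrib_left power2_eq_square mult_ac)
    also have "\<dots> \<le> 2 * c^2 * sqrt m * sqrt (m * W)"
      using c sw by (intro mult_left_mono) auto
    also have "\<dots> = 2 * c^2 * m * sqrt W" by (simp add: real_sqrt_mult)
    finally have "a s ^ 3 \<le> (2 * c^2 * m * sqrt W) ^ 3"
      using c w0 by (intro power_mono) (auto simp: a_def intro!: sum_nonneg)
    also have "\<dots> = 8 * c ^ 6 * m ^ 3 * (sqrt W * W)"
      using W0 by (simp add: power_mult_distrib power3_eq_cube[of "sqrt W"] power_mult[symmetric] mult_ac)
    also have "sqrt W * W \<le> (m * sqrt \<tau>) * W"
    proof (intro mult_right_mono W0)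
      have "W \<le> (\<Sum>i\<in>I s. \<tau>)" unfolding W_def by (intro sum_mono) (auto simp: I_def w_def \<tau>)
      also have "\<dots> \<le> m * \<tau>" using m[of s] \<tau>(2) by (auto simp: I_def intro!: mult_right_mono)
      also have "\<dots> \<le> (m * m) * \<tau>" using \<tau>(2) by (intro mult_right_mono) (auto simp flip: of_nat_mult simp: le_square)
      finally have "sqrt W \<le> sqrt ((m * m) * \<tau>)" by (intro real_sqrt_le_mono) simp
      then show "sqrt W \<le> m * sqrt \<tau>" by (simp add: real_sqrt_mult)
    qed
    finally have "a s ^ 3 \<le> 8 * c ^ 6 * m ^ 3 * ((m * sqrt \<tau>) * W)"
      using c by (simp add: mult_left_mono)
    also have "\<dots> = 8 * c ^ 6 * m ^ 4 * sqrt \<tau> * W" by (simp add: power4_eq_xxxx power3_eq_cube mult_ac)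
    finally show ?thesis by (simp add: W_def)
  qed
  have "cmod (\<phi> 0 - \<phi> n) \<le> (\<Sum>s<n. abs t ^ 3 / 3 * a s ^ 3)" for n
  proof (induction n)
    case (Suc n)
    have "cmod (\<phi> 0 - \<phi> (Suc n)) \<le> cmod (\<phi> 0 - \<phi> n) + cmod (\<phi> n - \<phi> (Suc n))"
      using norm_triangle_ineq[of "\<phi> 0 - \<phi> n" "\<phi> n - \<phi> (Suc n)"] by simp
    then show ?case using Suc step[of n] by simp
  qed simp
  also have "(\<Sum>s<N. abs t ^ 3 / 3 * a s ^ 3) \<le> (\<Sum>s<N. abs t ^ 3 / 3 * (8 * c ^ 6 * m ^ 4 * sqrt \<tau> * (\<Sum>i\<in>I s. w i)))"
    by (intro sum_mono mult_left_mono a3) simp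
  also have "\<dots> = abs t ^ 3 * (8 / 3 * c ^ 6 * m ^ 4 * sqrt \<tau> * (\<Sum>s<N. \<Sum>i\<in>I s. w i))"
    by (simp add: sum_distrib_left mult_ac)
  also have "(\<Sum>s<N. \<Sum>i\<in>I s. w i) = (\<Sum>i<p. w i)"
    using sum.group[of "{..<p}" "{..<N}" bl w] N by (auto simp: I_def image_subset_iff)
  also have "abs t ^ 3 * (8 / 3 * c ^ 6 * m ^ 4 * sqrt \<tau> * (\<Sum>i<p. w i)) \<le> abs t ^ 3 * (3 * c ^ 6 * m ^ 4 * sqrt \<tau> * (\<Sum>i<p. w i))"
    using c w0 \<tau>(2) by (intro mult_left_mono mult_right_mono) (auto intro: sum_nonneg)
  finally have fin: "cmod (\<phi> 0 - \<phi> N) \<le> abs t ^ 3 * (3 * c ^ 6 * m ^ 4 * sqrt \<tau> * (\<Sum>i<p. w i))" .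
  have k0: "\<kappa> 0 = \<nu>" by (simp add: \<kappa>_def fun_eq_iff)
  have kN: "\<kappa> N = \<gamma>" using beyond by (auto simp: \<kappa>_def fun_eq_iff)
  show "cmod (chf (PiM UNIV \<nu>) (block_form p bl B) t - chf (PiM UNIV \<gamma>) (block_form p bl B) t)
     \<le> abs t ^ 3 * (3 * c ^ 6 * m ^ 4 * sqrt \<tau> * (\<Sum>i<p. \<Sum>j<p. (B i j + B j i)^2))"
    using fin unfolding \<phi>_def k0 kN w_def .
  have "\<psi> 0 = \<psi> n" for n by (induction n) (use sq in auto)
  from this[of N] show "(LINT w|(PiM UNIV \<nu>). (block_form p bl B w)^2) = (LINT w|(PiM UNIV \<gamma>). (block_form p bl B w)^2)"
    unfolding \<psi>_def k0 kN .
qed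

section \<open>Gaussian quadratic forms and their diagonalisation\<close>

text \<open>A Gram matrix has a square root by Gram-Schmidt: the induction splits one variable off and projects
  the others. It provides Gaussian variables with prescribed covariances.\<close>
lemma gram_factor:
  fixes Y :: "'i \<Rightarrow> 'a \<Rightarrow> real"
  assumes "finite I" "\<And>i. i \<in> I \<Longrightarrow> \<exists>c. mom_le M 2 (Y i) c"
  shows "\<exists>S. \<forall>i\<in>I. \<forall>j\<in>I. (LINT x|M. Y i x * Y j x) = (\<Sum>r\<in>I. S i r * S j r)"
  using assms
proof (induction I arbitrary: Y rule: finite_induct)
  case empty then show ?case by simp
next
  case (insert p I)
  define v where "v = (LINT x|M. Y p x * Y p x)"
  have m: "\<exists>c. mom_le M 2 (Y i) c" if "i \<in> insert p I" for i using insert.prems that by blast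
  have int: "integrable M (\<lambda>x. Y i x * Y j x)" if "i \<in> insert p I" "j \<in> insert p I" for i j
    using m[OF that(1)] m[OF that(2)] mom_le_mult_integrable(1) by blast
  have v0: "0 \<le> v" unfolding v_def by simp
  define k where "k i = (if v = 0 then 0 else (LINT x|M. Y i x * Y p x) / v)" for i
  define Y' where "Y' i x = Y i x - k i * Y p x" for i x
  have "\<exists>c. mom_le M 2 (Y' i) c" if i: "i \<in> I" for i
  proof -
    obtain a b where ab: "mom_le M 2 (Y i) a" "mom_le M 2 (Y p) b" using m[of i] m[of p] i by auto
    have "mom_le M 2 (Y' i) (a + \<bar>k i\<bar> * b)" unfolding Y'_def by (intro mom_le_diff mom_le_cmult ab) simp
    then show ?thesis by blast
  qed
  from insert.IH[of Y', OF this] obtain S where S: "\<And>i j. i \<in> I \<Longrightarrow> j \<in> I \<Longrightarrow> (LINT x|M. Y' i x * Y' j x) = (\<Sum>r\<in>I. S i r * S j r)"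
    by blast
  have zero: "(LINT x|M. Y i x * Y p x) = 0" if vz: "v = 0" and ii: "i \<in> insert p I" for i
  proof -
    obtain a b where ab: "mom_le M 2 (Y i) a" "mom_le M 2 (Y p) b" using m[OF ii] m[of p] by auto
    have "mom_le M 2 (Y p) 0"
      by (rule mom_leI_integrable) (use int[of p p] vz ab(2) in \<open>auto simp: v_def power2_eq_square mom_le_def\<close>)
    from mom_le_mult_integrable(2)[OF ab(1) this] show ?thesis by simp
  qed
  have kv: "k i * v = (LINT x|M. Y i x * Y p x)" if "i \<in> insert p I" for i
    using zero[OF _ that] by (auto simp: k_def)
  have cross: "(LINT x|M. Y' i x * Y' j x) = (LINT x|M. Y i x * Y j x) - k i * k j * v" if "i \<in> I" "j \<in> I" for i j
  proof -
    have "Y' i x * Y' j x = Y i x * Y j x - k j * (Y i x * Y p x) - k i * (Y j x * Y p x) + k i * k j * (Y p x * Y p x)" for x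
      by (simp add: Y'_def algebra_simps)
    then have "(LINT x|M. Y' i x * Y' j x) = (LINT x|M. Y i x * Y j x) - k j * (LINT x|M. Y i x * Y p x)
       - k i * (LINT x|M. Y j x * Y p x) + k i * k j * v"
      using int that by (simp add: v_def)
    also have "\<dots> = (LINT x|M. Y i x * Y j x) - k j * (k i * v) - k i * (k j * v) + k i * k j * v"
      using kv that by simp
    finally show ?thesis by (simp add: algebra_simps)
  qed
  define T where "T i r = (if r = p then (if i = p then sqrt v else k i * sqrt v) else if i = p then 0 else S i r)" for i r
  have "(LINT x|M. Y i x * Y j x) = (\<Sum>r\<in>insert p I. T i r * T j r)" if i: "i \<in> insert p I" and j: "j \<in> insert p I" for i j
  proof -
    have "(\<Sum>r\<in>insert p I. T i r * T j r) = T i p * T j p + (\<Sum>r\<in>I. T i r * T j r)"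
      using insert.hyps by simp
    also have "(\<Sum>r\<in>I. T i r * T j r) = (if i = p \<or> j = p then 0 else (\<Sum>r\<in>I. S i r * S j r))"
    proof (cases "i = p \<or> j = p")
      case True
      then have "\<forall>r\<in>I. T i r * T j r = 0" using insert.hyps by (auto simp: T_def)
      then have "(\<Sum>r\<in>I. T i r * T j r) = 0" by (rule sum.neutral)
      then show ?thesis using True by simp
    next
      case False
      then show ?thesis using insert.hyps by (auto simp: T_def intro!: sum.cong)
    qed
    also have "T i p * T j p + \<dots> = (LINT x|M. Y i x * Y j x)"
    proof (cases "i = p \<or> j = p")
      case True
      then show ?thesis using kv[OF i] kv[OF j] v0 by (auto simp: T_def v_def mult_ac)
    next
      case False
      then have "i \<in> I" "j \<in> I" using i j by auto
      moreover have "T i p * T j p = k i * k j * v"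
      proof -
        have "T i p * T j p = k i * k j * (sqrt v)^2" using False by (simp add: T_def power2_eq_square)
        then show ?thesis using v0 by simp
      qed
      ultimately show ?thesis using False S[of i j] cross[of i j] by simp
    qed
    finally show ?thesis by simp
  qed
  then show ?case by blast
qed

abbreviation gauss :: "real measure" where "gauss \<equiv> density lborel std_normal_density"
abbreviation gauss_seq :: "rseq measure" where "gauss_seq \<equiv> \<Pi>\<^sub>M i\<in>UNIV. gauss"

lemma prob_gauss: "prob_space gauss" by (rule prob_space_normal_density) simp

interpretation gauss: iid_law gauss
  by (intro iid_law.intro prob_gauss iid_law_axioms.intro) simp

lemma gauss_coord[measurable]: "(\<lambda>z. z i) \<in> borel_measurable gauss_seq"
  by (rule measurable_compose[OF measurable_component_singleton[of i UNIV "\<lambda>_. gauss"]]) auto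

lemma gauss_law_coord: "distr gauss_seq gauss (\<lambda>z. z i) = gauss"
  by (rule distr_PiM_component) (auto intro: prob_gauss)

lemma gauss_moments: "(LINT x|gauss. x) = 0" "(LINT x|gauss. x^2) = 1" "(LINT x|gauss. x ^ 3) = 0" "(LINT x|gauss. x ^ 4) = 3"
  "integrable gauss (\<lambda>x. x ^ k)"
proof -
  show "(LINT x|gauss. x) = 0" using integral_std_normal_distribution_moment_odd[of 1] by simp
  show "(LINT x|gauss. x ^ 3) = 0" using integral_std_normal_distribution_moment_odd[of 3] by simp
  show "(LINT x|gauss. x^2) = 1" using std_normal_distribution_even_moments(1)[of 1] by simp
  show "(LINT x|gauss. x ^ 4) = 3" using std_normal_distribution_even_moments(1)[of 2] by (simp add: fact_numeral)
  show "integrable gauss (\<lambda>x. x ^ k)" by (rule integrable_std_normal_distribution_moment)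
qed

lemma gauss_coord_mom: "mom_le gauss_seq 4 (\<lambda>z. z i) 2"
proof -
  have "mom_le gauss 4 (\<lambda>x. x) 2"
    by (rule mom_leI_integrable) (use gauss_moments(4) gauss_moments(5)[of 4] in \<open>auto simp: power_even_abs\<close>)
  then have "mom_le (distr gauss_seq gauss (\<lambda>z. z i)) 4 (\<lambda>x. x) 2" by (simp only: gauss_law_coord)
  then show ?thesis by (subst (asm) mom_le_distr) auto
qed

lemma gauss_indep_coord:
  fixes f :: "real \<Rightarrow> real" and g :: "statistic"
  assumes f: "integrable gauss f" and g: "integrable gauss_seq g" and g': "\<And>z x. g (z(p := x)) = g z"
  shows "integrable gauss_seq (\<lambda>z. f (z p) * g z)" "(LINT z|gauss_seq. f (z p) * g z) = (LINT x|gauss. f x) * (LINT z|gauss_seq. g z)"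
proof -
  have [measurable]: "f \<in> borel_measurable borel" using borel_measurable_integrable[OF f] by simp
  have gm: "g \<in> borel_measurable gauss_seq" using g by auto
  have ind: "gauss.S.indep_vars (\<lambda>_. gauss) (\<lambda>k z. z k) UNIV" by (rule indep_vars_PiM_coordinates) (rule prob_gauss)
  have "gauss.S.indep_var (PiM {p} (\<lambda>_. gauss)) (\<lambda>z. restrict (\<lambda>i. z i) {p}) (PiM (UNIV - {p}) (\<lambda>_. gauss)) (\<lambda>z. restrict (\<lambda>i. z i) (UNIV - {p}))"
    by (rule gauss.S.indep_var_restrict[OF ind]) auto
  moreover have "(\<lambda>v. f (v p)) \<in> borel_measurable (PiM {p} (\<lambda>_. gauss))"
  proof -
    have "(\<lambda>v. v p) \<in> PiM {p} (\<lambda>_. gauss) \<rightarrow>\<^sub>M gauss" by (rule measurable_component_singleton) simp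
    then show ?thesis by (rule measurable_compose) simp
  qed
  moreover have "(\<lambda>v. g (\<lambda>i. if i = p then 0 else v i)) \<in> borel_measurable (PiM (UNIV - {p}) (\<lambda>_. gauss))"
  proof (rule measurable_compose[OF _ gm], rule measurable_PiM_single')
    show "(\<lambda>v. if i = p then 0 else v i) \<in> PiM (UNIV - {p}) (\<lambda>_. gauss) \<rightarrow>\<^sub>M gauss" for i
    proof (cases "i = p")
      case False
      then have "(\<lambda>v. v i) \<in> PiM (UNIV - {p}) (\<lambda>_. gauss) \<rightarrow>\<^sub>M gauss" by (intro measurable_component_singleton) simp
      then show ?thesis unfolding if_not_P[OF False] .
    qed simp
  qed simp
  ultimately have "gauss.S.indep_var borel ((\<lambda>v. f (v p)) \<circ> (\<lambda>z. restrict (\<lambda>i. z i) {p})) borel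
      ((\<lambda>v. g (\<lambda>i. if i = p then 0 else v i)) \<circ> (\<lambda>z. restrict (\<lambda>i. z i) (UNIV - {p})))"
    by (rule gauss.S.indep_var_compose)
  moreover have "(\<lambda>v. g (\<lambda>i. if i = p then 0 else v i)) \<circ> (\<lambda>z. restrict (\<lambda>i. z i) (UNIV - {p})) = g"
  proof
    fix z :: "nat \<Rightarrow> real"
    have "(\<lambda>i. if i = p then 0 else restrict (\<lambda>i. z i) (UNIV - {p}) i) = z(p := 0)" by auto
    then show "((\<lambda>v. g (\<lambda>i. if i = p then 0 else v i)) \<circ> (\<lambda>z. restrict (\<lambda>i. z i) (UNIV - {p}))) z = g z"
      by (simp add: g')
  qed
  moreover have "(\<lambda>v. f (v p)) \<circ> (\<lambda>z. restrict (\<lambda>i. z i) {p}) = (\<lambda>z. f (z p))" by auto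
  ultimately have iv: "gauss.S.indep_var borel (\<lambda>z. f (z p)) borel g" by simp
  have cm: "(\<lambda>z. z p) \<in> gauss_seq \<rightarrow>\<^sub>M gauss" by (rule measurable_component_singleton) simp
  have fi: "integrable gauss_seq (\<lambda>z. f (z p))"
    using f by (intro integrable_distr[OF cm]) (simp only: gauss_law_coord)
  have fe: "(LINT z|gauss_seq. f (z p)) = (LINT x|gauss. f x)"
    using integral_distr[OF cm, of f] by (simp add: gauss_law_coord)
  show "integrable gauss_seq (\<lambda>z. f (z p) * g z)" by (rule gauss.S.indep_var_integrable[OF iv fi g])
  show "(LINT z|gauss_seq. f (z p) * g z) = (LINT x|gauss. f x) * (LINT z|gauss_seq. g z)"
    using gauss.S.indep_var_lebesgue_integral[OF iv fi g] fe by simp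
qed

definition quad :: "nat \<Rightarrow> array \<Rightarrow> statistic" where
  "quad p A z = (\<Sum>i<p. \<Sum>j<p. A i j * (z i * z j))"

lemma quad_mom: "\<exists>c. mom_le gauss_seq 2 (quad p A) c"
proof -
  have "mom_le gauss_seq 2 (quad p A) (\<Sum>i<p. \<Sum>j<p. \<bar>A i j\<bar> * (2 * 2))"
    unfolding quad_def[abs_def] by (intro mom_le_sum mom_le_cmult mom_le_mult) (auto intro: gauss_coord_mom)
  then show ?thesis by blast
qed

lemma quad_measurable[measurable]: "quad p A \<in> borel_measurable gauss_seq"
  using quad_mom[of p A] by (auto simp: mom_le_def)

text \<open>Induction over the number of variables; the newest one enters through a linear form in the others and
  its own square.\<close>
lemma quad_moments_symmetric:
  "(\<forall>i j. i < p \<longrightarrow> j < p \<longrightarrow> A i j = A j i) \<longrightarrow> (LINT z|gauss_seq. quad p A z) = (\<Sum>i<p. A i i) \<and>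
    (LINT z|gauss_seq. (quad p A z)^2) = 2 * (\<Sum>i<p. \<Sum>j<p. (A i j)^2) + (\<Sum>i<p. A i i)^2"
proof (induction p)
  case 0 then show ?case by (simp add: quad_def)
next
  case (Suc p)
  define q where "q = quad p A"
  have IH: "(LINT z|gauss_seq. q z) = (\<Sum>i<p. A i i)" "(LINT z|gauss_seq. (q z)^2) = 2 * (\<Sum>i<p. \<Sum>j<p. (A i j)^2) + (\<Sum>i<p. A i i)^2"
    if "\<And>i j. i < Suc p \<Longrightarrow> j < Suc p \<Longrightarrow> A i j = A j i"
    using Suc that by (auto simp: q_def)
  define l where "l n z = (\<Sum>a<n. A a p * z a)" for n and z :: "nat \<Rightarrow> real"
  define D where "D = A p p"
  have lm: "mom_le gauss_seq 4 (l n) (\<Sum>a<n. \<bar>A a p\<bar> * 2)" for n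
    unfolding l_def[abs_def] by (intro mom_le_sum mom_le_cmult gauss_coord_mom) auto
  obtain c where qm: "mom_le gauss_seq 2 q c" using quad_mom q_def by blast
  have lu: "l n (z(k := x)) = l n z" if "n \<le> k" for n k z x using that by (auto simp: l_def intro!: sum.cong)
  have qu: "q (z(p := x)) = q z" for z x by (auto simp: q_def quad_def intro!: sum.cong)
  have i_l: "integrable gauss_seq (l n)" "integrable gauss_seq (\<lambda>z. (l n z)^2)" for n
    using gauss.S.mom_le_integrable(1)[OF gauss.S.mom_le_4_2[OF lm]] mom_le_even(1)[OF gauss.S.mom_le_4_2[OF lm]] by auto
  have i_q: "integrable gauss_seq q" "integrable gauss_seq (\<lambda>z. (q z)^2)" "integrable gauss_seq (\<lambda>z. q z * l p z)"
    using gauss.S.mom_le_integrable(1)[OF qm] mom_le_even(1)[OF qm] mom_le_mult_integrable(1)[OF qm gauss.S.mom_le_4_2[OF lm]] by auto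
  note gi = gauss_indep_coord(1) and ge = gauss_indep_coord(2)
  have id: "integrable gauss (\<lambda>x. x)" using gauss_moments(5)[of 1] by simp
  have el2: "(LINT z|gauss_seq. (l n z)^2) = (\<Sum>a<n. (A a p)^2)" for n
  proof (induction n)
    case 0 then show ?case by (simp add: l_def)
  next
    case (Suc n)
    have e: "(l (Suc n) z)^2 = (l n z)^2 + 2 * A n p * (z n * l n z) + (A n p)^2 * ((z n)^2 * 1)" for z
      by (simp add: l_def power2_eq_square algebra_simps)
    have i1: "integrable gauss_seq (\<lambda>z. z n * l n z)" using gi[OF id i_l(1), of n n] lu by simp
    have e1: "(LINT z|gauss_seq. z n * l n z) = 0" using ge[OF id i_l(1), of n n] lu gauss_moments(1) by simp
    have i2: "integrable gauss_seq (\<lambda>z. (z n)^2 * 1)" using gi[OF gauss_moments(5)[of 2], of "\<lambda>_. 1" n] by simp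
    have e2: "(LINT z|gauss_seq. (z n)^2 * 1) = 1"
      using ge[OF gauss_moments(5)[of 2], of "\<lambda>_. 1" n] gauss_moments(2) gauss.S.prob_space by simp
    show ?case unfolding e using i1 i2 i_l(2)[of n] e1 e2 Suc.IH by simp
  qed
  have ez: "(LINT z|gauss_seq. z p * (q z * l p z)) = 0" "integrable gauss_seq (\<lambda>z. z p * (q z * l p z))"
    using ge[OF id i_q(3)] gi[OF id i_q(3)] lu qu gauss_moments(1) by auto
  have ez1: "(LINT z|gauss_seq. z p * l p z) = 0" "integrable gauss_seq (\<lambda>z. z p * l p z)"
    using ge[OF id i_l(1)] gi[OF id i_l(1)] lu gauss_moments(1) by auto
  have ez2l: "(LINT z|gauss_seq. (z p)^2 * (l p z)^2) = (\<Sum>a<p. (A a p)^2)" "integrable gauss_seq (\<lambda>z. (z p)^2 * (l p z)^2)"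
    using ge[OF gauss_moments(5)[of 2] i_l(2)] gi[OF gauss_moments(5)[of 2] i_l(2)] lu gauss_moments(2) el2 by auto
  have ez2q: "(LINT z|gauss_seq. (z p)^2 * q z) = (LINT z|gauss_seq. q z)" "integrable gauss_seq (\<lambda>z. (z p)^2 * q z)"
    using ge[OF gauss_moments(5)[of 2] i_q(1)] gi[OF gauss_moments(5)[of 2] i_q(1)] qu gauss_moments(2) by auto
  have ez3: "(LINT z|gauss_seq. (z p) ^ 3 * l p z) = 0" "integrable gauss_seq (\<lambda>z. (z p) ^ 3 * l p z)"
    using ge[OF gauss_moments(5)[of 3] i_l(1)] gi[OF gauss_moments(5)[of 3] i_l(1)] lu gauss_moments(3) by auto
  have ez4: "(LINT z|gauss_seq. (z p) ^ 4 * 1) = 3" "integrable gauss_seq (\<lambda>z. (z p) ^ 4 * 1)"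
    using ge[OF gauss_moments(5)[of 4], of "\<lambda>_. 1" p] gi[OF gauss_moments(5)[of 4], of "\<lambda>_. 1" p] gauss_moments(4) gauss.S.prob_space by auto
  have ez2: "(LINT z|gauss_seq. (z p)^2 * 1) = 1" "integrable gauss_seq (\<lambda>z. (z p)^2 * 1)"
    using ge[OF gauss_moments(5)[of 2], of "\<lambda>_. 1" p] gi[OF gauss_moments(5)[of 2], of "\<lambda>_. 1" p] gauss_moments(2) gauss.S.prob_space by auto
  show ?case
  proof (intro impI conjI)
    assume "\<forall>i j. i < Suc p \<longrightarrow> j < Suc p \<longrightarrow> A i j = A j i"
    then have sym: "\<And>i j. i < Suc p \<Longrightarrow> j < Suc p \<Longrightarrow> A i j = A j i" by blast
    have dec: "quad (Suc p) A z = q z + 2 * (z p * l p z) + D * ((z p)^2 * 1)" for z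
    proof -
      have "quad (Suc p) A z = q z + (\<Sum>i<p. A i p * (z i * z p)) + ((\<Sum>j<p. A p j * (z p * z j)) + A p p * (z p * z p))"
        by (simp add: quad_def q_def sum.distrib)
      also have "(\<Sum>j<p. A p j * (z p * z j)) = z p * l p z"
        unfolding l_def sum_distrib_left by (intro sum.cong refl) (simp add: sym[of p])
      also have "(\<Sum>i<p. A i p * (z i * z p)) = z p * l p z"
        by (simp add: l_def sum_distrib_left mult_ac)
      finally show ?thesis by (simp add: D_def power2_eq_square)
    qed
    show "(LINT z|gauss_seq. quad (Suc p) A z) = (\<Sum>i<Suc p. A i i)"
      unfolding dec using i_q(1) ez1 ez2 IH(1)[OF sym] by (simp add: D_def)
    have dec2: "(quad (Suc p) A z)^2 = (q z)^2 + 4 * ((z p)^2 * (l p z)^2) + D^2 * ((z p) ^ 4 * 1) + 4 * (z p * (q z * l p z))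
        + 2 * D * ((z p)^2 * q z) + 4 * D * ((z p) ^ 3 * l p z)" for z
      unfolding dec by (simp add: power2_eq_square power3_eq_cube power4_eq_xxxx algebra_simps)
    have "(LINT z|gauss_seq. (quad (Suc p) A z)^2) = 2 * (\<Sum>i<p. \<Sum>j<p. (A i j)^2) + (\<Sum>i<p. A i i)^2
        + 4 * (\<Sum>a<p. (A a p)^2) + D^2 * 3 + 2 * D * (\<Sum>i<p. A i i)"
      unfolding dec2 using i_q(2) ez ez2l ez2q ez3 ez4 IH[OF sym] by simp
    also have "\<dots> = 2 * (\<Sum>i<Suc p. \<Sum>j<Suc p. (A i j)^2) + (\<Sum>i<Suc p. A i i)^2"
    proof -
      have "(\<Sum>j<p. (A p j)^2) = (\<Sum>a<p. (A a p)^2)" by (intro sum.cong refl) (simp add: sym[of p])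
      then show ?thesis by (simp add: sum.distrib D_def power2_eq_square algebra_simps)
    qed
    finally show "(LINT z|gauss_seq. (quad (Suc p) A z)^2) = 2 * (\<Sum>i<Suc p. \<Sum>j<Suc p. (A i j)^2) + (\<Sum>i<Suc p. A i i)^2" .
  qed
qed

lemma quad_moments:
  assumes "\<And>i j. i < p \<Longrightarrow> j < p \<Longrightarrow> A i j = A j i"
  shows "(LINT z|gauss_seq. quad p A z) = (\<Sum>i<p. A i i)"
    "(LINT z|gauss_seq. (quad p A z)^2) = 2 * (\<Sum>i<p. \<Sum>j<p. (A i j)^2) + (\<Sum>i<p. A i i)^2"
  using quad_moments_symmetric[of p A] assms by blast+

lemma lebesgue_shear1:
  fixes K :: "real \<times> real \<Rightarrow> ennreal"
  assumes [measurable]: "K \<in> borel_measurable (borel \<Otimes>\<^sub>M borel)"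
  shows "(\<integral>\<^sup>+z. K (fst z + a * snd z, snd z) \<partial>(lborel \<Otimes>\<^sub>M lborel)) = (\<integral>\<^sup>+z. K z \<partial>(lborel \<Otimes>\<^sub>M (lborel :: real measure)))"
proof -
  have "(\<integral>\<^sup>+z. K (fst z + a * snd z, snd z) \<partial>(lborel \<Otimes>\<^sub>M lborel)) = (\<integral>\<^sup>+y. (\<integral>\<^sup>+x. K (x + a * y, y) \<partial>lborel) \<partial>lborel)"
    by (subst lborel_pair.nn_integral_snd[symmetric]) auto
  also have "\<dots> = (\<integral>\<^sup>+y. (\<integral>\<^sup>+x. K (x, y) \<partial>lborel) \<partial>lborel)"
  proof (rule nn_integral_cong)
    fix y
    show "(\<integral>\<^sup>+x. K (x + a * y, y) \<partial>lborel) = (\<integral>\<^sup>+x. K (x, y) \<partial>lborel)"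
      using nn_integral_real_affine[of "\<lambda>x. K (x, y)" 1 "a * y"] by (simp add: add.commute)
  qed
  also have "\<dots> = (\<integral>\<^sup>+z. K z \<partial>(lborel \<Otimes>\<^sub>M lborel))"
    by (subst lborel_pair.nn_integral_snd) auto
  finally show ?thesis .
qed

lemma lebesgue_shear2:
  fixes K :: "real \<times> real \<Rightarrow> ennreal"
  assumes [measurable]: "K \<in> borel_measurable (borel \<Otimes>\<^sub>M borel)"
  shows "(\<integral>\<^sup>+z. K (fst z, snd z + b * fst z) \<partial>(lborel \<Otimes>\<^sub>M lborel)) = (\<integral>\<^sup>+z. K z \<partial>(lborel \<Otimes>\<^sub>M (lborel :: real measure)))"
proof -
  have "(\<integral>\<^sup>+z. K (fst z, snd z + b * fst z) \<partial>(lborel \<Otimes>\<^sub>M lborel)) = (\<integral>\<^sup>+x. (\<integral>\<^sup>+y. K (x, y + b * x) \<partial>lborel) \<partial>lborel)"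
    by (subst lborel.nn_integral_fst[symmetric]) auto
  also have "\<dots> = (\<integral>\<^sup>+x. (\<integral>\<^sup>+y. K (x, y) \<partial>lborel) \<partial>lborel)"
  proof (rule nn_integral_cong)
    fix x
    show "(\<integral>\<^sup>+y. K (x, y + b * x) \<partial>lborel) = (\<integral>\<^sup>+y. K (x, y) \<partial>lborel)"
      using nn_integral_real_affine[of "\<lambda>y. K (x, y)" 1 "b * x"] by (simp add: add.commute)
  qed
  also have "\<dots> = (\<integral>\<^sup>+z. K z \<partial>(lborel \<Otimes>\<^sub>M lborel))"
    by (subst lborel.nn_integral_fst) auto
  finally show ?thesis .
qed

text \<open>For \<open>c \<ge> 0\<close> a rotation is a product of three shears, and a shear is a translation in one coordinate.\<close>
lemma lebesgue_rotation:
  fixes K :: "real \<times> real \<Rightarrow> ennreal"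
  assumes K[measurable]: "K \<in> borel_measurable (borel \<Otimes>\<^sub>M borel)" and cs: "c^2 + s^2 = 1" "0 \<le> c"
  shows "(\<integral>\<^sup>+z. K (c * fst z - s * snd z, s * fst z + c * snd z) \<partial>(lborel \<Otimes>\<^sub>M lborel)) = (\<integral>\<^sup>+z. K z \<partial>(lborel \<Otimes>\<^sub>M (lborel :: real measure)))"
proof -
  define a where "a = - s / (1 + c)"
  have sa: "1 + s * a = c"
  proof -
    have "s * s = (1 - c) * (1 + c)" using cs by (simp add: power2_eq_square algebra_simps)
    then show ?thesis using cs by (simp add: a_def)
  qed
  have ac: "a * (1 + c) = - s" using cs by (simp add: a_def)
  define K1 where "K1 z = K (fst z + a * snd z, snd z)" for z
  define K2 where "K2 z = K1 (fst z, snd z + s * fst z)" for z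
  have [measurable]: "K1 \<in> borel_measurable (borel \<Otimes>\<^sub>M borel)" unfolding K1_def[abs_def] by measurable
  have [measurable]: "K2 \<in> borel_measurable (borel \<Otimes>\<^sub>M borel)" unfolding K2_def[abs_def] by measurable
  have "K (c * x - s * y, s * x + c * y) = K2 (x + a * y, y)" for x y
  proof -
    have e1: "y + s * (x + a * y) = s * x + (1 + s * a) * y" by (simp add: algebra_simps)
    have e2: "x + a * y + a * (s * x + c * y) = (1 + s * a) * x + (a * (1 + c)) * y" by (simp add: algebra_simps)
    show ?thesis unfolding K2_def K1_def fst_conv snd_conv e1 sa e2 ac by simp
  qed
  then have "(\<integral>\<^sup>+z. K (c * fst z - s * snd z, s * fst z + c * snd z) \<partial>(lborel \<Otimes>\<^sub>M lborel)) = (\<integral>\<^sup>+z. K2 (fst z + a * snd z, snd z) \<partial>(lborel \<Otimes>\<^sub>M lborel))"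
    by simp
  also have "\<dots> = (\<integral>\<^sup>+z. K2 z \<partial>(lborel \<Otimes>\<^sub>M lborel))" by (rule lebesgue_shear1) simp
  also have "\<dots> = (\<integral>\<^sup>+z. K1 z \<partial>(lborel \<Otimes>\<^sub>M lborel))" unfolding K2_def by (rule lebesgue_shear2) simp
  also have "\<dots> = (\<integral>\<^sup>+z. K z \<partial>(lborel \<Otimes>\<^sub>M lborel))" unfolding K1_def by (rule lebesgue_shear1) simp
  finally show ?thesis .
qed

text \<open>The Gaussian density depends on the radius only.\<close>
lemma gauss_rotation:
  fixes K :: "real \<times> real \<Rightarrow> ennreal"
  assumes K[measurable]: "K \<in> borel_measurable (borel \<Otimes>\<^sub>M borel)" and cs: "c^2 + s^2 = 1" "0 \<le> c"
  shows "(\<integral>\<^sup>+z. K (c * fst z - s * snd z, s * fst z + c * snd z) \<partial>(gauss \<Otimes>\<^sub>M gauss)) = (\<integral>\<^sup>+z. K z \<partial>(gauss \<Otimes>\<^sub>M gauss))"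
proof -
  let ?d = "\<lambda>z :: real \<times> real. ennreal (std_normal_density (fst z)) * ennreal (std_normal_density (snd z))"
  have gg: "gauss \<Otimes>\<^sub>M gauss = density (lborel \<Otimes>\<^sub>M lborel) ?d"
    by (subst pair_measure_density) (auto simp: split_beta' prob_gauss prob_space_imp_sigma_finite lborel.sigma_finite_measure_axioms)
  have dr: "?d (c * fst z - s * snd z, s * fst z + c * snd z) = ?d z" for z
  proof -
    have "(c * fst z - s * snd z)^2 + (s * fst z + c * snd z)^2 = (c^2 + s^2) * ((fst z)^2 + (snd z)^2)"
      by (simp add: power2_eq_square algebra_simps)
    then have e: "- (c * fst z - s * snd z)\<^sup>2 / 2 + - (s * fst z + c * snd z)\<^sup>2 / 2 = - (fst z)\<^sup>2 / 2 + - (snd z)\<^sup>2 / 2"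
      using cs by simp
    have "std_normal_density x * std_normal_density y = (1 / sqrt (2 * pi))^2 * exp (- x\<^sup>2 / 2 + - y\<^sup>2 / 2)" for x y
      by (simp only: std_normal_density_def exp_add power2_eq_square mult_ac)
    then show ?thesis
      using e by (simp add: ennreal_mult[symmetric])
  qed
  have "(\<integral>\<^sup>+z. K (c * fst z - s * snd z, s * fst z + c * snd z) \<partial>(gauss \<Otimes>\<^sub>M gauss))
    = (\<integral>\<^sup>+z. ?d z * K (c * fst z - s * snd z, s * fst z + c * snd z) \<partial>(lborel \<Otimes>\<^sub>M lborel))"
    unfolding gg by (subst nn_integral_density) auto
  also have "\<dots> = (\<integral>\<^sup>+z. (\<lambda>z. ?d z * K z) (c * fst z - s * snd z, s * fst z + c * snd z) \<partial>(lborel \<Otimes>\<^sub>M lborel))"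
    by (intro nn_integral_cong) (simp only: dr)
  also have "\<dots> = (\<integral>\<^sup>+z. ?d z * K z \<partial>(lborel \<Otimes>\<^sub>M lborel))"
    by (rule lebesgue_rotation[OF _ cs]) measurable
  also have "\<dots> = (\<integral>\<^sup>+z. K z \<partial>(gauss \<Otimes>\<^sub>M gauss))"
    unfolding gg by (subst nn_integral_density) auto
  finally show ?thesis .
qed

definition rotate_at :: "nat \<Rightarrow> nat \<Rightarrow> real \<Rightarrow> real \<Rightarrow> rseq \<Rightarrow> nat \<Rightarrow> real" where
  "rotate_at i j c s z = z(i := c * z i - s * z j, j := s * z i + c * z j)"

lemma rotate_at_measurable[measurable]: "rotate_at i j c s \<in> gauss_seq \<rightarrow>\<^sub>M gauss_seq"
proof (rule measurable_PiM_single')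
  fix k
  have "(\<lambda>z. rotate_at i j c s z k) = (\<lambda>z. if k = j then s * z i + c * z j else if k = i then c * z i - s * z j else z k)"
    by (auto simp: rotate_at_def)
  moreover have "(\<lambda>z. if k = j then s * z i + c * z j else if k = i then c * z i - s * z j else z k) \<in> borel_measurable gauss_seq"
    by measurable
  ultimately show "(\<lambda>z. rotate_at i j c s z k) \<in> gauss_seq \<rightarrow>\<^sub>M gauss" by (simp cong: measurable_cong_sets)
qed simp

lemma gauss_seq_two:
  fixes F :: "rseq \<Rightarrow> ennreal"
  assumes [measurable]: "F \<in> borel_measurable gauss_seq" and "i \<noteq> j"
  defines "R \<equiv> \<Pi>\<^sub>M k\<in>UNIV - {i, j}. gauss"
  shows "(\<lambda>z. \<integral>\<^sup>+w. F (w(j := snd z, i := fst z)) \<partial>R) \<in> borel_measurable (borel \<Otimes>\<^sub>M borel)"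
    and "(\<integral>\<^sup>+z. F z \<partial>gauss_seq) = (\<integral>\<^sup>+z. (\<integral>\<^sup>+w. F (w(j := snd z, i := fst z)) \<partial>R) \<partial>(gauss \<Otimes>\<^sub>M gauss))"
proof -
  let ?R1 = "\<Pi>\<^sub>M k\<in>UNIV - {i}. gauss"
  interpret G: prob_space gauss by (rule prob_gauss)
  interpret R: prob_space R unfolding R_def by (intro prob_space_PiM prob_gauss)
  interpret R1: prob_space ?R1 by (intro prob_space_PiM prob_gauss)
  have sg: "sets (gauss \<Otimes>\<^sub>M gauss) = sets (borel \<Otimes>\<^sub>M borel)" by (intro sets_pair_measure_cong) auto
  have ins: "insert j (UNIV - {i, j}) = UNIV - {i}" using \<open>i \<noteq> j\<close> by auto
  have d1: "distr (gauss \<Otimes>\<^sub>M ?R1) gauss_seq (\<lambda>z. (snd z)(i := fst z)) = gauss_seq"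
    by (rule PiM_replace) (rule prob_gauss)
  have m1: "(\<lambda>z. (snd z)(i := fst z)) \<in> gauss \<Otimes>\<^sub>M ?R1 \<rightarrow>\<^sub>M gauss_seq" by (rule measurable_replace)
  have d2: "distr (gauss \<Otimes>\<^sub>M R) ?R1 (\<lambda>z. (snd z)(j := fst z)) = ?R1"
    using distr_pair_PiM_eq_PiM[of "UNIV - {i, j}" "\<lambda>_. gauss" j] prob_gauss by (simp add: ins R_def split_beta')
  have m2: "(\<lambda>z. (snd z)(j := fst z)) \<in> gauss \<Otimes>\<^sub>M R \<rightarrow>\<^sub>M ?R1"
  proof (rule measurable_PiM_single')
    fix k assume k: "k \<in> UNIV - {i}"
    show "(\<lambda>z. ((snd z)(j := fst z)) k) \<in> gauss \<Otimes>\<^sub>M R \<rightarrow>\<^sub>M gauss"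
    proof (cases "k = j")
      case False
      then have "(\<lambda>z. snd z k) \<in> gauss \<Otimes>\<^sub>M R \<rightarrow>\<^sub>M gauss" using k unfolding R_def
        by (intro measurable_compose[OF measurable_snd measurable_component_singleton]) simp
      then show ?thesis using False by simp
    qed (simp add: measurable_fst)
  qed (use \<open>i \<noteq> j\<close> in \<open>auto simp: space_pair_measure space_PiM R_def PiE_def extensional_def\<close>)
  have m3: "(\<lambda>z. (snd z)(j := snd (fst z), i := fst (fst z))) \<in> (gauss \<Otimes>\<^sub>M gauss) \<Otimes>\<^sub>M R \<rightarrow>\<^sub>M gauss_seq"
  proof -
    have "(\<lambda>z. (fst (fst z), (snd z)(j := snd (fst z)))) \<in> (gauss \<Otimes>\<^sub>M gauss) \<Otimes>\<^sub>M R \<rightarrow>\<^sub>M gauss \<Otimes>\<^sub>M ?R1"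
    proof (rule measurable_Pair)
      have "(\<lambda>z. (snd (fst z), snd z)) \<in> (gauss \<Otimes>\<^sub>M gauss) \<Otimes>\<^sub>M R \<rightarrow>\<^sub>M gauss \<Otimes>\<^sub>M R" by measurable
      from measurable_compose[OF this m2]
      show "(\<lambda>z. (snd z)(j := snd (fst z))) \<in> (gauss \<Otimes>\<^sub>M gauss) \<Otimes>\<^sub>M R \<rightarrow>\<^sub>M ?R1" by simp
    qed measurable
    from measurable_compose[OF this m1] show ?thesis by simp
  qed
  have Fm: "(\<lambda>(z, w). F (w(j := snd z, i := fst z))) \<in> borel_measurable ((gauss \<Otimes>\<^sub>M gauss) \<Otimes>\<^sub>M R)"
    using measurable_compose[OF m3 assms(1)] by (simp add: split_beta')
  have Km: "(\<lambda>z. \<integral>\<^sup>+w. F (w(j := snd z, i := fst z)) \<partial>R) \<in> borel_measurable (gauss \<Otimes>\<^sub>M gauss)"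
    by (rule R.borel_measurable_nn_integral[OF Fm])
  then show "(\<lambda>z. \<integral>\<^sup>+w. F (w(j := snd z, i := fst z)) \<partial>R) \<in> borel_measurable (borel \<Otimes>\<^sub>M borel)"
    by (simp add: measurable_cong_sets[OF sg refl])
  have "(\<integral>\<^sup>+z. F z \<partial>gauss_seq) = (\<integral>\<^sup>+z. F z \<partial>(distr (gauss \<Otimes>\<^sub>M ?R1) gauss_seq (\<lambda>z. (snd z)(i := fst z))))"
    by (simp only: d1)
  also have "\<dots> = (\<integral>\<^sup>+z. F ((snd z)(i := fst z)) \<partial>(gauss \<Otimes>\<^sub>M ?R1))"
    by (rule nn_integral_distr[OF m1]) simp
  also have "\<dots> = (\<integral>\<^sup>+x. (\<integral>\<^sup>+w. F (w(i := x)) \<partial>?R1) \<partial>gauss)"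
    using measurable_compose[OF m1 assms(1)] by (subst R1.nn_integral_fst[symmetric]) auto
  also have "\<dots> = (\<integral>\<^sup>+x. (\<integral>\<^sup>+y. (\<integral>\<^sup>+w. F (w(j := y, i := x)) \<partial>R) \<partial>gauss) \<partial>gauss)"
  proof (rule nn_integral_cong)
    fix x :: real
    have "(\<lambda>w. (x, w)) \<in> ?R1 \<rightarrow>\<^sub>M gauss \<Otimes>\<^sub>M ?R1" by simp
    from measurable_compose[OF measurable_compose[OF this m1] assms(1)]
    have Fx: "(\<lambda>w. F (w(i := x))) \<in> borel_measurable ?R1" by simp
    have "(\<integral>\<^sup>+w. F (w(i := x)) \<partial>?R1) = (\<integral>\<^sup>+w. F (w(i := x)) \<partial>(distr (gauss \<Otimes>\<^sub>M R) ?R1 (\<lambda>z. (snd z)(j := fst z))))"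
      by (simp only: d2)
    also have "\<dots> = (\<integral>\<^sup>+z. F ((snd z)(j := fst z, i := x)) \<partial>(gauss \<Otimes>\<^sub>M R))"
      by (rule nn_integral_distr[OF m2]) (simp only: d2 Fx)
    also have "\<dots> = (\<integral>\<^sup>+y. (\<integral>\<^sup>+w. F (w(j := y, i := x)) \<partial>R) \<partial>gauss)"
      using measurable_compose[OF m2 Fx] by (subst R.nn_integral_fst[symmetric]) auto
    finally show "(\<integral>\<^sup>+w. F (w(i := x)) \<partial>?R1) = (\<integral>\<^sup>+y. (\<integral>\<^sup>+w. F (w(j := y, i := x)) \<partial>R) \<partial>gauss)" .
  qed
  also have "\<dots> = (\<integral>\<^sup>+z. (\<integral>\<^sup>+w. F (w(j := snd z, i := fst z)) \<partial>R) \<partial>(gauss \<Otimes>\<^sub>M gauss))"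
    using Km by (subst gauss.nn_integral_fst[symmetric]) auto
  finally show "(\<integral>\<^sup>+z. F z \<partial>gauss_seq) = (\<integral>\<^sup>+z. (\<integral>\<^sup>+w. F (w(j := snd z, i := fst z)) \<partial>R) \<partial>(gauss \<Otimes>\<^sub>M gauss))" .
qed

lemma distr_rotate_at:
  assumes "i \<noteq> j" and cs: "c^2 + s^2 = 1" "0 \<le> c"
  shows "distr gauss_seq gauss_seq (rotate_at i j c s) = gauss_seq"
proof (rule measure_eqI)
  let ?R = "\<Pi>\<^sub>M k\<in>UNIV - {i, j}. gauss"
  fix A assume A: "A \<in> sets (distr gauss_seq gauss_seq (rotate_at i j c s))"
  then have [measurable]: "A \<in> sets gauss_seq" by simp
  define F where "F z = (indicator A z :: ennreal)" for z
  have Fm[measurable]: "F \<in> borel_measurable gauss_seq" unfolding F_def[abs_def] by (rule borel_measurable_indicator) fact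
  have FR: "(\<lambda>z. F (rotate_at i j c s z)) \<in> borel_measurable gauss_seq" by measurable
  define K where "K z = (\<integral>\<^sup>+w. F (w(j := snd z, i := fst z)) \<partial>?R)" for z :: "real \<times> real"
  have "emeasure (distr gauss_seq gauss_seq (rotate_at i j c s)) A = (\<integral>\<^sup>+z. F z \<partial>(distr gauss_seq gauss_seq (rotate_at i j c s)))"
    unfolding F_def using A by simp
  also have "\<dots> = (\<integral>\<^sup>+z. F (rotate_at i j c s z) \<partial>gauss_seq)" by (rule nn_integral_distr) auto
  also have "\<dots> = (\<integral>\<^sup>+z. (\<integral>\<^sup>+w. F (rotate_at i j c s (w(j := snd z, i := fst z))) \<partial>?R) \<partial>(gauss \<Otimes>\<^sub>M gauss))"
    by (rule gauss_seq_two(2)[OF FR \<open>i \<noteq> j\<close>])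
  also have "\<dots> = (\<integral>\<^sup>+z. K (c * fst z - s * snd z, s * fst z + c * snd z) \<partial>(gauss \<Otimes>\<^sub>M gauss))"
  proof -
    have "rotate_at i j c s (w(j := y, i := x)) = w(j := s * x + c * y, i := c * x - s * y)" for w x y
      using \<open>i \<noteq> j\<close> by (auto simp: rotate_at_def fun_eq_iff)
    then show ?thesis by (simp add: K_def)
  qed
  also have "\<dots> = (\<integral>\<^sup>+z. K z \<partial>(gauss \<Otimes>\<^sub>M gauss))"
    unfolding K_def by (rule gauss_rotation[OF gauss_seq_two(1)[OF Fm \<open>i \<noteq> j\<close>] cs])
  also have "\<dots> = (\<integral>\<^sup>+z. F z \<partial>gauss_seq)" unfolding K_def by (rule gauss_seq_two(2)[OF Fm \<open>i \<noteq> j\<close>, symmetric])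
  also have "\<dots> = emeasure gauss_seq A" unfolding F_def by simp
  finally show "emeasure (distr gauss_seq gauss_seq (rotate_at i j c s)) A = emeasure gauss_seq A" .
qed simp

text \<open>Symmetry is kept because every further rotation needs it.\<close>
definition same_quad_law :: "nat \<Rightarrow> array \<Rightarrow> array \<Rightarrow> bool" where
  "same_quad_law p A A' \<longleftrightarrow> (\<forall>i<p. \<forall>j<p. A' i j = A' j i) \<and>
     distr gauss_seq borel (quad p A) = distr gauss_seq borel (quad p A')"

text \<open>The angle that annihilates the off-diagonal entry \<open>\<gamma>\<close> of a symmetric two by two matrix.\<close>
lemma jacobi_angle:
  fixes \<alpha> \<beta> \<gamma> :: real
  obtains c s where "c^2 + s^2 = 1" "0 \<le> c" "(c^2 - s^2) * \<gamma> + c * s * (\<beta> - \<alpha>) = 0"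
proof -
  define h where "h x = ((cos x)^2 - (sin x)^2) * \<gamma> + cos x * sin x * (\<beta> - \<alpha>)" for x
  have cont: "continuous_on {0..pi/2} h" unfolding h_def by (intro continuous_intros)
  have "\<exists>x. 0 \<le> x \<and> x \<le> pi / 2 \<and> h x = 0"
  proof (cases "\<gamma> \<le> 0")
    case True
    then show ?thesis by (intro IVT' cont) (auto simp: h_def)
  next
    case False
    then show ?thesis by (intro IVT2' cont) (auto simp: h_def)
  qed
  then obtain x where x: "0 \<le> x" "x \<le> pi / 2" "h x = 0" by blast
  show thesis
  proof (rule that)
    show "(cos x)^2 + (sin x)^2 = 1" by simp
    show "0 \<le> cos x" using x by (intro cos_ge_zero) auto
    show "((cos x)^2 - (sin x)^2) * \<gamma> + cos x * sin x * (\<beta> - \<alpha>) = 0" using x(3) by (simp add: h_def)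
  qed
qed

text \<open>Rotating the plane of \<open>i\<close> and \<open>j\<close> moves the mass \<open>2 A\<^sub>i\<^sub>j\<^sup>2\<close> onto the diagonal and leaves the law of the
  form unchanged.\<close>
lemma jacobi_step:
  assumes ij: "i < p" "j < p" "i \<noteq> j" and sym: "\<And>i j. i < p \<Longrightarrow> j < p \<Longrightarrow> A i j = A j i"
  shows "\<exists>A'. same_quad_law p A A' \<and> (\<Sum>k<p. (A' k k)^2) = (\<Sum>k<p. (A k k)^2) + 2 * (A i j)^2"
proof -
  obtain c s where cs: "c^2 + s^2 = 1" "0 \<le> c" and z: "(c^2 - s^2) * A i j + c * s * (A j j - A i i) = 0"
    by (rule jacobi_angle[of "A i j" "A j j" "A i i"])
  define R where "R a k = (if a = i then (if k = i then c else if k = j then - s else 0)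
     else if a = j then (if k = i then s else if k = j then c else 0) else if a = k then 1 else (0::real))" for a k
  have two: "(\<Sum>a<p. g a) = g i + g j + (\<Sum>a\<in>{..<p} - {i, j}. g a)" for g :: "nat \<Rightarrow> real"
  proof -
    have "(\<Sum>a<p. g a) = (\<Sum>a\<in>{..<p} - {i, j}. g a) + (\<Sum>a\<in>{i, j}. g a)"
      using ij by (intro sum.subset_diff) auto
    then show ?thesis using ij by simp
  qed
  have Ri: "(\<Sum>a<p. R a i * g a) = c * g i + s * g j" and Rj: "(\<Sum>a<p. R a j * g a) = - s * g i + c * g j" for g
    unfolding two using ij by (auto simp: R_def intro!: sum.neutral)
  have Rk: "(\<Sum>a<p. R a k * g a) = g k" if "k < p" "k \<noteq> i" "k \<noteq> j" for g k
  proof -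
    have "(\<Sum>a<p. R a k * g a) = (\<Sum>a<p. if a = k then g a else 0)"
      using that by (intro sum.cong refl) (auto simp: R_def)
    then show ?thesis using that by simp
  qed
  have rot: "rotate_at i j c s x a = (\<Sum>k<p. R a k * x k)" if "a < p" for a x
  proof -
    have "(\<Sum>k<p. R a k * x k) = R a i * x i + R a j * x j + (\<Sum>k\<in>{..<p} - {i, j}. R a k * x k)" by (rule two)
    also have "(\<Sum>k\<in>{..<p} - {i, j}. R a k * x k) = (if a = i \<or> a = j then 0 else x a)"
    proof (cases "a = i \<or> a = j")
      case True
      then have "\<forall>k\<in>{..<p} - {i, j}. R a k * x k = 0" by (auto simp: R_def)
      then have "(\<Sum>k\<in>{..<p} - {i, j}. R a k * x k) = 0" by (rule sum.neutral)
      then show ?thesis using True by simp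
    next
      case False
      then have "(\<Sum>k\<in>{..<p} - {i, j}. R a k * x k) = (\<Sum>k\<in>{..<p} - {i, j}. if k = a then x k else 0)"
        by (intro sum.cong refl) (auto simp: R_def)
      then show ?thesis using False that by simp
    qed
    finally show ?thesis using ij by (auto simp: rotate_at_def R_def)
  qed
  define A' where "A' k l = (\<Sum>a<p. R a k * (\<Sum>b<p. R b l * A a b))" for k l
  have A'sym: "A' k l = A' l k" if "k < p" "l < p" for k l
  proof -
    have "A' k l = (\<Sum>a<p. \<Sum>b<p. R a k * (R b l * A a b))" by (simp add: A'_def sum_distrib_left)
    also have "\<dots> = (\<Sum>b<p. \<Sum>a<p. R a k * (R b l * A a b))" by (rule sum.swap)
    also have "\<dots> = (\<Sum>b<p. \<Sum>a<p. R b l * (R a k * A b a))"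
      by (intro sum.cong refl) (simp add: sym mult_ac)
    finally show ?thesis by (simp add: A'_def sum_distrib_left)
  qed
  have q: "quad p A (rotate_at i j c s x) = quad p A' x" for x
  proof -
    have "quad p A (rotate_at i j c s x) = (\<Sum>a<p. \<Sum>b<p. A a b * ((\<Sum>k<p. R a k * x k) * (\<Sum>l<p. R b l * x l)))"
      unfolding quad_def by (intro sum.cong refl) (simp add: rot)
    also have "\<dots> = (\<Sum>a<p. \<Sum>b<p. \<Sum>k<p. \<Sum>l<p. R a k * R b l * A a b * (x k * x l))"
    proof (intro sum.cong refl)
      fix a b
      show "A a b * ((\<Sum>k<p. R a k * x k) * (\<Sum>l<p. R b l * x l)) = (\<Sum>k<p. \<Sum>l<p. R a k * R b l * A a b * (x k * x l))"
        by (subst sum_product, simp only: sum_distrib_left, intro sum.cong refl) (simp add: mult_ac)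
    qed
    also have "\<dots> = (\<Sum>a<p. \<Sum>k<p. \<Sum>b<p. \<Sum>l<p. R a k * R b l * A a b * (x k * x l))"
      by (intro sum.cong refl sum.swap)
    also have "\<dots> = (\<Sum>k<p. \<Sum>a<p. \<Sum>b<p. \<Sum>l<p. R a k * R b l * A a b * (x k * x l))"
      by (rule sum.swap)
    also have "\<dots> = (\<Sum>k<p. \<Sum>a<p. \<Sum>l<p. \<Sum>b<p. R a k * R b l * A a b * (x k * x l))"
      by (intro sum.cong refl sum.swap)
    also have "\<dots> = (\<Sum>k<p. \<Sum>l<p. \<Sum>a<p. \<Sum>b<p. R a k * R b l * A a b * (x k * x l))"
      by (intro sum.cong refl sum.swap)
    also have "\<dots> = quad p A' x"
      unfolding quad_def A'_def sum_distrib_left sum_distrib_right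
      by (intro sum.cong refl) (simp add: mult_ac)
    finally show ?thesis .
  qed
  have law: "distr gauss_seq borel (quad p A) = distr gauss_seq borel (quad p A')"
  proof -
    have "distr gauss_seq borel (quad p A) = distr (distr gauss_seq gauss_seq (rotate_at i j c s)) borel (quad p A)"
      by (simp only: distr_rotate_at[OF ij(3) cs])
    also have "\<dots> = distr gauss_seq borel (quad p A \<circ> rotate_at i j c s)"
      by (rule distr_distr) auto
    also have "quad p A \<circ> rotate_at i j c s = quad p A'" by (simp add: fun_eq_iff q)
    finally show ?thesis .
  qed
  have kk: "A' k k = A k k" if "k < p" "k \<noteq> i" "k \<noteq> j" for k
    unfolding A'_def using that by (simp add: Rk)
  have ii: "A' i i = c^2 * A i i + 2 * c * s * A i j + s^2 * A j j"
    unfolding A'_def Ri using sym[OF ij(1,2)] by (simp add: power2_eq_square algebra_simps)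
  have jj: "A' j j = s^2 * A i i - 2 * c * s * A i j + c^2 * A j j"
    unfolding A'_def Rj using sym[OF ij(1,2)] by (simp add: power2_eq_square algebra_simps)
  have "(A' i i)^2 + (A' j j)^2 + 2 * ((c^2 - s^2) * A i j + c * s * (A j j - A i i))^2
      = (c^2 + s^2)^2 * ((A i i)^2 + (A j j)^2 + 2 * (A i j)^2)"
    unfolding ii jj by (simp add: power2_eq_square algebra_simps)
  then have d2: "(A' i i)^2 + (A' j j)^2 = (A i i)^2 + (A j j)^2 + 2 * (A i j)^2"
    unfolding z cs(1) by simp
  have "(\<Sum>k<p. (A' k k)^2) = (\<Sum>k<p. (A k k)^2) + 2 * (A i j)^2"
    unfolding two using d2 kk by (simp add: algebra_simps)
  then show ?thesis using law A'sym by (intro exI[of _ A']) (auto simp: same_quad_law_def)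
qed

lemma same_quad_law_moments:
  assumes "same_quad_law p A A'" and sym: "\<And>i j. i < p \<Longrightarrow> j < p \<Longrightarrow> A i j = A j i"
  shows "(\<Sum>i<p. A' i i) = (\<Sum>i<p. A i i)" "(\<Sum>i<p. \<Sum>j<p. (A' i j)^2) = (\<Sum>i<p. \<Sum>j<p. (A i j)^2)"
proof -
  have sym': "\<And>i j. i < p \<Longrightarrow> j < p \<Longrightarrow> A' i j = A' j i" and law: "distr gauss_seq borel (quad p A) = distr gauss_seq borel (quad p A')"
    using assms(1) by (auto simp: same_quad_law_def)
  have "(LINT x|(distr gauss_seq borel (quad p A)). x) = (LINT x|(distr gauss_seq borel (quad p A')). x)" by (simp only: law)
  then have e: "(LINT z|gauss_seq. quad p A z) = (LINT z|gauss_seq. quad p A' z)" by (simp add: integral_distr)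
  then show tr: "(\<Sum>i<p. A' i i) = (\<Sum>i<p. A i i)" using quad_moments(1)[OF sym] quad_moments(1)[OF sym'] by simp
  have "(LINT x|(distr gauss_seq borel (quad p A)). x^2) = (LINT x|(distr gauss_seq borel (quad p A')). x^2)" by (simp only: law)
  then have "(LINT z|gauss_seq. (quad p A z)^2) = (LINT z|gauss_seq. (quad p A' z)^2)" by (simp add: integral_distr)
  then show "(\<Sum>i<p. \<Sum>j<p. (A' i j)^2) = (\<Sum>i<p. \<Sum>j<p. (A i j)^2)"
    using quad_moments(2)[OF sym] quad_moments(2)[OF sym'] tr by simp
qed

lemma diag_le_square_sum:
  fixes A :: "array"
  shows "(\<Sum>k<p. (A k k)^2) \<le> (\<Sum>k<p. \<Sum>l<p. (A k l :: real)^2)"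
proof (rule sum_mono)
  fix k assume "k \<in> {..<p}"
  then show "(A k k)^2 \<le> (\<Sum>l<p. (A k l)^2)" by (intro member_le_sum) auto
qed

text \<open>Take a matrix with the same law and almost maximal diagonal mass; the total mass, which the law
  determines, is an upper bound. A large off-diagonal rest would let one more rotation pass the supremum.\<close>
lemma jacobi_diagonalise:
  assumes sym: "\<And>i j. i < p \<Longrightarrow> j < p \<Longrightarrow> A i j = A j i" and e: "e > 0"
  shows "\<exists>A'. same_quad_law p A A' \<and> (\<Sum>i<p. \<Sum>j<p. if i = j then 0 else (A' i j)^2) \<le> e"
proof (rule ccontr)
  assume neg: "\<not> ?thesis"
  define D where "D = {(\<Sum>k<p. (A' k k)^2) |A'. same_quad_law p A A'}"
  have refl: "same_quad_law p A A" using sym by (auto simp: same_quad_law_def)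
  have ne: "D \<noteq> {}" using refl by (auto simp: D_def)
  have bd: "bdd_above D"
  proof (rule bdd_aboveI[of _ "\<Sum>i<p. \<Sum>j<p. (A i j)^2"])
    fix x assume "x \<in> D"
    then obtain A' where "same_quad_law p A A'" "x = (\<Sum>k<p. (A' k k)^2)" by (auto simp: D_def)
    then show "x \<le> (\<Sum>i<p. \<Sum>j<p. (A i j)^2)" using same_quad_law_moments(2)[OF _ sym] diag_le_square_sum[of A' p] by simp
  qed
  have "p \<noteq> 0"
  proof
    assume "p = 0"
    then have "(\<Sum>i<p. \<Sum>j<p. if i = j then 0 else (A i j)^2) \<le> e" using e by simp
    then show False using neg refl by blast
  qed
  \<comment> \<open>if the off-diagonal squares exceed \<open>e\<close> in sum, one of them exceeds this average\<close>
  define d where "d = e / (real p * real p)"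
  have d: "0 < d" using e \<open>p \<noteq> 0\<close> by (simp add: d_def)
  have "Sup D - d < Sup D" using d by simp
  then obtain x where x: "x \<in> D" "Sup D - d < x" using less_cSup_iff[OF ne bd] by blast
  then obtain A1 where A1: "same_quad_law p A A1" "x = (\<Sum>k<p. (A1 k k)^2)" by (auto simp: D_def)
  have big: "e < (\<Sum>i<p. \<Sum>j<p. if i = j then 0 else (A1 i j)^2)" using neg A1(1) by (auto simp: not_le)
  have "\<exists>i<p. \<exists>j<p. i \<noteq> j \<and> d < (A1 i j)^2"
  proof (rule ccontr)
    assume small: "\<not> ?thesis"
    have "(if i = j then 0 else (A1 i j)^2) \<le> d" if "i < p" "j < p" for i j
    proof (cases "i = j")
      case False
      then have "\<not> d < (A1 i j)^2" using small that by blast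
      then show ?thesis using False by simp
    qed (use d in simp)
    then have "(\<Sum>i<p. \<Sum>j<p. if i = j then 0 else (A1 i j)^2) \<le> (\<Sum>i<p. \<Sum>j<p. d)"
      by (intro sum_mono) auto
    also have "\<dots> = e" using \<open>p \<noteq> 0\<close> by (simp add: d_def)
    finally show False using big by simp
  qed
  then obtain i j where ij: "i < p" "j < p" "i \<noteq> j" "d < (A1 i j)^2" by blast
  have sym1: "\<And>i j. i < p \<Longrightarrow> j < p \<Longrightarrow> A1 i j = A1 j i" using A1(1) by (auto simp: same_quad_law_def)
  obtain A2 where A2: "same_quad_law p A1 A2" "(\<Sum>k<p. (A2 k k)^2) = (\<Sum>k<p. (A1 k k)^2) + 2 * (A1 i j)^2"
    using jacobi_step[of i p j A1, OF ij(1-3) sym1] by blast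
  have "same_quad_law p A A2" using A1(1) A2(1) by (auto simp: same_quad_law_def)
  then have "(\<Sum>k<p. (A2 k k)^2) \<le> Sup D" using bd by (intro cSup_upper) (auto simp: D_def)
  then show False using x(2) A1(2) A2(2) ij(4) d by linarith
qed

lemma char_diff_le:
  fixes f g :: "'a \<Rightarrow> real"
  assumes "prob_space M" and [measurable]: "f \<in> borel_measurable M" "g \<in> borel_measurable M"
    and "integrable M (\<lambda>x. \<bar>f x - g x\<bar>)"
  shows "cmod (chf M f t - chf M g t) \<le> abs t * (LINT x|M. \<bar>f x - g x\<bar>)"
proof -
  interpret prob_space M by fact
  have i: "integrable M (\<lambda>x. iexp (t * h x))" if "h \<in> borel_measurable M" for h
    using that by (intro integrable_const_bound[where B=1]) auto
  have pw: "cmod (iexp (t * f x) - iexp (t * g x)) \<le> abs t * \<bar>f x - g x\<bar>" for x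
  proof -
    have "iexp (t * f x) - iexp (t * g x) = iexp (t * g x) * (iexp (t * (f x - g x)) - 1)"
      by (simp add: exp_add[symmetric] algebra_simps)
    then have "cmod (iexp (t * f x) - iexp (t * g x)) = cmod (iexp (t * (f x - g x)) - 1)"
      by (simp only: norm_mult norm_exp_i_times mult_1)
    also have "\<dots> \<le> \<bar>t * (f x - g x)\<bar>" using iexp_approx1[of "t * (f x - g x)" 0] by simp
    finally show ?thesis by (simp add: abs_mult)
  qed
  have "cmod (chf M f t - chf M g t) = cmod (LINT x|M. iexp (t * f x) - iexp (t * g x))"
    using i by simp
  also have "\<dots> \<le> (LINT x|M. abs t * \<bar>f x - g x\<bar>)"
    by (rule norm_integral_le_integral[OF _ pw]) (use i assms in auto)
  finally show ?thesis by simp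
qed

definition chaos :: "nat \<Rightarrow> rseq \<Rightarrow> statistic" where
  "chaos p \<alpha> z = (\<Sum>i<p. \<alpha> i * ((z i)^2 - 1))"

text \<open>After diagonalisation the off-diagonal rest is small in \<open>L\<^sup>2\<close>, and the trace, being the mean, is zero.\<close>
lemma quad_chaos_approx:
  assumes sym: "\<And>i j. i < p \<Longrightarrow> j < p \<Longrightarrow> A i j = A j i" and tr: "(\<Sum>i<p. A i i) = 0" and e: "e > 0"
  shows "\<exists>\<alpha>. (\<Sum>i<p. (\<alpha> i)^2) \<le> (\<Sum>i<p. \<Sum>j<p. (A i j)^2) \<and>
    (\<forall>t. cmod (chf gauss_seq (quad p A) t - chf gauss_seq (chaos p \<alpha>) t) \<le> abs t * e)"
proof -
  obtain A' where A': "same_quad_law p A A'" "(\<Sum>i<p. \<Sum>j<p. if i = j then 0 else (A' i j)^2) \<le> e^2 / 2"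
    using jacobi_diagonalise[of p A "e^2 / 2"] sym e by auto
  have sym': "\<And>i j. i < p \<Longrightarrow> j < p \<Longrightarrow> A' i j = A' j i" using A'(1) by (auto simp: same_quad_law_def)
  define \<alpha> where "\<alpha> i = A' i i" for i
  define E where "E i j = (if i = j then 0 else A' i j)" for i j
  have "(\<Sum>i<p. (\<alpha> i)^2) \<le> (\<Sum>i<p. \<Sum>j<p. (A i j)^2)"
    using diag_le_square_sum[of A' p] same_quad_law_moments(2)[OF A'(1) sym] by (simp add: \<alpha>_def)
  moreover have "cmod (chf gauss_seq (quad p A) t - chf gauss_seq (chaos p \<alpha>) t) \<le> abs t * e" for t
  proof -
    have "(\<Sum>i<p. \<alpha> i) = 0" using same_quad_law_moments(1)[OF A'(1) sym] tr by (simp add: \<alpha>_def)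
    then have ch: "chaos p \<alpha> z = (\<Sum>i<p. \<alpha> i * (z i * z i))" for z
      by (simp add: chaos_def right_diff_distrib sum_subtractf power2_eq_square)
    have diff: "quad p A' z - chaos p \<alpha> z = quad p E z" for z
    proof -
      have "(\<Sum>j<p. A' i j * (z i * z j)) = (\<Sum>j<p. E i j * (z i * z j)) + \<alpha> i * (z i * z i)" if "i < p" for i
      proof -
        have "(\<Sum>j<p. A' i j * (z i * z j)) = (\<Sum>j<p. E i j * (z i * z j) + (if i = j then A' i j * (z i * z j) else 0))"
          by (intro sum.cong refl) (simp add: E_def)
        then show ?thesis using that by (simp add: sum.distrib \<alpha>_def)
      qed
      then have "quad p A' z = (\<Sum>i<p. (\<Sum>j<p. E i j * (z i * z j)) + \<alpha> i * (z i * z i))"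
        unfolding quad_def by (intro sum.cong refl) auto
      then show ?thesis unfolding ch by (simp add: quad_def sum.distrib)
    qed
    have "(LINT z|gauss_seq. (quad p E z)^2) = 2 * (\<Sum>i<p. \<Sum>j<p. (E i j)^2) + (\<Sum>i<p. E i i)^2"
      by (rule quad_moments(2)) (auto simp: E_def sym')
    also have "\<dots> \<le> e^2"
    proof -
      have "(\<Sum>i<p. \<Sum>j<p. (E i j)^2) = (\<Sum>i<p. \<Sum>j<p. if i = j then 0 else (A' i j)^2)"
        by (intro sum.cong refl) (auto simp: E_def)
      then show ?thesis using A'(2) by (simp add: E_def)
    qed
    finally have "mom_le gauss_seq 2 (quad p E) e"
      using quad_mom[of p E] e by (intro mom_leI_integrable) (auto dest: mom_le_even(1))
    note qa = gauss.S.mom_le_abs_1[OF this]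
    have [measurable]: "chaos p \<alpha> \<in> borel_measurable gauss_seq" unfolding chaos_def[abs_def] by measurable
    have "(chf gauss_seq (quad p A) t) = (LINT x|(distr gauss_seq borel (quad p A)). iexp (t * x))"
      by (subst integral_distr) auto
    also have "\<dots> = (LINT x|(distr gauss_seq borel (quad p A')). iexp (t * x))"
      using A'(1) by (simp add: same_quad_law_def)
    also have "\<dots> = (chf gauss_seq (quad p A') t)" by (subst integral_distr) auto
    finally have "cmod (chf gauss_seq (quad p A) t - chf gauss_seq (chaos p \<alpha>) t)
      = cmod (chf gauss_seq (quad p A') t - chf gauss_seq (chaos p \<alpha>) t)" by simp
    also have "\<dots> \<le> abs t * (LINT z|gauss_seq. \<bar>quad p A' z - chaos p \<alpha> z\<bar>)"
      by (rule char_diff_le) (use qa gauss.S.prob_space_axioms in \<open>auto simp: diff\<close>)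
    also have "\<dots> \<le> abs t * e" using qa by (intro mult_left_mono) (auto simp: diff)
    finally show ?thesis .
  qed
  ultimately show ?thesis by blast
qed

section \<open>Approximation of block forms by Gaussian chaos\<close>

lemma quad_of_linear:
  fixes a b :: "nat \<Rightarrow> real"
  shows "(LINT z|gauss_seq. (\<Sum>r<p. a r * z r) * (\<Sum>r<p. b r * z r)) = (\<Sum>r<p. a r * b r)"
proof -
  define A where "A r s = (a r * b s + a s * b r) / 2" for r s
  have "(\<Sum>r<p. a r * z r) * (\<Sum>r<p. b r * z r) = quad p A z" for z
  proof -
    have "(\<Sum>r<p. a r * z r) * (\<Sum>r<p. b r * z r) = (\<Sum>r<p. \<Sum>s<p. a r * b s * (z r * z s))"
      by (simp add: sum_product mult_ac)
    moreover have "\<dots> = (\<Sum>s<p. \<Sum>r<p. a r * b s * (z r * z s))" by (rule sum.swap)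
    moreover have "quad p A z = ((\<Sum>r<p. \<Sum>s<p. a r * b s * (z r * z s)) + (\<Sum>r<p. \<Sum>s<p. a s * b r * (z r * z s))) / 2"
      by (simp add: quad_def A_def sum.distrib[symmetric] sum_divide_distrib algebra_simps add_divide_distrib)
    ultimately show ?thesis by (simp add: mult_ac)
  qed
  then have "(LINT z|gauss_seq. (\<Sum>r<p. a r * z r) * (\<Sum>r<p. b r * z r)) = (LINT z|gauss_seq. quad p A z)" by simp
  also have "\<dots> = (\<Sum>r<p. A r r)" by (rule quad_moments) (simp add: A_def)
  finally show ?thesis by (simp add: A_def)
qed

lemma gauss_linear_mom4: "mom_le gauss_seq 4 (\<lambda>z. \<Sum>r<p. a r * z r) (4 * sqrt (\<Sum>r<p. (a r)^2))"
proof -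
  have ind: "gauss.S.indep_vars (\<lambda>_. gauss) (\<lambda>k z. z k) UNIV" by (rule indep_vars_PiM_coordinates) (rule prob_gauss)
  have "gauss.S.indep_vars (\<lambda>_. borel) (\<lambda>r z. a r * z r) UNIV"
    by (rule gauss.S.indep_vars_compose2[OF ind]) simp
  then have "gauss.S.indep_vars (\<lambda>_. borel) (\<lambda>r z. a r * z r) {..<p}" by (rule gauss.S.indep_vars_subset) simp
  then have "mom_le gauss_seq 4 (\<lambda>z. \<Sum>r<p. a r * z r) (sqrt (3 * (\<Sum>r<p. (\<bar>a r\<bar> * 2)^2)))"
  proof (rule gauss.S.indep_sum_mom4)
    show "mom_le gauss_seq 4 (\<lambda>z. a r * z r) (\<bar>a r\<bar> * 2)" for r by (intro mom_le_cmult gauss_coord_mom)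
    have "(LINT z|gauss_seq. z r) = 0" for r
    proof -
      have "(LINT z|gauss_seq. z r) = (LINT x|(distr gauss_seq gauss (\<lambda>z. z r)). x)" by (subst integral_distr) auto
      then show ?thesis by (simp only: gauss_law_coord gauss_moments)
    qed
    then show "gauss.S.expectation (\<lambda>z. a r * z r) = 0" for r by simp
  qed
  moreover have "sqrt (3 * (\<Sum>r<p. (\<bar>a r\<bar> * 2)^2)) \<le> 4 * sqrt (\<Sum>r<p. (a r)^2)"
  proof -
    have "3 * (\<Sum>r<p. (\<bar>a r\<bar> * 2)^2) = 12 * (\<Sum>r<p. (a r)^2)" by (simp add: power_mult_distrib sum_distrib_left)
    also have "\<dots> \<le> 16 * (\<Sum>r<p. (a r)^2)" by (intro mult_right_mono sum_nonneg) auto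
    finally have "sqrt (3 * (\<Sum>r<p. (\<bar>a r\<bar> * 2)^2)) \<le> sqrt (16 * (\<Sum>r<p. (a r)^2))" by (rule real_sqrt_le_mono)
    then show ?thesis by (simp add: real_sqrt_mult)
  qed
  ultimately show ?thesis by (rule mom_le_weaken)
qed

lemma distr_constant:
  assumes "prob_space M" "prob_space M'" "x \<in> space N" shows "distr M N (\<lambda>_. x) = distr M' N (\<lambda>_. x)"
  using prob_space.distr_const[OF assms(1,3)] prob_space.distr_const[OF assms(2,3)] by simp

lemma (in prob_space) block_vectors_law:
  assumes "indep_vars (\<lambda>_. N) V UNIV"
  shows "distr M (\<Pi>\<^sub>M b\<in>UNIV. N) (\<lambda>\<omega> b. V b \<omega>) = (\<Pi>\<^sub>M b\<in>UNIV. distr M N (V b))"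
  using assms indep_vars_iff_distr_eq_PiM[of UNIV V "\<lambda>_. N"] by (simp add: indep_vars_def restrict_def)

text \<open>Functions of disjoint groups of coordinates, collected block by block. Coordinates that belong to other
  blocks are set to zero so that all blocks share one space of vectors.\<close>
lemma block_vectors_indep:
  fixes C :: "nat \<Rightarrow> 'k set" and F :: "nat \<Rightarrow> ('k \<Rightarrow> real) \<Rightarrow> real"
  assumes \<mu>: "prob_space \<mu>" "sets \<mu> = sets borel"
    and C: "disjoint_family C" and F: "\<And>i. i < p \<Longrightarrow> F i \<in> borel_measurable (\<Pi>\<^sub>M k\<in>UNIV. \<mu>)"
    and dep: "\<And>i x y. i < p \<Longrightarrow> (\<And>k. k \<in> C (bl i) \<Longrightarrow> x k = y k) \<Longrightarrow> F i x = F i y"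
  shows "prob_space.indep_vars (\<Pi>\<^sub>M k\<in>UNIV. \<mu>) (\<lambda>_. vec_borel) (\<lambda>b x i. if i < p \<and> bl i = b then F i x else 0) (UNIV :: nat set)"
proof -
  let ?S = "\<Pi>\<^sub>M k\<in>(UNIV :: 'k set). \<mu>"
  interpret S: prob_space ?S by (intro prob_space_PiM \<mu>)
  have sp: "space \<mu> = UNIV" using sets_eq_imp_space_eq[OF \<mu>(2)] by simp
  have ind: "S.indep_vars (\<lambda>_. \<mu>) (\<lambda>k w. w k) UNIV" by (rule indep_vars_PiM_coordinates) (rule \<mu>)
  have r: "S.indep_vars (\<lambda>b. PiM (C b) (\<lambda>_. \<mu>)) (\<lambda>b x. restrict (\<lambda>k. x k) (C b)) UNIV"
    by (rule S.indep_vars_restrict[OF ind]) (use C in auto)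
  define f where "f b v i = (if i < p \<and> bl i = b then F i (\<lambda>k. if k \<in> C b then v k else 0) else 0)" for b v i
  have fm: "f b \<in> PiM (C b) (\<lambda>_. \<mu>) \<rightarrow>\<^sub>M vec_borel" for b
  proof (rule measurable_PiM_single')
    fix i
    show "(\<lambda>v. f b v i) \<in> borel_measurable (PiM (C b) (\<lambda>_. \<mu>))"
    proof (cases "i < p \<and> bl i = b")
      case True
      have "(\<lambda>v k. if k \<in> C b then v k else 0) \<in> PiM (C b) (\<lambda>_. \<mu>) \<rightarrow>\<^sub>M ?S"
      proof (rule measurable_PiM_single')
        show "(\<lambda>v. if k \<in> C b then v k else 0) \<in> PiM (C b) (\<lambda>_. \<mu>) \<rightarrow>\<^sub>M \<mu>" for k
          by (cases "k \<in> C b") (auto simp: sp)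
      qed (auto simp: sp)
      from measurable_compose[OF this F[of i]] True show ?thesis by (simp add: f_def)
    qed (auto simp: f_def)
  qed auto
  have "S.indep_vars (\<lambda>_. vec_borel) (\<lambda>b x. f b (restrict (\<lambda>k. x k) (C b))) UNIV"
    by (rule S.indep_vars_compose2[OF r]) (rule fm)
  moreover have "(\<lambda>b x. f b (restrict (\<lambda>k. x k) (C b))) = (\<lambda>b x i. if i < p \<and> bl i = b then F i x else 0)"
    by (auto simp: f_def fun_eq_iff intro!: dep)
  ultimately show ?thesis by simp
qed

text \<open>The blocks are exchanged for Gaussian vectors with the same covariances, realised as linear forms in a
  standard Gaussian sequence; the result is a Gaussian quadratic form of mean zero.\<close>
theorem chaos_approx:
  fixes Y :: "nat \<Rightarrow> 'a \<Rightarrow> real" and B :: "array" and m :: nat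
  assumes M: "prob_space M"
    and ind: "prob_space.indep_vars M (\<lambda>_. vec_borel) (\<lambda>b \<omega> i. if i < p \<and> bl i = b then Y i \<omega> else 0) (UNIV :: nat set)"
    and Y4: "\<And>i. i < p \<Longrightarrow> mom_le M 4 (Y i) c" and Y0: "\<And>i. i < p \<Longrightarrow> (LINT \<omega>|M. Y i \<omega>) = 0" and c: "0 \<le> c"
    and m: "\<And>s. card {i. i < p \<and> bl i = s} \<le> m"
    and diag: "\<And>i j. i < p \<Longrightarrow> j < p \<Longrightarrow> bl i = bl j \<Longrightarrow> B i j = 0"
    and \<tau>: "\<And>i. i < p \<Longrightarrow> (\<Sum>j<p. (B i j + B j i)^2) \<le> \<tau>" "0 \<le> \<tau>" and e: "0 < e"
  defines "Q \<equiv> (\<lambda>\<omega>. \<Sum>i<p. \<Sum>j<p. B i j * (Y i \<omega> * Y j \<omega>))"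
  shows "\<exists>\<alpha>. 2 * (\<Sum>i<p. (\<alpha> i)^2) \<le> (LINT \<omega>|M. (Q \<omega>)^2) \<and>
    (\<forall>t. cmod (chf M Q t - chf gauss_seq (chaos p \<alpha>) t)
       \<le> abs t ^ 3 * (3 * (4 * c) ^ 6 * m ^ 4 * sqrt \<tau> * (\<Sum>i<p. \<Sum>j<p. (B i j + B j i)^2)) + abs t * e)"
proof -
  interpret M: prob_space M by fact
  define V where "V b \<omega> i = (if i < p \<and> bl i = b then Y i \<omega> else 0)" for b \<omega> i
  have indV: "M.indep_vars (\<lambda>_. vec_borel) V UNIV" using ind unfolding V_def[abs_def] .
  have Vm: "V b \<in> M \<rightarrow>\<^sub>M vec_borel" for b using indV by (auto simp: M.indep_vars_def)
  define \<nu> where "\<nu> b = distr M vec_borel (V b)" for b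
  define I where "I b = {i. i < p \<and> bl i = b}" for b
  have cm: "(\<lambda>v. v i) \<in> borel_measurable vec_borel" for i by (rule measurable_component_singleton) simp
  have cm2: "(\<lambda>v. v i * v j) \<in> borel_measurable vec_borel" for i j by (intro borel_measurable_times cm)
  obtain N where N: "\<And>i. i < p \<Longrightarrow> bl i < N"
    using finite_nat_set_iff_bounded[of "bl ` {..<p}"] by auto
  have "\<exists>S. \<forall>i\<in>I b. \<forall>j\<in>I b. (LINT \<omega>|M. Y i \<omega> * Y j \<omega>) = (\<Sum>r\<in>I b. S i r * S j r)" for b
    by (rule gram_factor) (use M.mom_le_4_2[OF Y4] in \<open>auto simp: I_def\<close>)
  then obtain S0 where S0: "\<And>b i j. i \<in> I b \<Longrightarrow> j \<in> I b \<Longrightarrow> (LINT \<omega>|M. Y i \<omega> * Y j \<omega>) = (\<Sum>r\<in>I b. S0 b i r * S0 b j r)"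
    by metis
  define T where "T i r = (if bl r = bl i then S0 (bl i) i r else 0)" for i r
  have T: "(LINT \<omega>|M. Y i \<omega> * Y j \<omega>) = (\<Sum>r<p. T i r * T j r)" if "i < p" "j < p" "bl i = bl j" for i j
  proof -
    have "(LINT \<omega>|M. Y i \<omega> * Y j \<omega>) = (\<Sum>r\<in>I (bl i). S0 (bl i) i r * S0 (bl i) j r)" using that by (intro S0) (auto simp: I_def)
    also have "\<dots> = (\<Sum>r<p. T i r * T j r)"
      by (rule sum.mono_neutral_cong_left) (use that in \<open>auto simp: I_def T_def\<close>)
    finally show ?thesis .
  qed
  define G where "G i z = (\<Sum>r<p. T i r * z r)" for i and z :: "nat \<Rightarrow> real"
  define U where "U b z i = (if i < p \<and> bl i = b then G i z else 0)" for b z i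
  have Gm: "G i \<in> borel_measurable gauss_seq" for i unfolding G_def[abs_def] by measurable
  have indU: "gauss.S.indep_vars (\<lambda>_. vec_borel) U UNIV"
    unfolding U_def[abs_def]
  proof (rule block_vectors_indep[where C="\<lambda>b. {r. bl r = b}"])
    show "disjoint_family (\<lambda>b. {r. bl r = b})" by (auto simp: disjoint_family_on_def)
    show "G i x = G i y" if "\<And>k. k \<in> {r. bl r = bl i} \<Longrightarrow> x k = y k" for i x y
      unfolding G_def using that by (intro sum.cong refl) (auto simp: T_def)
  qed (auto intro: prob_gauss Gm)
  have Um: "U b \<in> gauss_seq \<rightarrow>\<^sub>M vec_borel" for b using indU by (auto simp: gauss.S.indep_vars_def)
  define \<Gamma> where "\<Gamma> b = distr gauss_seq vec_borel (U b)" for b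
  have \<nu>l: "block_law p bl (4 * c) b (\<nu> b)" for b
    unfolding block_law_def \<nu>_def
  proof (intro conjI allI impI)
    show "prob_space (distr M vec_borel (V b))" by (rule M.prob_space_distr[OF Vm])
    fix i assume i: "i < p" "bl i = b"
    have eq: "(\<lambda>\<omega>. V b \<omega> i) = Y i" using i by (simp add: V_def)
    show "mom_le (distr M vec_borel (V b)) 4 (\<lambda>v. v i) (4 * c)"
      unfolding mom_le_distr[OF Vm cm] eq by (rule mom_le_weaken[OF Y4[OF i(1)]]) (use c in simp)
    show "(LINT v|(distr M vec_borel (V b)). v i) = 0"
      unfolding integral_distr[OF Vm cm] eq by (rule Y0[OF i(1)])
  qed simp
  have \<Gamma>l: "block_law p bl (4 * c) b (\<Gamma> b)" for b
    unfolding block_law_def \<Gamma>_def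
  proof (intro conjI allI impI)
    show "prob_space (distr gauss_seq vec_borel (U b))" by (rule gauss.S.prob_space_distr[OF Um])
    fix i assume i: "i < p" "bl i = b"
    have eq: "(\<lambda>z. U b z i) = G i" using i by (simp add: U_def)
    have "(\<Sum>r<p. (T i r)^2) = (LINT \<omega>|M. Y i \<omega> * Y i \<omega>)" using T[of i i] i by (simp add: power2_eq_square)
    also have "\<dots> \<le> c^2" using mom_le_even(2)[OF M.mom_le_4_2[OF Y4[OF i(1)]]] by (simp add: power2_eq_square)
    finally have "sqrt (\<Sum>r<p. (T i r)^2) \<le> c" using c by (intro real_le_lsqrt) (auto intro: sum_nonneg)
    then show "mom_le (distr gauss_seq vec_borel (U b)) 4 (\<lambda>v. v i) (4 * c)"
      unfolding mom_le_distr[OF Um cm] eq unfolding G_def[abs_def] by (intro mom_le_weaken[OF gauss_linear_mom4]) simp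
    have "(LINT z|gauss_seq. G i z) = (LINT v|gauss_seq. (\<Sum>r<p. T i r * v r))" by (simp add: G_def)
    also have "\<dots> = 0"
    proof -
      have "(LINT z|gauss_seq. z r) = 0" for r
      proof -
        have "(LINT z|gauss_seq. z r) = (LINT x|(distr gauss_seq gauss (\<lambda>z. z r)). x)" by (subst integral_distr) auto
        then show ?thesis by (simp only: gauss_law_coord gauss_moments)
      qed
      then show ?thesis
        using gauss.S.mom_le_integrable(1)[OF gauss.S.mom_le_4_2[OF gauss_coord_mom]]
        by (subst Bochner_Integration.integral_sum) auto
    qed
    finally show "(LINT v|(distr gauss_seq vec_borel (U b)). v i) = 0"
      unfolding integral_distr[OF Um cm] eq .
  qed simp
  have cov: "(LINT v|(\<nu> (bl i)). v i * v j) = (LINT v|(\<Gamma> (bl i)). v i * v j)" if "i < p" "j < p" "bl i = bl j" for i j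
  proof -
    have "(LINT v|(\<nu> (bl i)). v i * v j) = (LINT \<omega>|M. Y i \<omega> * Y j \<omega>)"
      unfolding \<nu>_def integral_distr[OF Vm cm2] using that by (simp add: V_def)
    also have "\<dots> = (LINT z|gauss_seq. G i z * G j z)" unfolding T[OF that] G_def by (rule quad_of_linear[symmetric])
    also have "\<dots> = (LINT v|(\<Gamma> (bl i)). v i * v j)"
      unfolding \<Gamma>_def integral_distr[OF Um cm2] using that by (simp add: U_def)
    finally show ?thesis .
  qed
  have beyond: "\<nu> b = \<Gamma> b" if "N \<le> b" for b
  proof -
    have "V b = (\<lambda>_ _. 0)" "U b = (\<lambda>_ _. 0)" using N that by (auto simp: V_def U_def fun_eq_iff not_less[symmetric])
    then show ?thesis unfolding \<nu>_def \<Gamma>_def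
      by (simp only:) (rule distr_constant, auto simp: M.prob_space_axioms gauss.S.prob_space_axioms space_PiM)
  qed
  have lV: "distr M (\<Pi>\<^sub>M b\<in>UNIV. vec_borel) (\<lambda>\<omega> b. V b \<omega>) = PiM UNIV \<nu>"
    using M.block_vectors_law[OF indV] by (simp add: \<nu>_def[abs_def])
  have lU: "distr gauss_seq (\<Pi>\<^sub>M b\<in>UNIV. vec_borel) (\<lambda>z b. U b z) = (\<Pi>\<^sub>M b\<in>UNIV. \<Gamma> b)"
    using gauss.S.block_vectors_law[OF indU] by (simp add: \<Gamma>_def)
  have mV: "(\<lambda>\<omega> b. V b \<omega>) \<in> M \<rightarrow>\<^sub>M (\<Pi>\<^sub>M b\<in>UNIV. vec_borel)" by (rule measurable_PiM_single') (use Vm in \<open>auto simp: space_PiM\<close>)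
  have mU: "(\<lambda>z b. U b z) \<in> gauss_seq \<rightarrow>\<^sub>M (\<Pi>\<^sub>M b\<in>UNIV. vec_borel)" by (rule measurable_PiM_single') (use Um in \<open>auto simp: space_PiM\<close>)
  have bm: "block_form p bl B \<in> borel_measurable (\<Pi>\<^sub>M b\<in>UNIV. vec_borel)"
    unfolding block_form_def[abs_def]
    by (intro borel_measurable_sum borel_measurable_times borel_measurable_const coordinate_measurable refl)
  have bV: "block_form p bl B (\<lambda>b. V b \<omega>) = Q \<omega>" for \<omega>
    unfolding block_form_def Q_def by (intro sum.cong refl) (simp add: V_def)
  define A0 where "A0 r s = (\<Sum>i<p. \<Sum>j<p. B i j * (T i r * T j s))" for r s
  define A where "A r s = (A0 r s + A0 s r) / 2" for r s
  have bU: "block_form p bl B (\<lambda>b. U b z) = quad p A z" for z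
  proof -
    have "block_form p bl B (\<lambda>b. U b z) = (\<Sum>i<p. \<Sum>j<p. B i j * (G i z * G j z))"
      unfolding block_form_def by (intro sum.cong refl) (simp add: U_def)
    also have "\<dots> = (\<Sum>i<p. \<Sum>j<p. \<Sum>r<p. \<Sum>s<p. B i j * (T i r * T j s) * (z r * z s))"
    proof (intro sum.cong refl)
      fix i j show "B i j * (G i z * G j z) = (\<Sum>r<p. \<Sum>s<p. B i j * (T i r * T j s) * (z r * z s))"
        unfolding G_def by (subst sum_product, simp only: sum_distrib_left, intro sum.cong refl) (simp add: mult_ac)
    qed
    also have "\<dots> = (\<Sum>i<p. \<Sum>r<p. \<Sum>j<p. \<Sum>s<p. B i j * (T i r * T j s) * (z r * z s))"
      by (intro sum.cong refl sum.swap)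
    also have "\<dots> = (\<Sum>r<p. \<Sum>i<p. \<Sum>j<p. \<Sum>s<p. B i j * (T i r * T j s) * (z r * z s))" by (rule sum.swap)
    also have "\<dots> = (\<Sum>r<p. \<Sum>i<p. \<Sum>s<p. \<Sum>j<p. B i j * (T i r * T j s) * (z r * z s))"
      by (intro sum.cong refl sum.swap)
    also have "\<dots> = (\<Sum>r<p. \<Sum>s<p. \<Sum>i<p. \<Sum>j<p. B i j * (T i r * T j s) * (z r * z s))"
      by (intro sum.cong refl sum.swap)
    also have "\<dots> = (\<Sum>r<p. \<Sum>s<p. A0 r s * (z r * z s))" by (simp add: A0_def sum_distrib_right)
    finally have 1: "block_form p bl B (\<lambda>b. U b z) = (\<Sum>r<p. \<Sum>s<p. A0 r s * (z r * z s))" .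
    also have "\<dots> = (\<Sum>s<p. \<Sum>r<p. A0 r s * (z r * z s))" by (rule sum.swap)
    finally have 2: "block_form p bl B (\<lambda>b. U b z) = (\<Sum>r<p. \<Sum>s<p. A0 s r * (z r * z s))" by (simp add: mult_ac)
    have "quad p A z = ((\<Sum>r<p. \<Sum>s<p. A0 r s * (z r * z s)) + (\<Sum>r<p. \<Sum>s<p. A0 s r * (z r * z s))) / 2"
      by (simp add: quad_def A_def sum.distrib[symmetric] sum_divide_distrib algebra_simps add_divide_distrib)
    then show ?thesis using 1 2 by simp
  qed
  have sym: "A r s = A s r" for r s by (simp add: A_def)
  have tr: "(\<Sum>r<p. A r r) = 0"
  proof -
    have "A r r = 0" if "r < p" for r
    proof -
      have "B i j * (T i r * T j r) = 0" if "i < p" "j < p" for i j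
        using diag[OF that] by (auto simp: T_def)
      then have "A0 r r = 0" unfolding A0_def by (intro sum.neutral ballI) auto
      then show ?thesis by (simp add: A_def)
    qed
    then show ?thesis by simp
  qed
  obtain \<alpha> where \<alpha>: "(\<Sum>i<p. (\<alpha> i)^2) \<le> (\<Sum>i<p. \<Sum>j<p. (A i j)^2)"
    "\<And>t. cmod (chf gauss_seq (quad p A) t - chf gauss_seq (chaos p \<alpha>) t) \<le> abs t * e"
    using quad_chaos_approx[of p A, OF sym tr e] by blast
  have c4: "0 \<le> 4 * c" using c by simp
  note lin = lindeberg[OF \<nu>l \<Gamma>l N beyond cov m c4 diag \<tau>]
  have "(LINT \<omega>|M. (Q \<omega>)^2) = (LINT w|(PiM UNIV \<nu>). (block_form p bl B w)^2)"
    unfolding lV[symmetric] by (subst integral_distr[OF mV]) (use bm in \<open>auto simp: bV\<close>)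
  also have "\<dots> = (LINT w|(\<Pi>\<^sub>M b\<in>UNIV. \<Gamma> b). (block_form p bl B w)^2)" by (rule lin(2))
  also have "\<dots> = (LINT z|gauss_seq. (quad p A z)^2)"
    unfolding lU[symmetric] by (subst integral_distr[OF mU]) (use bm in \<open>auto simp: bU\<close>)
  also have "\<dots> = 2 * (\<Sum>i<p. \<Sum>j<p. (A i j)^2)" using quad_moments(2)[of p A, OF sym] tr by simp
  finally have Q2: "2 * (\<Sum>i<p. (\<alpha> i)^2) \<le> (LINT \<omega>|M. (Q \<omega>)^2)" using \<alpha>(1) by simp
  have "cmod (chf M Q t - chf gauss_seq (chaos p \<alpha>) t)
       \<le> abs t ^ 3 * (3 * (4 * c) ^ 6 * m ^ 4 * sqrt \<tau> * (\<Sum>i<p. \<Sum>j<p. (B i j + B j i)^2)) + abs t * e" for t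
  proof -
    have im: "(\<lambda>w. iexp (t * block_form p bl B w)) \<in> borel_measurable (\<Pi>\<^sub>M b\<in>UNIV. vec_borel)" using bm by measurable
    have 1: "(chf M Q t) = (chf (PiM UNIV \<nu>) (block_form p bl B) t)"
      unfolding lV[symmetric] integral_distr[OF mV im] bV ..
    have 2: "(chf gauss_seq (quad p A) t) = (chf (\<Pi>\<^sub>M b\<in>UNIV. \<Gamma> b) (block_form p bl B) t)"
      unfolding lU[symmetric] integral_distr[OF mU im] bU ..
    have "cmod (chf M Q t - chf gauss_seq (quad p A) t)
      \<le> abs t ^ 3 * (3 * (4 * c) ^ 6 * m ^ 4 * sqrt \<tau> * (\<Sum>i<p. \<Sum>j<p. (B i j + B j i)^2))"
      unfolding 1 2 by (rule lin(1))
    from norm_triangle_mono[OF this \<alpha>(2)[of t]] show ?thesis by simp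
  qed
  then show ?thesis using Q2 by blast
qed

section \<open>Oscillating functionals of a causal process\<close>

definition shift :: "nat \<Rightarrow> rseq \<Rightarrow> nat \<Rightarrow> real" where
  "shift s e i = e (i + s)"

text \<open>The Hilbert-Schmidt norm.\<close>
definition hs :: "nat \<Rightarrow> array \<Rightarrow> real" where
  "hs n A = sqrt (\<Sum>k=1..n. \<Sum>j=1..n. (A k j)^2)"

text \<open>The phase \<open>p\<close> lets one real function stand for the real part (\<open>p = 0\<close>) and the imaginary part
  (\<open>p = \<pi>/2\<close>) of \<open>L(F) exp(i x F)\<close>.\<close>
definition osc :: "(real \<Rightarrow> real) \<Rightarrow> real \<Rightarrow> real \<Rightarrow> statistic \<Rightarrow> statistic" where
  "osc L p x F e = L (F e) * cos (x * F e - p)"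

definition osc_const :: "real \<Rightarrow> real \<Rightarrow> real" where "osc_const CL K = K * (CL * (2 * K + 1)) + K * K + 2 * K"

definition wt :: "real \<Rightarrow> real \<Rightarrow> real" where "wt s x = (1 + \<bar>x\<bar>) powr s"

lemma wt_ge_1: "0 \<le> s \<Longrightarrow> 1 \<le> wt s x"
  by (simp add: wt_def ge_one_powr_ge_zero)

lemma wt_mono: "0 \<le> s \<Longrightarrow> \<bar>y\<bar> \<le> \<bar>x\<bar> \<Longrightarrow> wt s y \<le> wt s x"
  by (simp add: wt_def powr_mono2)

lemma abs_cos_diff: "\<bar>cos a - cos b\<bar> \<le> \<bar>a - b\<bar>" for a b :: real
proof -
  have "\<bar>cos a - cos b\<bar> \<le> cmod (iexp a - iexp b)"
    using complex_Re_le_cmod[of "iexp a - iexp b"] abs_Re_le_cmod[of "iexp a - iexp b"] by (simp add: Re_exp)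
  also have "iexp a - iexp b = iexp b * (iexp (a - b) - 1)" by (simp add: exp_add[symmetric] algebra_simps)
  also have "cmod \<dots> = cmod (iexp (a - b) - 1)" by (simp only: norm_mult norm_exp_i_times mult_1)
  also have "\<dots> \<le> \<bar>a - b\<bar>" using iexp_approx1[of "a - b" 0] by simp
  finally show ?thesis .
qed

lemma geometric_sum_le:
  fixes q :: real assumes "0 \<le> q" "q < 1" "finite J" shows "(\<Sum>i\<in>J. q ^ i) \<le> 1 / (1 - q)"
  using sum_le_suminf[of "\<lambda>i. q ^ i" J] assms suminf_geometric[of q] summable_geometric[of q] by simp

lemma geometric_tail_le:
  fixes q :: real assumes "0 \<le> q" "q < 1" shows "(\<Sum>i=m..<N. q ^ i) \<le> q ^ m / (1 - q)"
proof -
  have q: "0 < 1 - q" using assms by simp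
  show ?thesis
  proof (cases "m \<le> N")
    case True
    then have "(\<Sum>i=m..<N. q ^ i) = (q ^ m - q ^ N) / (1 - q)"
    proof (induction rule: dec_induct)
      case (step n)
      then have "(\<Sum>i=m..<Suc n. q ^ i) = (q ^ m - q ^ n) / (1 - q) + q ^ n" by simp
      also have "\<dots> = (q ^ m - q ^ Suc n) / (1 - q)" using q by (simp add: field_simps)
      finally show ?case .
    qed simp
    also have "\<dots> \<le> q ^ m / (1 - q)" using assms q by (intro divide_right_mono) auto
    finally show ?thesis .
  qed (use assms in auto)
qed

context iid_law begin

lemma shift_measurable[measurable]: "shift s \<in> S \<rightarrow>\<^sub>M S"
  unfolding shift_def[abs_def] by (rule measurable_PiM_reindex)

lemma distr_shift: "distr S S (shift s) = S"
  unfolding shift_def[abs_def] by (rule iid_reindex[OF prob_space_axioms]) (simp add: inj_def)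

lemma mom_le_shift: assumes "mom_le S p f a" shows "mom_le S p (\<lambda>e. f (shift s e)) a"
proof -
  have [measurable]: "f \<in> borel_measurable S" using assms by (simp add: mom_le_def)
  have "mom_le (distr S S (shift s)) p f a" using assms by (simp add: distr_shift)
  then show ?thesis by (simp add: mom_le_distr)
qed

lemma integral_shift:
  fixes f :: "rseq \<Rightarrow> 'b::{banach, second_countable_topology}"
  assumes [measurable]: "f \<in> borel_measurable S"
  shows "(LINT e|S. f (shift s e)) = (LINT e|S. f e)"
proof -
  have "(LINT e|S. f e) = (LINT e|(distr S S (shift s)). f e)" by (simp only: distr_shift)
  also have "\<dots> = (LINT e|S. f (shift s e))" by (rule integral_distr) measurable
  finally show ?thesis ..
qed

lemma infl_shift:
  assumes "infl p f l a" shows "infl p (\<lambda>e. f (shift s e)) (l + s) a"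
proof -
  define \<sigma> :: "nat + nat \<Rightarrow> nat + nat" where "\<sigma> = map_sum (\<lambda>i. i + s) (\<lambda>i. i + s)"
  have inj: "inj \<sigma>" unfolding \<sigma>_def by (intro sum.inj_map) (simp_all add: inj_def)
  have d: "distr S2 S2 (\<lambda>w c. w (\<sigma> c)) = S2" by (rule iid_reindex[OF prob_space_axioms inj])
  have eq: "mix {} (\<lambda>c. w (\<sigma> c)) = shift s (mix {} w)" "mix {l} (\<lambda>c. w (\<sigma> c)) = shift s (mix {l + s} w)" for w
    by (auto simp: mix_def \<sigma>_def shift_def fun_eq_iff)
  have F: "(\<lambda>w. f (mix {} w) - f (mix {l} w)) \<in> borel_measurable S2" using assms by (simp add: infl_def mom_le_def)
  have "mom_le (distr S2 S2 (\<lambda>w c. w (\<sigma> c))) p (\<lambda>w. f (mix {} w) - f (mix {l} w)) a"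
    unfolding d using assms by (simp add: infl_def)
  then show ?thesis unfolding mom_le_distr[OF measurable_PiM_reindex F] by (simp add: infl_def eq)
qed

lemma infl_shift_zero: assumes "l < s" "p > 0" shows "infl p (\<lambda>e. f (shift s e)) l 0"
proof -
  have "shift s (mix {} w) = shift s (mix {l} w)" for w using assms by (auto simp: shift_def mix_def fun_eq_iff)
  then show ?thesis using \<open>p > 0\<close> by (simp add: infl_def mom_le_def power_0_left)
qed

text \<open>Influences decay geometrically, with fourth moments finite. The amplitude \<open>a\<close> is what the error bounds
  track; the rate stays fixed.\<close>
definition rated :: "real \<Rightarrow> statistic \<Rightarrow> real \<Rightarrow> bool" where
  "rated r f a \<longleftrightarrow> (\<exists>c. mom_le S 4 f c) \<and> (\<forall>l. infl 4 f l (a * r ^ l)) \<and> 0 \<le> a"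

lemma rated_measurable: "rated r f a \<Longrightarrow> f \<in> borel_measurable S"
  by (auto simp: rated_def mom_le_def)

lemma infl_weaken: "infl p f l a \<Longrightarrow> a \<le> b \<Longrightarrow> infl p f l b"
  unfolding infl_def by (rule mom_le_weaken)

lemma rated_weaken: "rated r f a \<Longrightarrow> a \<le> b \<Longrightarrow> 0 \<le> r \<Longrightarrow> rated r f b"
  unfolding rated_def
proof (elim conjE, intro conjI allI)
  fix l assume *: "\<forall>l. infl 4 f l (a * r ^ l)" "a \<le> b" "0 \<le> r"
  show "infl 4 f l (b * r ^ l)"
    by (rule infl_weaken[OF spec[OF *(1)]]) (use * in \<open>intro mult_right_mono, auto\<close>)
qed auto

lemma rated_faster:
  assumes "rated q f a" "0 \<le> q" "q \<le> r" shows "rated r f a"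
  using assms unfolding rated_def
proof (intro conjI allI)
  fix l show "infl 4 f l (a * r ^ l)"
    by (rule infl_weaken[of _ _ _ "a * q ^ l"]) (use assms in \<open>auto simp: rated_def intro!: mult_left_mono power_mono\<close>)
qed auto

lemma infl_diff: "infl p f l a \<Longrightarrow> infl p g l b \<Longrightarrow> 1 \<le> p \<Longrightarrow> infl p (\<lambda>e. f e - g e) l (a + b)"
  using mom_le_diff[of S2 p "\<lambda>w. f (mix {} w) - f (mix {l} w)" a "\<lambda>w. g (mix {} w) - g (mix {l} w)" b]
  by (simp add: infl_def algebra_simps)

lemma rated_diff:
  assumes "rated r f a" "rated r g b" shows "rated r (\<lambda>e. f e - g e) (a + b)"
proof -
  have "infl 4 (\<lambda>e. f e - g e) l ((a + b) * r ^ l)" for l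
    using infl_diff[of 4 f l "a * r ^ l" g "b * r ^ l"] assms by (simp add: rated_def distrib_right)
  then show ?thesis using assms mom_le_diff[of S 4 f _ g] by (force simp: rated_def)
qed

lemma infl_mom: assumes "mom_le S p f b" "1 \<le> p" shows "infl p f l (2 * b)"
  using mom_le_diff[OF mom_le_mix[OF assms(1)] mom_le_mix[OF assms(1)] assms(2), of "{}" "{l}"]
  by (simp only: infl_def mult_2)

lemma infl_geometric_mean:
  assumes "infl p f l a" "infl p f l b" shows "infl p f l (sqrt (a * b))"
proof (cases "a \<le> b")
  case True
  have "0 \<le> a" using assms by (simp add: infl_def mom_le_def)
  then have "a = sqrt (a * a)" by simp
  also have "\<dots> \<le> sqrt (a * b)" using True \<open>0 \<le> a\<close> by (intro real_sqrt_le_mono mult_left_mono)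
  finally show ?thesis using assms(1) infl_weaken by blast
next
  case False
  have "0 \<le> b" using assms by (simp add: infl_def mom_le_def)
  then have "b = sqrt (b * b)" by simp
  also have "\<dots> \<le> sqrt (a * b)" using False \<open>0 \<le> b\<close> by (intro real_sqrt_le_mono mult_right_mono) auto
  finally show ?thesis using assms(2) infl_weaken by blast
qed

text \<open>An influence is bounded by its decay and by twice the norm of the function, hence by their geometric
  mean: half of the decay is traded for a small norm.\<close>
lemma rated_interpolate:
  assumes f: "rated (r^2) f a" and b: "mom_le S 4 f b" and r: "0 \<le> r"
  shows "rated r f (sqrt (2 * a * b))"
  unfolding rated_def
proof (intro conjI allI)
  fix l
  have "infl 4 f l (sqrt (a * (r^2) ^ l * (2 * b)))"
    by (rule infl_geometric_mean) (use f infl_mom[OF b] in \<open>auto simp: rated_def\<close>)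
  moreover have "sqrt (a * (r^2) ^ l * (2 * b)) = sqrt (2 * a * b) * r ^ l"
  proof -
    have "(r^2) ^ l = (r ^ l)^2" by (metis power_mult mult.commute)
    then have "a * (r^2) ^ l * (2 * b) = (2 * a * b) * (r ^ l)^2" by simp
    then show ?thesis using r by (simp only: real_sqrt_mult real_sqrt_abs) simp
  qed
  ultimately show "infl 4 f l (sqrt (2 * a * b) * r ^ l)" by simp
qed (use f b in \<open>auto simp: rated_def mom_le_def\<close>)

lemma rated_avg: assumes "rated r f a" "0 \<le> r" shows "rated r (avg m f) a"
  unfolding rated_def
proof (intro conjI allI)
  obtain c where c: "mom_le S 4 f c" using assms by (auto simp: rated_def)
  then show "\<exists>c. mom_le S 4 (avg m f) c" using avg_mom by blast
  fix l
  show "infl 4 (avg m f) l (a * r ^ l)"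
  proof (cases "l < m")
    case True
    then show ?thesis using assms by (intro infl_avg[OF c]) (auto simp: rated_def)
  next
    case False
    then have "infl 4 (avg m f) l 0" using rated_measurable[OF assms(1)] by (intro infl_avg_zero) auto
    then show ?thesis using assms by (elim infl_weaken) (auto simp: rated_def)
  qed
qed (use assms in \<open>auto simp: rated_def\<close>)

text \<open>The tail of the geometric influences bounds the norm of the error, and interpolation passes this
  smallness on to its influences.\<close>
lemma rated_avg_error:
  assumes f: "rated (r^2) f a" and r: "0 \<le> r" "r < 1"
  shows "rated r (\<lambda>e. f e - avg m f e) (2 * a * r ^ m / (1 - r))"
proof -
  have a: "0 \<le> a" using f by (simp add: rated_def)
  have r2: "0 \<le> r^2" "r^2 < 1" using r by (auto simp: power_less_one_iff abs_square_less_1)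
  obtain c where c: "mom_le S 4 f c" using f by (auto simp: rated_def)
  have fast: "rated (r^2) (\<lambda>e. f e - avg m f e) (a + a)" by (intro rated_diff f rated_avg) simp
  have mom: "mom_le S 4 (\<lambda>e. f e - avg m f e) (a * ((r^2) ^ m / (1 - r^2)))"
  proof (rule avg_error[OF c])
    show "infl 4 f l (a * (r^2) ^ l)" for l using f by (simp add: rated_def)
    show "(\<Sum>l=m..<N. a * (r^2) ^ l) \<le> a * ((r^2) ^ m / (1 - r^2))" for N
      unfolding sum_distrib_left[symmetric] using a r2 by (intro mult_left_mono geometric_tail_le)
  qed
  have "sqrt (2 * (a + a) * (a * ((r^2) ^ m / (1 - r^2)))) \<le> 2 * a * r ^ m / (1 - r)"
  proof (rule real_le_lsqrt)
    have "2 * (a + a) * (a * ((r^2) ^ m / (1 - r^2))) = (2 * a * r ^ m)^2 * (1 / (1 - r^2))"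
    proof -
      have "(r^2) ^ m = r ^ m * r ^ m" by (metis power_mult mult.commute power2_eq_square)
      then show ?thesis unfolding power2_eq_square[of "2 * a * r ^ m"] by simp
    qed
    also have "\<dots> \<le> (2 * a * r ^ m)^2 * (1 / (1 - r)^2)"
    proof (intro mult_left_mono divide_left_mono)
      show "(1 - r)^2 \<le> 1 - r^2" using r mult_left_le[of r r] by (simp add: power2_eq_square algebra_simps)
      show "0 < (1 - r^2) * (1 - r)^2" using r r2 by (intro mult_pos_pos zero_less_power) auto
    qed auto
    also have "\<dots> = (2 * a * r ^ m / (1 - r))^2" by (simp add: power_divide)
    finally show "2 * (a + a) * (a * ((r^2) ^ m / (1 - r^2))) \<le> (2 * a * r ^ m / (1 - r))^2" .
  qed (use a r in auto)
  then show ?thesis by (rule rated_weaken[OF rated_interpolate[OF fast mom r(1)]]) (rule r)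
qed

text \<open>Variable \<open>k\<close> is a function of the innovations up to time \<open>k\<close>; relative to time \<open>n\<close> this is a shift by
  \<open>n - k\<close>.\<close>
definition proc :: "nat \<Rightarrow> (nat \<Rightarrow> statistic) \<Rightarrow> nat \<Rightarrow> statistic" where
  "proc n f k e = f k (shift (n - k) e) - (LINT e|S. f k e)"

lemma proc_mean: "mom_le S 4 (f k) c \<Longrightarrow> (LINT e|S. proc n f k e) = 0"
  using S.mom_le_integrable(1)[OF S.mom_le_4_2[OF mom_le_shift]] integral_shift[of "f k"] S.prob_space
  by (simp add: proc_def mom_le_measurable)

lemma proc_mom: assumes "mom_le S 4 (f k) c" shows "mom_le S 4 (proc n f k) (2 * c)"
  using S.mom_le_center[OF mom_le_shift[OF assms]] integral_shift[OF mom_le_measurable[OF assms]]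
  by (simp add: proc_def[abs_def])

lemma proc_array:
  assumes f: "\<And>k. k \<in> {1..n} \<Longrightarrow> rated r (f k) a" and r: "0 \<le> r" "r < 1" and a: "0 \<le> a"
  shows "infl_array {1..n} (proc n f) (a / (1 - r))"
  unfolding infl_array_def
proof (intro conjI ballI)
  show "0 \<le> a / (1 - r)" using a r by simp
  fix k assume k: "k \<in> {1..n}"
  obtain c where c: "mom_le S 4 (f k) c" using f[OF k] by (auto simp: rated_def)
  show "\<exists>c. mom_le S 4 (proc n f k) c" using proc_mom[where f=f and k=k, OF c] by blast
  show "(LINT e|S. proc n f k e) = 0" by (rule proc_mean[where f=f and k=k, OF c])
next
  define u where "u k l = (if n - k \<le> l then a * r ^ (l - (n - k)) else 0)" for k l :: nat
  have "\<forall>l. infl 4 (proc n f k) l (u k l)" if k: "k \<in> {1..n}" for k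
  proof
    fix l
    have "infl 4 (\<lambda>e. f k (shift (n - k) e)) l (u k l)"
    proof (cases "n - k \<le> l")
      case True
      then show ?thesis using infl_shift[of 4 "f k" "l - (n - k)" _ "n - k"] f[OF k] by (simp add: u_def rated_def)
    next
      case False then show ?thesis using infl_shift_zero[of l "n - k" 4 "f k"] by (simp add: u_def)
    qed
    then show "infl 4 (proc n f k) l (u k l)" by (simp add: infl_def proc_def)
  qed
  moreover have "\<forall>l. (\<Sum>k=1..n. u k l) \<le> a / (1 - r)"
  proof
    fix l
    have "(\<Sum>k=1..n. u k l) = (\<Sum>k\<in>{k\<in>{1..n}. n - k \<le> l}. a * r ^ (l - (n - k)))"
      unfolding u_def by (rule sum.inter_filter[symmetric]) simp
    also have "\<dots> = (\<Sum>i\<in>(\<lambda>k. l - (n - k)) ` {k\<in>{1..n}. n - k \<le> l}. a * r ^ i)"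
      by (subst sum.reindex) (auto simp: inj_on_def)
    also have "\<dots> \<le> a * (1 / (1 - r))"
      unfolding sum_distrib_left[symmetric] using r a by (intro mult_left_mono geometric_sum_le) auto
    finally show "(\<Sum>k=1..n. u k l) \<le> a / (1 - r)" by simp
  qed
  moreover have "\<forall>N. (\<Sum>l<N. u k l) \<le> a / (1 - r)" for k
  proof
    fix N
    have "(\<Sum>l<N. u k l) = (\<Sum>l\<in>{l\<in>{..<N}. n - k \<le> l}. a * r ^ (l - (n - k)))"
      unfolding u_def by (rule sum.inter_filter[symmetric]) simp
    also have "\<dots> = (\<Sum>i\<in>(\<lambda>l. l - (n - k)) ` {l\<in>{..<N}. n - k \<le> l}. a * r ^ i)"
      by (subst sum.reindex) (auto simp: inj_on_def)
    also have "\<dots> \<le> a * (1 / (1 - r))"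
      unfolding sum_distrib_left[symmetric] using r a by (intro mult_left_mono geometric_sum_le) auto
    finally show "(\<Sum>l<N. u k l) \<le> a / (1 - r)" by simp
  qed
  ultimately show "\<exists>u. (\<forall>k\<in>{1..n}. \<forall>l. infl 4 (proc n f k) l (u k l)) \<and> (\<forall>l. (\<Sum>k=1..n. u k l) \<le> a / (1 - r)) \<and>
      (\<forall>k\<in>{1..n}. \<forall>N. (\<Sum>l<N. u k l) \<le> a / (1 - r))"
    by (intro exI[of _ u]) blast
qed auto

definition form :: "nat \<Rightarrow> array \<Rightarrow> (nat \<Rightarrow> statistic) \<Rightarrow> (nat \<Rightarrow> statistic) \<Rightarrow> statistic" where
  "form n A f g e = (\<Sum>k=1..n. \<Sum>j=1..n. A k j * proc n f k e * proc n g j e)"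

abbreviation oform :: "nat \<Rightarrow> array \<Rightarrow> (real \<Rightarrow> real) \<Rightarrow> (nat \<Rightarrow> statistic) \<Rightarrow> real \<Rightarrow> real \<Rightarrow> real \<Rightarrow> real \<Rightarrow> statistic" where
  "oform n A L F p q x y \<equiv> form n A (\<lambda>k. osc L p x (F k)) (\<lambda>k. osc L q y (F k))"

abbreviation aform :: "nat \<Rightarrow> array \<Rightarrow> nat \<Rightarrow> (real \<Rightarrow> real) \<Rightarrow> (nat \<Rightarrow> statistic) \<Rightarrow> real \<Rightarrow> real \<Rightarrow> real \<Rightarrow> real \<Rightarrow> statistic" where
  "aform n A m L F p q x y \<equiv> form n A (\<lambda>k. avg m (osc L p x (F k))) (\<lambda>k. avg m (osc L q y (F k)))"

definition centred :: "statistic \<Rightarrow> statistic" where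
  "centred f e = f e - (LINT e|S. f e)"

lemma form_bound:
  assumes f: "\<And>k. k \<in> {1..n} \<Longrightarrow> rated r (f k) a" and g: "\<And>k. k \<in> {1..n} \<Longrightarrow> rated r (g k) b"
    and r: "0 \<le> r" "r < 1" and ab: "0 \<le> a" "0 \<le> b"
  shows "mom_le S 2 (centred (form n A f g)) (3 / (1 - r)^2 * (a * b) * hs n A)" and "\<exists>c. mom_le S 2 (form n A f g) c"
proof -
  have fa: "infl_array {1..n} (proc n f) (a / (1 - r))" by (rule proc_array[OF _ r ab(1)]) (rule f)
  have ga: "infl_array {1..n} (proc n g) (b / (1 - r))" by (rule proc_array[OF _ r ab(2)]) (rule g)
  note q = quadratic_form_variance[OF fa ga, where A=A]
  have "3 * (a / (1 - r)) * (b / (1 - r)) * sqrt (\<Sum>k=1..n. \<Sum>j=1..n. (A k j)^2) = 3 / (1 - r)^2 * (a * b) * hs n A"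
    by (simp add: hs_def power2_eq_square)
  then show "mom_le S 2 (centred (form n A f g)) (3 / (1 - r)^2 * (a * b) * hs n A)"
    using q(1) unfolding centred_def[abs_def] form_def[abs_def] by simp
  show "\<exists>c. mom_le S 2 (form n A f g) c" using q(2) unfolding form_def[abs_def] by simp
qed

text \<open>Eighth moments are required because an influence of \<open>L(F) cos(x F)\<close> in the fourth norm is bounded by
  products of two factors.\<close>
definition good_obs :: "(real \<Rightarrow> real) \<Rightarrow> (real \<Rightarrow> real) \<Rightarrow> real \<Rightarrow> real \<Rightarrow> real \<Rightarrow> statistic \<Rightarrow> bool" where
  "good_obs L dL CL K \<rho> F \<longleftrightarrow> 0 \<le> CL \<and> 0 \<le> K \<and> 0 < \<rho> \<and> \<rho> < 1 \<and> L \<in> borel_measurable borel \<and> dL \<in> borel_measurable borel \<and> F \<in> borel_measurable S \<and>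
     (\<forall>a b. \<bar>L a - L b\<bar> \<le> \<bar>a - b\<bar> * (CL * (\<bar>dL a\<bar> + \<bar>dL b\<bar> + 1))) \<and>
     mom_le S 8 (\<lambda>e. dL (F e)) K \<and> mom_le S 8 (\<lambda>e. L (F e)) K \<and> mom_le S 8 (\<lambda>e. F e * L (F e)) K \<and>
     (\<forall>l. infl 8 F l (K * \<rho> ^ l))"

lemma osc_basic:
  assumes "good_obs L dL CL K \<rho> F"
  shows "osc L p x F \<in> borel_measurable S" "mom_le S 4 (osc L p x F) K"
    "mom_le S 4 (\<lambda>e. osc L p x F e - osc L p y F e) (\<bar>x - y\<bar> * K)"
proof -
  have [measurable]: "L \<in> borel_measurable borel" "F \<in> borel_measurable S" using assms by (auto simp: good_obs_def)
  show m: "osc L p x F \<in> borel_measurable S" for x unfolding osc_def[abs_def] by measurable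
  have L4: "mom_le S 4 (\<lambda>e. L (F e)) K" "mom_le S 4 (\<lambda>e. F e * L (F e)) K"
    using assms S.mom_le_8_4 by (auto simp: good_obs_def)
  show "mom_le S 4 (osc L p x F) K"
    by (rule mom_le_mono[OF L4(1) m]) (auto simp: osc_def abs_mult mult_left_le)
  have "\<bar>osc L p x F e - osc L p y F e\<bar> \<le> \<bar>(x - y) * (F e * L (F e))\<bar>" for e
  proof -
    have "osc L p x F e - osc L p y F e = L (F e) * (cos (x * F e - p) - cos (y * F e - p))" by (simp add: osc_def algebra_simps)
    then have "\<bar>osc L p x F e - osc L p y F e\<bar> \<le> \<bar>L (F e)\<bar> * \<bar>(x * F e - p) - (y * F e - p)\<bar>"
      using mult_left_mono[OF abs_cos_diff[of "x * F e - p" "y * F e - p"], of "\<bar>L (F e)\<bar>"] by (simp add: abs_mult)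
    also have "(x * F e - p) - (y * F e - p) = (x - y) * F e" by (simp add: algebra_simps)
    finally show ?thesis by (simp add: abs_mult mult_ac)
  qed
  then show "mom_le S 4 (\<lambda>e. osc L p x F e - osc L p y F e) (\<bar>x - y\<bar> * K)"
    by (intro mom_le_mono[OF mom_le_cmult[OF L4(2), of "x - y"]]) (use m in auto)
qed

lemma osc_infl:
  assumes g: "good_obs L dL CL K \<rho> F"
  shows "infl 4 (osc L p x F) l (osc_const CL K * (1 + \<bar>x\<bar>) * \<rho> ^ l)"
proof -
  have [measurable]: "L \<in> borel_measurable borel" "dL \<in> borel_measurable borel" "F \<in> borel_measurable S" and nn: "0 \<le> CL" "0 \<le> K" "0 < \<rho>"
    using g by (auto simp: good_obs_def)
  have Lip: "\<bar>L a - L b\<bar> \<le> \<bar>a - b\<bar> * (CL * (\<bar>dL a\<bar> + \<bar>dL b\<bar> + 1))" for a b using g by (auto simp: good_obs_def)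
  let ?a = "\<lambda>w. F (mix {} w)" and ?b = "\<lambda>w. F (mix {l} w)"
  have d8: "mom_le S2 8 (\<lambda>w. ?a w - ?b w) (K * \<rho> ^ l)" using g by (auto simp: good_obs_def infl_def)
  have dL8: "mom_le S2 8 (\<lambda>w. \<bar>dL (F (mix B w))\<bar>) K" for B
    by (rule mom_le_mono[OF mom_le_mix[of 8 "\<lambda>e. dL (F e)" K B]]) (use g in \<open>auto simp: good_obs_def\<close>)
  have L8: "mom_le S2 8 (\<lambda>w. L (?b w)) K" by (rule mom_le_mix[of 8 "\<lambda>e. L (F e)" K "{l}"]) (use g in \<open>auto simp: good_obs_def\<close>)
  have "mom_le S2 8 (\<lambda>w. \<bar>dL (?a w)\<bar> + \<bar>dL (?b w)\<bar> + 1) (K + K + \<bar>1\<bar>)"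
    by (intro mom_le_add dL8 S2.mom_le_const) auto
  from mom_le_cmult[OF this, of CL]
  have D8: "mom_le S2 8 (\<lambda>w. CL * (\<bar>dL (?a w)\<bar> + \<bar>dL (?b w)\<bar> + 1)) (CL * (2 * K + 1))" using nn by simp
  have m1: "mom_le S2 4 (\<lambda>w. \<bar>(?a w - ?b w) * (CL * (\<bar>dL (?a w)\<bar> + \<bar>dL (?b w)\<bar> + 1))\<bar>) (K * \<rho> ^ l * (CL * (2 * K + 1)))"
  proof (rule mom_le_mono)
    show "mom_le S2 4 (\<lambda>w. (?a w - ?b w) * (CL * (\<bar>dL (?a w)\<bar> + \<bar>dL (?b w)\<bar> + 1))) (K * \<rho> ^ l * (CL * (2 * K + 1)))"
      by (rule mom_le_mult) (use d8 D8 in simp_all)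
  qed simp_all
  have m2: "mom_le S2 4 (\<lambda>w. \<bar>x * ((?a w - ?b w) * L (?b w))\<bar>) (\<bar>x\<bar> * (K * \<rho> ^ l * K))"
  proof (rule mom_le_mono)
    show "mom_le S2 4 (\<lambda>w. x * ((?a w - ?b w) * L (?b w))) (\<bar>x\<bar> * (K * \<rho> ^ l * K))"
      by (rule mom_le_cmult, rule mom_le_mult) (use d8 L8 in simp_all)
  qed simp_all
  have "mom_le S2 4 (\<lambda>w. osc L p x F (mix {} w) - osc L p x F (mix {l} w)) (K * \<rho> ^ l * (CL * (2 * K + 1)) + \<bar>x\<bar> * (K * \<rho> ^ l * K))"
  proof (rule mom_le_mono[OF mom_le_add[OF m1 m2]])
    fix w
    have "osc L p x F (mix {} w) - osc L p x F (mix {l} w) = (L (?a w) - L (?b w)) * cos (x * ?a w - p) + L (?b w) * (cos (x * ?a w - p) - cos (x * ?b w - p))"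
      by (simp add: osc_def algebra_simps)
    also have "\<bar>\<dots>\<bar> \<le> \<bar>L (?a w) - L (?b w)\<bar> * \<bar>cos (x * ?a w - p)\<bar> + \<bar>L (?b w)\<bar> * \<bar>cos (x * ?a w - p) - cos (x * ?b w - p)\<bar>"
      by (rule order_trans[OF abs_triangle_ineq]) (simp add: abs_mult)
    also have "\<dots> \<le> \<bar>?a w - ?b w\<bar> * (CL * (\<bar>dL (?a w)\<bar> + \<bar>dL (?b w)\<bar> + 1)) * 1 + \<bar>L (?b w)\<bar> * \<bar>(x * ?a w - p) - (x * ?b w - p)\<bar>"
      using nn by (intro add_mono mult_mono Lip abs_cos_diff) auto
    also have "(x * ?a w - p) - (x * ?b w - p) = x * (?a w - ?b w)" by (simp add: algebra_simps)
    finally have "\<bar>osc L p x F (mix {} w) - osc L p x F (mix {l} w)\<bar> \<le> \<bar>?a w - ?b w\<bar> * (CL * (\<bar>dL (?a w)\<bar> + \<bar>dL (?b w)\<bar> + 1)) + \<bar>x\<bar> * (\<bar>?a w - ?b w\<bar> * \<bar>L (?b w)\<bar>)"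
      by (simp add: abs_mult mult_ac)
    then show "\<bar>osc L p x F (mix {} w) - osc L p x F (mix {l} w)\<bar> \<le> \<bar>\<bar>(?a w - ?b w) * (CL * (\<bar>dL (?a w)\<bar> + \<bar>dL (?b w)\<bar> + 1))\<bar> + \<bar>x * ((?a w - ?b w) * L (?b w))\<bar>\<bar>"
      using nn by (simp add: abs_mult)
  qed (use osc_basic(1)[OF g] in auto)
  moreover have "K * \<rho> ^ l * (CL * (2 * K + 1)) + \<bar>x\<bar> * (K * \<rho> ^ l * K) \<le> osc_const CL K * (1 + \<bar>x\<bar>) * \<rho> ^ l"
  proof -
    have "osc_const CL K * (1 + \<bar>x\<bar>) * \<rho> ^ l - (K * \<rho> ^ l * (CL * (2 * K + 1)) + \<bar>x\<bar> * (K * \<rho> ^ l * K))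
      = \<rho> ^ l * (K * (CL * (2 * K + 1)) * \<bar>x\<bar> + K * K + 2 * K * (1 + \<bar>x\<bar>))"
      by (simp add: osc_const_def algebra_simps)
    also have "\<dots> \<ge> 0" using nn by (intro mult_nonneg_nonneg add_nonneg_nonneg) auto
    finally show ?thesis by simp
  qed
  ultimately show ?thesis unfolding infl_def by (rule mom_le_weaken)
qed

text \<open>The influence is at most \<open>C t\<close> with \<open>t = (1 + |x|) \<rho>\<^sup>l\<close>, and at most \<open>C\<close>. Both are at most \<open>C t\<^sup>s\<close> when
  the right one is chosen, which lowers the growth in \<open>x\<close> to the power \<open>s\<close>.\<close>
lemma osc_rated:
  assumes g: "good_obs L dL CL K \<rho> F" and s: "0 < s" "s \<le> 1"
  shows "rated (\<rho> powr s) (osc L p x F) (osc_const CL K * wt s x)"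
  unfolding rated_def
proof (intro conjI allI exI)
  have nn: "0 \<le> CL" "0 \<le> K" "0 < \<rho>" using g by (auto simp: good_obs_def)
  have C0: "0 \<le> osc_const CL K" "2 * K \<le> osc_const CL K" using nn by (auto simp: osc_const_def)
  show "mom_le S 4 (osc L p x F) K" by (rule osc_basic(2)[OF g])
  show "0 \<le> osc_const CL K * wt s x" using C0 by (simp add: wt_def)
  fix l
  define t where "t = (1 + \<bar>x\<bar>) * \<rho> ^ l"
  have t0: "0 < t" using nn by (simp add: t_def add_pos_nonneg)
  have ts: "t powr s = wt s x * (\<rho> powr s) ^ l"
    using nn by (simp add: t_def wt_def powr_mult powr_power powr_realpow[symmetric] powr_powr mult.commute)
  have "infl 4 (osc L p x F) l (osc_const CL K * t powr s)"
  proof (cases "t \<le> 1")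
    case True
    then have "t \<le> t powr s" using t0 s powr_mono'[of s 1 t] by simp
    then show ?thesis using osc_infl[OF g, of p x l] C0
      by (elim infl_weaken) (simp add: t_def mult.assoc mult_left_mono)
  next
    case False
    then have "1 \<le> t powr s" using s by (intro ge_one_powr_ge_zero) auto
    then have "osc_const CL K * 1 \<le> osc_const CL K * t powr s" using C0 by (intro mult_left_mono)
    moreover have "infl 4 (osc L p x F) l (2 * K)" by (rule infl_mom[OF osc_basic(2)[OF g]]) simp
    ultimately show ?thesis using C0 by (elim infl_weaken) linarith
  qed
  then show "infl 4 (osc L p x F) l (osc_const CL K * wt s x * (\<rho> powr s) ^ l)" by (simp add: ts mult.assoc)
qed

text \<open>Interpolation between the decay and the norm, which is proportional to \<open>|x - y|\<close>.\<close>
lemma osc_diff_rated: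
  assumes g: "good_obs L dL CL K \<rho> F" and s: "0 < s" "s \<le> 1" and xy: "\<bar>y\<bar> \<le> \<bar>x\<bar>" and r: "r = \<rho> powr (s / 2)"
  shows "rated r (\<lambda>e. osc L p x F e - osc L p y F e) (2 * osc_const CL K * wt s x * min 1 (sqrt \<bar>x - y\<bar>))"
proof -
  have nn: "0 \<le> CL" "0 \<le> K" "0 < \<rho>" "\<rho> < 1" using g by (auto simp: good_obs_def)
  define C where "C = osc_const CL K"
  have C0: "0 \<le> C" "K \<le> C" using nn by (auto simp: osc_const_def C_def)
  have r0: "0 \<le> r" "r \<le> 1" "0 < r" using nn s by (auto simp: r powr_le_one_le intro!: powr_le1)
  have r2: "\<rho> powr s = r^2" using nn by (simp add: r powr_power)
  have w: "0 \<le> wt s x" "wt s y \<le> wt s x" "1 \<le> wt s x" using s xy wt_ge_1[of s x] by (auto simp: wt_mono)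
  have fast: "rated (r^2) (\<lambda>e. osc L p x F e - osc L p y F e) (2 * C * wt s x)"
  proof (rule rated_weaken[OF rated_diff])
    show "rated (r^2) (osc L p x F) (C * wt s x)" "rated (r^2) (osc L p y F) (C * wt s y)"
      unfolding r2[symmetric] C_def by (rule osc_rated[OF g s])+
    show "C * wt s x + C * wt s y \<le> 2 * C * wt s x" using mult_left_mono[OF w(2) C0(1)] by simp
  qed simp
  have "r^2 \<le> r" using r0 by (simp add: power2_eq_square mult_left_le)
  then have 1: "rated r (\<lambda>e. osc L p x F e - osc L p y F e) (2 * C * wt s x)"
    by (intro rated_faster[OF fast]) simp_all
  have "sqrt (2 * (2 * C * wt s x) * (\<bar>x - y\<bar> * K)) \<le> 2 * C * wt s x * sqrt \<bar>x - y\<bar>"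
  proof (rule real_le_lsqrt)
    have "2 * (2 * C * wt s x) * (\<bar>x - y\<bar> * K) \<le> 2 * (2 * C * wt s x) * (\<bar>x - y\<bar> * (C * wt s x))"
    proof (intro mult_left_mono)
      have "K * 1 \<le> C * wt s x" using C0 w nn by (intro mult_mono) auto
      then show "K \<le> C * wt s x" by simp
    qed (use C0 w in auto)
    also have "\<dots> = (2 * C * wt s x * sqrt \<bar>x - y\<bar>)^2"
      by (simp add: power_mult_distrib power2_eq_square[of C] power2_eq_square[of "wt s x"])
    finally show "2 * (2 * C * wt s x) * (\<bar>x - y\<bar> * K) \<le> (2 * C * wt s x * sqrt \<bar>x - y\<bar>)^2" .
  qed (use C0 w nn in auto)
  then have 2: "rated r (\<lambda>e. osc L p x F e - osc L p y F e) (2 * C * wt s x * sqrt \<bar>x - y\<bar>)"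
    by (rule rated_weaken[OF rated_interpolate[OF fast osc_basic(3)[OF g] r0(1)]]) (rule r0)
  show ?thesis using 1 2 unfolding C_def by (simp add: min_def)
qed

lemma proc_diff:
  assumes "integrable S (f k)" "integrable S (g k)"
  shows "proc n (\<lambda>k e. f k e - g k e) k e = proc n f k e - proc n g k e"
  using assms by (simp add: proc_def)

lemma rated_integrable: "rated r f a \<Longrightarrow> integrable S f"
  using S.mom_le_integrable(1)[OF S.mom_le_4_2] by (auto simp: rated_def)

text \<open>The two forms differ by five forms of the same kind: the frequency changes in the first and in the second
  factor, then the averaging in each factor, then the matrix. Each is bounded by \<open>form_bound\<close>.\<close>
lemma kernel_error:
  assumes obs: "\<And>k. k \<in> {1..n} \<Longrightarrow> good_obs L dL CL K \<rho> (F k)" and CL: "0 \<le> CL" "0 \<le> K" "0 < \<rho>" "\<rho> < 1"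
    and s: "0 < s" "s \<le> 1" and r: "r = \<rho> powr (s / 2)"
    and x: "\<bar>x'\<bar> \<le> \<bar>x\<bar>" and y: "\<bar>y'\<bar> \<le> \<bar>y\<bar>"
  shows "mom_le S 2 (\<lambda>e. centred (oform n A L F p q x y) e
      - centred (aform n A' m L F p q x' y') e)
     (3 / (1 - r)^2 * (osc_const CL K)^2 * (wt s x * wt s y) *
       ((2 * min 1 (sqrt \<bar>x - x'\<bar>) + 2 * min 1 (sqrt \<bar>y - y'\<bar>) + 4 * r ^ m / (1 - r)) * hs n A + hs n (\<lambda>k j. A k j - A' k j)))"
    (is "mom_le S 2 ?D ?B")
proof -
  define C where "C = osc_const CL K"
  have C0: "0 \<le> C" using CL by (auto simp: osc_const_def C_def)
  have r0: "0 \<le> r" "r < 1" using CL s powr_less_mono2[of "s / 2" \<rho> 1] by (auto simp: r)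
  have r2: "\<rho> powr s = r^2" using CL by (simp add: r powr_power)
  have r2r: "r^2 \<le> r" using r0 by (simp add: power2_eq_square mult_left_le)
  define wx wy where "wx = wt s x" and "wy = wt s y"
  have w: "0 \<le> wx" "0 \<le> wy" "wt s x' \<le> wx" "wt s y' \<le> wy" "0 \<le> wt s x'" "0 \<le> wt s y'"
    using s x y by (auto simp: wx_def wy_def wt_mono) (auto simp: wt_def)
  define P P' Pa Q Q' Qa where "P k = osc L p x (F k)" and "P' k = osc L p x' (F k)" and "Pa k = avg m (P' k)"
    and "Q k = osc L q y (F k)" and "Q' k = osc L q y' (F k)" and "Qa k = avg m (Q' k)" for k
  let ?I = "{1..n}"
  have fast: "rated (r^2) (P' k) (C * wx)" "rated (r^2) (Q' k) (C * wy)" "rated (r^2) (P k) (C * wx)" "rated (r^2) (Q k) (C * wy)" if "k \<in> ?I" for k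
    using osc_rated[OF obs[OF that] s, of p x'] osc_rated[OF obs[OF that] s, of q y'] osc_rated[OF obs[OF that] s, of p x] osc_rated[OF obs[OF that] s, of q y]
      rated_weaken[of "r^2" "P' k" "C * wt s x'" "C * wx"] rated_weaken[of "r^2" "Q' k" "C * wt s y'" "C * wy"] mult_left_mono[OF w(3) C0] mult_left_mono[OF w(4) C0]
    by (auto simp: r2 C_def wx_def wy_def P_def P'_def Q_def Q'_def)
  have slow: "rated r (P' k) (C * wx)" "rated r (Q' k) (C * wy)" "rated r (P k) (C * wx)" "rated r (Q k) (C * wy)" if "k \<in> ?I" for k
    using fast[OF that] rated_faster[OF _ zero_le_power2 r2r] by auto
  have slowa: "rated r (Pa k) (C * wx)" "rated r (Qa k) (C * wy)" if "k \<in> ?I" for k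
    unfolding Pa_def Qa_def using slow[OF that] rated_avg r0 by auto
  define ox oy rm where "ox = min 1 (sqrt \<bar>x - x'\<bar>)" and "oy = min 1 (sqrt \<bar>y - y'\<bar>)" and "rm = r ^ m / (1 - r)"
  have nn: "0 \<le> ox" "0 \<le> oy" "0 \<le> rm" using r0 by (auto simp: ox_def oy_def rm_def)
  have dP: "rated r (\<lambda>e. P k e - P' k e) (2 * C * wx * ox)" and dQ: "rated r (\<lambda>e. Q k e - Q' k e) (2 * C * wy * oy)" if "k \<in> ?I" for k
    unfolding P_def P'_def Q_def Q'_def C_def wx_def wy_def ox_def oy_def
    using osc_diff_rated[OF obs[OF that] s x r] osc_diff_rated[OF obs[OF that] s y r] by auto
  have aP: "rated r (\<lambda>e. P' k e - Pa k e) (2 * (C * wx) * rm)" and aQ: "rated r (\<lambda>e. Q' k e - Qa k e) (2 * (C * wy) * rm)" if "k \<in> ?I" for k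
    unfolding Pa_def Qa_def rm_def using rated_avg_error[OF fast(1)[OF that] r0, of m] rated_avg_error[OF fast(2)[OF that] r0, of m] by auto
  define X1 where "X1 = form n A (\<lambda>k e. P k e - P' k e) Q"
  define X2 where "X2 = form n A P' (\<lambda>k e. Q k e - Q' k e)"
  define X3 where "X3 = form n A (\<lambda>k e. P' k e - Pa k e) Q'"
  define X4 where "X4 = form n A Pa (\<lambda>k e. Q' k e - Qa k e)"
  define X5 where "X5 = form n (\<lambda>k j. A k j - A' k j) Pa Qa"
  define c where "c = 3 / (1 - r)^2"
  have h0: "0 \<le> hs n A" by (simp add: hs_def sum_nonneg)
  have pos: "0 \<le> C * wx" "0 \<le> C * wy" "0 \<le> 2 * C * wx * ox" "0 \<le> 2 * C * wy * oy" "0 \<le> 2 * (C * wx) * rm" "0 \<le> 2 * (C * wy) * rm"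
    using C0 w nn by auto
  have b1: "mom_le S 2 (centred X1) (c * ((2 * C * wx * ox) * (C * wy)) * hs n A)" "\<exists>c. mom_le S 2 X1 c"
    unfolding X1_def c_def by (rule form_bound[OF dP slow(4) r0 pos(3,2)], assumption+)+
  have b2: "mom_le S 2 (centred X2) (c * ((C * wx) * (2 * C * wy * oy)) * hs n A)" "\<exists>c. mom_le S 2 X2 c"
    unfolding X2_def c_def by (rule form_bound[OF slow(1) dQ r0 pos(1,4)], assumption+)+
  have b3: "mom_le S 2 (centred X3) (c * ((2 * (C * wx) * rm) * (C * wy)) * hs n A)" "\<exists>c. mom_le S 2 X3 c"
    unfolding X3_def c_def by (rule form_bound[OF aP slow(2) r0 pos(5,2)], assumption+)+
  have b4: "mom_le S 2 (centred X4) (c * ((C * wx) * (2 * (C * wy) * rm)) * hs n A)" "\<exists>c. mom_le S 2 X4 c"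
    unfolding X4_def c_def by (rule form_bound[OF slowa(1) aQ r0 pos(1,6)], assumption+)+
  have b5: "mom_le S 2 (centred X5) (c * ((C * wx) * (C * wy)) * hs n (\<lambda>k j. A k j - A' k j))" "\<exists>c. mom_le S 2 X5 c"
    unfolding X5_def c_def by (rule form_bound[OF slowa(1) slowa(2) r0 pos(1,2)], assumption+)+
  have bX': "\<exists>c. mom_le S 2 (form n A' Pa Qa) c"
    by (rule form_bound(2)[OF slowa(1) slowa(2) r0 pos(1,2)])
  have i: "integrable S X" if "\<exists>c. mom_le S 2 X c" for X using that S.mom_le_integrable(1) by blast
  note ii = i[OF b1(2)] i[OF b2(2)] i[OF b3(2)] i[OF b4(2)] i[OF b5(2)] i[OF bX']
  have dec: "form n A P Q e = X1 e + X2 e + X3 e + X4 e + X5 e + form n A' Pa Qa e" for e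
  proof -
    have "A k j * proc n P k e * proc n Q j e = A k j * proc n (\<lambda>k e. P k e - P' k e) k e * proc n Q j e
        + A k j * proc n P' k e * proc n (\<lambda>k e. Q k e - Q' k e) j e + A k j * proc n (\<lambda>k e. P' k e - Pa k e) k e * proc n Q' j e
        + A k j * proc n Pa k e * proc n (\<lambda>k e. Q' k e - Qa k e) j e + (A k j - A' k j) * proc n Pa k e * proc n Qa j e + A' k j * proc n Pa k e * proc n Qa j e"
      if "k \<in> ?I" "j \<in> ?I" for k j
      using rated_integrable[OF slow(1)[OF that(1)]] rated_integrable[OF slow(3)[OF that(1)]] rated_integrable[OF slowa(1)[OF that(1)]]
        rated_integrable[OF slow(2)[OF that(2)]] rated_integrable[OF slow(4)[OF that(2)]] rated_integrable[OF slowa(2)[OF that(2)]]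
      by (simp add: proc_diff algebra_simps)
    then show ?thesis unfolding form_def X1_def X2_def X3_def X4_def X5_def sum.distrib[symmetric]
      by (intro sum.cong refl) auto
  qed
  have cdec: "centred (form n A P Q) e - centred (form n A' Pa Qa) e = centred X1 e + centred X2 e + centred X3 e + centred X4 e + centred X5 e" for e
  proof -
    have "form n A P Q = (\<lambda>e. X1 e + X2 e + X3 e + X4 e + X5 e + form n A' Pa Qa e)" using dec by auto
    then show ?thesis using ii by (simp add: centred_def)
  qed
  have "mom_le S 2 (\<lambda>e. centred X1 e + centred X2 e + centred X3 e + centred X4 e + centred X5 e)
     (c * ((2 * C * wx * ox) * (C * wy)) * hs n A + c * ((C * wx) * (2 * C * wy * oy)) * hs n A + c * ((2 * (C * wx) * rm) * (C * wy)) * hs n A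
       + c * ((C * wx) * (2 * (C * wy) * rm)) * hs n A + c * ((C * wx) * (C * wy)) * hs n (\<lambda>k j. A k j - A' k j))"
    by (intro mom_le_add b1(1) b2(1) b3(1) b4(1) b5(1)) auto
  also have "c * ((2 * C * wx * ox) * (C * wy)) * hs n A + c * ((C * wx) * (2 * C * wy * oy)) * hs n A + c * ((2 * (C * wx) * rm) * (C * wy)) * hs n A
       + c * ((C * wx) * (2 * (C * wy) * rm)) * hs n A + c * ((C * wx) * (C * wy)) * hs n (\<lambda>k j. A k j - A' k j)
     = c * C^2 * (wx * wy) * ((2 * ox + 2 * oy + 4 * rm) * hs n A + hs n (\<lambda>k j. A k j - A' k j))"
    by (simp add: power2_eq_square algebra_simps)
  finally show ?thesis
    unfolding cdec[symmetric] unfolding P_def[abs_def] P'_def[abs_def] Q_def[abs_def] Q'_def[abs_def] Pa_def[abs_def] Qa_def[abs_def]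
      C_def wx_def wy_def c_def ox_def oy_def rm_def by simp
qed

lemma indep_product_zero:
  assumes J: "J1 \<inter> J2 = {}" and f: "mom_le S 2 f a" and g: "mom_le S 2 g b"
    and fd: "\<And>x y. (\<And>k. k \<in> J1 \<Longrightarrow> x k = y k) \<Longrightarrow> f x = f y" and gd: "\<And>x y. (\<And>k. k \<in> J2 \<Longrightarrow> x k = y k) \<Longrightarrow> g x = g y"
  shows "(LINT x|S. f x * g x) = (LINT x|S. f x) * (LINT x|S. g x)"
proof -
  define H where "H i = (if i = 0 then f else g)" for i :: nat
  define C where "C b = (if b = 0 then J1 else if b = 1 then J2 else {})" for b :: nat
  have "S.indep_vars (\<lambda>_. vec_borel) (\<lambda>b x i. if i < 2 \<and> id i = b then H i x else 0) (UNIV :: nat set)"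
  proof (rule block_vectors_indep)
    show "disjoint_family C" using J by (auto simp: disjoint_family_on_def C_def)
    show "H i \<in> borel_measurable S" for i using f g by (auto simp: H_def mom_le_def)
    show "H i x = H i y" if "i < 2" "\<And>k. k \<in> C (id i) \<Longrightarrow> x k = y k" for i x y
      using that fd[of x y] gd[of x y] by (auto simp: H_def C_def split: if_splits)
    show "prob_space \<mu>" by (rule prob_space_axioms)
    show "sets \<mu> = sets borel" by (rule sets_law)
  qed
  then have "S.indep_vars (\<lambda>_. borel) (\<lambda>b x. (if b < 2 \<and> id b = b then H b x else 0)) (UNIV :: nat set)"
    by (rule S.indep_vars_compose2[where Y="\<lambda>b v. v b"]) simp
  then have "S.indep_vars (\<lambda>_. borel) (\<lambda>b x. (if b < 2 \<and> id b = b then H b x else 0)) {0, 1}"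
    by (rule S.indep_vars_subset) simp
  moreover have "integrable S f" "integrable S g" using S.mom_le_integrable(1)[OF f] S.mom_le_integrable(1)[OF g] by auto
  then have "integrable S (\<lambda>x. if b < 2 \<and> id b = b then H b x else 0)" if "b \<in> {0, 1}" for b :: nat
    using that by (auto simp: H_def)
  ultimately have "(LINT x|S. (\<Prod>b\<in>{0, 1::nat}. if b < 2 \<and> id b = b then H b x else 0))
      = (\<Prod>b\<in>{0, 1::nat}. (LINT x|S. (if b < 2 \<and> id b = b then H b x else 0)))"
    by (intro S.indep_vars_lebesgue_integral) auto
  then show ?thesis by (simp add: H_def)
qed

end

section \<open>Mixing over frequencies\<close>

lemma mom_le_1_integrable:
  assumes "mom_le M 1 f a" shows "integrable M f" "(LINT x|M. \<bar>f x\<bar>) \<le> a" "\<bar>\<integral>x. f x \<partial>M\<bar> \<le> a"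
proof -
  have [measurable]: "f \<in> borel_measurable M" using assms by (simp add: mom_le_def)
  have i: "integrable M (\<lambda>x. \<bar>f x\<bar>)" "(LINT x|M. \<bar>f x\<bar>) \<le> a" using mom_le_integrable_power[OF assms] by simp_all
  then show "integrable M f" "(LINT x|M. \<bar>f x\<bar>) \<le> a" by (simp_all add: integrable_abs_iff)
  show "\<bar>\<integral>x. f x \<partial>M\<bar> \<le> a" using integral_abs_bound[of M f] i(2) by linarith
qed

lemma mom_le_mixture:
  fixes R :: "'z \<Rightarrow> 'w \<Rightarrow> real"
  assumes N: "sigma_finite_measure N" and M: "sigma_finite_measure M"
    and R[measurable]: "(\<lambda>(z, e). R z e) \<in> borel_measurable (N \<Otimes>\<^sub>M M)"
    and b: "\<And>z. mom_le M 1 (R z) (B z)" and B: "integrable N B"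
  shows "mom_le M 1 (\<lambda>e. \<integral>z. R z e \<partial>N) (LINT z|N. B z)"
proof -
  interpret N: sigma_finite_measure N by fact
  interpret M: sigma_finite_measure M by fact
  interpret P: pair_sigma_finite N M ..
  have [measurable]: "(\<lambda>e. \<integral>z. R z e \<partial>N) \<in> borel_measurable M"
    using measurable_pair_swap[OF R] by (intro N.borel_measurable_lebesgue_integral) (simp add: case_prod_beta')
  have [measurable]: "(\<lambda>e. R z e) \<in> borel_measurable M" for z using b[of z] by (simp add: mom_le_def)
  have B0: "0 \<le> B z" for z using b[of z] by (simp add: mom_le_def)
  have "(\<integral>\<^sup>+e. ennreal \<bar>\<integral>z. R z e \<partial>N\<bar> \<partial>M) \<le> (\<integral>\<^sup>+e. (\<integral>\<^sup>+z. ennreal \<bar>R z e\<bar> \<partial>N) \<partial>M)"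
  proof (rule nn_integral_mono)
    fix e show "ennreal \<bar>\<integral>z. R z e \<partial>N\<bar> \<le> (\<integral>\<^sup>+z. ennreal \<bar>R z e\<bar> \<partial>N)"
    proof (cases "integrable N (\<lambda>z. R z e)")
      case True then show ?thesis using integral_norm_bound_ennreal[OF True] by simp
    qed (simp add: not_integrable_integral_eq)
  qed
  also have "\<dots> = (\<integral>\<^sup>+z. (\<integral>\<^sup>+e. ennreal \<bar>R z e\<bar> \<partial>M) \<partial>N)" by (rule P.Fubini') measurable
  also have "\<dots> \<le> (\<integral>\<^sup>+z. ennreal (B z) \<partial>N)" using b by (intro nn_integral_mono) (simp add: mom_le_def)
  also have "\<dots> = ennreal (LINT z|N. B z)" by (rule nn_integral_eq_integral[OF B]) (simp add: B0)
  finally show ?thesis by (simp add: mom_le_def B0)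
qed

text \<open>With the four products of real and imaginary parts indexed by two truth values, these are the
  coefficients of the real part of \<open>g (a + i b) (c + i d)\<close>.\<close>
definition gc :: "complex \<Rightarrow> bool \<Rightarrow> bool \<Rightarrow> real" where
  "gc w u v = (if u = v then (if u then - Re w else Re w) else - Im w)"

definition ph :: "bool \<Rightarrow> real" where "ph u = (if u then pi / 2 else 0)"

lemma abs_gc: "\<bar>gc w u v\<bar> \<le> cmod w"
  by (simp add: gc_def abs_Re_le_cmod abs_Im_le_cmod)

lemma gc_measurable[measurable]: "(\<lambda>w. gc w u v) \<in> borel_measurable borel"
  unfolding gc_def by measurable

lemma fst_snd_lborel[measurable]: "fst \<in> borel_measurable (lborel :: (real \<times> real) measure)" "snd \<in> borel_measurable (lborel :: (real \<times> real) measure)"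
  by (auto intro!: borel_measurable_continuous_onI continuous_intros)

text \<open>The mass of one component of \<open>g\<close> on the cell that is rounded to \<open>(a, b)\<close>.\<close>
definition coef :: "(real \<times> real \<Rightarrow> complex) \<Rightarrow> (real \<Rightarrow> real) \<Rightarrow> bool \<Rightarrow> bool \<Rightarrow> real \<Rightarrow> real \<Rightarrow> real" where
  "coef g \<pi> u v a b = (LINT z|lborel. gc (g z) u v * (if \<pi> (fst z) = a \<and> \<pi> (snd z) = b then 1 else 0))"

lemma finite_range_expand:
  fixes h :: "'a \<Rightarrow> 'a \<Rightarrow> real"
  assumes "finite \<Lambda>" "x \<in> \<Lambda>" "y \<in> \<Lambda>"
  shows "(\<Sum>a\<in>\<Lambda>. \<Sum>b\<in>\<Lambda>. (if x = a \<and> y = b then 1 else 0) * h a b) = h x y"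
proof -
  have "(\<Sum>a\<in>\<Lambda>. \<Sum>b\<in>\<Lambda>. (if x = a \<and> y = b then 1 else 0) * h a b) = (\<Sum>a\<in>\<Lambda>. if x = a then (\<Sum>b\<in>\<Lambda>. if y = b then h a b else 0) else 0)"
    by (intro sum.cong refl) (auto intro!: sum.cong)
  also have "\<dots> = h x y" using assms by simp
  finally show ?thesis .
qed

abbreviation wmass :: "real \<Rightarrow> (real \<times> real \<Rightarrow> complex) \<Rightarrow> real \<times> real \<Rightarrow> real" where
  "wmass s g z \<equiv> cmod (g z) * (wt s (fst z) * wt s (snd z))"

text \<open>The bound of \<open>kernel_error\<close> times \<open>|g|\<close>: \<open>a\<close> is the norm of the matrix and \<open>b\<close> the norm of what is
  removed from it.\<close>
abbreviation err_kernel :: "real \<Rightarrow> real \<Rightarrow> real \<Rightarrow> nat \<Rightarrow> (real \<Rightarrow> real) \<Rightarrow> real \<Rightarrow> real \<Rightarrow> (real \<times> real \<Rightarrow> complex) \<Rightarrow> real \<times> real \<Rightarrow> real" where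
  "err_kernel C s r m \<pi> a b g z \<equiv> cmod (g z) * (3 / (1 - r)^2 * C^2 * (wt s (fst z) * wt s (snd z)) *
     ((2 * min 1 (sqrt \<bar>fst z - \<pi> (fst z)\<bar>) + 2 * min 1 (sqrt \<bar>snd z - \<pi> (snd z)\<bar>) + 4 * r ^ m / (1 - r)) * a + b))"

context iid_law begin

lemma osc_joint:
  assumes [measurable]: "L \<in> borel_measurable borel" "F \<in> borel_measurable S" "x \<in> borel_measurable Z"
  shows "(\<lambda>(z, e). osc L p (x z) F e) \<in> borel_measurable (Z \<Otimes>\<^sub>M S)"
  unfolding osc_def by measurable

lemma form_joint:
  assumes L: "L \<in> borel_measurable borel" and F: "\<And>k. k \<in> {1..n} \<Longrightarrow> F k \<in> borel_measurable S"
    and x: "x \<in> borel_measurable Z" "y \<in> borel_measurable Z"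
  shows "(\<lambda>(z, e). oform n A L F p q (x z) (y z) e) \<in> borel_measurable (Z \<Otimes>\<^sub>M S)"
    and "(\<lambda>z. \<integral>e. oform n A L F p q (x z) (y z) e \<partial>S) \<in> borel_measurable Z"
proof -
  have P: "(\<lambda>(z, e). proc n (\<lambda>k. osc L p (x z) (F k)) k e) \<in> borel_measurable (Z \<Otimes>\<^sub>M S)"
    if k: "k \<in> {1..n}" and x: "x \<in> borel_measurable Z" for k p x
  proof -
    have j: "(\<lambda>(z, e). osc L p (x z) (F k) e) \<in> borel_measurable (Z \<Otimes>\<^sub>M S)" by (rule osc_joint[OF L F[OF k] x])
    have [measurable]: "(\<lambda>z. \<integral>e. osc L p (x z) (F k) e \<partial>S) \<in> borel_measurable Z"
      by (rule S.borel_measurable_lebesgue_integral) (rule j)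
    have "(\<lambda>w. (fst w, shift (n - k) (snd w))) \<in> Z \<Otimes>\<^sub>M S \<rightarrow>\<^sub>M Z \<Otimes>\<^sub>M S" by measurable
    from measurable_compose[OF this j]
    have [measurable]: "(\<lambda>w. osc L p (x (fst w)) (F k) (shift (n - k) (snd w))) \<in> borel_measurable (Z \<Otimes>\<^sub>M S)" by simp
    show ?thesis unfolding proc_def case_prod_beta' by measurable
  qed
  show j: "(\<lambda>(z, e). oform n A L F p q (x z) (y z) e) \<in> borel_measurable (Z \<Otimes>\<^sub>M S)"
    unfolding form_def case_prod_beta' using P[OF _ x(1), of _ p] P[OF _ x(2), of _ q]
    by (intro borel_measurable_sum borel_measurable_times borel_measurable_const) (auto simp: case_prod_beta')
  show "(\<lambda>z. \<integral>e. oform n A L F p q (x z) (y z) e \<partial>S) \<in> borel_measurable Z"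
    by (rule S.borel_measurable_lebesgue_integral) (rule j)
qed

text \<open>A bound on the quadratic form that is uniform in the frequencies.\<close>
definition envelope :: "nat \<Rightarrow> array \<Rightarrow> (real \<Rightarrow> real) \<Rightarrow> (nat \<Rightarrow> statistic) \<Rightarrow> statistic" where
  "envelope n A L F e = (\<Sum>k=1..n. \<Sum>j=1..n. \<bar>A k j\<bar> *
     ((\<bar>L (F k (shift (n - k) e))\<bar> + (LINT e|S. \<bar>L (F k e)\<bar>)) * (\<bar>L (F j (shift (n - j) e))\<bar> + (LINT e|S. \<bar>L (F j e)\<bar>))))"

lemma form_le_envelope:
  assumes L: "L \<in> borel_measurable borel" and F: "\<And>k. k \<in> {1..n} \<Longrightarrow> F k \<in> borel_measurable S"
    and m: "\<And>k. k \<in> {1..n} \<Longrightarrow> mom_le S 4 (\<lambda>e. L (F k e)) K"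
  shows "integrable S (envelope n A L F)"
    and "\<bar>oform n A L F p q x y e\<bar> \<le> envelope n A L F e"
    and "\<bar>\<integral>e. oform n A L F p q x y e \<partial>S\<bar> \<le> (LINT e|S. envelope n A L F e)"
proof -
  have [measurable]: "L \<in> borel_measurable borel" by (rule L)
  have a: "mom_le S 4 (\<lambda>e. \<bar>L (F k e)\<bar>) K" if "k \<in> {1..n}" for k
    by (rule mom_le_mono[OF m[OF that]]) (use m[OF that] in \<open>auto simp: mom_le_def\<close>)
  have e2: "\<exists>c. mom_le S 2 (\<lambda>e. \<bar>L (F k (shift (n - k) e))\<bar> + (LINT e|S. \<bar>L (F k e)\<bar>)) c" if "k \<in> {1..n}" for k
    using mom_le_add[OF S.mom_le_4_2[OF mom_le_shift[OF a[OF that]]] S.mom_le_const, of "n - k"] by auto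
  show env: "integrable S (envelope n A L F)"
    unfolding envelope_def[abs_def]
  proof (intro Bochner_Integration.integrable_sum integrable_mult_right)
    fix k j assume "k \<in> {1..n}" "j \<in> {1..n}"
    then show "integrable S (\<lambda>e. (\<bar>L (F k (shift (n - k) e))\<bar> + (LINT e|S. \<bar>L (F k e)\<bar>)) * (\<bar>L (F j (shift (n - j) e))\<bar> + (LINT e|S. \<bar>L (F j e)\<bar>)))"
      using e2[of k] e2[of j] mom_le_mult_integrable(1) by blast
  qed
  have pb: "\<bar>proc n (\<lambda>k. osc L p x (F k)) k e\<bar> \<le> \<bar>L (F k (shift (n - k) e))\<bar> + (LINT e|S. \<bar>L (F k e)\<bar>)" if "k \<in> {1..n}" for k p x e
  proof -
    have [measurable]: "F k \<in> borel_measurable S" by (rule F[OF that])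
    have o: "\<bar>osc L p x (F k) e\<bar> \<le> \<bar>L (F k e)\<bar>" for e by (simp add: osc_def abs_mult mult_left_le)
    have i: "integrable S (\<lambda>e. \<bar>L (F k e)\<bar>)" by (rule S.mom_le_integrable(1)[OF S.mom_le_4_2[OF a[OF that]]])
    have "osc L p x (F k) \<in> borel_measurable S" unfolding osc_def[abs_def] by measurable
    then have "integrable S (osc L p x (F k))" by (rule Bochner_Integration.integrable_bound[OF i]) (simp add: o)
    then have "\<bar>\<integral>e. osc L p x (F k) e \<partial>S\<bar> \<le> (LINT e|S. \<bar>L (F k e)\<bar>)"
      using norm_integral_le_integral[of S "osc L p x (F k)" "\<lambda>e. \<bar>L (F k e)\<bar>"] o i by simp
    then show ?thesis using o[of "shift (n - k) e"] unfolding proc_def by linarith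
  qed
  show fe: "\<bar>oform n A L F p q x y e\<bar> \<le> envelope n A L F e" for e
    unfolding form_def envelope_def
  proof (rule order_trans[OF sum_abs], rule sum_mono, rule order_trans[OF sum_abs], rule sum_mono)
    fix k j assume "k \<in> {1..n}" "j \<in> {1..n}"
    then show "\<bar>A k j * proc n (\<lambda>k. osc L p x (F k)) k e * proc n (\<lambda>k. osc L q y (F k)) j e\<bar> \<le> \<bar>A k j\<bar> *
     ((\<bar>L (F k (shift (n - k) e))\<bar> + (LINT e|S. \<bar>L (F k e)\<bar>)) * (\<bar>L (F j (shift (n - j) e))\<bar> + (LINT e|S. \<bar>L (F j e)\<bar>)))"
      unfolding abs_mult mult.assoc by (intro mult_left_mono mult_mono pb) auto
  qed
  have "(\<lambda>(u, e). oform n A L F p q x y e) \<in> borel_measurable (count_space (UNIV :: unit set) \<Otimes>\<^sub>M S)"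
    by (rule form_joint(1)[OF L F]) auto
  from measurable_Pair2[OF this, of "()"]
  have "(\<lambda>e. oform n A L F p q x y e) \<in> borel_measurable S" by simp
  then have "integrable S (\<lambda>e. oform n A L F p q x y e)"
    by (rule Bochner_Integration.integrable_bound[OF env _ AE_I2]) (unfold real_norm_def, rule order_trans[OF fe abs_ge_self])
  then show "\<bar>\<integral>e. oform n A L F p q x y e \<partial>S\<bar> \<le> (LINT e|S. envelope n A L F e)"
    using norm_integral_le_integral[of S "oform n A L F p q x y", OF _ _ env] fe by simp
qed

text \<open>The statistic as a function of the innovations.\<close>
definition wform :: "nat \<Rightarrow> array \<Rightarrow> (real \<Rightarrow> real) \<Rightarrow> (nat \<Rightarrow> statistic) \<Rightarrow> (real \<times> real \<Rightarrow> complex) \<Rightarrow> statistic" where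
  "wform n A L F g e = (LINT z|lborel. (\<Sum>u\<in>UNIV. \<Sum>v\<in>UNIV. gc (g z) u v *
     oform n A L F (ph u) (ph v) (fst z) (snd z) e))"

text \<open>Its finite-dimensional approximation: rounded frequencies and finite memory.\<close>
definition dform :: "nat \<Rightarrow> array \<Rightarrow> (real \<Rightarrow> real) \<Rightarrow> (nat \<Rightarrow> statistic) \<Rightarrow> (real \<times> real \<Rightarrow> complex) \<Rightarrow> (real \<Rightarrow> real) \<Rightarrow> nat \<Rightarrow> statistic" where
  "dform n A L F g \<pi> m e = (\<Sum>u\<in>UNIV. \<Sum>v\<in>UNIV. \<Sum>a\<in>range \<pi>. \<Sum>b\<in>range \<pi>. coef g \<pi> u v a b *
     aform n A m L F (ph u) (ph v) a b e)"

lemma avg_form_bound: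
  assumes obs: "\<And>k. k \<in> {1..n} \<Longrightarrow> good_obs L dL CL K \<rho> (F k)" and CL: "0 \<le> CL" "0 \<le> K" "0 < \<rho>" "\<rho> < 1"
    and s: "0 < s" "s \<le> 1"
  shows "mom_le S 2 (centred (aform n A m L F p q a b))
      (3 / (1 - \<rho> powr s)^2 * ((osc_const CL K * wt s a) * (osc_const CL K * wt s b)) * hs n A)"
    and "\<exists>c. mom_le S 2 (aform n A m L F p q a b) c"
proof -
  have r: "0 \<le> \<rho> powr s" "\<rho> powr s < 1" using CL s powr_less_mono2[of s \<rho> 1] by auto
  have c: "0 \<le> osc_const CL K * wt s x" for x using CL by (simp add: osc_const_def wt_def)
  have f: "rated (\<rho> powr s) (avg m (osc L p x (F k))) (osc_const CL K * wt s x)" if "k \<in> {1..n}" for k p x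
    by (intro rated_avg osc_rated[OF obs[OF that] s] r)
  show "mom_le S 2 (centred (aform n A m L F p q a b))
      (3 / (1 - \<rho> powr s)^2 * ((osc_const CL K * wt s a) * (osc_const CL K * wt s b)) * hs n A)"
    by (rule form_bound(1)[OF f f r c c])
  show "\<exists>c. mom_le S 2 (aform n A m L F p q a b) c"
    by (rule form_bound(2)[OF f f r c c])
qed

text \<open>The approximation is compared with \<open>wform\<close> minus the mixture of the means of the forms; because the
  approximation has mean zero, centring \<open>wform\<close> itself at most doubles the error.\<close>
theorem wform_error:
  assumes obs: "\<And>k. k \<in> {1..n} \<Longrightarrow> good_obs L dL CL K \<rho> (F k)" and CL: "0 \<le> CL" "0 \<le> K" "0 < \<rho>" "\<rho> < 1" and L: "L \<in> borel_measurable borel"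
    and s: "0 < s" "s \<le> 1" and r: "r = \<rho> powr (s / 2)"
    and g: "integrable lborel g" and gw: "integrable lborel (wmass s g)"
    and \<pi>: "\<pi> \<in> borel_measurable borel" "finite (range \<pi>)" "\<And>x. \<bar>\<pi> x\<bar> \<le> \<bar>x\<bar>"
    and mean: "\<And>u v a b. (LINT e|S. aform n A' m L F (ph u) (ph v) a b e) = 0"
  shows "integrable S (wform n A L F g)"
    and "mom_le S 1 (\<lambda>e. centred (wform n A L F g) e - dform n A' L F g \<pi> m e)
     (2 * (LINT z|lborel. 4 * err_kernel (osc_const CL K) s r m \<pi> (hs n A) (hs n (\<lambda>k j. A k j - A' k j)) g z))"
proof -
  have Lm[measurable]: "L \<in> borel_measurable borel" by (rule L)
  have [measurable]: "g \<in> borel_measurable lborel" using g by simp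
  have [measurable]: "\<pi> \<in> borel_measurable borel" by (rule \<pi>)
  have Fm: "F k \<in> borel_measurable S" if "k \<in> {1..n}" for k using obs[OF that] by (auto simp: good_obs_def)
  have L4: "mom_le S 4 (\<lambda>e. L (F k e)) K" if "k \<in> {1..n}" for k using obs[OF that] by (auto simp: good_obs_def intro: S.mom_le_8_4)
  define Ff where "Ff u v z = oform n A L F (ph u) (ph v) (fst z) (snd z)" for u v and z :: "real \<times> real"
  define Fa where "Fa u v a b = aform n A' m L F (ph u) (ph v) a b" for u v a b
  define B where "B z = 3 / (1 - r)^2 * (osc_const CL K)^2 * (wt s (fst z) * wt s (snd z)) *
       ((2 * min 1 (sqrt \<bar>fst z - \<pi> (fst z)\<bar>) + 2 * min 1 (sqrt \<bar>snd z - \<pi> (snd z)\<bar>) + 4 * r ^ m / (1 - r)) * hs n A + hs n (\<lambda>k j. A k j - A' k j))" for z :: "real \<times> real"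
  let ?\<Lambda> = "range \<pi>"
  have r0: "0 \<le> r" "r < 1" using CL s powr_less_mono2[of "s / 2" \<rho> 1] by (auto simp: r)
  have err: "mom_le S 2 (\<lambda>e. centred (Ff u v z) e - centred (Fa u v (\<pi> (fst z)) (\<pi> (snd z))) e) (B z)" for u v z
    unfolding Ff_def Fa_def B_def by (rule kernel_error[OF obs CL s r \<pi>(3) \<pi>(3)])
  have mean': "(LINT e|S. Fa u v a b e) = 0" for u v a b unfolding Fa_def by (rule mean)
  have B0: "0 \<le> B z" for z using err[of undefined undefined z] by (simp add: mom_le_def)
  have gB: "integrable lborel (\<lambda>z. 4 * (cmod (g z) * B z))"
  proof (intro integrable_mult_right)
    have h: "0 \<le> hs n A" "0 \<le> hs n (\<lambda>k j. A k j - A' k j)" by (auto simp: hs_def sum_nonneg)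
    define c where "c = 3 / (1 - r)^2 * (osc_const CL K)^2 * ((4 + 4 * r ^ m / (1 - r)) * hs n A + hs n (\<lambda>k j. A k j - A' k j))"
    have "B z \<le> (wt s (fst z) * wt s (snd z)) * c" for z
    proof -
      have "B z \<le> 3 / (1 - r)^2 * (osc_const CL K)^2 * (wt s (fst z) * wt s (snd z)) * ((2 * 1 + 2 * 1 + 4 * r ^ m / (1 - r)) * hs n A + hs n (\<lambda>k j. A k j - A' k j))"
        unfolding B_def using h by (intro mult_left_mono mult_right_mono add_mono) (auto simp: wt_def)
      then show ?thesis by (simp add: c_def mult_ac)
    qed
    then have n: "norm (cmod (g z) * B z) \<le> norm (wmass s g z * c)" for z
      using mult_left_mono[of "B z" "wt s (fst z) * wt s (snd z) * c" "cmod (g z)"] B0[of z] by (simp add: mult.assoc)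
    have i: "integrable lborel (\<lambda>z. wmass s g z * c)" by (intro integrable_mult_left gw)
    have "(\<lambda>z. cmod (g z) * B z) \<in> borel_measurable lborel" unfolding B_def wt_def by measurable
    then show "integrable lborel (\<lambda>z. cmod (g z) * B z)"
      by (rule Bochner_Integration.integrable_bound[OF i _ AE_I2]) (rule n)
  qed
  have jF: "(\<lambda>(z, e). Ff u v z e) \<in> borel_measurable (lborel \<Otimes>\<^sub>M S)" and jE: "(\<lambda>z. \<integral>e. Ff u v z e \<partial>S) \<in> borel_measurable lborel" for u v
    unfolding Ff_def by (rule form_joint[OF L Fm]; measurable)+
  note envb = form_le_envelope[OF L Fm L4, of n]
  have ib: "integrable lborel (\<lambda>z. gc (g z) u v * f z)" if f: "f \<in> borel_measurable lborel" "\<And>z. \<bar>f z\<bar> \<le> c" for f c u v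
  proof (rule Bochner_Integration.integrable_bound)
    show "integrable lborel (\<lambda>z. cmod (g z) * c)" using g by (intro integrable_mult_left integrable_norm)
    show "(\<lambda>z. gc (g z) u v * f z) \<in> borel_measurable lborel" using f(1) by measurable
    show "AE z in lborel. norm (gc (g z) u v * f z) \<le> norm (cmod (g z) * c)"
    proof (rule AE_I2)
      fix z have "norm (gc (g z) u v * f z) \<le> cmod (g z) * c" unfolding real_norm_def abs_mult by (intro mult_mono abs_gc f) auto
      then show "norm (gc (g z) u v * f z) \<le> norm (cmod (g z) * c)" by simp
    qed
  qed
  have iF: "integrable lborel (\<lambda>z. gc (g z) u v * Ff u v z e)" for u v e
  proof (rule ib)
    show "(\<lambda>z. Ff u v z e) \<in> borel_measurable lborel" using measurable_Pair1[OF jF[of u v], of e] by simp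
    show "\<bar>Ff u v z e\<bar> \<le> envelope n A L F e" for z unfolding Ff_def by (rule envb(2))
  qed
  have iE: "integrable lborel (\<lambda>z. gc (g z) u v * (LINT e|S. Ff u v z e))" for u v
  proof (rule ib[OF jE])
    show "\<bar>LINT e|S. Ff u v z e\<bar> \<le> (LINT e|S. envelope n A L F e)" for z unfolding Ff_def by (rule envb(3))
  qed
  have iC: "integrable lborel (\<lambda>z. gc (g z) u v * (if \<pi> (fst z) = a \<and> \<pi> (snd z) = b then 1 else 0))" for u v a b
  proof (rule Bochner_Integration.integrable_bound[OF integrable_norm[OF g]])
    show "(\<lambda>z. gc (g z) u v * (if \<pi> (fst z) = a \<and> \<pi> (snd z) = b then 1 else 0)) \<in> borel_measurable lborel" by measurable
    show "AE z in lborel. norm (gc (g z) u v * (if \<pi> (fst z) = a \<and> \<pi> (snd z) = b then 1 else 0)) \<le> norm (norm (g z))"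
      using abs_gc by (intro AE_I2) auto
  qed
  define R where "R z e = (\<Sum>u\<in>UNIV. \<Sum>v\<in>UNIV. gc (g z) u v * (centred (Ff u v z) e - centred (Fa u v (\<pi> (fst z)) (\<pi> (snd z))) e))" for z e
  have R_eq: "R z e = (\<Sum>u\<in>UNIV. \<Sum>v\<in>UNIV. gc (g z) u v * Ff u v z e) - (\<Sum>u\<in>UNIV. \<Sum>v\<in>UNIV. gc (g z) u v * (LINT e|S. Ff u v z e))
      - (\<Sum>u\<in>UNIV. \<Sum>v\<in>UNIV. \<Sum>a\<in>?\<Lambda>. \<Sum>b\<in>?\<Lambda>. (gc (g z) u v * (if \<pi> (fst z) = a \<and> \<pi> (snd z) = b then 1 else 0)) * Fa u v a b e)" for z e
  proof -
    have "(\<Sum>a\<in>?\<Lambda>. \<Sum>b\<in>?\<Lambda>. (gc (g z) u v * (if \<pi> (fst z) = a \<and> \<pi> (snd z) = b then 1 else 0)) * Fa u v a b e) = gc (g z) u v * Fa u v (\<pi> (fst z)) (\<pi> (snd z)) e" for u v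
      unfolding mult.assoc sum_distrib_left[symmetric] by (subst finite_range_expand) (use \<pi> in auto)
    then show ?thesis unfolding R_def by (simp only: centred_def mean' sum_subtractf[symmetric] right_diff_distrib diff_0_right)
  qed
  have fm: "Fa u v a b \<in> borel_measurable S" for u v a b
  proof -
    have "\<exists>c. mom_le S 2 (Fa u v a b) c" unfolding Fa_def by (rule avg_form_bound(2)[OF obs CL s])
    then show ?thesis by (auto simp: mom_le_def)
  qed
  have jR: "(\<lambda>(z, e). R z e) \<in> borel_measurable (lborel \<Otimes>\<^sub>M S)"
  proof -
    have [measurable]: "(\<lambda>w. Ff u v (fst w) (snd w)) \<in> borel_measurable (lborel \<Otimes>\<^sub>M S)" for u v using jF[of u v] by (simp add: case_prod_beta')
    note [measurable] = jE fm
    show ?thesis unfolding R_eq case_prod_beta' by measurable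
  qed
  have mR: "mom_le S 1 (R z) (4 * (cmod (g z) * B z))" for z
  proof -
    have 1: "mom_le S 1 (\<lambda>e. centred (Ff u v z) e - centred (Fa u v (\<pi> (fst z)) (\<pi> (snd z))) e) (B z)" for u v
      by (rule S.mom_le_half) (use err[of u v z] in simp)
    have "mom_le S 1 (R z) (\<Sum>u\<in>(UNIV::bool set). \<Sum>v\<in>(UNIV::bool set). \<bar>gc (g z) u v\<bar> * B z)"
      unfolding R_def by (intro mom_le_sum mom_le_cmult 1) auto
    moreover have "(\<Sum>u\<in>(UNIV::bool set). \<Sum>v\<in>(UNIV::bool set). \<bar>gc (g z) u v\<bar> * B z) \<le> (\<Sum>u\<in>(UNIV::bool set). \<Sum>v\<in>(UNIV::bool set). cmod (g z) * B z)"
      by (intro sum_mono mult_right_mono abs_gc B0)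
    ultimately show ?thesis by (elim mom_le_weaken) (simp add: UNIV_bool)
  qed
  have mix: "mom_le S 1 (\<lambda>e. \<integral>z. R z e \<partial>lborel) (LINT z|lborel. 4 * (cmod (g z) * B z))"
    by (rule mom_le_mixture[OF sigma_finite_lborel _ jR mR gB]) (rule S.sigma_finite_measure_axioms)
  define c where "c = (LINT z|lborel. (\<Sum>u\<in>UNIV. \<Sum>v\<in>UNIV. gc (g z) u v * (LINT e|S. Ff u v z e)))"
  have dec: "(LINT z|lborel. R z e) = wform n A L F g e - c - dform n A' L F g \<pi> m e" for e
  proof -
    have "has_bochner_integral lborel (\<lambda>z. \<Sum>u\<in>UNIV. \<Sum>v\<in>UNIV. gc (g z) u v * Ff u v z e) (\<Sum>u\<in>UNIV. \<Sum>v\<in>UNIV. (LINT z|lborel. gc (g z) u v * Ff u v z e))"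
      by (intro has_bochner_integral_sum has_bochner_integral_integrable iF)
    note 1 = this
    have 2: "has_bochner_integral lborel (\<lambda>z. \<Sum>u\<in>UNIV. \<Sum>v\<in>UNIV. gc (g z) u v * (LINT e|S. Ff u v z e)) (\<Sum>u\<in>UNIV. \<Sum>v\<in>UNIV. (LINT z|lborel. gc (g z) u v * (LINT e|S. Ff u v z e)))"
      by (intro has_bochner_integral_sum has_bochner_integral_integrable iE)
    have 3: "has_bochner_integral lborel (\<lambda>z. \<Sum>u\<in>UNIV. \<Sum>v\<in>UNIV. \<Sum>a\<in>?\<Lambda>. \<Sum>b\<in>?\<Lambda>. (gc (g z) u v * (if \<pi> (fst z) = a \<and> \<pi> (snd z) = b then 1 else 0)) * Fa u v a b e)
        (\<Sum>u\<in>UNIV. \<Sum>v\<in>UNIV. \<Sum>a\<in>?\<Lambda>. \<Sum>b\<in>?\<Lambda>. coef g \<pi> u v a b * Fa u v a b e)"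
      unfolding coef_def by (intro has_bochner_integral_sum has_bochner_integral_mult_left has_bochner_integral_integrable iC)
    from has_bochner_integral_integral_eq[OF has_bochner_integral_diff[OF has_bochner_integral_diff[OF 1 2] 3]]
    show ?thesis
      unfolding R_eq[symmetric] dform_def Fa_def[symmetric] has_bochner_integral_integral_eq[OF 1, symmetric] has_bochner_integral_integral_eq[OF 2, symmetric]
      by (simp only: c_def wform_def Ff_def)
  qed
  have id: "integrable S (dform n A' L F g \<pi> m)" and Ed: "(LINT e|S. dform n A' L F g \<pi> m e) = 0"
  proof -
    have "\<exists>c. mom_le S 2 (Fa u v a b) c" for u v a b unfolding Fa_def by (rule avg_form_bound(2)[OF obs CL s])
    then have i: "integrable S (Fa u v a b)" for u v a b using S.mom_le_integrable(1) by blast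
    show "integrable S (dform n A' L F g \<pi> m)" "(LINT e|S. dform n A' L F g \<pi> m e) = 0"
      unfolding dform_def[abs_def] Fa_def[symmetric] using i by (simp_all add: Bochner_Integration.integral_sum mean')
  qed
  have iW: "integrable S (\<lambda>e. wform n A L F g e - c - dform n A' L F g \<pi> m e)" and
    bW: "\<bar>\<integral>e. wform n A L F g e - c - dform n A' L F g \<pi> m e \<partial>S\<bar> \<le> (LINT z|lborel. 4 * (cmod (g z) * B z))"
    using mom_le_1_integrable[OF mix] by (simp_all add: dec)
  show iw: "integrable S (wform n A L F g)"
    using Bochner_Integration.integrable_add[OF Bochner_Integration.integrable_add[OF iW id] S.integrable_const[of c]] by simp
  have "mom_le S 1 (\<lambda>e. (LINT z|lborel. R z e) - (LINT e|S. wform n A L F g e - c - dform n A' L F g \<pi> m e)) ((LINT z|lborel. 4 * (cmod (g z) * B z)) + (LINT z|lborel. 4 * (cmod (g z) * B z)))"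
    using mom_le_diff[OF mix mom_le_weaken[OF S.mom_le_const bW]] by simp
  moreover have "(LINT z|lborel. R z e) - (LINT e|S. wform n A L F g e - c - dform n A' L F g \<pi> m e) = centred (wform n A L F g) e - dform n A' L F g \<pi> m e" for e
    using iw id Ed S.prob_space by (simp add: dec centred_def)
  ultimately show "mom_le S 1 (\<lambda>e. centred (wform n A L F g) e - dform n A' L F g \<pi> m e)
     (2 * (LINT z|lborel. 4 * err_kernel (osc_const CL K) s r m \<pi> (hs n A) (hs n (\<lambda>k j. A k j - A' k j)) g z))"
    unfolding B_def[symmetric] by simp
qed

end

section \<open>Blocks and gaps\<close>

definition blk :: "nat \<Rightarrow> nat \<Rightarrow> nat \<Rightarrow> nat" where "blk l h k = (k + h) div l"

text \<open>The first \<open>m\<close> times of a block of length \<open>l\<close>. Dropping them separates the innovations used by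
  averages over \<open>m\<close> lags in different blocks. The offset \<open>h\<close> is free.\<close>
definition gap :: "nat \<Rightarrow> nat \<Rightarrow> nat \<Rightarrow> nat \<Rightarrow> bool" where "gap l m h k \<longleftrightarrow> (k + h) mod l < m"

definition blocked :: "nat \<Rightarrow> nat \<Rightarrow> nat \<Rightarrow> array \<Rightarrow> array" where
  "blocked l m h A k j = (if gap l m h k \<or> gap l m h j \<or> blk l h k = blk l h j then 0 else A k j)"

text \<open>The coordinates of the innovations at the times of block \<open>b\<close>, seen from time \<open>n\<close>.\<close>
definition coords :: "nat \<Rightarrow> nat \<Rightarrow> nat \<Rightarrow> nat \<Rightarrow> nat set" where
  "coords n l h b = {c. c \<le> n + h \<and> (n + h - c) div l = b}"

text \<open>Averaged over all offsets, the gaps carry the share \<open>m/l\<close> of the mass; some offset does not exceed the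
  average.\<close>
lemma sum_gap_le:
  fixes w :: "nat \<Rightarrow> real"
  assumes I: "finite I" and w: "\<And>k. k \<in> I \<Longrightarrow> 0 \<le> w k" and l: "0 < l"
  shows "\<exists>h<l. (\<Sum>k\<in>{k\<in>I. gap l m h k}. w k) \<le> real m / real l * (\<Sum>k\<in>I. w k)"
proof (rule ccontr)
  assume "\<not> ?thesis"
  then have big: "real m / real l * (\<Sum>k\<in>I. w k) < (\<Sum>k\<in>{k\<in>I. gap l m h k}. w k)" if "h < l" for h using that by auto
  have c: "card {h \<in> {..<l}. gap l m h k} \<le> m" for k
  proof -
    have "inj_on (\<lambda>h. (k + h) mod l) {..<l}"
    proof (rule inj_onI)
      fix x y assume *: "x \<in> {..<l}" "y \<in> {..<l}" "(k + x) mod l = (k + y) mod l"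
      have "y \<le> x" if "x \<le> y" "y < l" "(k + x) mod l = (k + y) mod l" for x y
        using that mod_eq_dvd_iff_nat[of "k + x" "k + y" l] dvd_imp_le[of l "y - x"] by force
      from this[of x y] this[of y x] show "x = y" using * by force
    qed
    then have "inj_on (\<lambda>h. (k + h) mod l) {h \<in> {..<l}. gap l m h k}" by (rule inj_on_subset) auto
    then have "card {h \<in> {..<l}. gap l m h k} \<le> card {..<m}"
      by (rule card_inj_on_le) (auto simp: gap_def)
    then show ?thesis by simp
  qed
  have "real l * (real m / real l * (\<Sum>k\<in>I. w k)) = (\<Sum>h\<in>{..<l}. real m / real l * (\<Sum>k\<in>I. w k))" by simp
  also have "\<dots> < (\<Sum>h\<in>{..<l}. \<Sum>k\<in>{k\<in>I. gap l m h k}. w k)" using big l by (intro sum_strict_mono) auto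
  also have "\<dots> = (\<Sum>h\<in>{..<l}. \<Sum>k\<in>I. if gap l m h k then w k else 0)" using I by (simp add: sum.inter_filter)
  also have "\<dots> = (\<Sum>k\<in>I. \<Sum>h\<in>{..<l}. if gap l m h k then w k else 0)" by (rule sum.swap)
  also have "\<dots> = (\<Sum>k\<in>I. real (card {h \<in> {..<l}. gap l m h k}) * w k)" by (simp add: sum.inter_filter[symmetric])
  also have "\<dots> \<le> (\<Sum>k\<in>I. real m * w k)" using c w by (intro sum_mono mult_right_mono) auto
  finally show False using l by (simp add: sum_distrib_left)
qed

lemma hs_blocked_diff:
  assumes sym: "\<And>k j. k \<in> {1..n} \<Longrightarrow> j \<in> {1..n} \<Longrightarrow> A k j = A j k"
  shows "(hs n (\<lambda>k j. A k j - blocked l m h A k j))^2 \<le> (\<Sum>k=1..n. \<Sum>j\<in>{j\<in>{1..n}. blk l h k = blk l h j}. (A k j)^2)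
     + 2 * (\<Sum>k\<in>{k\<in>{1..n}. gap l m h k}. \<Sum>j=1..n. (A k j)^2)"
proof -
  let ?I = "{1..n}"
  have "(hs n (\<lambda>k j. A k j - blocked l m h A k j))^2 = (\<Sum>k\<in>?I. \<Sum>j\<in>?I. (A k j - blocked l m h A k j)^2)"
    by (simp add: hs_def sum_nonneg)
  also have "\<dots> \<le> (\<Sum>k\<in>?I. \<Sum>j\<in>?I. (if blk l h k = blk l h j then (A k j)^2 else 0) + (if gap l m h k then (A k j)^2 else 0) + (if gap l m h j then (A k j)^2 else 0))"
    by (intro sum_mono) (auto simp: blocked_def)
  also have "\<dots> = (\<Sum>k\<in>?I. \<Sum>j\<in>?I. (if blk l h k = blk l h j then (A k j)^2 else 0)) + (\<Sum>k\<in>?I. \<Sum>j\<in>?I. (if gap l m h k then (A k j)^2 else 0))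
     + (\<Sum>k\<in>?I. \<Sum>j\<in>?I. (if gap l m h j then (A k j)^2 else 0))"
    by (simp only: sum.distrib)
  also have "(\<Sum>k\<in>?I. \<Sum>j\<in>?I. (if gap l m h j then (A k j)^2 else 0)) = (\<Sum>j\<in>?I. \<Sum>k\<in>?I. (if gap l m h j then (A j k)^2 else 0))"
    by (subst sum.swap) (intro sum.cong refl, simp add: sym)
  also have "(\<Sum>k\<in>?I. \<Sum>j\<in>?I. (if gap l m h k then (A k j)^2 else 0)) = (\<Sum>k\<in>?I. if gap l m h k then (\<Sum>j\<in>?I. (A k j)^2) else 0)"
    by (intro sum.cong refl) auto
  also have "\<dots> = (\<Sum>k\<in>{k\<in>?I. gap l m h k}. \<Sum>j\<in>?I. (A k j)^2)" by (rule sum.inter_filter[symmetric]) simp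
  also have "(\<Sum>k\<in>?I. \<Sum>j\<in>?I. (if blk l h k = blk l h j then (A k j)^2 else 0)) = (\<Sum>k\<in>?I. \<Sum>j\<in>{j\<in>?I. blk l h k = blk l h j}. (A k j)^2)"
    by (intro sum.cong refl sum.inter_filter[symmetric]) simp
  finally show ?thesis by simp
qed

lemma same_block_close:
  assumes "blk l h k = blk l h j" "0 < l" shows "\<bar>real k - real j\<bar> \<le> real l - 1"
proof -
  have *: "q * l \<le> k + h \<and> k + h < q * l + l" if "(k + h) div l = q" for k q
    using that assms(2) div_mult_mod_eq[of "k + h" l] mod_less_divisor[of l "k + h"] by (metis add_less_cancel_left le_add1)
  define q where "q = blk l h j"
  have "(k + h) div l = q" "(j + h) div l = q" using assms(1) by (simp_all add: blk_def q_def)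
  from *[OF this(1)] *[OF this(2)] have "k < j + l" "j < k + l" by linarith+
  then show ?thesis by linarith
qed

lemma card_block: assumes "0 < l" shows "card {k \<in> {1..n}. blk l h k = b} \<le> l"
proof -
  have "{k \<in> {1..n}. blk l h k = b} \<subseteq> {b * l - h..<b * l + l - h}"
  proof
    fix k assume "k \<in> {k \<in> {1..n}. blk l h k = b}"
    then have "(k + h) div l = b" by (simp add: blk_def)
    then have "b * l \<le> k + h" "k + h < b * l + l"
      using assms div_mult_mod_eq[of "k + h" l] mod_less_divisor[of l "k + h"] by (metis le_add1, metis add_less_cancel_left)
    then show "k \<in> {b * l - h..<b * l + l - h}" by auto
  qed
  then have "card {k \<in> {1..n}. blk l h k = b} \<le> card {b * l - h..<b * l + l - h}" by (rule card_mono[rotated]) simp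
  then show ?thesis by simp
qed

lemma blocked_sq_le: "(blocked l m h A k j)^2 \<le> (A k j)^2" by (simp add: blocked_def)

lemma hs_blocked_le: "hs n (blocked l m h A) \<le> hs n A"
  unfolding hs_def by (intro real_sqrt_le_mono sum_mono blocked_sq_le)

lemma coords_disjoint: "disjoint_family (coords n l h)"
  by (auto simp: disjoint_family_on_def coords_def)

context iid_law begin

lemma proc_avg_cong:
  assumes xy: "\<And>c. c \<in> coords n l h (blk l h k) \<Longrightarrow> x c = y c" and k: "k \<le> n" "\<not> gap l m h k" and l: "0 < l"
  shows "proc n (\<lambda>k. avg m (f k)) k x = proc n (\<lambda>k. avg m (f k)) k y"
proof -
  have "avg m (f k) (shift (n - k) x) = avg m (f k) (shift (n - k) y)"
  proof (rule avg_cong)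
    fix i assume i: "i < m"
    define q where "q = k + h"
    have q: "i < q mod l" using i k by (simp add: gap_def q_def)
    have q': "q mod l \<le> q" "q mod l < l" "l * (q div l) + q mod l = q" using l by (auto simp: mod_less_eq_dividend)
    have "i + (n - k) \<in> coords n l h (blk l h k)"
      unfolding coords_def blk_def
    proof (intro CollectI conjI)
      show "i + (n - k) \<le> n + h" using q q' k unfolding q_def by linarith
      have e: "n + h - (i + (n - k)) = q - i" using q q' k unfolding q_def by linarith
      have "l * (q div l) \<le> q - i" "q - i < l * Suc (q div l)" using q q' unfolding mult_Suc_right by linarith+
      then show "(n + h - (i + (n - k))) div l = (k + h) div l" unfolding e by (simp add: div_nat_eqI q_def)
    qed
    then show "shift (n - k) x i = shift (n - k) y i" unfolding shift_def by (rule xy)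
  qed
  then show ?thesis by (simp add: proc_def)
qed

lemma blocked_form_mean:
  assumes f: "\<And>k. k \<in> {1..n} \<Longrightarrow> mom_le S 4 (f k) c" and g: "\<And>k. k \<in> {1..n} \<Longrightarrow> mom_le S 4 (g k) c" and l: "0 < l"
  shows "(LINT e|S. form n (blocked l m h A) (\<lambda>k. avg m (f k)) (\<lambda>k. avg m (g k)) e) = 0"
proof -
  let ?p = "proc n (\<lambda>k. avg m (f k))" and ?q = "proc n (\<lambda>k. avg m (g k))"
  have p: "mom_le S 2 (?p k) (2 * c)" "(LINT e|S. ?p k e) = 0" if "k \<in> {1..n}" for k
    using S.mom_le_4_2[OF proc_mom[where f="\<lambda>k. avg m (f k)" and k=k, OF avg_mom[OF f[OF that]]]]
      proc_mean[where f="\<lambda>k. avg m (f k)" and k=k, OF avg_mom[OF f[OF that]]] by simp_all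
  have q: "mom_le S 2 (?q k) (2 * c)" if "k \<in> {1..n}" for k
    using S.mom_le_4_2[OF proc_mom[where f="\<lambda>k. avg m (g k)" and k=k, OF avg_mom[OF g[OF that]]]] by simp
  have i: "integrable S (\<lambda>e. blocked l m h A k j * ?p k e * ?q j e)" if "k \<in> {1..n}" "j \<in> {1..n}" for k j
    unfolding mult.assoc by (intro integrable_mult_right mom_le_mult_integrable(1)[OF p(1)[OF that(1)] q[OF that(2)]])
  have z: "(LINT e|S. blocked l m h A k j * ?p k e * ?q j e) = 0" if k: "k \<in> {1..n}" and j: "j \<in> {1..n}" for k j
  proof (cases "gap l m h k \<or> gap l m h j \<or> blk l h k = blk l h j")
    case True then show ?thesis by (simp add: blocked_def)
  next
    case False
    have "(LINT e|S. ?p k e * ?q j e) = (LINT e|S. ?p k e) * (LINT e|S. ?q j e)"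
    proof (rule indep_product_zero[OF _ p(1)[OF k] q[OF j]])
      show "coords n l h (blk l h k) \<inter> coords n l h (blk l h j) = {}" using False by (auto simp: coords_def)
      show "?p k x = ?p k y" if "\<And>c. c \<in> coords n l h (blk l h k) \<Longrightarrow> x c = y c" for x y
        by (rule proc_avg_cong[OF that _ _ l]) (use k False in auto)
      show "?q j x = ?q j y" if "\<And>c. c \<in> coords n l h (blk l h j) \<Longrightarrow> x c = y c" for x y
        by (rule proc_avg_cong[OF that _ _ l]) (use j False in auto)
    qed
    then show ?thesis by (simp add: mult.assoc p(2)[OF k])
  qed
  have "(LINT e|S. form n (blocked l m h A) (\<lambda>k. avg m (f k)) (\<lambda>k. avg m (g k)) e)
      = (\<Sum>k=1..n. (LINT e|S. (\<Sum>j=1..n. blocked l m h A k j * ?p k e * ?q j e)))"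
    unfolding form_def by (rule Bochner_Integration.integral_sum) (intro Bochner_Integration.integrable_sum i)
  also have "\<dots> = (\<Sum>k=1..n. \<Sum>j=1..n. (LINT e|S. blocked l m h A k j * ?p k e * ?q j e))"
    by (intro sum.cong refl Bochner_Integration.integral_sum i)
  also have "\<dots> = 0" by (intro sum.neutral ballI z)
  finally show ?thesis .
qed

text \<open>The triples of a time, a phase and a rounded frequency index the variables of one quadratic form in
  independent blocks, whose matrix entries are weights times coefficients.\<close>
theorem dform_chaos:
  fixes F :: "nat \<Rightarrow> statistic" and A :: "array" and g :: "real \<times> real \<Rightarrow> complex" and \<pi> :: "real \<Rightarrow> real" and L :: "real \<Rightarrow> real" and n l m h :: nat
  assumes obs: "\<And>k. k \<in> {1..n} \<Longrightarrow> good_obs L dL CL K \<rho> (F k)" and K: "0 \<le> K" and l: "0 < l"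
    and \<pi>: "finite (range \<pi>)" and e: "0 < e"
    and rows: "\<And>k. k \<in> {1..n} \<Longrightarrow> (\<Sum>j=1..n. (A k j)^2) \<le> V^2" and columns: "\<And>k. k \<in> {1..n} \<Longrightarrow> (\<Sum>j=1..n. (A j k)^2) \<le> V^2"
  defines "cf \<equiv> (\<Sum>u\<in>UNIV. \<Sum>v\<in>UNIV. \<Sum>a\<in>range \<pi>. \<Sum>b\<in>range \<pi>. (coef g \<pi> u v a b)^2)"
  defines "D \<equiv> dform n (blocked l m h A) L F g \<pi> m"
  shows "\<exists>p \<alpha>. 2 * (\<Sum>i<p. (\<alpha> i)^2) \<le> (LINT x|S. (D x)^2) \<and>
    (\<forall>t. cmod (chf S D t - chf gauss_seq (chaos p \<alpha>) t)
       \<le> abs t ^ 3 * (3 * (4 * (2 * K)) ^ 6 * real (2 * l * card (range \<pi>)) ^ 4 * sqrt (4 * (V^2 * cf)) * (4 * ((hs n A)^2 * cf))) + abs t * e)"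
proof -
  let ?\<Lambda> = "range \<pi>"
  define Ix where "Ix = {1..n} \<times> (UNIV :: bool set) \<times> ?\<Lambda>"
  have fin: "finite Ix" using \<pi> by (simp add: Ix_def)
  define p where "p = card Ix"
  obtain \<phi> where bij: "bij_betw \<phi> {..<p} Ix" using ex_bij_betw_nat_finite[OF fin] by (auto simp: p_def atLeast0LessThan)
  have in_Ix: "\<phi> i \<in> Ix" if "i < p" for i using bij that by (auto simp: bij_betw_def)
  define bl where "bl i = blk l h (fst (\<phi> i))" for i
  define YY where "YY x e = (if gap l m h (fst x) then 0 else proc n (\<lambda>k. avg m (osc L (ph (fst (snd x))) (snd (snd x)) (F k))) (fst x) e)" for x :: "nat \<times> bool \<times> real" and e
  define BB where "BB x y = blocked l m h A (fst x) (fst y) * coef g \<pi> (fst (snd x)) (fst (snd y)) (snd (snd x)) (snd (snd y))" for x y :: "nat \<times> bool \<times> real"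
  define B where "B i j = BB (\<phi> i) (\<phi> j)" for i j
  have reindex: "(\<Sum>i<p. f (\<phi> i)) = (\<Sum>x\<in>Ix. f x)" for f :: "_ \<Rightarrow> real" by (rule sum.reindex_bij_betw[OF bij])
  have D_eq: "D e = (\<Sum>i<p. \<Sum>j<p. B i j * (YY (\<phi> i) e * YY (\<phi> j) e))" for e
  proof -
    have "(\<Sum>i<p. \<Sum>j<p. B i j * (YY (\<phi> i) e * YY (\<phi> j) e)) = (\<Sum>i<p. \<Sum>y\<in>Ix. BB (\<phi> i) y * (YY (\<phi> i) e * YY y e))"
      unfolding B_def by (intro sum.cong refl reindex)
    also have "\<dots> = (\<Sum>x\<in>Ix. \<Sum>y\<in>Ix. BB x y * (YY x e * YY y e))" by (rule reindex)
    also have "\<dots> = (\<Sum>w\<in>Ix \<times> Ix. BB (fst w) (snd w) * (YY (fst w) e * YY (snd w) e))" by (simp add: sum.cartesian_product case_prod_beta')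
    also have "\<dots> = (\<Sum>w\<in>UNIV \<times> UNIV \<times> ?\<Lambda> \<times> ?\<Lambda> \<times> {1..n} \<times> {1..n}. (\<lambda>(u, v, a, b, k, j). coef g \<pi> u v a b * (blocked l m h A k j * proc n (\<lambda>k. avg m (osc L (ph u) a (F k))) k e * proc n (\<lambda>k. avg m (osc L (ph v) b (F k))) j e)) w)"
      by (rule sum.reindex_bij_witness[where i="\<lambda>(u, v, a, b, k, j). ((k, u, a), (j, v, b))" and j="\<lambda>((k, u, a), (j, v, b)). (u, v, a, b, k, j)"])
         (auto simp: Ix_def BB_def YY_def blocked_def)
    also have "\<dots> = D e"
      unfolding D_def dform_def form_def sum.cartesian_product sum_distrib_left by (simp add: case_prod_beta')
    finally show ?thesis ..
  qed
  have Om: "mom_le S 4 (osc L q a (F k)) K" if "k \<in> {1..n}" for k q a by (rule osc_basic(2)[OF obs[OF that]])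
  have Ym: "mom_le S 4 (YY x) (2 * K)" "(LINT e|S. YY x e) = 0" if "x \<in> Ix" for x
  proof -
    have k: "fst x \<in> {1..n}" using that by (auto simp: Ix_def)
    note m = avg_mom[OF Om[OF k]]
    show "mom_le S 4 (YY x) (2 * K)"
    proof (cases "gap l m h (fst x)")
      case True
      then have "YY x = (\<lambda>_. 0)" by (auto simp: YY_def)
      then show ?thesis using mom_le_weaken[OF S.mom_le_const[of 4 0]] K by simp
    next
      case False
      then show ?thesis using proc_mom[where f="\<lambda>k. avg m (osc L (ph (fst (snd x))) (snd (snd x)) (F k))" and k="fst x", OF m]
        by (simp add: YY_def[abs_def])
    qed
    show "(LINT e|S. YY x e) = 0"
      using proc_mean[where f="\<lambda>k. avg m (osc L (ph (fst (snd x))) (snd (snd x)) (F k))" and k="fst x", OF m]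
      by (cases "gap l m h (fst x)") (simp_all add: YY_def)
  qed
  have ind: "S.indep_vars (\<lambda>_. vec_borel) (\<lambda>b x i. if i < p \<and> bl i = b then YY (\<phi> i) x else 0) (UNIV :: nat set)"
  proof (rule block_vectors_indep[where C="coords n l h"])
    show "YY (\<phi> i) \<in> borel_measurable S" if "i < p" for i using Ym(1)[OF in_Ix[OF that]] by (simp add: mom_le_def)
    show "YY (\<phi> i) x = YY (\<phi> i) y" if "i < p" "\<And>k. k \<in> coords n l h (bl i) \<Longrightarrow> x k = y k" for i x y
    proof (cases "gap l m h (fst (\<phi> i))")
      case False
      have "fst (\<phi> i) \<le> n" using in_Ix[OF that(1)] by (auto simp: Ix_def)
      then show ?thesis using proc_avg_cong[OF that(2)[unfolded bl_def] _ False l] False by (simp add: YY_def)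
    qed (simp add: YY_def)
    show "prob_space \<mu>" by (rule prob_space_axioms)
    show "sets \<mu> = sets borel" by (rule sets_law)
  qed (rule coords_disjoint)
  have cfp: "(\<Sum>v\<in>UNIV. \<Sum>b\<in>?\<Lambda>. (coef g \<pi> u v a b)^2) \<le> cf" "(\<Sum>v\<in>UNIV. \<Sum>b\<in>?\<Lambda>. (coef g \<pi> v u b a)^2) \<le> cf" if a: "a \<in> ?\<Lambda>" for u a
  proof -
    have "(\<Sum>v\<in>UNIV. \<Sum>b\<in>?\<Lambda>. (coef g \<pi> u v a b)^2) \<le> (\<Sum>v\<in>UNIV. \<Sum>a\<in>?\<Lambda>. \<Sum>b\<in>?\<Lambda>. (coef g \<pi> u v a b)^2)"
      by (intro sum_mono member_le_sum[where f="\<lambda>a. \<Sum>b\<in>?\<Lambda>. (coef g \<pi> u _ a b)^2"] a \<pi> sum_nonneg) auto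
    also have "\<dots> \<le> cf" unfolding cf_def
      by (rule member_le_sum[where f="\<lambda>u. \<Sum>v\<in>UNIV. \<Sum>a\<in>?\<Lambda>. \<Sum>b\<in>?\<Lambda>. (coef g \<pi> u v a b)^2"]) (auto intro!: sum_nonneg)
    finally show "(\<Sum>v\<in>UNIV. \<Sum>b\<in>?\<Lambda>. (coef g \<pi> u v a b)^2) \<le> cf" .
    have "(\<Sum>v\<in>UNIV. \<Sum>b\<in>?\<Lambda>. (coef g \<pi> v u b a)^2) \<le> (\<Sum>v\<in>UNIV. \<Sum>w\<in>UNIV. \<Sum>b\<in>?\<Lambda>. \<Sum>c\<in>?\<Lambda>. (coef g \<pi> v w b c)^2)"
    proof (rule sum_mono)
      fix v
      have "(\<Sum>b\<in>?\<Lambda>. (coef g \<pi> v u b a)^2) \<le> (\<Sum>b\<in>?\<Lambda>. \<Sum>c\<in>?\<Lambda>. (coef g \<pi> v u b c)^2)"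
        by (intro sum_mono member_le_sum[OF a]) (use \<pi> in auto)
      also have "\<dots> \<le> (\<Sum>w\<in>UNIV. \<Sum>b\<in>?\<Lambda>. \<Sum>c\<in>?\<Lambda>. (coef g \<pi> v w b c)^2)"
        by (rule member_le_sum[where f="\<lambda>w. \<Sum>b\<in>?\<Lambda>. \<Sum>c\<in>?\<Lambda>. (coef g \<pi> v w b c)^2"]) (auto intro!: sum_nonneg)
      finally show "(\<Sum>b\<in>?\<Lambda>. (coef g \<pi> v u b a)^2) \<le> (\<Sum>w\<in>UNIV. \<Sum>b\<in>?\<Lambda>. \<Sum>c\<in>?\<Lambda>. (coef g \<pi> v w b c)^2)" .
    qed
    then show "(\<Sum>v\<in>UNIV. \<Sum>b\<in>?\<Lambda>. (coef g \<pi> v u b a)^2) \<le> cf" by (simp add: cf_def)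
  qed
  have cf0: "0 \<le> cf" by (auto simp: cf_def intro!: sum_nonneg)
  have expand: "(\<Sum>y\<in>Ix. (f (fst y) * h (fst (snd y)) (snd (snd y)))^2) = (\<Sum>k=1..n. (f k)^2) * (\<Sum>v\<in>UNIV. \<Sum>b\<in>?\<Lambda>. (h v b)^2)" for f :: "nat \<Rightarrow> real" and h
  proof -
    have "(\<Sum>y\<in>Ix. (f (fst y) * h (fst (snd y)) (snd (snd y)))^2) = (\<Sum>k=1..n. \<Sum>w\<in>UNIV \<times> ?\<Lambda>. (f k)^2 * (h (fst w) (snd w))^2)"
      unfolding Ix_def sum.cartesian_product by (simp add: case_prod_beta' power_mult_distrib)
    also have "\<dots> = (\<Sum>k=1..n. (f k)^2) * (\<Sum>w\<in>UNIV \<times> ?\<Lambda>. (h (fst w) (snd w))^2)" by (rule sum_product[symmetric])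
    finally show ?thesis by (simp add: sum.cartesian_product case_prod_beta')
  qed
  have row: "(\<Sum>y\<in>Ix. (BB x y)^2) \<le> (\<Sum>j=1..n. (A (fst x) j)^2) * cf" "(\<Sum>y\<in>Ix. (BB y x)^2) \<le> V^2 * cf" if x: "x \<in> Ix" for x
  proof -
    have a: "snd (snd x) \<in> ?\<Lambda>" and k: "fst x \<in> {1..n}" using x by (auto simp: Ix_def)
    show "(\<Sum>y\<in>Ix. (BB x y)^2) \<le> (\<Sum>j=1..n. (A (fst x) j)^2) * cf"
      unfolding BB_def expand[of "\<lambda>j. blocked l m h A (fst x) j" "\<lambda>v b. coef g \<pi> (fst (snd x)) v (snd (snd x)) b"]
      by (intro mult_mono cfp a sum_mono blocked_sq_le sum_nonneg) auto
    have "(\<Sum>j=1..n. (blocked l m h A j (fst x))^2) \<le> V^2"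
      by (rule order_trans[OF _ columns[OF k]]) (intro sum_mono blocked_sq_le)
    then show "(\<Sum>y\<in>Ix. (BB y x)^2) \<le> V^2 * cf"
      unfolding BB_def expand[of "\<lambda>j. blocked l m h A j (fst x)" "\<lambda>v b. coef g \<pi> v (fst (snd x)) b (snd (snd x))"] by (intro mult_mono cfp a) (auto intro!: sum_nonneg)
  qed
  have sq2: "(s + t)^2 \<le> 2 * s^2 + 2 * t^2" for s t :: real using zero_le_power2[of "s - t"] by (simp add: power2_eq_square algebra_simps)
  have \<tau>: "(\<Sum>j<p. (B i j + B j i)^2) \<le> 4 * (V^2 * cf)" if "i < p" for i
  proof -
    have "(\<Sum>j<p. (B i j + B j i)^2) = (\<Sum>y\<in>Ix. (BB (\<phi> i) y + BB y (\<phi> i))^2)" unfolding B_def by (rule reindex)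
    also have "\<dots> \<le> (\<Sum>y\<in>Ix. 2 * (BB (\<phi> i) y)^2 + 2 * (BB y (\<phi> i))^2)" by (intro sum_mono sq2)
    also have "\<dots> = 2 * (\<Sum>y\<in>Ix. (BB (\<phi> i) y)^2) + 2 * (\<Sum>y\<in>Ix. (BB y (\<phi> i))^2)" by (simp add: sum.distrib sum_distrib_left)
    finally show ?thesis using row[OF in_Ix[OF that]] mult_right_mono[OF rows cf0, of "fst (\<phi> i)"] in_Ix[OF that] by (fastforce simp: Ix_def)
  qed
  have tot: "(\<Sum>i<p. \<Sum>j<p. (B i j + B j i)^2) \<le> 4 * ((hs n A)^2 * cf)"
  proof -
    have b2: "(\<Sum>i<p. \<Sum>j<p. (B i j)^2) \<le> (hs n A)^2 * cf"
    proof -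
      have "(\<Sum>i<p. \<Sum>j<p. (B i j)^2) = (\<Sum>i<p. \<Sum>y\<in>Ix. (BB (\<phi> i) y)^2)" unfolding B_def by (intro sum.cong refl reindex)
      also have "\<dots> = (\<Sum>x\<in>Ix. \<Sum>y\<in>Ix. (BB x y)^2)" by (rule reindex)
      also have "\<dots> = (\<Sum>x\<in>Ix. (\<Sum>j=1..n. (blocked l m h A (fst x) j)^2) * (\<Sum>v\<in>UNIV. \<Sum>b\<in>?\<Lambda>. (coef g \<pi> (fst (snd x)) v (snd (snd x)) b)^2))"
        unfolding BB_def by (intro sum.cong refl expand)
      also have "\<dots> = (\<Sum>k=1..n. \<Sum>w\<in>UNIV \<times> ?\<Lambda>. (\<Sum>j=1..n. (blocked l m h A k j)^2) * (\<Sum>v\<in>UNIV. \<Sum>b\<in>?\<Lambda>. (coef g \<pi> (fst w) v (snd w) b)^2))"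
        unfolding Ix_def sum.cartesian_product[of _ "UNIV \<times> ?\<Lambda>"] by (simp add: case_prod_beta')
      also have "\<dots> = (\<Sum>k=1..n. \<Sum>j=1..n. (blocked l m h A k j)^2) * (\<Sum>w\<in>UNIV \<times> ?\<Lambda>. \<Sum>v\<in>UNIV. \<Sum>b\<in>?\<Lambda>. (coef g \<pi> (fst w) v (snd w) b)^2)"
        by (rule sum_product[symmetric])
      also have "(\<Sum>w\<in>UNIV \<times> ?\<Lambda>. \<Sum>v\<in>UNIV. \<Sum>b\<in>?\<Lambda>. (coef g \<pi> (fst w) v (snd w) b)^2) = (\<Sum>u\<in>UNIV. \<Sum>a\<in>?\<Lambda>. \<Sum>v\<in>UNIV. \<Sum>b\<in>?\<Lambda>. (coef g \<pi> u v a b)^2)"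
        by (simp add: sum.cartesian_product[of _ ?\<Lambda> UNIV] case_prod_beta')
      also have "\<dots> = cf" unfolding cf_def by (intro sum.cong refl sum.swap)
      also have "(\<Sum>k=1..n. \<Sum>j=1..n. (blocked l m h A k j)^2) * cf \<le> (hs n A)^2 * cf"
        using cf0 unfolding hs_def by (intro mult_right_mono) (auto simp: sum_nonneg intro!: sum_mono blocked_sq_le)
      finally show ?thesis .
    qed
    have "(\<Sum>i<p. \<Sum>j<p. (B i j + B j i)^2) \<le> (\<Sum>i<p. \<Sum>j<p. 2 * (B i j)^2 + 2 * (B j i)^2)" by (intro sum_mono sq2)
    also have "\<dots> = 2 * (\<Sum>i<p. \<Sum>j<p. (B i j)^2) + 2 * (\<Sum>i<p. \<Sum>j<p. (B j i)^2)" by (simp add: sum.distrib sum_distrib_left)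
    also have "(\<Sum>i<p. \<Sum>j<p. (B j i)^2) = (\<Sum>i<p. \<Sum>j<p. (B i j)^2)" by (rule sum.swap)
    finally show ?thesis using b2 by simp
  qed
  have blocks: "card {i. i < p \<and> bl i = b} \<le> 2 * l * card ?\<Lambda>" for b
  proof -
    have "card {i. i < p \<and> bl i = b} = card (\<phi> ` {i. i < p \<and> bl i = b})"
      by (rule card_image[symmetric]) (rule inj_on_subset[OF bij_betw_imp_inj_on[OF bij]], auto)
    also have "\<dots> \<le> card ({k \<in> {1..n}. blk l h k = b} \<times> (UNIV :: bool set) \<times> ?\<Lambda>)"
    proof (rule card_mono)
      show "\<phi> ` {i. i < p \<and> bl i = b} \<subseteq> {k \<in> {1..n}. blk l h k = b} \<times> UNIV \<times> ?\<Lambda>"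
      proof
        fix x assume "x \<in> \<phi> ` {i. i < p \<and> bl i = b}"
        then obtain i where "i < p" "bl i = b" "x = \<phi> i" by auto
        then show "x \<in> {k \<in> {1..n}. blk l h k = b} \<times> UNIV \<times> ?\<Lambda>" using in_Ix[of i] by (auto simp: Ix_def bl_def)
      qed
    qed (use \<pi> in auto)
    also have "\<dots> \<le> l * (2 * card ?\<Lambda>)" using card_block[OF l, of n h b] by (simp add: card_cartesian_product)
    finally show ?thesis by (simp add: mult_ac)
  qed
  have "\<exists>\<alpha>. 2 * (\<Sum>i<p. (\<alpha> i)^2) \<le> (LINT x|S. (\<Sum>i<p. \<Sum>j<p. B i j * (YY (\<phi> i) x * YY (\<phi> j) x))^2) \<and>
    (\<forall>t. cmod ((LINT x|S. iexp (t * (\<Sum>i<p. \<Sum>j<p. B i j * (YY (\<phi> i) x * YY (\<phi> j) x)))) - (chf gauss_seq (chaos p \<alpha>) t))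
       \<le> abs t ^ 3 * (3 * (4 * (2 * K)) ^ 6 * real (2 * l * card ?\<Lambda>) ^ 4 * sqrt (4 * (V^2 * cf)) * (\<Sum>i<p. \<Sum>j<p. (B i j + B j i)^2)) + abs t * e)"
    unfolding of_nat_power[symmetric]
  proof (rule chaos_approx[OF S.prob_space_axioms ind])
    show "mom_le S 4 (YY (\<phi> i)) (2 * K)" "(LINT x|S. YY (\<phi> i) x) = 0" if "i < p" for i using Ym[OF in_Ix[OF that]] by auto
    show "B i j = 0" if "bl i = bl j" for i j using that by (simp add: B_def BB_def blocked_def bl_def)
  qed (use K blocks \<tau> e cf0 in auto)
  then obtain \<alpha> where a: "2 * (\<Sum>i<p. (\<alpha> i)^2) \<le> (LINT x|S. (D x)^2)"
    "\<And>t. cmod (chf S D t - chf gauss_seq (chaos p \<alpha>) t)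
       \<le> abs t ^ 3 * (3 * (4 * (2 * K)) ^ 6 * real (2 * l * card ?\<Lambda>) ^ 4 * sqrt (4 * (V^2 * cf)) * (\<Sum>i<p. \<Sum>j<p. (B i j + B j i)^2)) + abs t * e"
    unfolding D_eq[symmetric] by blast
  have "abs t ^ 3 * (3 * (4 * (2 * K)) ^ 6 * real (2 * l * card ?\<Lambda>) ^ 4 * sqrt (4 * (V^2 * cf)) * (\<Sum>i<p. \<Sum>j<p. (B i j + B j i)^2))
     \<le> abs t ^ 3 * (3 * (4 * (2 * K)) ^ 6 * real (2 * l * card ?\<Lambda>) ^ 4 * sqrt (4 * (V^2 * cf)) * (4 * ((hs n A)^2 * cf)))" for t
    using K cf0 by (intro mult_left_mono tot) auto
  from order_trans[OF a(2) add_right_mono[OF this]] show ?thesis using a(1) by (intro exI[of _ p] exI[of _ \<alpha>] conjI allI)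
qed

end

section \<open>Rounding of frequencies and vanishing weights\<close>

text \<open>Rounds towards zero, which keeps \<open>|rnd N x| \<le> |x|\<close>, and cuts off at \<open>N\<close>, which keeps the range finite.\<close>
definition rnd :: "nat \<Rightarrow> real \<Rightarrow> real" where
  "rnd N x = (if \<bar>x\<bar> \<le> real N then (if x < 0 then - 1 else 1) * (of_int \<lfloor>\<bar>x\<bar> * real N\<rfloor> / real N) else 0)"

lemma rnd_measurable: "rnd N \<in> borel_measurable borel"
  unfolding rnd_def[abs_def] by measurable

lemma rnd_abs_le: "\<bar>rnd N x\<bar> \<le> \<bar>x\<bar>"
proof (cases "N = 0")
  case False
  have "of_int \<lfloor>\<bar>x\<bar> * real N\<rfloor> / real N \<le> \<bar>x\<bar>" using False of_int_floor_le[of "\<bar>x\<bar> * real N"] by (simp add: field_simps)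
  then show ?thesis by (auto simp: rnd_def abs_mult)
qed (simp add: rnd_def)

lemma finite_range_rnd: "finite (range (rnd N))"
proof -
  let ?f = "\<lambda>(\<sigma>, i). \<sigma> * (of_int i / real N)"
  have "range (rnd N) \<subseteq> ?f ` ({-1, 1} \<times> {0..int (N * N)})"
  proof (rule image_subsetI)
    fix x
    show "rnd N x \<in> ?f ` ({-1, 1} \<times> {0..int (N * N)})"
    proof (cases "\<bar>x\<bar> \<le> real N")
      case True
      have "\<lfloor>\<bar>x\<bar> * real N\<rfloor> \<le> \<lfloor>real N * real N\<rfloor>" using True by (intro floor_mono mult_right_mono) auto
      also have "\<lfloor>real N * real N\<rfloor> = int (N * N)" by (simp only: of_nat_mult[symmetric] floor_of_nat)
      finally show ?thesis
        using True by (intro image_eqI[of _ _ "(if x < 0 then - 1 else 1, \<lfloor>\<bar>x\<bar> * real N\<rfloor>)"]) (auto simp: rnd_def)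
    qed (auto simp: rnd_def intro!: image_eqI[of _ _ "(1, 0)"])
  qed
  then show ?thesis by (rule finite_subset) simp
qed

lemma rnd_tendsto: "(\<lambda>N. rnd N x) \<longlonglongrightarrow> x"
proof (rule LIM_zero_cancel, rule Lim_null_comparison)
  show "\<forall>\<^sub>F N in sequentially. norm (rnd N x - x) \<le> 1 / real N"
    using eventually_ge_at_top[of "Suc (nat \<lceil>\<bar>x\<bar>\<rceil>)"]
  proof eventually_elim
    case (elim N)
    then have N: "\<bar>x\<bar> \<le> real N" "0 < N" by linarith+
    have "rnd N x - x = (if x < 0 then - 1 else 1) * (of_int \<lfloor>\<bar>x\<bar> * real N\<rfloor> / real N - \<bar>x\<bar>)"
      using N by (auto simp: rnd_def)
    then have "norm (rnd N x - x) = \<bar>of_int \<lfloor>\<bar>x\<bar> * real N\<rfloor> / real N - \<bar>x\<bar>\<bar>" by (simp add: abs_mult)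
    also have "of_int \<lfloor>\<bar>x\<bar> * real N\<rfloor> / real N - \<bar>x\<bar> = (of_int \<lfloor>\<bar>x\<bar> * real N\<rfloor> - \<bar>x\<bar> * real N) / real N" using N by (simp add: field_simps)
    also have "\<bar>\<dots>\<bar> \<le> 1 / real N" unfolding abs_divide using N by (intro divide_mono) (auto, linarith)
    finally show ?case .
  qed
  show "(\<lambda>N. 1 / real N) \<longlonglongrightarrow> 0" by (rule lim_1_over_n)
qed

lemma rounding_error_tendsto:
  fixes G :: "real \<times> real \<Rightarrow> real"
  assumes G: "integrable lborel G"
  shows "(\<lambda>N. \<integral>z. G z * (min 1 (sqrt \<bar>fst z - rnd N (fst z)\<bar>) + min 1 (sqrt \<bar>snd z - rnd N (snd z)\<bar>)) \<partial>lborel) \<longlonglongrightarrow> 0"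
    and "integrable lborel (\<lambda>z. G z * (min 1 (sqrt \<bar>fst z - rnd N (fst z)\<bar>) + min 1 (sqrt \<bar>snd z - rnd N (snd z)\<bar>)))"
proof -
  note [measurable] = rnd_measurable
  have [measurable]: "G \<in> borel_measurable lborel" using G by simp
  let ?f = "\<lambda>N z. G z * (min 1 (sqrt \<bar>fst z - rnd N (fst z)\<bar>) + min 1 (sqrt \<bar>snd z - rnd N (snd z)\<bar>))"
  have b: "norm (?f N z) \<le> 2 * \<bar>G z\<bar>" for N z
  proof -
    have "norm (?f N z) = \<bar>G z\<bar> * (min 1 (sqrt \<bar>fst z - rnd N (fst z)\<bar>) + min 1 (sqrt \<bar>snd z - rnd N (snd z)\<bar>))"
      unfolding real_norm_def abs_mult by (simp add: abs_of_nonneg)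
    also have "\<dots> \<le> \<bar>G z\<bar> * (1 + 1)" by (intro mult_left_mono add_mono) auto
    finally show ?thesis by simp
  qed
  have i: "integrable lborel (\<lambda>z. 2 * \<bar>G z\<bar>)" using G by simp
  have m: "?f N \<in> borel_measurable lborel" for N by measurable
  show "integrable lborel (?f N)"
    by (rule Bochner_Integration.integrable_bound[OF i m AE_I2]) (use b in simp)
  have "(\<lambda>N. integral\<^sup>L lborel (?f N)) \<longlonglongrightarrow> integral\<^sup>L lborel (\<lambda>z :: real \<times> real. 0 :: real)"
  proof (rule integral_dominated_convergence[where s="?f" and w="\<lambda>z. 2 * \<bar>G z\<bar>"])
    show "AE z in lborel. (\<lambda>N. ?f N z) \<longlonglongrightarrow> 0"
    proof (rule AE_I2)
      fix z :: "real \<times> real"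
      have "(\<lambda>N. ?f N z) \<longlonglongrightarrow> G z * (min 1 (sqrt \<bar>fst z - fst z\<bar>) + min 1 (sqrt \<bar>snd z - snd z\<bar>))"
        by (intro tendsto_intros rnd_tendsto)
      then show "(\<lambda>N. ?f N z) \<longlonglongrightarrow> 0" by simp
    qed
    show "AE z in lborel. norm (?f N z) \<le> 2 * \<bar>G z\<bar>" for N using b by simp
    show "?f N \<in> borel_measurable lborel" for N by (rule m)
    show "integrable lborel (\<lambda>z. 2 * \<bar>G z\<bar>)" by (rule i)
  qed simp
  then show "(\<lambda>N. integral\<^sup>L lborel (?f N)) \<longlonglongrightarrow> 0" by simp
qed

text \<open>For each \<open>n\<close> take a witness for the best accuracy \<open>1/(k+1)\<close> with \<open>k \<le> n\<close> that can be met.\<close>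
lemma diagonal_choice:
  assumes ev: "\<And>\<delta>. \<delta> > (0::real) \<Longrightarrow> \<forall>\<^sub>F n in sequentially. \<exists>x. P x \<and> R n x \<delta>"
    and mono: "\<And>n x \<delta> \<delta>'. R n x \<delta> \<Longrightarrow> \<delta> \<le> \<delta>' \<Longrightarrow> R n x \<delta>'" and x0: "P x0"
  shows "\<exists>X. (\<forall>n. P (X n)) \<and> (\<forall>\<delta>>0. \<forall>\<^sub>F n in sequentially. R n (X n) \<delta>)"
proof -
  define U where "U n = {k. k \<le> n \<and> (\<exists>x. P x \<and> R n x (1 / real (Suc k)))}" for n
  have fin: "finite (U n)" for n by (rule finite_subset[of _ "{..n}"]) (auto simp: U_def)
  have "\<exists>x. P x \<and> (U n \<noteq> {} \<longrightarrow> R n x (1 / real (Suc (Max (U n)))))" for n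
    using Max_in[OF fin, of n] x0 by (cases "U n = {}") (auto simp: U_def)
  then obtain X where X: "\<And>n. P (X n)" "\<And>n. U n \<noteq> {} \<Longrightarrow> R n (X n) (1 / real (Suc (Max (U n))))" by metis
  have "\<forall>\<^sub>F n in sequentially. R n (X n) \<delta>" if d: "\<delta> > 0" for \<delta>
  proof -
    obtain k where k: "1 / real (Suc k) < \<delta>" using d nat_approx_posE[of \<delta>] by auto
    show ?thesis using ev[of "1 / real (Suc k)", simplified] eventually_ge_at_top[of k]
    proof eventually_elim
      case (elim n)
      then have kU: "k \<in> U n" by (simp add: U_def)
      then have "k \<le> Max (U n)" by (rule Max_ge[OF fin])
      then have "1 / real (Suc (Max (U n))) \<le> 1 / real (Suc k)" by (simp add: field_simps)
      then show ?case using X(2)[of n] kU k mono[of n "X n" _ \<delta>] by force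
    qed
  qed
  then show ?thesis using X(1) by blast
qed

text \<open>Triangle inequality along the rows from \<open>k\<close> to \<open>n\<close>.\<close>
lemma row_le_variation:
  fixes A :: "array"
  assumes "k \<in> {1..n}"
  shows "sqrt (\<Sum>j=1..n. (A k j)^2) \<le> (\<Sum>i=1..n - 1. sqrt (\<Sum>j=1..n. (A i j - A (i + 1) j)^2)) + sqrt (\<Sum>j=1..n. (A n j)^2)"
proof -
  have tri: "sqrt (\<Sum>j\<in>I. (f j)^2) \<le> sqrt (\<Sum>j\<in>I. (f j - g j)^2) + sqrt (\<Sum>j\<in>I. (g j)^2)" for f g :: "nat \<Rightarrow> real" and I
    using L2_set_triangle_ineq[of "\<lambda>j. f j - g j" g I] by (simp add: L2_set_def)
  have "sqrt (\<Sum>j=1..n. (A k j)^2) \<le> (\<Sum>i=k..<n. sqrt (\<Sum>j=1..n. (A i j - A (i + 1) j)^2)) + sqrt (\<Sum>j=1..n. (A n j)^2)" if "k \<le> n" for k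
    using that
  proof (induction rule: inc_induct)
    case (step i)
    have "(\<Sum>i=i..<n. sqrt (\<Sum>j=1..n. (A i j - A (i + 1) j)^2)) = sqrt (\<Sum>j=1..n. (A i j - A (i + 1) j)^2) + (\<Sum>i=Suc i..<n. sqrt (\<Sum>j=1..n. (A i j - A (i + 1) j)^2))"
      using step by (intro sum.atLeast_Suc_lessThan) auto
    then show ?case using tri[of "A i" "{1..n}" "A (i + 1)"] step.IH by simp
  qed simp
  from this[of k] have "sqrt (\<Sum>j=1..n. (A k j)^2) \<le> (\<Sum>i=k..<n. sqrt (\<Sum>j=1..n. (A i j - A (i + 1) j)^2)) + sqrt (\<Sum>j=1..n. (A n j)^2)"
    using assms by simp
  moreover have "(\<Sum>i=k..<n. sqrt (\<Sum>j=1..n. (A i j - A (i + 1) j)^2)) \<le> (\<Sum>i=1..n - 1. sqrt (\<Sum>j=1..n. (A i j - A (i + 1) j)^2))"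
    by (rule sum_mono2) (use assms in \<open>auto simp: sum_nonneg\<close>)
  ultimately show ?thesis by linarith
qed

text \<open>Averaging \<open>A\<^sub>j\<^sub>j\<^sup>2\<close> over a window of at least \<open>q\<close> neighbours shows that \<open>q\<close> times the diagonal mass is bounded, so
  the diagonal mass vanishes; entries near the diagonal differ little from it.\<close>
lemma near_diagonal_small:
  fixes A :: "nat \<Rightarrow> array" and w :: "nat \<Rightarrow> real"
  assumes C0: "\<And>n. n \<ge> 1 \<Longrightarrow> (\<Sum>k=1..n. \<Sum>j=1..n. (A n k j)^2) \<le> C0"
    and w: "filterlim w at_top sequentially"
    and diag: "(\<lambda>n. \<Sum>j=1..n. sqrt (\<Sum>k\<in>{k\<in>{1..n}. \<bar>real k - real j\<bar> \<le> w n}. (A n j j - A n j k)^2)) \<longlonglongrightarrow> 0"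
  shows "(\<lambda>n. \<Sum>k=1..n. \<Sum>j\<in>{j\<in>{1..n}. \<bar>real k - real j\<bar> \<le> R}. (A n k j)^2) \<longlonglongrightarrow> 0"
proof (rule order_tendstoI)
  define d where "d n = (\<Sum>j=1..n. sqrt (\<Sum>k\<in>{k\<in>{1..n}. \<bar>real k - real j\<bar> \<le> w n}. (A n j j - A n j k)^2))" for n
  define E where "E n = (\<Sum>k=1..n. \<Sum>j\<in>{j\<in>{1..n}. \<bar>real k - real j\<bar> \<le> R}. (A n k j)^2)" for n
  have d0: "d \<longlonglongrightarrow> 0" using diag unfolding d_def .
  have sq2: "(s + t)^2 \<le> 2 * s^2 + 2 * t^2" for s t :: real using zero_le_power2[of "s - t"] by (simp add: power2_eq_square algebra_simps)
  define s where "s n j = (\<Sum>k\<in>{k\<in>{1..n}. \<bar>real k - real j\<bar> \<le> w n}. (A n j j - A n j k)^2)" for n j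
  have s0: "0 \<le> s n j" for n j by (auto simp: s_def intro!: sum_nonneg)
  have sd: "(\<Sum>j=1..n. s n j) \<le> (d n)^2" for n
  proof -
    have d: "d n = (\<Sum>j=1..n. sqrt (s n j))" by (simp add: d_def s_def)
    have "(\<Sum>j=1..n. s n j) = (\<Sum>j=1..n. sqrt (s n j) * sqrt (s n j))" using s0 by simp
    also have "\<dots> \<le> (\<Sum>j=1..n. sqrt (s n j) * d n)"
      unfolding d using s0 by (intro sum_mono mult_left_mono member_le_sum[where f="\<lambda>j. sqrt (s n j)"]) auto
    also have "\<dots> = (d n)^2" unfolding sum_distrib_right[symmetric] d power2_eq_square ..
    finally show ?thesis .
  qed
  have diagonal: "real q * (\<Sum>k=1..n. (A n k k)^2) \<le> 2 * C0 + 2 * (d n)^2" if n: "1 \<le> n" "q \<le> n" "real q \<le> w n" for n q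
  proof -
    let ?w = "\<lambda>j. {k\<in>{1..n}. \<bar>real k - real j\<bar> \<le> w n}"
    have card: "q \<le> card (?w j)" if j: "j \<in> {1..n}" for j
    proof (cases "q \<le> j")
      case True
      then have "{Suc (j - q)..j} \<subseteq> ?w j" using j n by auto
      then have "card {Suc (j - q)..j} \<le> card (?w j)" by (rule card_mono[rotated]) simp
      then show ?thesis using True by simp
    next
      case False
      then have "{1..q} \<subseteq> ?w j" using j n by auto
      then have "card {1..q} \<le> card (?w j)" by (rule card_mono[rotated]) simp
      then show ?thesis by simp
    qed
    have "real q * (A n j j)^2 \<le> 2 * (\<Sum>k=1..n. (A n j k)^2) + 2 * s n j" if j: "j \<in> {1..n}" for j
    proof -
      have "real q * (A n j j)^2 \<le> (\<Sum>k\<in>?w j. (A n j j)^2)" using card[OF j] by (simp add: mult_right_mono)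
      also have "\<dots> \<le> (\<Sum>k\<in>?w j. 2 * (A n j j - A n j k)^2 + 2 * (A n j k)^2)"
      proof (rule sum_mono)
        fix k show "(A n j j)^2 \<le> 2 * (A n j j - A n j k)^2 + 2 * (A n j k)^2" using sq2[of "A n j j - A n j k" "A n j k"] by simp
      qed
      also have "\<dots> = 2 * s n j + 2 * (\<Sum>k\<in>?w j. (A n j k)^2)" by (simp add: sum.distrib sum_distrib_left s_def)
      also have "(\<Sum>k\<in>?w j. (A n j k)^2) \<le> (\<Sum>k=1..n. (A n j k)^2)" by (rule sum_mono2) auto
      finally show ?thesis by simp
    qed
    then have "(\<Sum>j=1..n. real q * (A n j j)^2) \<le> (\<Sum>j=1..n. 2 * (\<Sum>k=1..n. (A n j k)^2) + 2 * s n j)" by (rule sum_mono)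
    also have "\<dots> = 2 * (\<Sum>j=1..n. \<Sum>k=1..n. (A n j k)^2) + 2 * (\<Sum>j=1..n. s n j)" by (simp add: sum.distrib sum_distrib_left)
    also have "\<dots> \<le> 2 * C0 + 2 * (d n)^2" using C0[OF n(1)] sd[of n] by simp
    finally show ?thesis by (simp add: sum_distrib_left)
  qed
  obtain M where M: "\<And>k :: nat. finite {j :: nat. \<bar>real k - real j\<bar> \<le> R}" "\<And>k :: nat. real (card {j :: nat. \<bar>real k - real j\<bar> \<le> R}) \<le> M" "0 \<le> M"
  proof
    have sub: "{j :: nat. \<bar>real k - real j\<bar> \<le> R} \<subseteq> {k - nat \<lceil>R\<rceil>..k + nat \<lceil>R\<rceil>}" for k :: nat by auto linarith+
    then show "finite {j :: nat. \<bar>real k - real j\<bar> \<le> R}" for k :: nat by (rule finite_subset) simp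
    have "card {j :: nat. \<bar>real k - real j\<bar> \<le> R} \<le> 2 * nat \<lceil>R\<rceil> + 1" for k
      using card_mono[OF _ sub[of k]] by simp
    then show "real (card {j :: nat. \<bar>real k - real j\<bar> \<le> R}) \<le> real (2 * nat \<lceil>R\<rceil> + 1)" for k by (simp only: of_nat_le_iff)
  qed simp
  have E_le: "E n \<le> 2 * M * (\<Sum>k=1..n. (A n k k)^2) + 2 * (d n)^2" if "R \<le> w n" for n
  proof -
    let ?r = "\<lambda>k. {j\<in>{1..n}. \<bar>real k - real j\<bar> \<le> R}"
    have "E n \<le> (\<Sum>k=1..n. 2 * M * (A n k k)^2 + 2 * s n k)"
      unfolding E_def
    proof (rule sum_mono)
      fix k assume "k \<in> {1..n}"
      have "(\<Sum>j\<in>?r k. (A n k j)^2) \<le> (\<Sum>j\<in>?r k. 2 * (A n k k)^2 + 2 * (A n k k - A n k j)^2)"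
      proof (rule sum_mono)
        fix j show "(A n k j)^2 \<le> 2 * (A n k k)^2 + 2 * (A n k k - A n k j)^2"
          using sq2[of "A n k k" "A n k j - A n k k"] by (simp add: power2_commute)
      qed
      also have "\<dots> = real (card (?r k)) * (2 * (A n k k)^2) + 2 * (\<Sum>j\<in>?r k. (A n k k - A n k j)^2)" by (simp add: sum.distrib sum_distrib_left)
      also have "\<dots> \<le> M * (2 * (A n k k)^2) + 2 * s n k"
      proof (intro add_mono mult_left_mono mult_right_mono)
        have "card (?r k) \<le> card {j :: nat. \<bar>real k - real j\<bar> \<le> R}" by (rule card_mono[OF M(1)]) auto
        then show "real (card (?r k)) \<le> M" using M(2)[of k] by linarith
        show "(\<Sum>j\<in>?r k. (A n k k - A n k j)^2) \<le> s n k" unfolding s_def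
          by (rule sum_mono2) (use that in \<open>auto simp: abs_minus_commute\<close>)
      qed auto
      finally show "(\<Sum>j\<in>?r k. (A n k j)^2) \<le> 2 * M * (A n k k)^2 + 2 * s n k" by simp
    qed
    also have "\<dots> = 2 * M * (\<Sum>k=1..n. (A n k k)^2) + 2 * (\<Sum>k=1..n. s n k)" by (simp add: sum.distrib sum_distrib_left)
    finally show ?thesis using sd[of n] by simp
  qed
  fix a :: real
  show "\<forall>\<^sub>F n in sequentially. (\<Sum>k=1..n. \<Sum>j\<in>{j\<in>{1..n}. \<bar>real k - real j\<bar> \<le> R}. (A n k j)^2) < a" if a: "0 < a"
  proof -
    have C0': "0 \<le> C0" using C0[of 1] by (simp add: order_trans[OF zero_le_power2])
    obtain q :: nat where q: "q > 0" "4 * M * (C0 + 1) / real q < a / 2"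
    proof -
      define c where "c = 4 * M * (C0 + 1) + 1"
      have c: "0 < c" using M C0' by (simp add: c_def add_nonneg_pos)
      obtain q :: nat where "q > 0" and q: "inverse (real q) < (a / 2) / c"
        using ex_inverse_of_nat_less[of "(a / 2) / c"] a c by auto
      have "4 * M * (C0 + 1) / real q \<le> c * inverse (real q)" unfolding divide_inverse c_def by (intro mult_right_mono) auto
      also have "\<dots> < a / 2" using mult_strict_left_mono[OF q c] c by simp
      finally have "4 * M * (C0 + 1) / real q < a / 2" .
      with \<open>q > 0\<close> that show ?thesis by blast
    qed
    have "(\<lambda>n. (d n)^2) \<longlonglongrightarrow> 0^2" by (intro tendsto_intros d0)
    from order_tendstoD(2)[OF this, of "min 1 (a / 4)"]
    have "\<forall>\<^sub>F n in sequentially. (d n)^2 < min 1 (a / 4)" using a by simp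
    moreover have "\<forall>\<^sub>F n in sequentially. max R (real q) \<le> w n" using w unfolding filterlim_at_top by blast
    ultimately show ?thesis using eventually_ge_at_top[of "max 1 q"]
    proof eventually_elim
      case (elim n)
      have "real q * (\<Sum>k=1..n. (A n k k)^2) \<le> 2 * C0 + 2 * (d n)^2" using elim by (intro diagonal) auto
      also have "\<dots> \<le> 2 * (C0 + 1)" using elim by simp
      finally have "(\<Sum>k=1..n. (A n k k)^2) \<le> 2 * (C0 + 1) / real q" using q(1) by (simp add: pos_le_divide_eq mult.commute)
      then have "2 * M * (\<Sum>k=1..n. (A n k k)^2) \<le> 2 * M * (2 * (C0 + 1) / real q)" using M by (intro mult_left_mono) auto
      also have "\<dots> = 4 * M * (C0 + 1) / real q" by simp
      finally have "E n < a" using E_le[of n] q(2) elim by simp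
      then show ?case by (simp add: E_def)
    qed
  qed
  show "\<forall>\<^sub>F n in sequentially. a < (\<Sum>k=1..n. \<Sum>j\<in>{j\<in>{1..n}. \<bar>real k - real j\<bar> \<le> R}. (A n k j)^2)" if a: "a < 0"
    by (rule always_eventually, rule allI, rule less_le_trans[OF a]) (intro sum_nonneg zero_le_power2)
qed

context iid_law begin

text \<open>Uniform in the rounding, since \<open>|\<pi> x| \<le> |x|\<close> lets the sum over cells be bounded by the integral over
  frequencies.\<close>
lemma dform_second_moment:
  assumes obs: "\<And>k. k \<in> {1..n} \<Longrightarrow> good_obs L dL CL K \<rho> (F k)" and CL: "0 \<le> CL" "0 \<le> K" "0 < \<rho>" "\<rho> < 1"
    and s: "0 < s" "s \<le> 1"
    and g: "integrable lborel g" and gw: "integrable lborel (wmass s g)"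
    and \<pi>[measurable]: "\<pi> \<in> borel_measurable borel" and fin: "finite (range \<pi>)" and \<pi>_le: "\<And>x. \<bar>\<pi> x\<bar> \<le> \<bar>x\<bar>"
    and mean: "\<And>u v a b. (LINT e|S. aform n A m L F (ph u) (ph v) a b e) = 0"
  shows "mom_le S 2 (dform n A L F g \<pi> m) (4 * (3 / (1 - \<rho> powr s)^2 * (osc_const CL K)^2 * (integral\<^sup>L lborel (wmass s g))) * hs n A)"
proof -
  have [measurable]: "g \<in> borel_measurable lborel" using g by simp
  define G where "G = (integral\<^sup>L lborel (wmass s g))"
  define \<kappa> where "\<kappa> = 3 / (1 - \<rho> powr s)^2 * (osc_const CL K)^2 * hs n A"
  have \<kappa>0: "0 \<le> \<kappa>" by (simp add: \<kappa>_def hs_def sum_nonneg)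
  let ?\<Lambda> = "range \<pi>"
  let ?F = "\<lambda>u v a b. aform n A m L F (ph u) (ph v) a b"
  have f2: "mom_le S 2 (?F u v a b) (\<kappa> * (wt s a * wt s b))" for u v a b
    using avg_form_bound(1)[where F=F and n=n, OF obs CL s, where A=A and m=m and p="ph u" and a=a and q="ph v" and b=b]
    by (simp add: centred_def[abs_def] mean \<kappa>_def power2_eq_square mult_ac)
  have "mom_le S 2 (dform n A L F g \<pi> m) (\<Sum>u\<in>UNIV. \<Sum>v\<in>UNIV. \<Sum>a\<in>?\<Lambda>. \<Sum>b\<in>?\<Lambda>. \<bar>coef g \<pi> u v a b\<bar> * (\<kappa> * (wt s a * wt s b)))"
    unfolding dform_def[abs_def] by (intro mom_le_sum mom_le_cmult f2 fin) auto
  moreover have "(\<Sum>u\<in>UNIV. \<Sum>v\<in>UNIV. \<Sum>a\<in>?\<Lambda>. \<Sum>b\<in>?\<Lambda>. \<bar>coef g \<pi> u v a b\<bar> * (\<kappa> * (wt s a * wt s b))) \<le> (\<Sum>u\<in>(UNIV::bool set). \<Sum>v\<in>(UNIV::bool set). \<kappa> * G)"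
  proof (intro sum_mono)
    fix u v
    let ?i = "\<lambda>a b z. (if \<pi> (fst z) = a \<and> \<pi> (snd z) = b then 1 else 0 :: real)"
    have im: "?i a b \<in> borel_measurable (lborel :: (real \<times> real) measure)" for a b by measurable
    have i: "integrable lborel (\<lambda>z. cmod (g z) * ?i a b z)" for a b
    proof (rule Bochner_Integration.integrable_bound[OF integrable_norm[OF g]])
      show "(\<lambda>z. cmod (g z) * ?i a b z) \<in> borel_measurable lborel" using im[of a b] by measurable
    qed simp
    have c: "\<bar>coef g \<pi> u v a b\<bar> \<le> (LINT z|lborel. cmod (g z) * ?i a b z)" for a b
    proof -
      have n: "norm (gc (g z) u v * ?i a b z) \<le> cmod (g z) * ?i a b z" for z using abs_gc[of "g z" u v] by simp
      have "integrable lborel (\<lambda>z. gc (g z) u v * ?i a b z)"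
      proof (rule Bochner_Integration.integrable_bound[OF i[of a b]])
        show "(\<lambda>z. gc (g z) u v * ?i a b z) \<in> borel_measurable lborel" using im[of a b] by measurable
        show "AE z in lborel. norm (gc (g z) u v * ?i a b z) \<le> norm (cmod (g z) * ?i a b z)" using abs_gc by (intro AE_I2) simp
      qed
      from norm_integral_le_integral[OF this n i] show ?thesis by (simp add: coef_def)
    qed
    have "(\<Sum>a\<in>?\<Lambda>. \<Sum>b\<in>?\<Lambda>. \<bar>coef g \<pi> u v a b\<bar> * (\<kappa> * (wt s a * wt s b))) \<le> (\<Sum>a\<in>?\<Lambda>. \<Sum>b\<in>?\<Lambda>. (LINT z|lborel. cmod (g z) * ?i a b z) * (\<kappa> * (wt s a * wt s b)))"
      by (intro sum_mono mult_right_mono c mult_nonneg_nonneg \<kappa>0) (auto simp: wt_def)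
    also have "\<dots> = (LINT z|lborel. (\<Sum>a\<in>?\<Lambda>. \<Sum>b\<in>?\<Lambda>. cmod (g z) * ?i a b z * (\<kappa> * (wt s a * wt s b))))"
      by (rule has_bochner_integral_integral_eq[symmetric]) (intro has_bochner_integral_sum has_bochner_integral_mult_left has_bochner_integral_integrable i)
    also have "\<dots> \<le> (LINT z|lborel. \<kappa> * (wmass s g z))"
    proof (rule integral_mono)
      show "integrable lborel (\<lambda>z. \<Sum>a\<in>?\<Lambda>. \<Sum>b\<in>?\<Lambda>. cmod (g z) * ?i a b z * (\<kappa> * (wt s a * wt s b)))"
        by (intro Bochner_Integration.integrable_sum integrable_mult_left i)
      show "integrable lborel (\<lambda>z. \<kappa> * (wmass s g z))" by (intro integrable_mult_right gw)
      fix z :: "real \<times> real"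
      have "(\<Sum>a\<in>?\<Lambda>. \<Sum>b\<in>?\<Lambda>. cmod (g z) * ?i a b z * (\<kappa> * (wt s a * wt s b))) = cmod (g z) * (\<Sum>a\<in>?\<Lambda>. \<Sum>b\<in>?\<Lambda>. ?i a b z * (\<kappa> * (wt s a * wt s b)))"
        by (simp only: sum_distrib_left mult.assoc)
      also have "(\<Sum>a\<in>?\<Lambda>. \<Sum>b\<in>?\<Lambda>. ?i a b z * (\<kappa> * (wt s a * wt s b))) = \<kappa> * (wt s (\<pi> (fst z)) * wt s (\<pi> (snd z)))"
        by (rule finite_range_expand[OF fin]) auto
      also have "cmod (g z) * \<dots> \<le> cmod (g z) * (\<kappa> * (wt s (fst z) * wt s (snd z)))"
        using s \<kappa>0 by (intro mult_left_mono mult_mono wt_mono \<pi>_le) (auto simp: wt_def)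
      finally show "(\<Sum>a\<in>?\<Lambda>. \<Sum>b\<in>?\<Lambda>. cmod (g z) * ?i a b z * (\<kappa> * (wt s a * wt s b))) \<le> \<kappa> * (wmass s g z)"
        by (simp add: mult_ac)
    qed
    also have "\<dots> = \<kappa> * G" by (simp add: G_def)
    finally show "(\<Sum>a\<in>?\<Lambda>. \<Sum>b\<in>?\<Lambda>. \<bar>coef g \<pi> u v a b\<bar> * (\<kappa> * (wt s a * wt s b))) \<le> \<kappa> * G" .
  qed
  ultimately show ?thesis by (elim mom_le_weaken) (simp add: UNIV_bool G_def \<kappa>_def mult_ac)
qed

text \<open>Rounding and memory are fixed first, then the block length, and the sample size last. The bound on the
  coefficients does not depend on \<open>\<delta>\<close>.\<close>
theorem wform_chaos:
  fixes F :: "nat \<Rightarrow> nat \<Rightarrow> statistic" and A :: "nat \<Rightarrow> array" and V :: "nat \<Rightarrow> real"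
  assumes obs: "\<And>n k. n \<ge> 1 \<Longrightarrow> k \<in> {1..n} \<Longrightarrow> good_obs L dL CL K \<rho> (F n k)" and CL: "0 \<le> CL" "0 \<le> K" "0 < \<rho>" "\<rho> < 1" and L: "L \<in> borel_measurable borel"
    and s: "0 < s" "s \<le> 1"
    and g: "integrable lborel g" and gw: "integrable lborel (wmass s g)"
    and sym: "\<And>n k j. n \<ge> 1 \<Longrightarrow> k \<in> {1..n} \<Longrightarrow> j \<in> {1..n} \<Longrightarrow> A n k j = A n j k"
    and C0: "\<And>n. n \<ge> 1 \<Longrightarrow> (\<Sum>k=1..n. \<Sum>j=1..n. (A n k j)^2) \<le> C0"
    and near: "\<And>R. (\<lambda>n. \<Sum>k=1..n. \<Sum>j\<in>{j\<in>{1..n}. \<bar>real k - real j\<bar> \<le> R}. (A n k j)^2) \<longlonglongrightarrow> 0"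
    and V: "\<And>n k. n \<ge> 1 \<Longrightarrow> k \<in> {1..n} \<Longrightarrow> (\<Sum>j=1..n. (A n k j)^2) \<le> (V n)^2" and V0: "V \<longlonglongrightarrow> 0"
    and \<delta>: "\<delta> > 0"
  shows "\<forall>\<^sub>F n in sequentially. \<exists>p \<alpha>.
    2 * (\<Sum>i<p. (\<alpha> i)^2) \<le> (4 * (3 / (1 - \<rho> powr s)^2 * (osc_const CL K)^2 * (integral\<^sup>L lborel (wmass s g))) * sqrt C0)^2 \<and>
    (\<forall>t. cmod ((LINT e|S. iexp (t * centred (wform n (A n) L (F n) g) e)) - (chf gauss_seq (chaos p \<alpha>) t)) \<le> \<delta> * (abs t + abs t ^ 3))"
proof -
  define r where "r = \<rho> powr (s / 2)"
  have r: "0 \<le> r" "r < 1" using CL s powr_less_mono2[of "s / 2" \<rho> 1] by (auto simp: r_def)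
  define \<kappa> where "\<kappa> = 3 / (1 - r)^2 * (osc_const CL K)^2"
  have \<kappa>0: "0 \<le> \<kappa>" by (simp add: \<kappa>_def)
  define \<Gamma> where "\<Gamma> z = wmass s g z" for z
  have \<Gamma>: "integrable lborel \<Gamma>" using gw by (simp add: \<Gamma>_def[abs_def])
  have \<Gamma>0: "0 \<le> \<Gamma> z" for z by (simp add: \<Gamma>_def wt_def)
  define G where "G = (LINT z|lborel. \<Gamma> z)"
  have G0: "0 \<le> G" by (simp add: G_def \<Gamma>0)
  define os where "os N z = min 1 (sqrt \<bar>fst z - rnd N (fst z)\<bar>) + min 1 (sqrt \<bar>snd z - rnd N (snd z)\<bar>)" for N and z :: "real \<times> real"
  define J where "J N = (LINT z|lborel. \<Gamma> z * os N z)" for N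
  have J: "J \<longlonglongrightarrow> 0" and Ji: "integrable lborel (\<lambda>z. \<Gamma> z * os N z)" for N
    using rounding_error_tendsto[OF \<Gamma>] unfolding J_def os_def by auto
  have C00: "0 \<le> C0" using C0[of 1] by (simp add: order_trans[OF zero_le_power2])
  define c where "c = sqrt C0"
  have c0: "0 \<le> c" using C00 by (simp add: c_def)
  have hsA: "hs n (A n) \<le> c" "(hs n (A n))^2 \<le> C0" if "n \<ge> 1" for n
    using C0[OF that] by (simp_all add: hs_def c_def sum_nonneg)
  \<comment> \<open>half of \<open>\<delta>\<close> is shared by rounding, memory and deleted entries, the other half goes to diagonalisation\<close>
  define d where "d = \<delta> / 6"
  have d: "0 < d" using \<delta> by (simp add: d_def)
  obtain N where N: "16 * \<kappa> * c * J N < d"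
  proof -
    have "(\<lambda>N. 16 * \<kappa> * c * J N) \<longlonglongrightarrow> 16 * \<kappa> * c * 0" by (intro tendsto_intros J)
    then have "\<forall>\<^sub>F N in sequentially. 16 * \<kappa> * c * J N < d" using d by (intro order_tendstoD) auto
    then show ?thesis using that by (auto simp: eventually_sequentially)
  qed
  obtain m where m: "32 * \<kappa> * c * G / (1 - r) * r ^ m < d"
  proof -
    have "(\<lambda>m. 32 * \<kappa> * c * G / (1 - r) * r ^ m) \<longlonglongrightarrow> 32 * \<kappa> * c * G / (1 - r) * 0" using r by (intro tendsto_intros LIMSEQ_power_zero) auto
    then have "\<forall>\<^sub>F m in sequentially. 32 * \<kappa> * c * G / (1 - r) * r ^ m < d" using d by (intro order_tendstoD) auto
    then show ?thesis using that by (auto simp: eventually_sequentially)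
  qed
  define \<xi> where "\<xi> = d / (8 * \<kappa> * G + 1)"
  have \<xi>: "0 < \<xi>" "8 * \<kappa> * G * \<xi> \<le> d"
  proof -
    have p: "0 < 8 * \<kappa> * G + 1" using \<kappa>0 G0 by (simp add: add_nonneg_pos)
    then show "0 < \<xi>" using d by (simp add: \<xi>_def)
    have "8 * \<kappa> * G * \<xi> \<le> (8 * \<kappa> * G + 1) * \<xi>" using \<open>0 < \<xi>\<close> by (intro mult_right_mono) auto
    also have "\<dots> = d" using p by (simp add: \<xi>_def)
    finally show "8 * \<kappa> * G * \<xi> \<le> d" .
  qed
  obtain l where l: "0 < l" "2 * (real m / real l * C0) \<le> \<xi>^2 / 2"
  proof -
    have x: "0 < \<xi>^2 / 2" using \<xi> by simp
    have "(\<lambda>l. 2 * real m * C0 * (1 / real l)) \<longlonglongrightarrow> 2 * real m * C0 * 0" by (intro tendsto_intros lim_1_over_n)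
    then have "\<forall>\<^sub>F l in sequentially. 2 * real m * C0 * (1 / real l) < \<xi>^2 / 2" using x by (intro order_tendstoD) auto
    then have "\<forall>\<^sub>F l in sequentially. 2 * (real m / real l * C0) \<le> \<xi>^2 / 2 \<and> 0 < l" using eventually_gt_at_top[of 0]
      by eventually_elim (simp add: field_simps)
    then show ?thesis using that by (auto simp: eventually_sequentially)
  qed
  define cf where "cf = (\<Sum>u\<in>UNIV. \<Sum>v\<in>UNIV. \<Sum>a\<in>range (rnd N). \<Sum>b\<in>range (rnd N). (coef g (rnd N) u v a b)^2)"
  have cf0: "0 \<le> cf" by (auto simp: cf_def intro!: sum_nonneg)
  define kk where "kk = 3 * (4 * (2 * K)) ^ 6 * real (2 * l * card (range (rnd N))) ^ 4"
  have kk0: "0 \<le> kk" using CL by (simp add: kk_def)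
  have "(\<lambda>n. kk * sqrt (4 * ((V n)^2 * cf)) * (4 * (C0 * cf))) \<longlonglongrightarrow> kk * sqrt (4 * (0^2 * cf)) * (4 * (C0 * cf))"
    by (intro tendsto_intros V0)
  then have "\<forall>\<^sub>F n in sequentially. kk * sqrt (4 * ((V n)^2 * cf)) * (4 * (C0 * cf)) < \<delta>" using \<delta> by (intro order_tendstoD) auto
  moreover have "\<forall>\<^sub>F n in sequentially. (\<Sum>k=1..n. \<Sum>j\<in>{j\<in>{1..n}. \<bar>real k - real j\<bar> \<le> real l - 1}. (A n k j)^2) < \<xi>^2 / 2"
    using order_tendstoD(2)[OF near[of "real l - 1"], of "\<xi>^2 / 2"] \<xi> by simp
  ultimately show ?thesis using eventually_ge_at_top[of 1]
  proof eventually_elim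
    case (elim n)
    then have n: "n \<ge> 1" by simp
    have O: "good_obs L dL CL K \<rho> (F n k)" if "k \<in> {1..n}" for k using obs[OF n that] .
    obtain h where h: "h < l" "(\<Sum>k\<in>{k\<in>{1..n}. gap l m h k}. \<Sum>j=1..n. (A n k j)^2) \<le> real m / real l * (\<Sum>k=1..n. \<Sum>j=1..n. (A n k j)^2)"
      using sum_gap_le[of "{1..n}" "\<lambda>k. \<Sum>j=1..n. (A n k j)^2" l m] l by (auto simp: sum_nonneg)
    define A' where "A' = blocked l m h (A n)"
    have gap_part: "2 * (\<Sum>k\<in>{k\<in>{1..n}. gap l m h k}. \<Sum>j=1..n. (A n k j)^2) \<le> \<xi>^2 / 2"
    proof -
      have "real m / real l * (\<Sum>k=1..n. \<Sum>j=1..n. (A n k j)^2) \<le> real m / real l * C0" by (intro mult_left_mono C0 n) auto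
      then show ?thesis using h(2) l(2) by linarith
    qed
    have "(\<Sum>k=1..n. \<Sum>j\<in>{j\<in>{1..n}. blk l h k = blk l h j}. (A n k j)^2) \<le> (\<Sum>k=1..n. \<Sum>j\<in>{j\<in>{1..n}. \<bar>real k - real j\<bar> \<le> real l - 1}. (A n k j)^2)"
      by (intro sum_mono sum_mono2) (use same_block_close[OF _ l(1)] in auto)
    then have "(hs n (\<lambda>k j. A n k j - A' k j))^2 \<le> \<xi>^2"
      using hs_blocked_diff[of n "A n" l m h] sym[OF n] gap_part elim(2) unfolding A'_def by fastforce
    then have hd: "hs n (\<lambda>k j. A n k j - A' k j) \<le> \<xi>" using \<xi>(1) by (simp add: power2_le_iff_abs_le abs_le_iff)
    have mean: "(LINT e|S. aform n A' m L (F n) (ph u) (ph v) a b e) = 0" for u v a b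
      unfolding A'_def by (rule blocked_form_mean[OF osc_basic(2)[OF O] osc_basic(2)[OF O] l(1)])
    have rndm: "rnd N \<in> borel_measurable borel" by (rule rnd_measurable)
    note err = wform_error[where F="F n" and A="A n" and m=m, OF O CL L s r_def g gw rndm finite_range_rnd rnd_abs_le mean]
    let ?D = "dform n A' L (F n) g (rnd N) m" and ?W = "centred (wform n (A n) L (F n) g)"
    define B where "B z = 4 * err_kernel (osc_const CL K) s r m (rnd N) (hs n (A n)) (hs n (\<lambda>k j. A n k j - A' k j)) g z" for z
    have B_eq: "B z = 8 * \<kappa> * hs n (A n) * (\<Gamma> z * os N z) + (16 * \<kappa> * hs n (A n) / (1 - r) * r ^ m + 4 * \<kappa> * hs n (\<lambda>k j. A n k j - A' k j)) * \<Gamma> z" for z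
      by (simp add: B_def \<kappa>_def \<Gamma>_def os_def algebra_simps)
    have "(LINT z|lborel. B z) = 8 * \<kappa> * hs n (A n) * J N + (16 * \<kappa> * hs n (A n) / (1 - r) * r ^ m + 4 * \<kappa> * hs n (\<lambda>k j. A n k j - A' k j)) * G"
      unfolding B_eq J_def G_def using Ji[of N] \<Gamma> by simp
    also have "2 * \<dots> \<le> 3 * d"
    proof -
      have J0: "0 \<le> J N" unfolding J_def by (intro integral_nonneg_AE AE_I2 mult_nonneg_nonneg \<Gamma>0) (auto simp: os_def)
      have "16 * \<kappa> * J N * hs n (A n) \<le> 16 * \<kappa> * J N * c" using J0 \<kappa>0 by (intro mult_left_mono hsA n) auto
      moreover have "32 * \<kappa> * G / (1 - r) * r ^ m * hs n (A n) \<le> 32 * \<kappa> * G / (1 - r) * r ^ m * c" using G0 \<kappa>0 r by (intro mult_left_mono hsA n) auto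
      moreover have "8 * \<kappa> * G * hs n (\<lambda>k j. A n k j - A' k j) \<le> 8 * \<kappa> * G * \<xi>" using G0 \<kappa>0 by (intro mult_left_mono hd) auto
      ultimately show ?thesis using N m \<xi>(2) by (simp add: algebra_simps)
    qed
    finally have B3: "2 * (LINT z|lborel. B z) \<le> \<delta> / 2" by (simp add: d_def)
    have err1: "mom_le S 1 (\<lambda>e. ?W e - ?D e) (\<delta> / 2)" using mom_le_weaken[OF err(2)[folded B_def] B3] .
    have D2: "mom_le S 2 ?D (4 * (3 / (1 - \<rho> powr s)^2 * (osc_const CL K)^2 * G) * hs n A')"
      unfolding G_def \<Gamma>_def by (rule dform_second_moment[where F="F n", OF O CL s g gw rndm finite_range_rnd rnd_abs_le mean])
    have Wm: "?W \<in> borel_measurable S" using err(1) by (simp add: centred_def[abs_def])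
    have Dm: "?D \<in> borel_measurable S" using D2 by (simp add: mom_le_def)
    have ch1: "cmod (chf S ?W t - chf S ?D t) \<le> abs t * (\<delta> / 2)" for t
      using order_trans[OF char_diff_le[OF S.prob_space_axioms Wm Dm] mult_left_mono[OF mom_le_1_integrable(2)[OF err1]]] mom_le_1_integrable(1)[OF err1] by simp
    have rows: "(\<Sum>j=1..n. (A n k j)^2) \<le> (V n)^2" "(\<Sum>j=1..n. (A n j k)^2) \<le> (V n)^2" if "k \<in> {1..n}" for k
      using V[OF n that] sym[OF n _ that] by simp_all
    have d2: "0 < \<delta> / 2" using \<delta> by simp
    obtain p \<alpha> where \<alpha>: "2 * (\<Sum>i<p. (\<alpha> i)^2) \<le> (LINT x|S. (?D x)^2)"
      "\<And>t. cmod (chf S ?D t - chf gauss_seq (chaos p \<alpha>) t) \<le> abs t ^ 3 * (kk * sqrt (4 * ((V n)^2 * cf)) * (4 * ((hs n (A n))^2 * cf))) + abs t * (\<delta> / 2)"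
      using dform_chaos[where F="F n" and A="A n" and g=g and m=m and h=h, OF O CL(2) l(1) finite_range_rnd d2 rows] unfolding A'_def kk_def cf_def by blast
    have "2 * (\<Sum>i<p. (\<alpha> i)^2) \<le> (4 * (3 / (1 - \<rho> powr s)^2 * (osc_const CL K)^2 * G) * sqrt C0)^2"
    proof -
      have "(LINT x|S. (?D x)^2) \<le> (4 * (3 / (1 - \<rho> powr s)^2 * (osc_const CL K)^2 * G) * hs n A')^2" by (rule mom_le_even(2)[OF D2]) simp
      also have "\<dots> \<le> (4 * (3 / (1 - \<rho> powr s)^2 * (osc_const CL K)^2 * G) * sqrt C0)^2"
      proof (intro power_mono mult_left_mono)
        show "hs n A' \<le> sqrt C0" using hs_blocked_le[of n l m h "A n"] hsA[OF n] unfolding A'_def c_def by linarith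
        show "0 \<le> 4 * (3 / (1 - \<rho> powr s)^2 * (osc_const CL K)^2 * G) * hs n A'" using D2 by (simp add: mom_le_def)
      qed (use G0 in auto)
      finally show ?thesis using \<alpha>(1) by linarith
    qed
    moreover have "cmod (chf S ?W t - chf gauss_seq (chaos p \<alpha>) t) \<le> \<delta> * (abs t + abs t ^ 3)" for t
    proof -
      have "kk * sqrt (4 * ((V n)^2 * cf)) * (4 * ((hs n (A n))^2 * cf)) \<le> kk * sqrt (4 * ((V n)^2 * cf)) * (4 * (C0 * cf))"
        using kk0 cf0 by (intro mult_left_mono mult_right_mono hsA n) auto
      then have "kk * sqrt (4 * ((V n)^2 * cf)) * (4 * ((hs n (A n))^2 * cf)) \<le> \<delta>" using elim(1) by linarith
      then have "abs t ^ 3 * (kk * sqrt (4 * ((V n)^2 * cf)) * (4 * ((hs n (A n))^2 * cf))) \<le> abs t ^ 3 * \<delta>"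
        by (rule mult_left_mono) simp
      then have "cmod (chf S ?D t - chf gauss_seq (chaos p \<alpha>) t) \<le> abs t ^ 3 * \<delta> + abs t * (\<delta> / 2)"
        using \<alpha>(2)[of t] by linarith
      moreover note ch1[of t]
      moreover have "\<delta> * (abs t + abs t ^ 3) = abs t * (\<delta> / 2) + (abs t ^ 3 * \<delta> + abs t * (\<delta> / 2))" by (simp add: algebra_simps)
      moreover have "cmod (x - z) \<le> cmod (x - y) + cmod (y - z)" for x y z :: complex
        using dist_triangle[of x z y] by (simp add: dist_norm)
      note this[of "\<integral>e. iexp (t * ?W e) \<partial>S" "\<integral>z. iexp (t * chaos p \<alpha> z) \<partial>gauss_seq" "\<integral>e. iexp (t * ?D e) \<partial>S"]
      ultimately show ?thesis by linarith
    qed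
    ultimately show ?case unfolding G_def \<Gamma>_def by blast
  qed
qed

end

section \<open>Translation of the analytic hypotheses\<close>

text \<open>\<open>|y|\<^sup>8 \<le> a\<^sup>8 + a\<^sup>8\<^sup>-\<^sup>p |y|\<^sup>p\<close>, which costs the factor \<open>2\<close> but asks only for \<open>a > 0\<close>.\<close>
lemma mom_le_of_Lp_norm:
  assumes M: "prob_space M" and Y[measurable]: "Y \<in> borel_measurable M" and p: "8 \<le> p" and a: "0 < a"
    and N: "Lp_norm M p Y \<le> ennreal a"
  shows "mom_le M 8 Y (2 * a)"
proof -
  interpret prob_space M by fact
  define I where "I = (\<integral>\<^sup>+\<omega>. ennreal (\<bar>Y \<omega>\<bar> powr p) \<partial>M)"
  have I: "I \<noteq> \<infinity>" "enn2real I powr (1 / p) \<le> a"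
    using N a by (auto simp: Lp_norm_def I_def[symmetric] Let_def top_unique split: if_splits)
  have "enn2real I = (enn2real I powr (1 / p)) powr p" using p by (simp add: powr_powr)
  also have "\<dots> \<le> a powr p" using I(2) p by (intro powr_mono2) auto
  finally have "ennreal (enn2real I) \<le> ennreal (a powr p)" by (rule ennreal_leI)
  then have Ia: "I \<le> ennreal (a powr p)" using I(1) by (simp add: ennreal_enn2real_if)
  have pw: "\<bar>y\<bar> ^ 8 \<le> a ^ 8 + a powr (8 - p) * \<bar>y\<bar> powr p" for y :: real
  proof (cases "\<bar>y\<bar> \<le> a")
    case True
    then have "\<bar>y\<bar> ^ 8 \<le> a ^ 8" by (intro power_mono) auto
    then show ?thesis by (simp add: add_increasing2)
  next
    case False
    then have y: "0 < \<bar>y\<bar>" "a \<le> \<bar>y\<bar>" using a by auto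
    have "\<bar>y\<bar> ^ 8 = \<bar>y\<bar> powr 8" using y powr_realpow[of "\<bar>y\<bar>" 8] by simp
    also have "\<dots> = \<bar>y\<bar> powr (8 - p) * \<bar>y\<bar> powr p" by (simp add: powr_add[symmetric])
    also have "\<dots> \<le> a powr (8 - p) * \<bar>y\<bar> powr p" using y a p by (intro mult_right_mono powr_mono2') auto
    finally show ?thesis using a by (simp add: add_increasing)
  qed
  have "(\<integral>\<^sup>+\<omega>. ennreal (\<bar>Y \<omega>\<bar> ^ 8) \<partial>M) \<le> (\<integral>\<^sup>+\<omega>. ennreal (a ^ 8) + ennreal (a powr (8 - p)) * ennreal (\<bar>Y \<omega>\<bar> powr p) \<partial>M)"
  proof (rule nn_integral_mono)
    fix \<omega> show "ennreal (\<bar>Y \<omega>\<bar> ^ 8) \<le> ennreal (a ^ 8) + ennreal (a powr (8 - p)) * ennreal (\<bar>Y \<omega>\<bar> powr p)"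
      using ennreal_leI[OF pw[of "Y \<omega>"]] a by (simp add: ennreal_plus ennreal_mult)
  qed
  also have "\<dots> = ennreal (a ^ 8) + ennreal (a powr (8 - p)) * I"
    by (simp add: nn_integral_add nn_integral_cmult emeasure_space_1 I_def)
  also have "\<dots> \<le> ennreal (a ^ 8) + ennreal (a powr (8 - p)) * ennreal (a powr p)" by (intro add_left_mono mult_left_mono Ia) simp
  also have "\<dots> = ennreal (a ^ 8 + a powr (8 - p) * a powr p)" using a by (simp add: ennreal_plus ennreal_mult)
  also have "a powr (8 - p) * a powr p = a ^ 8" using a powr_realpow[of a 8] by (simp add: powr_add[symmetric])
  also have "ennreal (a ^ 8 + a ^ 8) \<le> ennreal ((2 * a) ^ 8)" using a by (intro ennreal_leI) simp
  finally show ?thesis using a by (simp add: mom_le_def)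
qed

text \<open>Mean value theorem, with the derivative at the intermediate point bounded by those at the ends.\<close>
lemma controlled_deriv_lipschitz:
  assumes "controlled_deriv f"
  shows "\<exists>C\<ge>0. \<forall>a b. \<bar>f a - f b\<bar> \<le> \<bar>a - b\<bar> * (C * (\<bar>deriv f a\<bar> + \<bar>deriv f b\<bar> + 1))"
proof -
  obtain C where C: "\<And>a b t. a \<le> b \<Longrightarrow> t \<in> {a..b} \<Longrightarrow> \<bar>deriv f t\<bar> \<le> C * (\<bar>deriv f a\<bar> + \<bar>deriv f b\<bar> + 1)"
    using assms unfolding controlled_deriv_def by blast
  have D: "(f has_real_derivative deriv f x) (at x)" for x
    using assms by (simp add: controlled_deriv_def DERIV_deriv_iff_real_differentiable)
  have le: "\<bar>f b - f a\<bar> \<le> (b - a) * (\<bar>C\<bar> * (\<bar>deriv f a\<bar> + \<bar>deriv f b\<bar> + 1))" if ab: "a < b" for a b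
  proof -
    obtain z where z: "a < z" "z < b" "f b - f a = (b - a) * deriv f z"
      using MVT2[OF ab, of f "deriv f"] D by blast
    have "\<bar>deriv f z\<bar> \<le> C * (\<bar>deriv f a\<bar> + \<bar>deriv f b\<bar> + 1)" using z by (intro C) auto
    also have "\<dots> \<le> \<bar>C\<bar> * (\<bar>deriv f a\<bar> + \<bar>deriv f b\<bar> + 1)" by (intro mult_right_mono) auto
    finally show ?thesis using ab by (simp add: z(3) abs_mult mult_left_mono)
  qed
  have "\<bar>f a - f b\<bar> \<le> \<bar>a - b\<bar> * (\<bar>C\<bar> * (\<bar>deriv f a\<bar> + \<bar>deriv f b\<bar> + 1))" for a b
  proof (cases a b rule: linorder_cases)
    case less then show ?thesis using le[of a b] by (simp add: abs_minus_commute)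
  next
    case greater then show ?thesis using le[of b a] by (simp add: add_ac)
  qed simp
  then show ?thesis by (intro exI[of _ "\<bar>C\<bar>"]) simp
qed

lemma borel_measurable_deriv:
  fixes f :: "real \<Rightarrow> real"
  assumes "\<And>x. f differentiable (at x)"
  shows "f \<in> borel_measurable borel" "deriv f \<in> borel_measurable borel"
proof -
  have "continuous_on UNIV f" using assms by (intro continuous_at_imp_continuous_on ballI differentiable_imp_continuous_within)
  then show f[measurable]: "f \<in> borel_measurable borel" by (rule borel_measurable_continuous_onI)
  show "deriv f \<in> borel_measurable borel"
  proof (rule borel_measurable_LIMSEQ_real)
    show "(\<lambda>x. (f (x + 1 / real (Suc i)) - f x) / (1 / real (Suc i))) \<in> borel_measurable borel" for i by measurable
    fix x
    have D: "((\<lambda>h. (f (x + h) - f x) / h) \<longlongrightarrow> deriv f x) (at 0)"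
      using assms[of x] by (simp add: DERIV_deriv_iff_real_differentiable[symmetric] DERIV_def)
    have l: "filterlim (\<lambda>i. 1 / real (Suc i)) (at 0) sequentially"
      using LIMSEQ_Suc[OF lim_1_over_n] by (simp add: filterlim_at)
    show "(\<lambda>i. (f (x + 1 / real (Suc i)) - f x) / (1 / real (Suc i))) \<longlonglongrightarrow> deriv f x"
      by (rule filterlim_compose[OF D l])
  qed
qed

text \<open>\<open>(1 + |x|)\<^sup>s (1 + |y|)\<^sup>s \<le> (1 + |z|)\<^sup>\<eta> \<le> 2 (1 + |z|\<^sup>\<eta>)\<close> for \<open>z = (x, y)\<close> and \<open>s = \<eta>/2\<close>.\<close>
lemma wiener_weight_integrable:
  fixes g :: "real \<times> real \<Rightarrow> complex"
  assumes g: "integrable lborel g" "integrable lborel (\<lambda>z. norm z powr \<eta> * cmod (g z))" and \<eta>: "0 < \<eta>" "\<eta> \<le> 1"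
  shows "integrable lborel (\<lambda>z. cmod (g z) * (wt (\<eta> / 2) (fst z) * wt (\<eta> / 2) (snd z)))"
proof (rule Bochner_Integration.integrable_bound)
  show "integrable lborel (\<lambda>z. 2 * (cmod (g z) + norm z powr \<eta> * cmod (g z)))" using g by simp
  have [measurable]: "g \<in> borel_measurable lborel" using g by simp
  show "(\<lambda>z. cmod (g z) * (wt (\<eta> / 2) (fst z) * wt (\<eta> / 2) (snd z))) \<in> borel_measurable lborel" unfolding wt_def by measurable
  show "AE z in lborel. norm (cmod (g z) * (wt (\<eta> / 2) (fst z) * wt (\<eta> / 2) (snd z))) \<le> norm (2 * (cmod (g z) + norm z powr \<eta> * cmod (g z)))"
  proof (rule AE_I2)
    fix z :: "real \<times> real"
    have n: "\<bar>fst z\<bar> \<le> norm z" "\<bar>snd z\<bar> \<le> norm z" using norm_fst_le[of "fst z" "snd z"] norm_snd_le[of "snd z" "fst z"] by auto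
    have "wt (\<eta> / 2) (fst z) * wt (\<eta> / 2) (snd z) \<le> wt (\<eta> / 2) (norm z) * wt (\<eta> / 2) (norm z)"
      using \<eta> n by (intro mult_mono wt_mono) (auto simp: wt_def)
    also have "\<dots> = (1 + norm z) powr \<eta>" by (simp add: wt_def powr_add[symmetric])
    also have "\<dots> \<le> (2 * max 1 (norm z)) powr \<eta>" using \<eta> by (intro powr_mono2) auto
    also have "\<dots> = 2 powr \<eta> * max 1 (norm z) powr \<eta>" by (simp add: powr_mult)
    also have "\<dots> \<le> 2 * (1 + norm z powr \<eta>)"
    proof (intro mult_mono)
      show "2 powr \<eta> \<le> (2 :: real)" using powr_mono[of \<eta> 1 "2::real"] \<eta> by simp
      show "max 1 (norm z) powr \<eta> \<le> 1 + norm z powr \<eta>" by (auto simp: max_def)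
    qed auto
    finally have "cmod (g z) * (wt (\<eta> / 2) (fst z) * wt (\<eta> / 2) (snd z)) \<le> cmod (g z) * (2 * (1 + norm z powr \<eta>))" by (intro mult_left_mono) auto
    also have "\<dots> = 2 * (cmod (g z) + norm z powr \<eta> * cmod (g z))" by (simp add: algebra_simps)
    finally show "norm (cmod (g z) * (wt (\<eta> / 2) (fst z) * wt (\<eta> / 2) (snd z))) \<le> norm (2 * (cmod (g z) + norm z powr \<eta> * cmod (g z)))"
      by (simp add: wt_def)
  qed
qed

lemma iid_std_normal_gauss_seq: "iid_std_normal gauss_seq (\<lambda>j z. z j)"
  unfolding iid_std_normal_def
proof (intro conjI allI)
  show "prob_space gauss_seq" by (rule gauss.S.prob_space_axioms)
  have "gauss.S.indep_vars (\<lambda>_. gauss) (\<lambda>k w. w k) UNIV" by (rule indep_vars_PiM_coordinates) (rule prob_gauss)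
  then show "gauss.S.indep_vars (\<lambda>_. borel) (\<lambda>j z. z j) UNIV"
    by (rule gauss.S.indep_vars_compose2) (auto intro!: measurable_ident_sets)
  fix j
  have "distr gauss_seq lborel (\<lambda>z. z j) = distr gauss_seq gauss (\<lambda>z. z j)" by (rule distr_cong) auto
  then show "distributed gauss_seq lborel (\<lambda>z. z j) std_normal_density"
    by (simp add: distributed_def gauss_law_coord)
qed

text \<open>The chaos is the diagonal form minus its mean.\<close>
lemma chaos_mom: "mom_le gauss_seq 2 (chaos p \<alpha>) (sqrt (2 * (\<Sum>i<p. (\<alpha> i)^2)))"
proof -
  define A where "A i j = (if i = j then \<alpha> i else 0)" for i j :: nat
  have q: "quad p A z = (\<Sum>i<p. \<alpha> i * (z i)^2)" for z
    unfolding quad_def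
  proof (intro sum.cong refl)
    fix i assume "i \<in> {..<p}"
    have "(\<Sum>j<p. A i j * (z i * z j)) = (\<Sum>j<p. if i = j then \<alpha> i * (z i)^2 else 0)"
      by (intro sum.cong refl) (simp add: A_def power2_eq_square)
    then show "(\<Sum>j<p. A i j * (z i * z j)) = \<alpha> i * (z i)^2" using \<open>i \<in> {..<p}\<close> by simp
  qed
  have A2: "(\<Sum>i<p. \<Sum>j<p. (A i j)^2) = (\<Sum>i<p. (\<alpha> i)^2)"
  proof (intro sum.cong refl)
    fix i assume "i \<in> {..<p}"
    have "(\<Sum>j<p. (A i j)^2) = (\<Sum>j<p. if i = j then (\<alpha> i)^2 else 0)" by (intro sum.cong refl) (simp add: A_def)
    then show "(\<Sum>j<p. (A i j)^2) = (\<alpha> i)^2" using \<open>i \<in> {..<p}\<close> by simp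
  qed
  define \<sigma> where "\<sigma> = (\<Sum>i<p. \<alpha> i)"
  have tr: "(\<Sum>i<p. A i i) = \<sigma>" by (simp add: A_def \<sigma>_def)
  have sym: "A i j = A j i" for i j by (simp add: A_def)
  obtain c where c: "mom_le gauss_seq 2 (quad p A) c" using quad_mom by blast
  have ch: "chaos p \<alpha> z = quad p A z - \<sigma>" for z unfolding chaos_def q \<sigma>_def by (simp add: sum_subtractf right_diff_distrib)
  have i1: "integrable gauss_seq (quad p A)" using gauss.S.mom_le_integrable(1)[OF c] .
  have i2: "integrable gauss_seq (\<lambda>z. (quad p A z)^2)" using mom_le_even(1)[OF c] by simp
  have sq: "(chaos p \<alpha> z)^2 = (quad p A z)^2 - 2 * \<sigma> * quad p A z + \<sigma>^2" for z unfolding ch by (simp add: power2_eq_square algebra_simps)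
  have i: "integrable gauss_seq (\<lambda>z. (chaos p \<alpha> z)^2)" unfolding sq using i1 i2 by simp
  have "(LINT z|gauss_seq. (chaos p \<alpha> z)^2) = 2 * (\<Sum>i<p. (\<alpha> i)^2)"
    unfolding sq using i1 i2 quad_moments[of p A, OF sym] gauss.S.prob_space by (simp add: tr A2 power2_eq_square[of \<sigma>])
  moreover have "chaos p \<alpha> \<in> borel_measurable gauss_seq" unfolding ch[abs_def] using i1 by measurable
  ultimately show ?thesis using i by (intro mom_leI_integrable) (auto simp: sum_nonneg)
qed

lemma weights_vanish:
  assumes "(\<lambda>n. real n powr (1 / 4) * (ln (real n))^2 * weight_variation W n) \<longlonglongrightarrow> 0"
  shows "weight_variation W \<longlonglongrightarrow> 0"
proof (rule Lim_null_comparison[OF _ assms])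
  show "\<forall>\<^sub>F n in sequentially. norm (weight_variation W n) \<le> real n powr (1 / 4) * (ln (real n))^2 * weight_variation W n"
    using eventually_ge_at_top[of 3]
  proof eventually_elim
    case (elim n)
    have w: "0 \<le> weight_variation W n" by (simp add: weight_variation_def sum_nonneg)
    have "exp 1 \<le> real n" using exp_le elim by linarith
    then have "1 \<le> ln (real n)" using elim by (simp add: ln_ge_iff)
    then have "1 * 1 \<le> real n powr (1 / 4) * (ln (real n))^2" using elim by (intro mult_mono ge_one_powr_ge_zero) (auto simp: one_le_power)
    then show ?case using mult_right_mono[of 1 "real n powr (1 / 4) * (ln (real n))^2" "weight_variation W n"] w by simp
  qed
qed

lemma log_window_tendsto: "\<delta> > 0 \<Longrightarrow> filterlim (\<lambda>n. ln (real n) powr (1 + \<delta>)) at_top sequentially"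
proof -
  assume d: "\<delta> > 0"
  have l: "filterlim (\<lambda>n. ln (real n)) at_top sequentially" by (rule filterlim_compose[OF ln_at_top filterlim_real_sequentially])
  then have "\<forall>\<^sub>F n in sequentially. 1 \<le> ln (real n)" unfolding filterlim_at_top by blast
  then have "\<forall>\<^sub>F n in sequentially. ln (real n) \<le> ln (real n) powr (1 + \<delta>)"
    by eventually_elim (use d powr_mono[of 1 "1 + \<delta>"] in force)
  with l show ?thesis by (rule filterlim_at_top_mono)
qed

section \<open>The piecewise locally stationary model\<close>

lemma pls_knots_mono: fixes d :: "nat \<Rightarrow> real" assumes "\<forall>j\<le>r. d j < d (j + 1)" "a \<le> b" "b \<le> r + 1" shows "d a \<le> d b"
  using assms(2,3)
proof (induction b rule: dec_induct)
  case (step m) then show ?case using assms(1) by (metis Suc_eq_plus1 Suc_le_mono less_imp_le order_trans Suc_leD)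
qed simp

lemma pls_process_eq:
  assumes d: "d 0 = 0" "d (r + 1) = 1" "\<forall>j\<le>r. d j < d (j + 1)" and n: "n \<ge> 1" "k \<in> {1..n}"
  shows "\<exists>j\<le>r. grid n k \<in> {d j<..d (j + 1)} \<and> (\<forall>\<omega>. pls_process \<epsilon> r d G n k \<omega> = G j (grid n k) (past \<epsilon> (int k) \<omega>))"
proof -
  have t: "0 < grid n k" "grid n k \<le> 1" using n by (auto simp: grid_def)
  define j where "j = (LEAST j. grid n k \<le> d (j + 1))"
  have j1: "grid n k \<le> d (j + 1)" and jr: "j \<le> r" unfolding j_def
    using LeastI[of "\<lambda>j. grid n k \<le> d (j + 1)" r] Least_le[of "\<lambda>j. grid n k \<le> d (j + 1)" r] t d by auto
  have j0: "d j < grid n k"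
  proof (cases j)
    case 0 then show ?thesis using t d by simp
  next
    case (Suc i)
    then show ?thesis using not_less_Least[of i "\<lambda>j. grid n k \<le> d (j + 1)", folded j_def] by simp
  qed
  have uniq: "i = j" if "i \<le> r" "grid n k \<in> {d i<..d (i + 1)}" for i
  proof (rule ccontr)
    assume "i \<noteq> j"
    then consider "i + 1 \<le> j" | "j + 1 \<le> i" by linarith
    then show False
    proof cases
      case 1
      then have "d (i + 1) \<le> d j" using jr by (intro pls_knots_mono[OF d(3)]) auto
      then show ?thesis using that(2) j0 by simp
    next
      case 2
      then have "d (j + 1) \<le> d i" using that(1) by (intro pls_knots_mono[OF d(3)]) auto
      then show ?thesis using that(2) j1 by simp
    qed
  qed
  have "pls_process \<epsilon> r d G n k \<omega> = G j (grid n k) (past \<epsilon> (int k) \<omega>)" for \<omega>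
  proof -
    have "pls_process \<epsilon> r d G n k \<omega> = (\<Sum>i=0..r. if i = j then G i (grid n k) (past \<epsilon> (int k) \<omega>) else 0)"
      unfolding pls_process_def
    proof (intro sum.cong refl)
      fix i assume "i \<in> {0..r}"
      then show "G i (grid n k) (past \<epsilon> (int k) \<omega>) * indicator {d i<..d (i + 1)} (grid n k) = (if i = j then G i (grid n k) (past \<epsilon> (int k) \<omega>) else 0)"
        using uniq[of i] j0 j1 by (cases "i = j") (auto simp: indicator_def)
    qed
    then show ?thesis using jr by (simp del: One_nat_def)
  qed
  with jr j0 j1 show ?thesis by (intro exI[of _ j]) simp
qed

text \<open>The model supplies a law of innovations and identifies the coupled pasts of the dependence measure with
  the abstract coupling.\<close>
locale pls =
  fixes M :: "'w measure" and \<epsilon> \<epsilon>' :: "int \<Rightarrow> 'w \<Rightarrow> real" and r d G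
  assumes model: "pls_model M \<epsilon> \<epsilon>' r d G"
begin

definition \<mu> :: "real measure" where "\<mu> = distr M borel (\<epsilon> 0)"

sublocale M: prob_space M using model by (simp add: pls_model_def)

lemma noise_measurable: "case_sum \<epsilon> \<epsilon>' c \<in> borel_measurable M"
  using model by (auto simp: pls_model_def M.indep_vars_def)

lemma noise_law: "distr M borel (case_sum \<epsilon> \<epsilon>' c) = \<mu>"
  using model by (cases c) (auto simp: pls_model_def \<mu>_def)

sublocale iid_law \<mu>
proof (rule iid_law.intro)
  show "prob_space \<mu>" using M.prob_space_distr[OF noise_measurable[of "Inl 0"]] by (simp add: \<mu>_def)
  show "iid_law_axioms \<mu>" by unfold_locales (simp add: \<mu>_def)
qed

text \<open>Any distinct innovations, original or copied, form an i.i.d. family.\<close>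
lemma noise_joint_law:
  fixes \<sigma> :: "'k \<Rightarrow> int + int"
  assumes "inj \<sigma>"
  shows "(\<lambda>\<omega> k. case_sum \<epsilon> \<epsilon>' (\<sigma> k) \<omega>) \<in> M \<rightarrow>\<^sub>M (\<Pi>\<^sub>M k\<in>UNIV. \<mu>)"
    and "distr M (\<Pi>\<^sub>M k\<in>UNIV. \<mu>) (\<lambda>\<omega> k. case_sum \<epsilon> \<epsilon>' (\<sigma> k) \<omega>) = (\<Pi>\<^sub>M k\<in>UNIV. \<mu>)"
proof -
  have noise_measurable': "case_sum \<epsilon> \<epsilon>' c \<in> M \<rightarrow>\<^sub>M \<mu>" for c using noise_measurable[of c] by (simp add: measurable_cong_sets[OF refl sets_law])
  then have m: "(\<lambda>\<omega> k. case_sum \<epsilon> \<epsilon>' (\<sigma> k) \<omega>) \<in> M \<rightarrow>\<^sub>M (\<Pi>\<^sub>M k\<in>UNIV. \<mu>)" for \<sigma> :: "'l \<Rightarrow> int + int"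
    by (intro measurable_PiM_single') auto
  show "(\<lambda>\<omega> k. case_sum \<epsilon> \<epsilon>' (\<sigma> k) \<omega>) \<in> M \<rightarrow>\<^sub>M (\<Pi>\<^sub>M k\<in>UNIV. \<mu>)" by (rule m)
  have "M.indep_vars (\<lambda>_. borel) (case_sum \<epsilon> \<epsilon>') UNIV" using model by (simp add: pls_model_def)
  then have "distr M (\<Pi>\<^sub>M c\<in>UNIV. borel) (\<lambda>\<omega>. \<lambda>c\<in>UNIV. case_sum \<epsilon> \<epsilon>' c \<omega>) = (\<Pi>\<^sub>M c\<in>UNIV. distr M borel (case_sum \<epsilon> \<epsilon>' c))"
    by (subst (asm) M.indep_vars_iff_distr_eq_PiM) (auto intro: noise_measurable)
  then have "distr M (\<Pi>\<^sub>M c\<in>UNIV. borel) (\<lambda>\<omega> c. case_sum \<epsilon> \<epsilon>' c \<omega>) = (\<Pi>\<^sub>M c\<in>UNIV. \<mu>)" by (simp add: noise_law restrict_def)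
  moreover have "distr M (\<Pi>\<^sub>M c\<in>UNIV. borel) (\<lambda>\<omega> c. case_sum \<epsilon> \<epsilon>' c \<omega>) = distr M (\<Pi>\<^sub>M c\<in>UNIV. \<mu>) (\<lambda>\<omega> c. case_sum \<epsilon> \<epsilon>' c \<omega>)"
    by (intro distr_cong sets_PiM_cong) (auto simp: sets_law)
  ultimately have law: "distr M (\<Pi>\<^sub>M c\<in>(UNIV :: (int + int) set). \<mu>) (\<lambda>\<omega> c. case_sum \<epsilon> \<epsilon>' c \<omega>) = (\<Pi>\<^sub>M c\<in>UNIV. \<mu>)" by simp
  have "distr M (\<Pi>\<^sub>M k\<in>UNIV. \<mu>) (\<lambda>\<omega> k. case_sum \<epsilon> \<epsilon>' (\<sigma> k) \<omega>)
      = distr (distr M (\<Pi>\<^sub>M c\<in>(UNIV :: (int + int) set). \<mu>) (\<lambda>\<omega> c. case_sum \<epsilon> \<epsilon>' c \<omega>)) (\<Pi>\<^sub>M k\<in>UNIV. \<mu>) (\<lambda>w k. w (\<sigma> k))"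
    by (subst distr_distr[OF measurable_PiM_reindex m[of "\<lambda>c. c"]]) (simp add: comp_def)
  also have "\<dots> = (\<Pi>\<^sub>M k\<in>UNIV. \<mu>)" unfolding law by (rule iid_reindex[OF prob_space_axioms assms])
  finally show "distr M (\<Pi>\<^sub>M k\<in>UNIV. \<mu>) (\<lambda>\<omega> k. case_sum \<epsilon> \<epsilon>' (\<sigma> k) \<omega>) = (\<Pi>\<^sub>M k\<in>UNIV. \<mu>)" .
qed

lemma past_law: "past \<epsilon> n \<in> M \<rightarrow>\<^sub>M S" "distr M S (past \<epsilon> n) = S"
proof -
  have i: "inj (\<lambda>i. Inl (n - int i) :: int + int)" by (auto simp: inj_def)
  show "past \<epsilon> n \<in> M \<rightarrow>\<^sub>M S" "distr M S (past \<epsilon> n) = S"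
    using noise_joint_law[OF i] by (simp_all add: past_def[abs_def])
qed

lemma past_shift: "k \<le> n \<Longrightarrow> past \<epsilon> (int k) \<omega> = shift (n - k) (past \<epsilon> (int n) \<omega>)"
  by (auto simp: past_def shift_def fun_eq_iff of_nat_diff intro!: arg_cong[where f="\<lambda>i. \<epsilon> i \<omega>"])

lemma past_mom: assumes "f \<in> borel_measurable S" shows "mom_le S p f a \<longleftrightarrow> mom_le M p (\<lambda>\<omega>. f (past \<epsilon> n \<omega>)) a"
  using mom_le_distr[OF past_law(1)[of n] assms, of p a] by (simp only: past_law(2))

lemma past_integral:
  fixes f :: "rseq \<Rightarrow> 'b :: {banach, second_countable_topology}"
  assumes "f \<in> borel_measurable S" shows "(LINT \<omega>|M. f (past \<epsilon> n \<omega>)) = (LINT e|S. f e)"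
  using integral_distr[OF past_law(1)[of n] assms] by (simp only: past_law(2))

lemma infl_of_coupling:
  assumes f: "f \<in> borel_measurable S" and m: "mom_le M p (\<lambda>\<omega>. f (past \<epsilon> 0 \<omega>) - f (coupled_past \<epsilon> \<epsilon>' l \<omega>)) a"
  shows "infl p f l a"
proof -
  define \<sigma> :: "nat + nat \<Rightarrow> int + int" where "\<sigma> = map_sum (\<lambda>i. - int i) (\<lambda>i. - int i)"
  have inj: "inj \<sigma>" unfolding \<sigma>_def by (intro sum.inj_map) (simp_all add: inj_def)
  define T where "T \<omega> k = case_sum \<epsilon> \<epsilon>' (\<sigma> k) \<omega>" for \<omega> k
  have T: "T \<in> M \<rightarrow>\<^sub>M S2" "distr M S2 T = S2" using noise_joint_law[OF inj] by (simp_all add: T_def[abs_def])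
  have eq: "mix {} (T \<omega>) = past \<epsilon> 0 \<omega>" "mix {l} (T \<omega>) = coupled_past \<epsilon> \<epsilon>' l \<omega>" for \<omega>
    by (auto simp: mix_def T_def \<sigma>_def past_def coupled_past_def fun_eq_iff)
  have fm: "(\<lambda>w. f (mix {} w) - f (mix {l} w)) \<in> borel_measurable S2" using f by measurable
  show ?thesis unfolding infl_def
    using mom_le_distr[OF T(1) fm, of p a] m by (simp add: T(2) eq)
qed

lemma filter_measurable:
  assumes "j \<le> r" "t \<in> {d j..d (j + 1)}" shows "G j t \<in> borel_measurable S"
proof -
  have "(\<lambda>(t, x). G j t x) \<in> borel_measurable (restrict_space borel {d j..d (j + 1)} \<Otimes>\<^sub>M (\<Pi>\<^sub>M i\<in>UNIV. borel))"
    using model assms(1) by (simp add: pls_model_def)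
  from measurable_Pair2[OF this, of t] have "G j t \<in> borel_measurable (\<Pi>\<^sub>M i\<in>UNIV. borel)" using assms(2) by (simp add: space_restrict_space)
  moreover have sets: "sets S = sets (\<Pi>\<^sub>M i\<in>(UNIV :: nat set). (borel :: real measure))" by (intro sets_PiM_cong) (auto simp: sets_law)
  ultimately show ?thesis unfolding measurable_cong_sets[OF sets refl] by simp
qed

end

context iid_law begin

text \<open>The comparison with the zero matrix and the frequency zero.\<close>
lemma wform_first_moment:
  assumes obs: "\<And>k. k \<in> {1..n} \<Longrightarrow> good_obs L dL CL K \<rho> (F k)" and CL: "0 \<le> CL" "0 \<le> K" "0 < \<rho>" "\<rho> < 1" and L: "L \<in> borel_measurable borel"
    and s: "0 < s" "s \<le> 1" and r: "r = \<rho> powr (s / 2)"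
    and g: "integrable lborel g" and gw: "integrable lborel (wmass s g)" and c: "hs n A \<le> c"
  shows "mom_le S 1 (centred (wform n A L F g)) (2 * (4 * (3 / (1 - r)^2 * (osc_const CL K)^2) * ((5 + 4 / (1 - r)) * c) * (integral\<^sup>L lborel (wmass s g))))"
    and "integrable S (wform n A L F g)"
proof -
  have r0: "0 \<le> r" "r < 1" using CL s powr_less_mono2[of "s / 2" \<rho> 1] by (auto simp: r)
  define \<kappa> where "\<kappa> = 3 / (1 - r)^2 * (osc_const CL K)^2"
  have \<kappa>0: "0 \<le> \<kappa>" by (simp add: \<kappa>_def)
  let ?A' = "\<lambda>_ _. 0 :: real" and ?\<pi> = "\<lambda>_. 0 :: real"
  have mean: "(LINT e|S. aform n ?A' 0 L F (ph u) (ph v) a b e) = 0" for u v a b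
    by (simp add: form_def)
  have \<pi>: "?\<pi> \<in> borel_measurable borel" "finite (range ?\<pi>)" "\<And>x. \<bar>?\<pi> x\<bar> \<le> \<bar>x\<bar>" by auto
  note err = wform_error[where F=F and A=A and n=n and m=0 and A'="?A'" and \<pi>="?\<pi>", OF obs CL L s r g gw \<pi> mean]
  show "integrable S (wform n A L F g)" by (rule err(1))
  have h0: "0 \<le> hs n A" by (simp add: hs_def sum_nonneg)
  define B where "B z = 4 * err_kernel (osc_const CL K) s r 0 (\<lambda>_. 0) (hs n A) (hs n (\<lambda>k j. A k j - 0)) g z" for z :: "real \<times> real"
  have "(\<lambda>e. centred (wform n A L F g) e - dform n ?A' L F g ?\<pi> 0 e) = centred (wform n A L F g)"
    by (simp add: dform_def form_def)
  then have B1: "mom_le S 1 (centred (wform n A L F g)) (2 * (LINT z|lborel. B z))" using err(2) by (simp add: B_def)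
  have le: "B z \<le> 4 * \<kappa> * ((5 + 4 / (1 - r)) * c) * (wmass s g z)" for z
  proof -
    have "(2 * min 1 (sqrt \<bar>fst z - 0\<bar>) + 2 * min 1 (sqrt \<bar>snd z - 0\<bar>) + 4 * r ^ 0 / (1 - r)) * hs n A + hs n A \<le> (2 * 1 + 2 * 1 + 4 / (1 - r)) * c + c"
      using r0 h0 c by (intro add_mono mult_mono add_nonneg_nonneg) auto
    also have "\<dots> = (5 + 4 / (1 - r)) * c" by (simp add: algebra_simps)
    finally have "4 * \<kappa> * (wmass s g z) * ((2 * min 1 (sqrt \<bar>fst z - 0\<bar>) + 2 * min 1 (sqrt \<bar>snd z - 0\<bar>) + 4 * r ^ 0 / (1 - r)) * hs n A + hs n A)
       \<le> 4 * \<kappa> * (wmass s g z) * ((5 + 4 / (1 - r)) * c)"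
      using \<kappa>0 by (intro mult_left_mono) (auto simp: wt_def)
    then show ?thesis by (simp add: B_def \<kappa>_def mult_ac)
  qed
  have "(LINT z|lborel. B z) \<le> (LINT z|lborel. 4 * \<kappa> * ((5 + 4 / (1 - r)) * c) * (wmass s g z))"
  proof (rule integral_mono')
    show "integrable lborel (\<lambda>z. 4 * \<kappa> * ((5 + 4 / (1 - r)) * c) * (wmass s g z))"
      by (intro integrable_mult_right gw)
    show "0 \<le> 4 * \<kappa> * ((5 + 4 / (1 - r)) * c) * (wmass s g z)" for z :: "real \<times> real"
      using r0 h0 c \<kappa>0 by (intro mult_nonneg_nonneg) (auto simp: wt_def)
  qed (rule le)
  then have "2 * (LINT z|lborel. B z) \<le> 2 * (4 * \<kappa> * ((5 + 4 / (1 - r)) * c) * (integral\<^sup>L lborel (wmass s g)))"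
    unfolding integral_mult_right_zero by linarith
  from mom_le_weaken[OF B1 this]
  show "mom_le S 1 (centred (wform n A L F g)) (2 * (4 * (3 / (1 - r)^2 * (osc_const CL K)^2) * ((5 + 4 / (1 - r)) * c) * (integral\<^sup>L lborel (wmass s g))))"
    unfolding \<kappa>_def .
qed

end

lemma uniform_momentD:
  assumes "uniform_moment M X p f"
  shows "\<exists>a>0. \<forall>n\<ge>1. \<forall>k\<in>{1..n}. Lp_norm M p (\<lambda>\<omega>. f (X n k \<omega>)) \<le> ennreal a"
proof -
  define T where "T = (SUP n\<in>{1..}. SUP j\<in>{1..n}. Lp_norm M p (\<lambda>\<omega>. f (X n j \<omega>)))"
  have T: "T < \<infinity>" using assms by (simp add: uniform_moment_def T_def)
  have "Lp_norm M p (\<lambda>\<omega>. f (X n k \<omega>)) \<le> ennreal (enn2real T + 1)" if "n \<ge> 1" "k \<in> {1..n}" for n k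
  proof -
    have "Lp_norm M p (\<lambda>\<omega>. f (X n k \<omega>)) \<le> T" unfolding T_def
      by (rule SUP_upper2[of n]) (use that in \<open>auto intro!: SUP_upper2[of k]\<close>)
    also have "T = ennreal (enn2real T)" using T by simp
    also have "\<dots> \<le> ennreal (enn2real T + 1)" by (intro ennreal_leI) simp
    finally show ?thesis .
  qed
  then show ?thesis by (intro exI[of _ "enn2real T + 1"]) (auto intro: add_nonneg_pos)
qed

context pls begin

lemma dep_measure_bound:
  assumes "j \<le> r" "t \<in> {d j<..d (j + 1)}"
  shows "Lp_norm M p (\<lambda>\<omega>. G j t (past \<epsilon> 0 \<omega>) - G j t (coupled_past \<epsilon> \<epsilon>' k \<omega>)) \<le> dep_measure M \<epsilon> \<epsilon>' r d G k p"
  unfolding dep_measure_def by (rule SUP_upper2[of j]) (use assms in \<open>auto intro!: SUP_upper2[of t]\<close>)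

lemma coupled_past_measurable: "coupled_past \<epsilon> \<epsilon>' k \<in> M \<rightarrow>\<^sub>M S"
proof -
  have "inj (\<lambda>i. if i = k then Inr (- int k) else Inl (- int i) :: int + int)" by (auto simp: inj_def split: if_splits)
  from noise_joint_law(1)[OF this] show ?thesis
    by (rule measurable_cong[THEN iffD1, rotated]) (auto simp: coupled_past_def past_def fun_eq_iff)
qed

text \<open>Writing \<open>beta\<close> through its cosine and sine parts turns the double sum into four real forms; the past of
  time \<open>k\<close> is the shifted past of time \<open>n\<close>.\<close>
lemma D_stat_eq_wform:
  assumes n: "n \<ge> 1" and X: "\<And>k \<omega>. k \<in> {1..n} \<Longrightarrow> X n k \<omega> = F k (past \<epsilon> (int k) \<omega>)"
    and L: "L \<in> borel_measurable borel" and F: "\<And>k. k \<in> {1..n} \<Longrightarrow> F k \<in> borel_measurable S"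
    and m: "\<And>k. k \<in> {1..n} \<Longrightarrow> mom_le S 4 (\<lambda>e. L (F k e)) K" and g: "integrable lborel g"
  shows "D_stat M L g W X n \<omega> = wform n (\<lambda>k j. W n (grid n k) (grid n j)) L F g (past \<epsilon> (int n) \<omega>)"
proof -
  have [measurable]: "L \<in> borel_measurable borel" "g \<in> borel_measurable lborel" using L g by auto
  let ?A = "\<lambda>k j. W n (grid n k) (grid n j)"
  define e where "e = past \<epsilon> (int n) \<omega>"
  define P where "P u x k = proc n (\<lambda>k. osc L (ph u) x (F k)) k e" for u x k
  have gam_eq: "gam M L (X n k) x \<omega> = complex_of_real (P False x k) + \<i> * complex_of_real (P True x k)" if k: "k \<in> {1..n}" for k x
  proof -
    have [measurable]: "F k \<in> borel_measurable S" by (rule F[OF k])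
    have b: "beta L (X n k) x \<omega> = complex_of_real (osc L (ph False) x (F k) (past \<epsilon> (int k) \<omega>)) + \<i> * complex_of_real (osc L (ph True) x (F k) (past \<epsilon> (int k) \<omega>))" for \<omega>
      by (simp add: beta_def X[OF k] osc_def ph_def complex_eq_iff Re_exp Im_exp cos_diff)
    have om: "osc L p x (F k) \<in> borel_measurable S" for p unfolding osc_def[abs_def] by measurable
    have om4: "mom_le S 4 (osc L p x (F k)) K" for p
      by (rule mom_le_mono[OF m[OF k] om]) (auto simp: osc_def abs_mult mult_left_le)
    have i: "integrable M (\<lambda>\<omega>. osc L p x (F k) (past \<epsilon> (int k) \<omega>))" for p
      using M.mom_le_integrable(1)[OF M.mom_le_4_2] om4[of p] past_mom[OF om] by blast
    have "(LINT \<omega>|M. beta L (X n k) x \<omega>) = complex_of_real (LINT e|S. osc L (ph False) x (F k) e) + \<i> * complex_of_real (LINT e|S. osc L (ph True) x (F k) e)"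
      unfolding b using i by (simp add: past_integral[OF om])
    moreover have "past \<epsilon> (int k) \<omega> = shift (n - k) e" unfolding e_def by (rule past_shift) (use k in simp)
    ultimately show ?thesis unfolding gam_def b P_def proc_def by (simp add: algebra_simps)
  qed
  define \<Phi> where "\<Phi> u v z = oform n ?A L F (ph u) (ph v) (fst z) (snd z) e" for u v and z :: "real \<times> real"
  have \<Phi>_eq: "\<Phi> u v z = (\<Sum>k=1..n. \<Sum>j=1..n. ?A k j * (P u (fst z) k * P v (snd z) j))" for u v z
    by (simp add: \<Phi>_def form_def P_def mult.assoc)
  have sum_eq: "(\<Sum>k=1..n. \<Sum>j=1..n. complex_of_real (?A k j) * gam M L (X n k) (fst z) \<omega> * gam M L (X n j) (snd z) \<omega>)
      = complex_of_real (\<Phi> False False z - \<Phi> True True z) + \<i> * complex_of_real (\<Phi> False True z + \<Phi> True False z)" for z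
  proof -
    have "(\<Sum>k=1..n. \<Sum>j=1..n. complex_of_real (?A k j) * gam M L (X n k) (fst z) \<omega> * gam M L (X n j) (snd z) \<omega>)
      = (\<Sum>k=1..n. \<Sum>j=1..n. complex_of_real (?A k j * (P False (fst z) k * P False (snd z) j) - ?A k j * (P True (fst z) k * P True (snd z) j))
          + \<i> * complex_of_real (?A k j * (P False (fst z) k * P True (snd z) j) + ?A k j * (P True (fst z) k * P False (snd z) j)))"
      by (intro sum.cong refl) (simp add: gam_eq complex_eq_iff algebra_simps)
    also have "\<dots> = complex_of_real (\<Phi> False False z - \<Phi> True True z) + \<i> * complex_of_real (\<Phi> False True z + \<Phi> True False z)"
      unfolding \<Phi>_eq by (simp only: sum.distrib sum_subtractf of_real_sum of_real_add of_real_diff sum_distrib_left[symmetric])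
    finally show ?thesis .
  qed
  have i\<Phi>: "integrable lborel (\<lambda>z. g z * complex_of_real (\<Phi> u v z))" for u v
  proof (rule Bochner_Integration.integrable_bound)
    show "integrable lborel (\<lambda>z. cmod (g z) * envelope n ?A L F e)" using g by (intro integrable_mult_left integrable_norm)
    have "(\<lambda>(z, e). oform n ?A L F (ph u) (ph v) (fst z) (snd z) e) \<in> borel_measurable ((lborel :: (real \<times> real) measure) \<Otimes>\<^sub>M S)"
      by (rule form_joint(1)[OF L F]) (assumption, measurable)
    from measurable_Pair1[OF this, of e] have "\<Phi> u v \<in> borel_measurable lborel" by (simp add: \<Phi>_def[abs_def])
    then show "(\<lambda>z. g z * complex_of_real (\<Phi> u v z)) \<in> borel_measurable lborel" by measurable
    show "AE z in lborel. norm (g z * complex_of_real (\<Phi> u v z)) \<le> norm (cmod (g z) * envelope n ?A L F e)"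
    proof (rule AE_I2)
      fix z
      have b: "\<bar>\<Phi> u v z\<bar> \<le> envelope n ?A L F e" unfolding \<Phi>_def by (rule form_le_envelope(2)[OF L F m])
      have "norm (g z * complex_of_real (\<Phi> u v z)) = cmod (g z) * \<bar>\<Phi> u v z\<bar>" by (simp add: norm_mult)
      also have "\<dots> \<le> cmod (g z) * envelope n ?A L F e" using b by (intro mult_left_mono) auto
      finally show "norm (g z * complex_of_real (\<Phi> u v z)) \<le> norm (cmod (g z) * envelope n ?A L F e)" by simp
    qed
  qed
  have int: "integrable lborel (\<lambda>z. g z * (\<Sum>k=1..n. \<Sum>j=1..n. complex_of_real (?A k j) * gam M L (X n k) (fst z) \<omega> * gam M L (X n j) (snd z) \<omega>))"
  proof -
    have "integrable lborel (\<lambda>z. g z * complex_of_real (\<Phi> False False z) - g z * complex_of_real (\<Phi> True True z)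
        + \<i> * (g z * complex_of_real (\<Phi> False True z) + g z * complex_of_real (\<Phi> True False z)))"
      by (intro Bochner_Integration.integrable_add Bochner_Integration.integrable_diff integrable_mult_right i\<Phi>)
    then show ?thesis unfolding sum_eq by (simp add: algebra_simps)
  qed
  have "D_stat M L g W X n \<omega> = (LINT z|lborel. Re (g z * (\<Sum>k=1..n. \<Sum>j=1..n. complex_of_real (?A k j) * gam M L (X n k) (fst z) \<omega> * gam M L (X n j) (snd z) \<omega>)))"
    unfolding D_stat_def by (rule integral_Re[OF int, symmetric])
  also have "\<dots> = wform n ?A L F g e"
    unfolding wform_def \<Phi>_def[symmetric] sum_eq
    by (intro Bochner_Integration.integral_cong refl) (simp add: UNIV_bool gc_def algebra_simps)
  finally show ?thesis by (simp add: e_def)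
qed

text \<open>Constants are taken uniformly over the triangular array. The rate is raised to at least \<open>1/2\<close> so that it is
  positive.\<close>
lemma good_obs_of_model:
  assumes p: "8 \<le> p" and L: "controlled_deriv L"
    and mom: "\<And>f. f \<in> {L, \<lambda>x. x * L x, deriv L} \<Longrightarrow> uniform_moment M (pls_process \<epsilon> r d G) p f"
    and \<rho>: "0 \<le> \<rho>" "\<rho> < 1" and dep: "\<And>k. dep_measure M \<epsilon> \<epsilon>' r d G k p \<le> ennreal (C * \<rho> ^ k)"
  shows "\<exists>F CL K q. 0 \<le> CL \<and> 0 \<le> K \<and> 0 < q \<and> q < 1 \<and>
    (\<forall>n\<ge>1. \<forall>k\<in>{1..n}. good_obs L (deriv L) CL K q (F n k) \<and> (\<forall>\<omega>. pls_process \<epsilon> r d G n k \<omega> = F n k (past \<epsilon> (int k) \<omega>)))"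
proof -
  have d: "d 0 = 0" "d (r + 1) = 1" "\<forall>j\<le>r. d j < d (j + 1)" using model by (auto simp: pls_model_def)
  have "\<forall>n k. \<exists>j. n \<ge> 1 \<and> k \<in> {1..n} \<longrightarrow> j \<le> r \<and> grid n k \<in> {d j<..d (j + 1)} \<and> (\<forall>\<omega>. pls_process \<epsilon> r d G n k \<omega> = G j (grid n k) (past \<epsilon> (int k) \<omega>))"
    using pls_process_eq[OF d, where \<epsilon>=\<epsilon> and G=G] by blast
  then obtain J where J: "\<And>n k. n \<ge> 1 \<Longrightarrow> k \<in> {1..n} \<Longrightarrow> J n k \<le> r \<and> grid n k \<in> {d (J n k)<..d (J n k + 1)} \<and>
      (\<forall>\<omega>. pls_process \<epsilon> r d G n k \<omega> = G (J n k) (grid n k) (past \<epsilon> (int k) \<omega>))"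
    by metis
  define F where "F n k = G (J n k) (grid n k)" for n k
  have F: "F n k \<in> borel_measurable S" if "n \<ge> 1" "k \<in> {1..n}" for n k
    unfolding F_def by (rule filter_measurable) (use J[OF that] in auto)
  have X: "pls_process \<epsilon> r d G n k \<omega> = F n k (past \<epsilon> (int k) \<omega>)" if "n \<ge> 1" "k \<in> {1..n}" for n k \<omega>
    using J[OF that] by (simp add: F_def)
  have diff: "L differentiable (at x)" for x using L by (simp add: controlled_deriv_def)
  note [measurable] = borel_measurable_deriv[OF diff]
  have fm: "f \<in> borel_measurable borel" if "f \<in> {L, \<lambda>x. x * L x, deriv L}" for f :: "real \<Rightarrow> real"
    using that by auto
  have "\<exists>a. \<forall>n\<ge>1. \<forall>k\<in>{1..n}. mom_le S 8 (\<lambda>e. f (F n k e)) a" if f: "f \<in> {L, \<lambda>x. x * L x, deriv L}" for f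
  proof -
    obtain a where a: "a > 0" "\<And>n k. n \<ge> 1 \<Longrightarrow> k \<in> {1..n} \<Longrightarrow> Lp_norm M p (\<lambda>\<omega>. f (pls_process \<epsilon> r d G n k \<omega>)) \<le> ennreal a"
      using uniform_momentD[OF mom[OF f]] by blast
    have "mom_le S 8 (\<lambda>e. f (F n k e)) (2 * a)" if nk: "n \<ge> 1" "k \<in> {1..n}" for n k
    proof -
      have [measurable]: "F n k \<in> borel_measurable S" "f \<in> borel_measurable borel" by (rule F[OF nk], rule fm[OF f])
      have fF: "(\<lambda>e. f (F n k e)) \<in> borel_measurable S" by measurable
      have "Lp_norm M p (\<lambda>\<omega>. f (F n k (past \<epsilon> (int k) \<omega>))) \<le> ennreal a" using a(2)[OF nk] by (simp add: X[OF nk])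
      then have "mom_le M 8 (\<lambda>\<omega>. f (F n k (past \<epsilon> (int k) \<omega>))) (2 * a)"
        by (rule mom_le_of_Lp_norm[OF M.prob_space_axioms measurable_compose[OF past_law(1) fF] p a(1)])
      then show ?thesis by (simp only: past_mom[OF fF, of 8 "2 * a" "int k"])
    qed
    then show ?thesis by blast
  qed
  then have ex: "\<exists>a. \<forall>n\<ge>1. \<forall>k\<in>{1..n}. mom_le S 8 (\<lambda>e. L (F n k e)) a" "\<exists>a. \<forall>n\<ge>1. \<forall>k\<in>{1..n}. mom_le S 8 (\<lambda>e. F n k e * L (F n k e)) a"
      "\<exists>a. \<forall>n\<ge>1. \<forall>k\<in>{1..n}. mom_le S 8 (\<lambda>e. deriv L (F n k e)) a" by auto
  obtain a1 where a1: "\<And>n k. n \<ge> 1 \<Longrightarrow> k \<in> {1..n} \<Longrightarrow> mom_le S 8 (\<lambda>e. L (F n k e)) a1" using ex(1) by blast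
  obtain a2 where a2: "\<And>n k. n \<ge> 1 \<Longrightarrow> k \<in> {1..n} \<Longrightarrow> mom_le S 8 (\<lambda>e. F n k e * L (F n k e)) a2" using ex(2) by blast
  obtain a3 where a3: "\<And>n k. n \<ge> 1 \<Longrightarrow> k \<in> {1..n} \<Longrightarrow> mom_le S 8 (\<lambda>e. deriv L (F n k e)) a3" using ex(3) by blast
  define q where "q = max \<rho> (1 / 2)"
  define a4 where "a4 = max C 1"
  have q: "0 < q" "q < 1" "\<rho> \<le> q" using \<rho> by (auto simp: q_def)
  have i8: "infl 8 (F n k) l (2 * (a4 * q ^ l))" if nk: "n \<ge> 1" "k \<in> {1..n}" for n k l
  proof (rule infl_of_coupling[OF F[OF nk]], rule mom_le_of_Lp_norm[OF M.prob_space_axioms _ p])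
    show "(\<lambda>\<omega>. F n k (past \<epsilon> 0 \<omega>) - F n k (coupled_past \<epsilon> \<epsilon>' l \<omega>)) \<in> borel_measurable M"
      by (intro borel_measurable_diff measurable_compose[OF past_law(1) F[OF nk]] measurable_compose[OF coupled_past_measurable F[OF nk]])
    show "0 < a4 * q ^ l" using q by (simp add: a4_def)
    have "Lp_norm M p (\<lambda>\<omega>. F n k (past \<epsilon> 0 \<omega>) - F n k (coupled_past \<epsilon> \<epsilon>' l \<omega>)) \<le> ennreal (C * \<rho> ^ l)"
      unfolding F_def by (rule order_trans[OF dep_measure_bound dep]) (use J[OF nk] in auto)
    also have "C * \<rho> ^ l \<le> a4 * q ^ l" unfolding a4_def using \<rho> q by (intro mult_mono power_mono) auto
    then have "ennreal (C * \<rho> ^ l) \<le> ennreal (a4 * q ^ l)" by (rule ennreal_leI)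
    finally show "Lp_norm M p (\<lambda>\<omega>. F n k (past \<epsilon> 0 \<omega>) - F n k (coupled_past \<epsilon> \<epsilon>' l \<omega>)) \<le> ennreal (a4 * q ^ l)" .
  qed
  obtain CL where CL: "0 \<le> CL" "\<And>a b. \<bar>L a - L b\<bar> \<le> \<bar>a - b\<bar> * (CL * (\<bar>deriv L a\<bar> + \<bar>deriv L b\<bar> + 1))"
    using controlled_deriv_lipschitz[OF L] by blast
  define K where "K = max (2 * a4) (max a1 (max a2 a3))"
  have K: "2 * a4 \<le> K" "a1 \<le> K" "a2 \<le> K" "a3 \<le> K" "0 \<le> K" by (auto simp: K_def a4_def)
  have "good_obs L (deriv L) CL K q (F n k)" if nk: "n \<ge> 1" "k \<in> {1..n}" for n k
    unfolding good_obs_def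
  proof (intro conjI allI)
    show "mom_le S 8 (\<lambda>e. deriv L (F n k e)) K" "mom_le S 8 (\<lambda>e. L (F n k e)) K" "mom_le S 8 (\<lambda>e. F n k e * L (F n k e)) K"
      using mom_le_weaken[OF a1[OF nk] K(2)] mom_le_weaken[OF a2[OF nk] K(3)] mom_le_weaken[OF a3[OF nk] K(4)] by auto
    show "infl 8 (F n k) l (K * q ^ l)" for l
      by (rule infl_weaken[OF i8[OF nk]]) (use K(1) q in \<open>simp add: mult.assoc[symmetric] mult_right_mono\<close>)
  qed (use CL K q F[OF nk] in auto)
  then show ?thesis using CL(1) K(5) q X by blast
qed

text \<open>First moments of both sequences are bounded uniformly, so closeness of characteristic functions suffices.
  The coefficients are padded with zeros, so the series over them are finite sums.\<close>
theorem D_stat_chaos_limit: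
  fixes W :: "nat \<Rightarrow> real \<Rightarrow> real \<Rightarrow> real" and L :: "real \<Rightarrow> real" and g :: "real \<times> real \<Rightarrow> complex" and C0 \<eta> p \<rho> \<delta> C :: real
  defines "X \<equiv> pls_process \<epsilon> r d G"
  assumes W_sym: "\<And>n s t. n \<ge> 1 \<Longrightarrow> s \<in> {0..1} \<Longrightarrow> t \<in> {0..1} \<Longrightarrow> W n s t = W n t s"
    and W_bound: "\<And>n. n \<ge> 1 \<Longrightarrow> (\<Sum>k=1..n. \<Sum>j=1..n. (W n (grid n k) (grid n j))^2) \<le> C0"
    and \<eta>: "0 < \<eta>" "\<eta> \<le> 1" and g: "integrable lborel g" "integrable lborel (\<lambda>z. norm z powr \<eta> * cmod (g z))"
    and p: "8 \<le> p" and L: "controlled_deriv L" and mom: "\<And>f. f \<in> {L, \<lambda>x. x * L x, deriv L} \<Longrightarrow> uniform_moment M X p f"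
    and \<rho>: "0 \<le> \<rho>" "\<rho> < 1" and dep: "\<And>k. dep_measure M \<epsilon> \<epsilon>' r d G k p \<le> ennreal (C * \<rho> ^ k)"
    and W_variation: "weight_variation W \<longlonglongrightarrow> 0"
    and \<delta>: "\<delta> > 0" and W_diagonal: "(\<lambda>n. \<Sum>j=1..n. sqrt (\<Sum>k\<in>log_window \<delta> n j.
      (W n (grid n j) (grid n j) - W n (grid n j) (grid n k))^2)) \<longlonglongrightarrow> 0"
  shows "\<exists>\<alpha> :: array.
    (\<forall>n. \<exists>p. \<forall>i\<ge>p. \<alpha> n i = 0) \<and> (\<exists>B. \<forall>n. (\<Sum>k. (\<alpha> n k)^2) \<le> B) \<and>
    (\<forall>h :: real \<Rightarrow> real. continuous_on UNIV h \<longrightarrow> bounded (range h) \<longrightarrow>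
      (\<lambda>n. (LINT \<omega>|M. h (D_stat M L g W X n \<omega> - (LINT \<omega>'|M. D_stat M L g W X n \<omega>'))) -
            (LINT z|gauss_seq. h (\<Sum>j. \<alpha> n j * ((z j)^2 - 1)))) \<longlonglongrightarrow> 0)"
proof -
  obtain F CL K q where CL: "0 \<le> CL" "0 \<le> K" "0 < q" "q < 1"
    and obs: "\<And>n k. n \<ge> 1 \<Longrightarrow> k \<in> {1..n} \<Longrightarrow> good_obs L (deriv L) CL K q (F n k)"
    and XF: "\<And>n k \<omega>. n \<ge> 1 \<Longrightarrow> k \<in> {1..n} \<Longrightarrow> X n k \<omega> = F n k (past \<epsilon> (int k) \<omega>)"
    using good_obs_of_model[OF p L mom[unfolded X_def] \<rho> dep] unfolding X_def by blast
  have Lm: "L \<in> borel_measurable borel" using L by (intro borel_measurable_deriv(1)) (auto simp: controlled_deriv_def)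
  define s where "s = \<eta> / 2"
  have s: "0 < s" "s \<le> 1" using \<eta> by (auto simp: s_def)
  have gw: "integrable lborel (wmass s g)" unfolding s_def by (rule wiener_weight_integrable[OF g \<eta>])
  define A where "A n k j = W n (grid n k) (grid n j)" for n k j
  have g01: "grid n k \<in> {0..1}" if "k \<in> {1..n}" for n k using that by (auto simp: grid_def)
  have sym: "A n k j = A n j k" if "n \<ge> 1" "k \<in> {1..n}" "j \<in> {1..n}" for n k j
    unfolding A_def using that g01 by (intro W_sym) auto
  have AC: "(\<Sum>k=1..n. \<Sum>j=1..n. (A n k j)^2) \<le> C0" if "n \<ge> 1" for n using W_bound[OF that] by (simp add: A_def)
  have near: "(\<lambda>n. \<Sum>k=1..n. \<Sum>j\<in>{j\<in>{1..n}. \<bar>real k - real j\<bar> \<le> R}. (A n k j)^2) \<longlonglongrightarrow> 0" for R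
    by (rule near_diagonal_small[OF AC log_window_tendsto[OF \<delta>]]) (use W_diagonal in \<open>simp_all add: A_def log_window_def\<close>)
  have V: "(\<Sum>j=1..n. (A n k j)^2) \<le> (weight_variation W n)^2" if "n \<ge> 1" "k \<in> {1..n}" for n k
  proof (rule sqrt_le_D)
    have "grid n n = 1" using that by (simp add: grid_def)
    then show "sqrt (\<Sum>j=1..n. (A n k j)^2) \<le> weight_variation W n"
      using row_le_variation[OF that(2), of "A n"] unfolding weight_variation_def A_def by simp
  qed
  define \<beta> where "\<beta> = 4 * (3 / (1 - q powr s)^2 * (osc_const CL K)^2 * (integral\<^sup>L lborel (wmass s g))) * sqrt C0"
  let ?w = "\<lambda>n. centred (wform n (A n) L (F n) g)"
  define P where "P x = (2 * (\<Sum>i<fst x. (snd x i)^2) \<le> \<beta>^2)" for x :: "nat \<times> rseq"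
  define R where "R n x b = (\<forall>t. cmod ((chf S (?w n) t) - (LINT z|gauss_seq. iexp (t * chaos (fst x) (snd x) z))) \<le> b * (abs t + abs t ^ 3))"
    for n and x :: "nat \<times> rseq" and b
  have ev: "\<forall>\<^sub>F n in sequentially. \<exists>x. P x \<and> R n x b" if "b > 0" for b
    using wform_chaos[where F=F and A=A, OF obs CL Lm s g(1) gw sym AC near V W_variation that] unfolding P_def R_def \<beta>_def
    by (rule eventually_mono) auto
  have mono: "R n x b'" if "R n x b" "b \<le> b'" for n x b b'
    unfolding R_def
  proof
    fix t show "cmod ((chf S (?w n) t) - (LINT z|gauss_seq. iexp (t * chaos (fst x) (snd x) z))) \<le> b' * (abs t + abs t ^ 3)"
      using order_trans[OF spec[OF that(1)[unfolded R_def], of t] mult_right_mono[OF that(2)]] by simp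
  qed
  have P0: "P (0, \<lambda>_. 0)" by (simp add: P_def)
  obtain Z where Z: "\<And>n. P (Z n)" "\<And>b. b > 0 \<Longrightarrow> \<forall>\<^sub>F n in sequentially. R n (Z n) b"
  proof -
    have "\<exists>Z. (\<forall>n. P (Z n)) \<and> (\<forall>b>0. \<forall>\<^sub>F n in sequentially. R n (Z n) b)"
      by (rule diagonal_choice[where R=R, OF ev _ P0]) (assumption, rule mono)
    then show thesis using that by blast
  qed
  define m a where "m n = fst (Z n)" and "a n = snd (Z n)" for n
  define \<alpha> where "\<alpha> n i = (if i < m n then a n i else 0)" for n i
  have \<alpha>0: "\<alpha> n i = 0" if "i \<ge> m n" for n i using that by (simp add: \<alpha>_def)
  have chaos_eq: "(\<Sum>j. \<alpha> n j * ((z j)^2 - 1)) = chaos (m n) (a n) z" for n z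
    using suminf_finite[of "{..<m n}" "\<lambda>j. \<alpha> n j * ((z j)^2 - 1)"] \<alpha>0 by (simp add: chaos_def \<alpha>_def)
  have sq: "(\<Sum>k. (\<alpha> n k)^2) = (\<Sum>i<m n. (a n i)^2)" for n
    using suminf_finite[of "{..<m n}" "\<lambda>k. (\<alpha> n k)^2"] \<alpha>0 by (simp add: \<alpha>_def)
  have Pm: "2 * (\<Sum>i<m n. (a n i)^2) \<le> \<beta>^2" for n using Z(1)[of n] by (simp add: P_def m_def a_def)
  define c1 where "c1 = 2 * (4 * (3 / (1 - q powr (s / 2))^2 * (osc_const CL K)^2) * ((5 + 4 / (1 - q powr (s / 2))) * sqrt C0) * (integral\<^sup>L lborel (wmass s g)))"
  define c where "c = max c1 \<bar>\<beta>\<bar>"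
  have wm1: "mom_le S 1 (?w n) c" and wi: "integrable S (wform n (A n) L (F n) g)" if n: "n \<ge> 1" for n
  proof -
    have h: "hs n (A n) \<le> sqrt C0" using AC[OF n] by (simp add: hs_def)
    have O: "good_obs L (deriv L) CL K q (F n k)" if "k \<in> {1..n}" for k by (rule obs[OF n that])
    note fm = wform_first_moment[where F="F n" and A="A n", OF O CL Lm s refl g(1) gw h]
    show "mom_le S 1 (?w n) c" by (rule mom_le_weaken[OF fm(1)]) (assumption, unfold c_def c1_def, rule max.cobounded1)
    show "integrable S (wform n (A n) L (F n) g)" by (rule fm(2))
  qed
  have cm1: "mom_le gauss_seq 1 (chaos (m n) (a n)) c" for n
  proof -
    have "mom_le gauss_seq 1 (chaos (m n) (a n)) (sqrt (2 * (\<Sum>i<m n. (a n i)^2)))"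
      by (rule gauss.S.mom_le_half) (use chaos_mom in simp)
    moreover have "sqrt (2 * (\<Sum>i<m n. (a n i)^2)) \<le> \<bar>\<beta>\<bar>" using real_sqrt_le_mono[OF Pm[of n]] by simp
    ultimately show ?thesis by (elim mom_le_weaken) (simp add: c_def)
  qed
  define \<mu>' where "\<mu>' n = distr S borel (?w (Suc n))" for n
  define \<nu> where "\<nu> n = distr gauss_seq borel (chaos (m (Suc n)) (a (Suc n)))" for n
  have wmeas: "?w (Suc n) \<in> borel_measurable S" for n using wm1[of "Suc n"] by (simp add: mom_le_def)
  have cmeas: "chaos (m n) (a n) \<in> borel_measurable gauss_seq" for n using cm1[of n] by (simp add: mom_le_def)
  have rd: "real_distribution (\<mu>' n)" "real_distribution (\<nu> n)" for n
    unfolding \<mu>'_def \<nu>_def by (auto intro!: S.real_distribution_distr gauss.S.real_distribution_distr wmeas cmeas)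
  have m1: "mom_le (\<mu>' n) 1 (\<lambda>x. x) c" "mom_le (\<nu> n) 1 (\<lambda>x. x) c" for n
    unfolding \<mu>'_def \<nu>_def using wm1[of "Suc n"] cm1[of "Suc n"] by (simp_all add: mom_le_distr[OF wmeas] mom_le_distr[OF cmeas])
  have ch: "(\<lambda>n. char (\<mu>' n) t - char (\<nu> n) t) \<longlonglongrightarrow> 0" for t
  proof -
    define \<Delta> where "\<Delta> n = (chf S (?w n) t) - (LINT z|gauss_seq. iexp (t * chaos (m n) (a n) z))" for n
    have "\<Delta> \<longlonglongrightarrow> 0"
    proof (rule tendstoI)
      fix b :: real assume b: "0 < b"
      have T: "0 < abs t + abs t ^ 3 + 1" by (simp add: add_nonneg_pos)
      have "0 < b / (abs t + abs t ^ 3 + 1)" using b T by simp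
      from Z(2)[OF this] show "\<forall>\<^sub>F n in sequentially. dist (\<Delta> n) 0 < b"
      proof eventually_elim
        case (elim n)
        have "cmod (\<Delta> n) \<le> b / (abs t + abs t ^ 3 + 1) * (abs t + abs t ^ 3)" using elim by (simp add: R_def \<Delta>_def m_def a_def)
        also have "\<dots> < b / (abs t + abs t ^ 3 + 1) * (abs t + abs t ^ 3 + 1)" using b T by (intro mult_strict_left_mono) auto
        also have "\<dots> = b" using T by simp
        finally show ?case by simp
      qed
    qed
    from LIMSEQ_Suc[OF this] have "(\<lambda>n. \<Delta> (Suc n)) \<longlonglongrightarrow> 0" .
    moreover have "char (\<mu>' n) t - char (\<nu> n) t = \<Delta> (Suc n)" for n
      unfolding char_def \<mu>'_def \<nu>_def \<Delta>_def by (subst (1 2) integral_distr) (auto intro: wmeas cmeas)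
    ultimately show ?thesis by simp
  qed
  have lim: "(\<lambda>n. (LINT \<omega>|M. h (D_stat M L g W X n \<omega> - (LINT \<omega>'|M. D_stat M L g W X n \<omega>'))) -
            (LINT z|gauss_seq. h (\<Sum>j. \<alpha> n j * ((z j)^2 - 1)))) \<longlonglongrightarrow> 0"
    if h: "continuous_on UNIV h" "bounded (range h)" for h :: "real \<Rightarrow> real"
  proof (rule LIMSEQ_imp_Suc)
    have hm[measurable]: "h \<in> borel_measurable borel" by (rule borel_measurable_continuous_onI[OF h(1)])
    have "(LINT \<omega>|M. h (D_stat M L g W X n \<omega> - (LINT \<omega>'|M. D_stat M L g W X n \<omega>'))) = (LINT x|(\<mu>' (n - 1)). h x)" if n: "n \<ge> 1" for n
    proof -
      have O: "good_obs L (deriv L) CL K q (F n k)" if "k \<in> {1..n}" for k by (rule obs[OF n that])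
      have Fm: "F n k \<in> borel_measurable S" and L4: "mom_le S 4 (\<lambda>e. L (F n k e)) K" if "k \<in> {1..n}" for k
        using O[OF that] by (auto simp: good_obs_def intro: S.mom_le_8_4)
      have D: "D_stat M L g W X n \<omega> = wform n (A n) L (F n) g (past \<epsilon> (int n) \<omega>)" for \<omega>
        unfolding A_def by (rule D_stat_eq_wform[where F="F n" and X=X and n=n and L=L and K=K and W=W, OF n XF[OF n] Lm Fm L4 g(1)])
      have wfm: "wform n (A n) L (F n) g \<in> borel_measurable S" using wi[OF n] by simp
      have wcm: "?w n \<in> borel_measurable S" using wm1[OF n] by (simp add: mom_le_def)
      have "(LINT \<omega>|M. h (D_stat M L g W X n \<omega> - (LINT \<omega>'|M. D_stat M L g W X n \<omega>'))) = (LINT \<omega>|M. h (?w n (past \<epsilon> (int n) \<omega>)))"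
        unfolding D centred_def past_integral[OF wfm] ..
      also have "\<dots> = (LINT e|S. h (?w n e))" by (rule past_integral[OF measurable_compose[OF wcm hm]])
      also have "\<dots> = (LINT x|(\<mu>' (n - 1)). h x)" unfolding \<mu>'_def using n by (subst integral_distr) (auto intro: wcm)
      finally show ?thesis .
    qed
    from this[of "Suc _"]
    have 1: "(LINT \<omega>|M. h (D_stat M L g W X (Suc n) \<omega> - (LINT \<omega>'|M. D_stat M L g W X (Suc n) \<omega>'))) = (LINT x|(\<mu>' n). h x)" for n by simp
    have 2: "(LINT z|gauss_seq. h (\<Sum>j. \<alpha> (Suc n) j * ((z j)^2 - 1))) = (LINT x|(\<nu> n). h x)" for n
      unfolding chaos_eq \<nu>_def by (subst integral_distr) (auto intro: cmeas)
    show "(\<lambda>n. (LINT \<omega>|M. h (D_stat M L g W X (Suc n) \<omega> - (LINT \<omega>'|M. D_stat M L g W X (Suc n) \<omega>'))) -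
            (LINT z|gauss_seq. h (\<Sum>j. \<alpha> (Suc n) j * ((z j)^2 - 1)))) \<longlonglongrightarrow> 0"
      unfolding 1 2 by (rule char_close_imp_weak_close[OF rd(1) m1(1) rd(2) m1(2) ch h])
  qed
  show ?thesis
  proof (intro exI[of _ \<alpha>] conjI allI impI lim)
    show "\<exists>p. \<forall>i\<ge>p. \<alpha> n i = 0" for n using \<alpha>0 by blast
    show "\<exists>B. \<forall>n. (\<Sum>k. (\<alpha> n k)^2) \<le> B" using Pm by (intro exI[of _ "\<beta>^2 / 2"]) (simp add: sq field_simps)
  qed
qed

end

theorem theorem3:
  fixes M :: "'w measure"
    and \<epsilon> \<epsilon>' :: "int \<Rightarrow> 'w \<Rightarrow> real"
    and r :: nat
    and d :: "nat \<Rightarrow> real"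
    and G :: "nat \<Rightarrow> real \<Rightarrow> (nat \<Rightarrow> real) \<Rightarrow> real"
    and X :: "nat \<Rightarrow> nat \<Rightarrow> 'w \<Rightarrow> real"
    and H Hstar :: "real \<Rightarrow> real \<Rightarrow> real"
    and W :: "nat \<Rightarrow> real \<Rightarrow> real \<Rightarrow> real"
    and L :: "real \<Rightarrow> real"
    and g :: "real \<times> real \<Rightarrow> complex"
    and c0 C0 \<eta> \<kappa> \<rho> :: real
  defines "X \<equiv> pls_process \<epsilon> r d G"
  assumes model: "pls_model M \<epsilon> \<epsilon>' r d G"
    and H_borel: "(\<lambda>(x, y). H x y) \<in> borel_measurable borel"
    and H_sym: "\<And>x y. H x y = H y x"
    and W_borel: "\<And>n. n \<ge> 1 \<Longrightarrow>
      (\<lambda>(s, t). W n s t) \<in> borel_measurable (restrict_space borel ({0..1} \<times> {0..1}))"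
    and W_sym: "\<And>n s t. n \<ge> 1 \<Longrightarrow> s \<in> {0..1} \<Longrightarrow> t \<in> {0..1} \<Longrightarrow> W n s t = W n t s"
    and degenerate: "\<And>n j x. n \<ge> 1 \<Longrightarrow> j \<in> {1..n} \<Longrightarrow>
      integrable M (\<lambda>\<omega>. H x (X n j \<omega>)) \<and> (\<integral>\<omega>. H x (X n j \<omega>) \<partial>M) = 0"
    and c0_pos: "0 < c0"
    and W_bounds: "\<And>n. n \<ge> 1 \<Longrightarrow>
      c0 \<le> (\<Sum>k=1..n. \<Sum>j=1..n. (W n (grid n k) (grid n j))\<^sup>2) \<and>
      (\<Sum>k=1..n. \<Sum>j=1..n. (W n (grid n k) (grid n j))\<^sup>2) \<le> C0"
    \<comment> \<open>(1)\<close>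
    and \<eta>_range: "0 < \<eta>" "\<eta> \<le> 1"
    and Hstar_quotient: "\<And>t s. L t \<noteq> 0 \<Longrightarrow> L s \<noteq> 0 \<Longrightarrow> Hstar t s = H t s / (L t * L s)"
    and Hstar_wiener: "wiener_rep \<eta> Hstar g"
    \<comment> \<open>(2)\<close>
    and \<kappa>_pos: "\<kappa> > 0"
    and L_class: "\<And>F. F \<in> {L, \<lambda>x. x * L x} \<Longrightarrow>
      controlled_deriv F \<and> uniform_moment M X (8 + 4 * \<kappa>) F \<and>
      uniform_moment M X (8 + 4 * \<kappa>) (deriv F)"
    and \<rho>_range: "0 \<le> \<rho>" "\<rho> < 1"
    and dependence: "\<exists>C. \<forall>k. dep_measure M \<epsilon> \<epsilon>' r d G k (8 + 4 * \<kappa>) \<le> ennreal (C * \<rho> ^ k)"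
    \<comment> \<open>(3)\<close>
    and W_variation:
      "(\<lambda>n. real n powr (1 / 4) * (ln (real n))\<^sup>2 * weight_variation W n) \<longlonglongrightarrow> 0"
    and W_diagonal: "\<exists>\<delta>>0. (\<lambda>n. \<Sum>j=1..n. sqrt (\<Sum>k\<in>log_window \<delta> n j.
      (W n (grid n j) (grid n j) - W n (grid n j) (grid n k))\<^sup>2)) \<longlonglongrightarrow> 0"
    \<comment> \<open>(4)\<close>
    and W_blocks: "\<exists>\<delta>>0. \<forall>m l :: nat \<Rightarrow> nat.
      (\<forall>n\<ge>1. m n \<in> {1..n} \<and> l n \<in> {1..n}) \<longrightarrow>
      (\<lambda>n. \<bar>real (m n) - real (l n)\<bar>) \<in> O(\<lambda>n. ln (real n)) \<longrightarrow>
      (\<lambda>n. \<Sum>k=m n..l n. sqrt (\<Sum>j\<in>log_window \<delta> n k. (W n (grid n k) (grid n j))\<^sup>2))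
        \<longlonglongrightarrow> 0"
    \<comment> \<open>(5); a list containing both \<open>a\<close> and \<open>- a\<close> always gives a singular matrix, so such lists are excluded\<close>
    and long_run: "\<And>s k t. s \<noteq> [] \<Longrightarrow> sorted_wrt (<) s \<Longrightarrow> 0 \<notin> set s \<Longrightarrow>
      (\<And>a. a \<in> set s \<Longrightarrow> - a \<notin> set s) \<Longrightarrow>
      k \<le> r \<Longrightarrow> t \<in> {d k..d (k + 1)} \<Longrightarrow>
      (L constant_on UNIV \<longrightarrow> pos_def (Sigma_mat M \<epsilon> L (G k t) s)) \<and>
      (\<not> L constant_on UNIV \<longrightarrow> pos_def (Sigma_star_mat M \<epsilon> L (G k t) s))"
    \<comment> \<open>(6)\<close>
    and lipschitz: "\<exists>C. \<forall>k\<le>r. \<forall>t\<in>{d k..d (k + 1)}. \<forall>s\<in>{d k..d (k + 1)}.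
      Lp_norm M 4 (\<lambda>\<omega>. G k t (past \<epsilon> 0 \<omega>) - G k s (past \<epsilon> 0 \<omega>)) \<le> ennreal (C * \<bar>t - s\<bar>)"
  shows "\<exists>(\<alpha> :: nat \<Rightarrow> nat \<Rightarrow> real) (N :: (nat \<Rightarrow> real) measure) (Z :: nat \<Rightarrow> (nat \<Rightarrow> real) \<Rightarrow> real).
    (\<forall>n. summable (\<lambda>k. (\<alpha> n k)\<^sup>2)) \<and>
    (\<lambda>n. \<Sum>k. (\<alpha> n k)\<^sup>2) \<in> O(\<lambda>_. 1) \<and>
    iid_std_normal N Z \<and>
    (\<forall>n. AE z in N. summable (\<lambda>j. \<alpha> n j * ((Z j z)\<^sup>2 - 1))) \<and>
    (\<forall>h :: real \<Rightarrow> real. continuous_on UNIV h \<longrightarrow> bounded (range h) \<longrightarrow>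
      (\<lambda>n. \<bar>(\<integral>\<omega>. h (D_stat M L g W X n \<omega> - (\<integral>\<omega>'. D_stat M L g W X n \<omega>' \<partial>M)) \<partial>M) -
            (\<integral>z. h (\<Sum>j. \<alpha> n j * ((Z j z)\<^sup>2 - 1)) \<partial>N)\<bar>) \<longlonglongrightarrow> 0)"
proof -
  interpret pls M \<epsilon> \<epsilon>' r d G by unfold_locales (rule model)
  have \<eta>: "0 < \<eta>" "\<eta> \<le> 1" by (rule \<eta>_range)+
  have \<rho>: "0 \<le> \<rho>" "\<rho> < 1" by (rule \<rho>_range)+
  have g: "integrable lborel g" "integrable lborel (\<lambda>z. norm z powr \<eta> * cmod (g z))"
    using Hstar_wiener by (auto simp: wiener_rep_def)
  have p: "8 \<le> 8 + 4 * \<kappa>" using \<kappa>_pos by simp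
  have L: "controlled_deriv L" using L_class[of L] by simp
  have mom: "uniform_moment M (pls_process \<epsilon> r d G) (8 + 4 * \<kappa>) f" if "f \<in> {L, \<lambda>x. x * L x, deriv L}" for f
    using that L_class[of L] L_class[of "\<lambda>x. x * L x"] by (auto simp: X_def)
  obtain C where dep: "\<And>k. dep_measure M \<epsilon> \<epsilon>' r d G k (8 + 4 * \<kappa>) \<le> ennreal (C * \<rho> ^ k)"
    using dependence by blast
  obtain \<delta> where \<delta>: "\<delta> > 0" "(\<lambda>n. \<Sum>j=1..n. sqrt (\<Sum>k\<in>log_window \<delta> n j.
      (W n (grid n j) (grid n j) - W n (grid n j) (grid n k))^2)) \<longlonglongrightarrow> 0"
    using W_diagonal by blast
  obtain \<alpha> B where fin: "\<And>n. \<exists>p. \<forall>i\<ge>p. \<alpha> n i = 0" and B: "\<And>n. (\<Sum>k. (\<alpha> n k)^2) \<le> B"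
    and lim: "\<And>h :: real \<Rightarrow> real. continuous_on UNIV h \<Longrightarrow> bounded (range h) \<Longrightarrow>
      (\<lambda>n. (LINT \<omega>|M. h (D_stat M L g W X n \<omega> - (LINT \<omega>'|M. D_stat M L g W X n \<omega>'))) -
            (LINT z|gauss_seq. h (\<Sum>j. \<alpha> n j * ((z j)^2 - 1)))) \<longlonglongrightarrow> 0"
    using D_stat_chaos_limit[OF W_sym W_bounds[THEN conjunct2] \<eta> g p L mom \<rho> dep weights_vanish[OF W_variation] \<delta>]
    unfolding X_def by blast
  have sum: "summable (\<lambda>k. f k (\<alpha> n k))" if "\<And>k. f k 0 = 0" for n and f :: "nat \<Rightarrow> real \<Rightarrow> real"
  proof -
    obtain p where p: "\<And>i. i \<ge> p \<Longrightarrow> \<alpha> n i = 0" using fin by blast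
    show ?thesis by (rule summable_finite[of "{..<p}"]) (use p that in auto)
  qed
  show ?thesis
  proof (intro exI[of _ \<alpha>] exI[of _ gauss_seq] exI[of _ "\<lambda>j z. z j"] conjI allI impI)
    show s2: "summable (\<lambda>k. (\<alpha> n k)^2)" for n by (rule sum[of "\<lambda>_ x. x^2"]) simp
    show "(\<lambda>n. \<Sum>k. (\<alpha> n k)^2) \<in> O(\<lambda>_. 1)"
      by (rule bigoI[of _ B]) (use B suminf_nonneg[OF s2] in simp)
    show "iid_std_normal gauss_seq (\<lambda>j z. z j)" by (rule iid_std_normal_gauss_seq)
    show "AE z in gauss_seq. summable (\<lambda>j. \<alpha> n j * ((z j)^2 - 1))" for n
      by (intro AE_I2 sum) simp
    fix h :: "real \<Rightarrow> real" assume "continuous_on UNIV h" "bounded (range h)"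
    from tendsto_rabs_zero[OF lim[OF this]]
    show "(\<lambda>n. \<bar>(LINT \<omega>|M. h (D_stat M L g W X n \<omega> - (LINT \<omega>'|M. D_stat M L g W X n \<omega>'))) -
            (LINT z|gauss_seq. h (\<Sum>j. \<alpha> n j * ((z j)^2 - 1)))\<bar>) \<longlonglongrightarrow> 0" .
  qed
qed

end
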